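(* Let $(X,d)$ be a metric space homeomorphic to $\mathbb{R}^2$ with locally finite Hausdorff $2$-measure, let $Q \subset X$ be a quadrilateral, and let $\rho$ and $u: Q \to [0,1]$ be the associated minimizing function and harmonic function (as defined in the context). Then for all Borel functions $g: Q \to [0,\infty]$, $$\int_{[0,1]}^* \int_{\overline{u^{-1}(t)}} g\, d\mathcal{H}^1\, dt \leq 2000 \int_Q g\rho\, d\mathcal{H}^2.$$
   Context: Hausdorff measure: for $k\in\{1,2\}$, $\varepsilon>0$ and $E \subset X$, $\mathcal{H}^k_\varepsilon(E) = \inf\{\sum_j a_k \operatorname{diam}(A_j)^k : E \subset \bigcup_{j=1}^\infty A_j,\ \operatorname{diam} A_j < \varepsilon\}$ with $a_1 = 1$, $a_2 = \pi/4$, and $\mathcal{H}^k(E) = \lim_{\varepsilon\to 0}\mathcal{H}^k_\varepsilon(E)$. The space $(X,d)$ is equipped with the measure $\mathcal{H}^2$. Upper integral: $\int_A^* a(t)\,dt$ is the upper Lebesgue integral of $a: A \to [0,\infty]$ over $A$, i.e. the infimum of $\int_A b(t)\,dt$ over Lebesgue measurable $b \geq a$. Quadrilateral: a subset $Q \subset X$ homeomorphic to $[0,1]^2$, with four designated non-overlapping boundary arcs, denoted in cyclic order by $\zeta_1,\zeta_2,\zeta_3,\zeta_4$, which are the images of $[0,1]\times\{0\}$, $\{1\}\times[0,1]$, $[0,1]\times\{1\}$, $\{0\}\times[0,1]$, respectively, under the parametrizing homeomorphism from $[0,1]^2$. $\Gamma_1$ is the family of curves in $Q$ connecting $\zeta_1$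 and $\zeta_3$. All curves are assumed non-constant; $|\gamma|$ denotes the image of a curve $\gamma$. Modulus: for a family $\Gamma$ of curves in $X$, $\operatorname{mod}\Gamma = \inf \int_X \rho^2\, d\mathcal{H}^2$ over all Borel functions $\rho: X \to [0,\infty]$ with $\int_\gamma \rho\, ds \geq 1$ for all locally rectifiable $\gamma \in \Gamma$ (admissible functions). Construction of $\rho$ and $u$: there is a sequence $(\rho_k)$ of admissible functions for $\Gamma_1$ converging strongly in $L^2$ to a (Borel) function $\rho \in L^2(Q)$ with $\int_Q \rho^2\, d\mathcal{H}^2 = \operatorname{mod}\Gamma_1$, and such that $$( * )\qquad \int_\gamma \rho_k\, ds \to \int_\gamma \rho\, ds < \infty$$ for all curves $\gamma$ in $Q$ except for a family of modulus zero. Fix such $(\rho_k)$ and $\rho$, and extend $\rho$ by $0$ to $X \setminus Q$. Let $\Gamma_0$ be the family of curves in $Q$ having a subcurve on which $( * )$ does not hold (non-rectifiable curves are regarded as belonging to $\Gamma_0$); then $\operatorname{mod}\Gamma_0 = 0$. For $x \in Q$: if there is a curve $\gamma \in \Gamma_1 \setminus \Gamma_0$ with $x \in |\gamma|$, set $$u(x) = \inf \int_{\gamma_x} \rho\, ds,$$ the infimum over all such curves $\gamma$ and all subcurves $\gamma_x$ of $\gamma$ joining $\zeta_1$ and $x$. Otherwise set $u(x) = \liminf_{y \in E_u,\, y \to x} u(y)$, where $E_u$ is the set of those $y \in Q$ for which $u(y)$ is defined by the preceding formula. It is known that $u$ is well defined on $Q$ and $0 \leq u \leq 1$. *)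

theory Defs
  imports "HOL-Analysis.Analysis"
begin

section \<open>Hausdorff measure\<close>

text \<open>The library's \<^const>\<open>diameter\<close> is real-valued and meaningless on unbounded sets.\<close>

definition ediam :: "'a::metric_space set \<Rightarrow> ennreal" where
  "ediam A = (SUP x\<in>A. SUP y\<in>A. ennreal (dist x y))"

text \<open>The normalising constants \<open>a\<^sub>1 = 1\<close> and \<open>a\<^sub>2 = \<pi>/4\<close>; only \<open>k \<in> {1, 2}\<close> is used.\<close>

definition hausdorff_const :: "nat \<Rightarrow> real" where
  "hausdorff_const k = (if k = 2 then pi / 4 else 1)"

definition hausdorff_pre :: "nat \<Rightarrow> real \<Rightarrow> 'a::metric_space set \<Rightarrow> ennreal" where
  "hausdorff_pre k \<epsilon> E =
     (INF A\<in>{A :: nat \<Rightarrow> 'a set. E \<subseteq> (\<Union>j. A j) \<and> (\<forall>j. ediam (A j) < ennreal \<epsilon>)}.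
        \<Sum>j. ennreal (hausdorff_const k) * ediam (A j) ^ k)"

definition hausdorff_outer :: "nat \<Rightarrow> 'a::metric_space set \<Rightarrow> ennreal" where
  "hausdorff_outer k E = Lim (at_right 0) (\<lambda>\<epsilon>. hausdorff_pre k \<epsilon> E)"

text \<open>\<open>measure_of\<close> yields the null measure if its argument is not countably additive;
  \<open>emeasure_hausdorff\<close> at the end of this theory shows that this does not happen here.\<close>

definition hausdorff :: "nat \<Rightarrow> 'a::metric_space measure" where
  "hausdorff k = measure_of UNIV (sets borel) (hausdorff_outer k)"

lemma sets_hausdorff [simp, measurable_cong]: "sets (hausdorff k) = sets borel"
  and space_hausdorff [simp]: "space (hausdorff k) = UNIV"
  by (simp_all add: hausdorff_def sets.sigma_sets_eq[of borel, simplified])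

section \<open>Upper Lebesgue integral\<close>

definition upper_lebesgue_integral :: "real set \<Rightarrow> (real \<Rightarrow> ennreal) \<Rightarrow> ennreal" where
  "upper_lebesgue_integral A a =
     (INF b\<in>{b \<in> borel_measurable (lebesgue_on A). \<forall>t\<in>A. a t \<le> b t}. \<integral>\<^sup>+t. b t \<partial>lebesgue_on A)"

section \<open>Curves, line integrals and modulus\<close>

text \<open>A curve is a non-constant \<^const>\<open>path\<close>, i.e. it is parametrised over \<open>[0,1]\<close>; its
  subcurves are its restrictions to \<open>[a,b] \<subseteq> [0,1]\<close>, referred to by \<open>a\<close> and \<open>b\<close>. As the
  parameter interval is compact, local rectifiability is the same as rectifiability.\<close>

definition curves_in :: "'a::metric_space set \<Rightarrow> (real \<Rightarrow> 'a) set" where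
  "curves_in Q = {\<gamma>. path \<gamma> \<and> path_image \<gamma> \<subseteq> Q \<and> \<not> \<gamma> constant_on {0..1}}"

definition curves_joining :: "'a::metric_space set \<Rightarrow> 'a set \<Rightarrow> 'a set \<Rightarrow> (real \<Rightarrow> 'a) set" where
  "curves_joining Q A B = {\<gamma> \<in> curves_in Q.
     pathstart \<gamma> \<in> A \<and> pathfinish \<gamma> \<in> B \<or> pathstart \<gamma> \<in> B \<and> pathfinish \<gamma> \<in> A}"

definition curve_length :: "(real \<Rightarrow> 'a::metric_space) \<Rightarrow> real \<Rightarrow> real \<Rightarrow> ennreal" where
  "curve_length \<gamma> a b =
     (SUP (n, p)\<in>{(n :: nat, p :: nat \<Rightarrow> real).
          (\<forall>i\<le>n. p i \<in> {a..b}) \<and> (\<forall>i<n. p i \<le> p (Suc i))}.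
        \<Sum>i<n. ennreal (dist (\<gamma> (p i)) (\<gamma> (p (Suc i)))))"

definition rectifiable :: "(real \<Rightarrow> 'a::metric_space) \<Rightarrow> real \<Rightarrow> real \<Rightarrow> bool" where
  "rectifiable \<gamma> a b \<longleftrightarrow> curve_length \<gamma> a b < \<infinity>"

text \<open>The arc length parametrisation of a rectifiable curve on \<open>[a,b]\<close>. Which \<open>t\<close> is chosen is
  irrelevant: \<open>\<gamma>\<close> is constant on the set of all \<open>t\<close> with \<open>curve_length \<gamma> a t = r\<close>.\<close>

definition arc_length_param :: "(real \<Rightarrow> 'a::metric_space) \<Rightarrow> real \<Rightarrow> real \<Rightarrow> real \<Rightarrow> 'a" where
  "arc_length_param \<gamma> a b r = \<gamma> (SOME t. t \<in> {a..b} \<and> curve_length \<gamma> a t = ennreal r)"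

text \<open>The integral of \<open>\<rho>\<close> over \<open>\<gamma>\<close> restricted to \<open>[a,b]\<close>, with respect to arc length; used for
  rectifiable curves only.\<close>

definition line_integral ::
    "(real \<Rightarrow> 'a::metric_space) \<Rightarrow> real \<Rightarrow> real \<Rightarrow> ('a \<Rightarrow> ennreal) \<Rightarrow> ennreal" where
  "line_integral \<gamma> a b \<rho> =
     (\<integral>\<^sup>+r\<in>{0..enn2real (curve_length \<gamma> a b)}. \<rho> (arc_length_param \<gamma> a b r) \<partial>lborel)"

definition admissible :: "(real \<Rightarrow> 'a::metric_space) set \<Rightarrow> ('a \<Rightarrow> ennreal) \<Rightarrow> bool" where
  "admissible \<Gamma> \<rho> \<longleftrightarrow> \<rho> \<in> borel_measurable borel \<and>
     (\<forall>\<gamma>\<in>\<Gamma>. rectifiable \<gamma> 0 1 \<longrightarrow> 1 \<le> line_integral \<gamma> 0 1 \<rho>)"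

definition modulus :: "(real \<Rightarrow> 'a::metric_space) set \<Rightarrow> ennreal" where
  "modulus \<Gamma> = (INF \<rho>\<in>{\<rho>. admissible \<Gamma> \<rho>}. \<integral>\<^sup>+x. \<rho> x ^ 2 \<partial>hausdorff 2)"

section \<open>Quadrilaterals and the harmonic function\<close>

definition quadrilateral :: "'a::metric_space set \<Rightarrow> (real \<times> real \<Rightarrow> 'a) \<Rightarrow> bool" where
  "quadrilateral Q \<phi> \<longleftrightarrow> (\<exists>\<psi>. homeomorphism ({0..1} \<times> {0..1}) Q \<phi> \<psi>)"

definition \<zeta>\<^sub>1 :: "(real \<times> real \<Rightarrow> 'a) \<Rightarrow> 'a set" where "\<zeta>\<^sub>1 \<phi> = \<phi> ` ({0..1} \<times> {0})"
definition \<zeta>\<^sub>3 :: "(real \<times> real \<Rightarrow> 'a) \<Rightarrow> 'a set" where "\<zeta>\<^sub>3 \<phi> = \<phi> ` ({0..1} \<times> {1})"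

definition \<Gamma>\<^sub>1 :: "'a::metric_space set \<Rightarrow> (real \<times> real \<Rightarrow> 'a) \<Rightarrow> (real \<Rightarrow> 'a) set" where
  "\<Gamma>\<^sub>1 Q \<phi> = curves_joining Q (\<zeta>\<^sub>1 \<phi>) (\<zeta>\<^sub>3 \<phi>)"

text \<open>\<open>\<bar>a - b\<bar>\<close> on \<open>[0,\<infinity>]\<close>; one of the two truncated differences is \<open>0\<close> unless \<open>a = b = \<infinity>\<close>.\<close>

definition ennreal_absdiff :: "ennreal \<Rightarrow> ennreal \<Rightarrow> ennreal" where
  "ennreal_absdiff a b = (a - b) + (b - a)"

text \<open>Condition \<open>(*)\<close> for the subcurve of \<open>\<gamma>\<close> on \<open>[a,b]\<close>; it fails by convention for
  non-rectifiable curves.\<close>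

definition line_integrals_converge ::
    "(nat \<Rightarrow> 'a::metric_space \<Rightarrow> ennreal) \<Rightarrow> ('a \<Rightarrow> ennreal) \<Rightarrow> (real \<Rightarrow> 'a) \<Rightarrow> real \<Rightarrow> real \<Rightarrow> bool"
  where
  "line_integrals_converge \<rho>k \<rho> \<gamma> a b \<longleftrightarrow> rectifiable \<gamma> a b \<and>
     (\<lambda>k. line_integral \<gamma> a b (\<rho>k k)) \<longlonglongrightarrow> line_integral \<gamma> a b \<rho> \<and>
     line_integral \<gamma> a b \<rho> < \<infinity>"

definition \<Gamma>\<^sub>0 :: "'a::metric_space set \<Rightarrow> (nat \<Rightarrow> 'a \<Rightarrow> ennreal) \<Rightarrow> ('a \<Rightarrow> ennreal) \<Rightarrow> (real \<Rightarrow> 'a) set"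
  where
  "\<Gamma>\<^sub>0 Q \<rho>k \<rho> = {\<gamma> \<in> curves_in Q.
     \<exists>a b. 0 \<le> a \<and> a \<le> b \<and> b \<le> 1 \<and> \<not> line_integrals_converge \<rho>k \<rho> \<gamma> a b}"

definition minimizing_function ::
    "'a::metric_space set \<Rightarrow> (real \<times> real \<Rightarrow> 'a) \<Rightarrow> (nat \<Rightarrow> 'a \<Rightarrow> ennreal) \<Rightarrow> ('a \<Rightarrow> ennreal) \<Rightarrow> bool"
  where
  "minimizing_function Q \<phi> \<rho>k \<rho> \<longleftrightarrow>
     (\<forall>k. admissible (\<Gamma>\<^sub>1 Q \<phi>) (\<rho>k k) \<and> (\<integral>\<^sup>+x\<in>Q. \<rho>k k x ^ 2 \<partial>hausdorff 2) < \<infinity>) \<and>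
     \<rho> \<in> borel_measurable borel \<and> (\<forall>x. x \<notin> Q \<longrightarrow> \<rho> x = 0) \<and>
     (\<integral>\<^sup>+x\<in>Q. \<rho> x ^ 2 \<partial>hausdorff 2) < \<infinity> \<and>
     (\<lambda>k. \<integral>\<^sup>+x\<in>Q. ennreal_absdiff (\<rho>k k x) (\<rho> x) ^ 2 \<partial>hausdorff 2) \<longlonglongrightarrow> 0 \<and>
     (\<integral>\<^sup>+x\<in>Q. \<rho> x ^ 2 \<partial>hausdorff 2) = modulus (\<Gamma>\<^sub>1 Q \<phi>) \<and>
     modulus {\<gamma> \<in> curves_in Q. \<not> line_integrals_converge \<rho>k \<rho> \<gamma> 0 1} = 0"

definition E\<^sub>u :: "'a::metric_space set \<Rightarrow> (real \<times> real \<Rightarrow> 'a) \<Rightarrow> (nat \<Rightarrow> 'a \<Rightarrow> ennreal) \<Rightarrow>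
    ('a \<Rightarrow> ennreal) \<Rightarrow> 'a set" where
  "E\<^sub>u Q \<phi> \<rho>k \<rho> = {x \<in> Q. \<exists>\<gamma> \<in> \<Gamma>\<^sub>1 Q \<phi> - \<Gamma>\<^sub>0 Q \<rho>k \<rho>. x \<in> path_image \<gamma>}"

text \<open>The subcurves \<open>\<gamma>\<^sub>x\<close> may degenerate to a point (\<open>a = b\<close>), so that \<open>u = 0\<close> on
  \<open>E\<^sub>u \<inter> \<zeta>\<^sub>1\<close>.\<close>

definition u_inf :: "'a::metric_space set \<Rightarrow> (real \<times> real \<Rightarrow> 'a) \<Rightarrow> (nat \<Rightarrow> 'a \<Rightarrow> ennreal) \<Rightarrow>
    ('a \<Rightarrow> ennreal) \<Rightarrow> 'a \<Rightarrow> ennreal" where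
  "u_inf Q \<phi> \<rho>k \<rho> x =
     (INF (\<gamma>, a, b)\<in>{(\<gamma>, a, b). \<gamma> \<in> \<Gamma>\<^sub>1 Q \<phi> - \<Gamma>\<^sub>0 Q \<rho>k \<rho> \<and> 0 \<le> a \<and> a \<le> b \<and> b \<le> 1 \<and>
          (\<gamma> a \<in> \<zeta>\<^sub>1 \<phi> \<and> \<gamma> b = x \<or> \<gamma> a = x \<and> \<gamma> b \<in> \<zeta>\<^sub>1 \<phi>)}.
        line_integral \<gamma> a b \<rho>)"

definition harmonic_function :: "'a::metric_space set \<Rightarrow> (real \<times> real \<Rightarrow> 'a) \<Rightarrow>
    (nat \<Rightarrow> 'a \<Rightarrow> ennreal) \<Rightarrow> ('a \<Rightarrow> ennreal) \<Rightarrow> 'a \<Rightarrow> ennreal" where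
  "harmonic_function Q \<phi> \<rho>k \<rho> x =
     (if x \<in> E\<^sub>u Q \<phi> \<rho>k \<rho> then u_inf Q \<phi> \<rho>k \<rho> x
      else Liminf (at x within E\<^sub>u Q \<phi> \<rho>k \<rho>) (u_inf Q \<phi> \<rho>k \<rho>))"

section \<open>Hausdorff measure is a Borel measure\<close>

lemma ediam_empty [simp]: "ediam {} = 0"
  by (simp add: ediam_def bot_ennreal)

lemma ediam_mono: "A \<subseteq> B \<Longrightarrow> ediam A \<le> ediam B"
  unfolding ediam_def by (intro SUP_mono) (meson SUP_subset_mono order_refl subsetD)

lemma dist_le_ediam: "x \<in> A \<Longrightarrow> y \<in> A \<Longrightarrow> ennreal (dist x y) \<le> ediam A"
  unfolding ediam_def by (meson SUP_upper2 order_refl)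

lemma hausdorff_pre_antimono:
  "\<epsilon> \<le> \<epsilon>' \<Longrightarrow> hausdorff_pre k \<epsilon>' E \<le> hausdorff_pre k \<epsilon> E"
  unfolding hausdorff_pre_def
  by (intro INF_superset_mono) (auto intro: order.strict_trans2 ennreal_leI)

lemma hausdorff_pre_tendsto:
  "((\<lambda>\<epsilon>. hausdorff_pre k \<epsilon> E) \<longlongrightarrow> (SUP \<epsilon>\<in>{0<..}. hausdorff_pre k \<epsilon> E)) (at_right 0)"
proof (rule increasing_tendsto)
  show "\<forall>\<^sub>F \<epsilon> in at_right 0. hausdorff_pre k \<epsilon> E \<le> (SUP \<epsilon>\<in>{0<..}. hausdorff_pre k \<epsilon> E)"
    by (auto simp: eventually_at_right_field intro!: exI[of _ 1] SUP_upper)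
next
  fix y assume "y < (SUP \<epsilon>\<in>{0<..}. hausdorff_pre k \<epsilon> E)"
  then obtain d where "d > 0" "y < hausdorff_pre k d E"
    by (auto simp: less_SUP_iff)
  then show "\<forall>\<^sub>F \<epsilon> in at_right 0. y < hausdorff_pre k \<epsilon> E"
    by (auto simp: eventually_at_right_field intro!: exI[of _ d]
        intro: order.strict_trans2 hausdorff_pre_antimono[OF less_imp_le])
qed

lemma hausdorff_outer_eq_SUP:
  "hausdorff_outer k E = (SUP \<epsilon>\<in>{0<..}. hausdorff_pre k \<epsilon> E)"
  unfolding hausdorff_outer_def using hausdorff_pre_tendsto by (intro tendsto_Lim) auto

lemma hausdorff_pre_outer_measure_space:
  assumes "k > 0" "\<epsilon> > 0"
  shows "outer_measure_space (Pow UNIV) (hausdorff_pre k \<epsilon> :: 'a::metric_space set \<Rightarrow> ennreal)"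
proof -
  define f where "f = (\<lambda>A :: 'a set.
    if ediam A < ennreal \<epsilon> then ennreal (hausdorff_const k) * ediam A ^ k else top)"
  interpret ring_of_sets UNIV "Pow UNIV :: 'a set set"
    by (rule ring_of_sets_Pow)
  have pos: "positive (Pow UNIV) f"
    using assms by (auto simp: positive_def f_def)
  have inc: "increasing (Pow UNIV) f"
    unfolding increasing_def f_def
    by (auto intro!: mult_left_mono power_mono ediam_mono dest: order.strict_trans1[OF ediam_mono])
  have "hausdorff_pre k \<epsilon> = outer_measure (Pow UNIV) f"
  proof (intro ext antisym)
    fix E :: "'a set"
    show "outer_measure (Pow UNIV) f E \<le> hausdorff_pre k \<epsilon> E"
      unfolding hausdorff_pre_def
    proof (intro INF_greatest, safe)
      fix A :: "nat \<Rightarrow> 'a set"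
      assume A: "E \<subseteq> (\<Union>j. A j)" "\<forall>j. ediam (A j) < ennreal \<epsilon>"
      then have "outer_measure (Pow UNIV) f E \<le> (\<Sum>j. f (A j))"
        by (intro outer_measure_le pos inc) auto
      then show "outer_measure (Pow UNIV) f E \<le>
          (\<Sum>j. ennreal (hausdorff_const k) * ediam (A j) ^ k)"
        using A by (simp add: f_def)
    qed
    show "hausdorff_pre k \<epsilon> E \<le> outer_measure (Pow UNIV) f E"
      unfolding outer_measure_def
    proof (intro INF_greatest, safe)
      fix A :: "nat \<Rightarrow> 'a set"
      assume A: "E \<subseteq> (\<Union>j. A j)"
      show "hausdorff_pre k \<epsilon> E \<le> (\<Sum>j. f (A j))"
      proof (cases "\<forall>j. ediam (A j) < ennreal \<epsilon>")
        case True
        then have "hausdorff_pre k \<epsilon> E \<le> (\<Sum>j. ennreal (hausdorff_const k) * ediam (A j) ^ k)"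
          unfolding hausdorff_pre_def using A by (intro INF_lower) auto
        then show ?thesis using True by (simp add: f_def)
      next
        case False
        then obtain j where "\<not> ediam (A j) < ennreal \<epsilon>" by blast
          then have "f (A j) = top" by (simp add: f_def)
        then have "(\<Sum>j. f (A j)) = top"
          by (metis ennreal_suminf_lessD less_irrefl top.not_eq_extremum)
        then show ?thesis by simp
      qed
    qed
  qed
  then show ?thesis
    using outer_measure_space_outer_measure[OF pos inc] by simp
qed

lemma outer_measure_space_hausdorff_outer:
  assumes "k > 0"
  shows "outer_measure_space (Pow UNIV) (hausdorff_outer k :: 'a::metric_space set \<Rightarrow> ennreal)"
proof -
  note oms = hausdorff_pre_outer_measure_space[OF assms, where 'a='a, unfolded outer_measure_space_def]
  have "hausdorff_outer k ({} :: 'a set) = 0"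
    unfolding hausdorff_outer_eq_SUP using oms by (auto simp: positive_def)
  moreover have "hausdorff_outer k A \<le> hausdorff_outer k B" if "A \<subseteq> B" for A B :: "'a set"
    unfolding hausdorff_outer_eq_SUP using oms that
    by (intro SUP_mono) (auto simp: increasing_def)
  moreover have "hausdorff_outer k (\<Union>i. A i) \<le> (\<Sum>i. hausdorff_outer k (A i))"
    if "disjoint_family A" for A :: "nat \<Rightarrow> 'a set"
    unfolding hausdorff_outer_eq_SUP[of _ "\<Union>i. A i"]
  proof (intro SUP_least)
    fix \<epsilon> :: real assume "\<epsilon> \<in> {0<..}"
    then have "hausdorff_pre k \<epsilon> (\<Union>i. A i) \<le> (\<Sum>i. hausdorff_pre k \<epsilon> (A i))"
      using oms[of \<epsilon>] that unfolding countably_subadditive_def by auto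
    also have "\<dots> \<le> (\<Sum>i. hausdorff_outer k (A i))"
      unfolding hausdorff_outer_eq_SUP using \<open>\<epsilon> \<in> {0<..}\<close>
      by (intro suminf_le summableI SUP_upper)
    finally show "hausdorff_pre k \<epsilon> (\<Union>i. A i) \<le> (\<Sum>i. hausdorff_outer k (A i))" .
  qed
  ultimately show ?thesis
    by (auto simp: outer_measure_space_def positive_def increasing_def countably_subadditive_def)
qed

lemma hausdorff_outer_mono:
  "k > 0 \<Longrightarrow> A \<subseteq> B \<Longrightarrow> hausdorff_outer k A \<le> hausdorff_outer k B"
  using outer_measure_space_hausdorff_outer[of k]
  by (auto simp: outer_measure_space_def increasing_def)

lemma hausdorff_outer_separated:
  fixes A B :: "'a::metric_space set"
  assumes k: "k > 0" and \<delta>: "\<delta> > 0" and sep: "\<And>x y. x \<in> A \<Longrightarrow> y \<in> B \<Longrightarrow> \<delta> \<le> dist x y"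
  shows "hausdorff_outer k A + hausdorff_outer k B \<le> hausdorff_outer k (A \<union> B)"
proof -
  have pre: "hausdorff_pre k \<epsilon> A + hausdorff_pre k \<epsilon> B \<le> hausdorff_pre k \<epsilon> (A \<union> B)"
    if \<epsilon>: "0 < \<epsilon>" "\<epsilon> \<le> \<delta>" for \<epsilon>
    unfolding hausdorff_pre_def[of _ _ "A \<union> B"]
  proof (intro INF_greatest, safe)
    fix C :: "nat \<Rightarrow> 'a set"
    assume C: "A \<union> B \<subseteq> (\<Union>j. C j)" and small: "\<forall>j. ediam (C j) < ennreal \<epsilon>"
    define c where "c = (\<lambda>S :: 'a set. ennreal (hausdorff_const k) * ediam S ^ k)"
    define CA where "CA = (\<lambda>j. if C j \<inter> A \<noteq> {} then C j else {})"
    define CB where "CB = (\<lambda>j. if C j \<inter> B \<noteq> {} then C j else {})"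
    have "C j \<inter> A = {} \<or> C j \<inter> B = {}" for j
    proof (rule ccontr)
      assume "\<not> ?thesis"
      then obtain x y where xy: "x \<in> C j" "x \<in> A" "y \<in> C j" "y \<in> B" by blast
      have "ennreal \<epsilon> \<le> ennreal (dist x y)"
        using sep[OF xy(2,4)] \<epsilon> by (intro ennreal_leI) linarith
      also have "\<dots> \<le> ediam (C j)" using xy by (intro dist_le_ediam)
      also have "\<dots> < ennreal \<epsilon>" using small by blast
      finally show False by simp
    qed
    then have split: "c (CA j) + c (CB j) \<le> c (C j)" for j
      using k unfolding CA_def CB_def c_def by (cases "C j \<inter> A = {}") (auto simp: zero_power)
    have cover: "A \<subseteq> (\<Union>j. CA j)" "B \<subseteq> (\<Union>j. CB j)"
      using C by (fastforce simp: CA_def CB_def)+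
    have small': "ediam (CA j) < ennreal \<epsilon>" "ediam (CB j) < ennreal \<epsilon>" for j
      using small \<epsilon> by (auto simp: CA_def CB_def)
    have "hausdorff_pre k \<epsilon> A \<le> (\<Sum>j. c (CA j))" "hausdorff_pre k \<epsilon> B \<le> (\<Sum>j. c (CB j))"
      unfolding hausdorff_pre_def c_def using cover small' by (auto intro!: INF_lower)
    then have "hausdorff_pre k \<epsilon> A + hausdorff_pre k \<epsilon> B \<le> (\<Sum>j. c (CA j)) + (\<Sum>j. c (CB j))"
      by (rule add_mono)
    also have "\<dots> = (\<Sum>j. c (CA j) + c (CB j))" by (rule suminf_add) auto
    also have "\<dots> \<le> (\<Sum>j. c (C j))" by (intro suminf_le split summableI)
    finally show "hausdorff_pre k \<epsilon> A + hausdorff_pre k \<epsilon> B \<le>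
        (\<Sum>j. ennreal (hausdorff_const k) * ediam (C j) ^ k)"
      unfolding c_def .
  qed
  have "((\<lambda>\<epsilon>. hausdorff_pre k \<epsilon> A + hausdorff_pre k \<epsilon> B) \<longlongrightarrow>
      hausdorff_outer k A + hausdorff_outer k B) (at_right 0)"
    unfolding hausdorff_outer_eq_SUP by (intro tendsto_add hausdorff_pre_tendsto)
  moreover have "\<forall>\<^sub>F \<epsilon> in at_right 0.
      hausdorff_pre k \<epsilon> A + hausdorff_pre k \<epsilon> B \<le> hausdorff_pre k \<epsilon> (A \<union> B)"
    using pre \<delta> by (auto simp: eventually_at_right_field intro!: exI[of _ \<delta>])
  ultimately show ?thesis
    unfolding hausdorff_outer_eq_SUP[of _ "A \<union> B"]
    using hausdorff_pre_tendsto by (intro tendsto_le[of "at_right 0"]) auto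
qed

lemma hausdorff_outer_separated_sum:
  fixes S :: "nat \<Rightarrow> 'a::metric_space set"
  assumes k: "k > 0"
    and sep: "\<And>i. \<exists>\<delta>>0. \<forall>j>i. \<forall>x\<in>S i. \<forall>y\<in>S j. \<delta> \<le> dist x y"
  shows "(\<Sum>i<n. hausdorff_outer k (S i)) \<le> hausdorff_outer k (\<Union>i<n. S i)"
proof (induction n)
  case (Suc n)
  obtain d where d: "\<And>i. d i > 0" "\<And>i j x y. i < j \<Longrightarrow> x \<in> S i \<Longrightarrow> y \<in> S j \<Longrightarrow> d i \<le> dist x y"
    using sep by metis
  define \<delta> where "\<delta> = Min (insert 1 (d ` {..<n}))"
  have "\<delta> > 0" using d(1) by (auto simp: \<delta>_def)
  moreover have "\<delta> \<le> dist x y" if "x \<in> (\<Union>i<n. S i)" "y \<in> S n" for x y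
  proof -
    from that obtain i where "i < n" "x \<in> S i" by auto
    then have "\<delta> \<le> d i" "d i \<le> dist x y" using that d(2) by (auto simp: \<delta>_def)
    then show ?thesis by simp
  qed
  ultimately have "hausdorff_outer k (\<Union>i<n. S i) + hausdorff_outer k (S n) \<le>
      hausdorff_outer k ((\<Union>i<n. S i) \<union> S n)"
    by (rule hausdorff_outer_separated[OF k])
  with Suc.IH show ?case
    by (simp add: lessThan_Suc Un_commute add.commute) (meson add_left_mono order_trans)
qed simp

lemma closed_in_lambda_system:
  fixes C :: "'a::metric_space set"
  assumes k: "k > 0" and C: "closed C"
  shows "C \<in> lambda_system UNIV (Pow UNIV) (hausdorff_outer k)"
proof -
  let ?H = "hausdorff_outer k :: 'a set \<Rightarrow> ennreal"
  have oms: "outer_measure_space (Pow UNIV) ?H"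
    using outer_measure_space_hausdorff_outer[OF k] by simp
  have csub: "?H (\<Union>i. A i) \<le> (\<Sum>i. ?H (A i))" if "disjoint_family A" for A :: "nat \<Rightarrow> 'a set"
    using oms that by (auto simp: outer_measure_space_def countably_subadditive_def)
  have sub: "?H (A \<union> B) \<le> ?H A + ?H B" if "A \<inter> B = {}" for A B
  proof -
    have "subadditive (Pow UNIV) ?H"
      using oms by (intro ring_of_sets.countably_subadditive_subadditive[OF ring_of_sets_Pow])
        (simp_all only: outer_measure_space_def)
    then show ?thesis using that by (auto simp: subadditive_def)
  qed
  have le: "?H (E \<inter> C) + ?H (E - C) \<le> ?H E" for E
  proof (cases "C = {} \<or> ?H E = top")
    case True
    then show ?thesis
      using oms by (auto simp: outer_measure_space_def positive_def)
  next
    case False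
    then have Cne: "C \<noteq> {}" and fin: "?H E \<noteq> top" by auto
    define r where "r = (\<lambda>n. 1 / (real n + 1))"
    have r_anti: "r m < r n" if "n < m" for n m using that by (auto simp: r_def field_simps)
    have r_pos: "r n > 0" for n by (simp add: r_def)
    define B where "B = (\<lambda>n. {x \<in> E - C. r n \<le> infdist x C})"
    define R where "R = (\<lambda>n. {x \<in> E - C. r (Suc n) \<le> infdist x C \<and> infdist x C < r n})"
    have infd: "infdist x C > 0" if "x \<notin> C" for x
      using that C Cne infdist_pos_not_in_closed by blast
    have ex: "\<exists>n. r n \<le> infdist x C" if x: "x \<notin> C" for x
    proof -
      obtain n where n: "n > 0" "inverse (real n) < infdist x C"
        using ex_inverse_of_nat_less[OF infd[OF x]] by auto
      have "r n \<le> inverse (real n)"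
        using n(1) by (simp add: r_def field_simps)
      then show ?thesis using n(2) by (intro exI[of _ n]) linarith
    qed
    have sep: "r (Suc i) - r j \<le> dist x y" if "x \<in> R i" "y \<in> R j" for x y i j
      using that infdist_triangle[of x C y] by (auto simp: R_def)
    have half: "(\<Sum>i. ?H (R (2 * i + a))) \<le> ?H E" for a
    proof (rule suminf_le_const[OF summableI])
      fix n
      have "\<exists>\<delta>>0. \<forall>j>i. \<forall>x\<in>R (2 * i + a). \<forall>y\<in>R (2 * j + a). \<delta> \<le> dist x y" for i
      proof (intro exI conjI allI ballI impI)
        show "r (Suc (2 * i + a)) - r (2 * i + a + 2) > 0" using r_anti by simp
        fix j x y assume *: "i < j" "x \<in> R (2 * i + a)" "y \<in> R (2 * j + a)"
        have "r (2 * j + a) \<le> r (2 * i + a + 2)"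
          using * by (auto simp: r_def field_simps)
        then show "r (Suc (2 * i + a)) - r (2 * i + a + 2) \<le> dist x y"
          using sep[OF *(2,3)] by linarith
      qed
      then have "(\<Sum>i<n. ?H (R (2 * i + a))) \<le> ?H (\<Union>i<n. R (2 * i + a))"
        by (rule hausdorff_outer_separated_sum[OF k])
      also have "\<dots> \<le> ?H E" by (intro hausdorff_outer_mono k) (auto simp: R_def)
      finally show "(\<Sum>i<n. ?H (R (2 * i + a))) \<le> ?H E" .
    qed
    have sumR: "(\<Sum>i. ?H (R i)) < top"
    proof -
      have "(\<Sum>i<n. ?H (R i)) \<le> ?H E + ?H E" for n
      proof -
        have "(\<Sum>i<n. ?H (R i)) \<le> (\<Sum>i<2 * n. ?H (R i))" by (intro sum_mono2) auto
        also have "\<dots> = (\<Sum>i<n. ?H (R (2 * i + 0))) + (\<Sum>i<n. ?H (R (2 * i + 1)))"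
          by (induction n) (auto simp: algebra_simps)
        also have "\<dots> \<le> (\<Sum>i. ?H (R (2 * i + 0))) + (\<Sum>i. ?H (R (2 * i + 1)))"
          by (intro add_mono sum_le_suminf summableI) auto
        also have "\<dots> \<le> ?H E + ?H E" by (intro add_mono half)
        finally show ?thesis .
      qed
      then have "(\<Sum>i. ?H (R i)) \<le> ?H E + ?H E" by (intro suminf_le_const summableI)
      also have "\<dots> < top" using fin by (simp add: less_top)
      finally show ?thesis .
    qed
    have BR: "?H (E - C) \<le> ?H (B n) + (\<Sum>i. ?H (R (i + n)))" for n
    proof -
      have "E - C \<subseteq> B n \<union> (\<Union>i. R (i + n))"
      proof
        fix x assume x: "x \<in> E - C"
        define m where "m = (LEAST m. r m \<le> infdist x C)"
        have m: "r m \<le> infdist x C" unfolding m_def using x by (metis (lifting) DiffD2 LeastI_ex ex)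
        show "x \<in> B n \<union> (\<Union>i. R (i + n))"
        proof (cases "m \<le> n")
          case True
          then have "r n \<le> r m" using r_anti[of m n] by (cases "m = n") auto
          then show ?thesis using m x by (auto simp: B_def)
        next
          case False
          then obtain p where p: "m = Suc p" "n \<le> p" by (cases m) auto
          then have "p < m" by simp
          then have "infdist x C < r p" unfolding m_def by (meson not_less_Least not_le)
          with p m x have "x \<in> R ((p - n) + n)" by (simp add: R_def)
          then show ?thesis by blast
        qed
      qed
      then have "?H (E - C) \<le> ?H (B n \<union> (\<Union>i. R (i + n)))"
        by (rule hausdorff_outer_mono[OF k])
      also have "\<dots> \<le> ?H (B n) + ?H (\<Union>i. R (i + n))"
      proof (rule sub, safe)
        fix x i assume "x \<in> B n" "x \<in> R (i + n)"
        moreover have "r (i + n) \<le> r n" using r_anti[of n "i + n"] by (cases "i = 0") auto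
        ultimately show "x \<in> {}" by (auto simp: B_def R_def)
      qed
      also have "?H (\<Union>i. R (i + n)) \<le> (\<Sum>i. ?H (R (i + n)))"
      proof (rule csub, unfold disjoint_family_on_def, safe)
        fix i j x assume *: "i \<noteq> j" "x \<in> R (i + n)" "x \<in> R (j + n)"
        have mono: "r (q + n) \<le> r (Suc (p + n))" if "p < q" for p q
          using that r_anti[of "Suc (p + n)" "q + n"] by (cases "q = Suc p") auto
        show "x \<in> {}"
          using * mono[of i j] mono[of j i] by (cases "i < j") (auto simp: R_def)
      qed
      finally show ?thesis by (simp add: add_left_mono)
    qed
    have EB: "?H (E \<inter> C) + ?H (B n) \<le> ?H E" for n
    proof -
      have "?H (E \<inter> C) + ?H (B n) \<le> ?H ((E \<inter> C) \<union> B n)"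
      proof (rule hausdorff_outer_separated[OF k r_pos[of n]])
        fix x y assume "x \<in> E \<inter> C" "y \<in> B n"
        then show "r n \<le> dist x y"
          using infdist_le[of x C y] by (auto simp: B_def dist_commute)
      qed
      also have "\<dots> \<le> ?H E" by (intro hausdorff_outer_mono k) (auto simp: B_def)
      finally show ?thesis .
    qed
    have "(\<lambda>n. \<Sum>i. ?H (R (i + n))) \<longlonglongrightarrow> 0"
    proof -
      have "summable (\<lambda>i. enn2real (?H (R i)))" and R_fin: "\<And>i. ?H (R i) < top"
      proof -
        show R_fin: "?H (R i) < top" for i
          using sumR by (rule ennreal_suminf_lessD)
        then have "(\<Sum>i. ennreal (enn2real (?H (R i)))) \<noteq> top"
          using sumR by (simp add: ennreal_enn2real)
        then show "summable (\<lambda>i. enn2real (?H (R i)))"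
          by (intro summable_suminf_not_top) auto
      qed
      then have "(\<lambda>n. ennreal (\<Sum>i. enn2real (?H (R (i + n))))) \<longlonglongrightarrow> ennreal 0"
        by (intro tendsto_ennrealI suminf_exist_split2)
      moreover have "ennreal (\<Sum>i. enn2real (?H (R (i + n)))) = (\<Sum>i. ?H (R (i + n)))" for n
        using \<open>summable _\<close> R_fin
        by (subst suminf_ennreal2[symmetric])
           (auto simp: ennreal_enn2real intro: summable_ignore_initial_segment)
      ultimately show ?thesis by simp
    qed
    then have "(\<lambda>n. ?H E + (\<Sum>i. ?H (R (i + n)))) \<longlonglongrightarrow> ?H E + 0"
      by (intro tendsto_add tendsto_const)
    then have lim: "(\<lambda>n. ?H E + (\<Sum>i. ?H (R (i + n)))) \<longlonglongrightarrow> ?H E"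
      by simp
    have "?H (E \<inter> C) + ?H (E - C) \<le> ?H E + (\<Sum>i. ?H (R (i + n)))" for n
    proof -
      have "?H (E \<inter> C) + ?H (E - C) \<le> ?H (E \<inter> C) + (?H (B n) + (\<Sum>i. ?H (R (i + n))))"
        by (rule add_left_mono[OF BR])
      also have "\<dots> = (?H (E \<inter> C) + ?H (B n)) + (\<Sum>i. ?H (R (i + n)))"
        by (rule add.assoc[symmetric])
      also have "\<dots> \<le> ?H E + (\<Sum>i. ?H (R (i + n)))"
        by (rule add_right_mono[OF EB])
      finally show ?thesis .
    qed
    then show ?thesis by (intro LIMSEQ_le_const[OF lim] exI allI impI)
  qed
  have "?H E \<le> ?H (E \<inter> C) + ?H (E - C)" for E
  proof -
    have "?H ((E \<inter> C) \<union> (E - C)) \<le> ?H (E \<inter> C) + ?H (E - C)" by (rule sub) blast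
    then show ?thesis by (simp only: Int_Diff_Un)
  qed
  with le have "?H (E \<inter> C) + ?H (E - C) = ?H E" for E by (meson antisym)
  then show ?thesis
    by (simp add: algebra.lambda_system_eq[OF algebra_Pow] del: Pow_UNIV)
qed

proposition emeasure_hausdorff:
  assumes "k > 0" "A \<in> sets borel"
  shows "emeasure (hausdorff k) A = hausdorff_outer k A"
proof -
  let ?L = "lambda_system UNIV (Pow UNIV) (hausdorff_outer k :: 'a set \<Rightarrow> ennreal)"
  have ms: "measure_space UNIV ?L (hausdorff_outer k)"
    using outer_measure_space_hausdorff_outer[OF assms(1), where 'a='a]
    by (intro sigma_algebra.caratheodory_lemma sigma_algebra_Pow) simp
  then have "sigma_sets UNIV (Collect closed) \<subseteq> ?L"
    by (intro sigma_algebra.sigma_sets_subset)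
       (auto simp: measure_space_def simp del: Pow_UNIV intro: closed_in_lambda_system[OF assms(1)])
  then have "sets borel \<subseteq> ?L"
    by (simp add: borel_eq_closed)
  moreover have "sigma_algebra (UNIV :: 'a set) (sets borel)"
    using sets.sigma_algebra_axioms[of "borel :: 'a measure"] by simp
  ultimately have "measure_space UNIV (sets borel) (hausdorff_outer k :: 'a set \<Rightarrow> ennreal)"
    using measure_down[OF ms] by blast
  then show ?thesis
    unfolding hausdorff_def measure_space_def
    by (elim conjE) (rule emeasure_measure_of_sigma[OF _ _ _ assms(2)])
qed

end

theory Submission
  imports Defs
begin

text \<open>The theorem is a coarea inequality for \<open>u\<close>, and \<open>\<rho>\<close> plays the role of the length of its
gradient: along every curve that is not exceptional, \<open>u\<close> varies by at most the integral of
\<open>\<rho>\<close>. If \<open>u\<close> were Lipschitz, the classical argument of Eilenberg would do: in a cover of a set by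
small sets \<open>A\<^sub>j\<close>, the level sets of \<open>u\<close> meet \<open>A\<^sub>j\<close> only for \<open>t\<close> in a set of length
at most \<open>diam (u (A\<^sub>j))\<close>, and so the one-dimensional contents of the level sets integrate to at most
the sum of \<open>diam (A\<^sub>j) * diam (u (A\<^sub>j))\<close>. Here the oscillation of \<open>u\<close> is instead controlled
on balls, by the mass \<open>\<nu>\<close> that \<open>\<rho>\<close> gives to them: the values of \<open>u\<close> near a ball \<open>B(x,r)\<close>
have total length at most \<open>(4 / \<pi>) \<nu>(B(x,2r)) / r\<close> (\<open>values_near_bound\<close>).

This estimate comes from the circles around \<open>x\<close> of radius \<open>s \<in> (r,2r)\<close>. For almost every \<open>s\<close>
the components of the circle have finite length and contain no exceptional arcs. A continuum of finite length
is connected by rectifiable arcs (\<open>rectifiable_arc_in_continuum\<close>), along which line integrals are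
integrals against \<open>H\<^sup>1\<close> (\<open>line_integral_arc\<close>); so \<open>u\<close> varies on a component \<open>K\<close> by at
most the integral of \<open>\<rho>\<close> over \<open>K\<close>. The topology of the square shows that each point near \<open>x\<close> is
cut off from the far sides by a single component (\<open>level_component_separates\<close>), and a minimum and a
maximum principle bound \<open>u\<close> at the point by its values on this component. Averaging over \<open>s\<close> with
the coarea inequality for the distance from \<open>x\<close> (\<open>lipschitz_coarea\<close>) gives the estimate.

The minimum principle is immediate, as \<open>u\<close> is a distance from \<open>\<zeta>\<^sub>1\<close>. The maximum principle
(\<open>maximum_principle\<close>) is where the minimality of \<open>\<rho>\<close> enters. If \<open>u\<close> exceeded at some point its
supremum \<open>M < 1\<close> on the separating continuum \<open>K\<close>, then \<open>\<rho>\<close> would vanish almost everywhere on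
the part of the superlevel set of \<open>M\<close> that \<open>K\<close> cuts off, because erasing \<open>\<rho>\<close> there leaves
admissibility intact (\<open>truncation_admissible\<close>, \<open>minimizer_vanishes\<close>). Hence \<open>u\<close> would be
constant on generic continua that start in the superlevel set, and such a continuum could be chosen to run
into \<open>K\<close>, where \<open>u \<le> M\<close>. To erase \<open>\<rho>\<close> on a Borel set, the superlevel set is replaced by its
interior; the difference lies in a null set, since \<open>u\<close> is lower semicontinuous outside the set of
points around which \<open>\<nu>\<close> has mass comparable with the radius
(\<open>lower_semicontinuous_off_heavy_set\<close>).

Finally, the estimate on balls is summed. Balls whose mass grows by at most the factor 50 when the radius
is multiplied by 5 are selected disjointly, in the manner of Vitali, and yield the constant \<open>400 / \<pi>\<close>,
which is less than 2000. At every other point the mass of balls decays faster than the square of the radius,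
and these points contribute nothing, as \<open>Q\<close> has finite area (\<open>non_doubling_part_null\<close>). The passage
from contents in open sets to the integral of \<open>g\<close> is general measure theory (\<open>coarea_extension\<close>).\<close>

section \<open>Upper integrals\<close>

text \<open>A minimizing sequence of measurable majorants can be replaced by its pointwise infimum. Thus there is an
optimal majorant, and the rules for the Lebesgue integral pass to upper integrals.\<close>

lemma upper_integral_attained:
  obtains b where "b \<in> borel_measurable (lebesgue_on A)" "\<And>t. t \<in> A \<Longrightarrow> a t \<le> b t"
    "(\<integral>\<^sup>+t. b t \<partial>lebesgue_on A) = upper_lebesgue_integral A a"
proof -
  define B where "B = {b \<in> borel_measurable (lebesgue_on A). \<forall>t\<in>A. a t \<le> b t}"
  let ?I = "(\<lambda>b. \<integral>\<^sup>+t. b t \<partial>lebesgue_on A) ` B"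
  have "(\<lambda>_. top) \<in> B" by (auto simp: B_def)
  then have "?I \<noteq> {}" by blast
  from ennreal_Inf_countable_INF[OF this]
  obtain f :: "nat \<Rightarrow> ennreal" where f: "range f \<subseteq> ?I" "Inf ?I = (INF i. f i)"
    by (elim exE conjE)
  have "\<exists>b\<in>B. f i = (\<integral>\<^sup>+t. b t \<partial>lebesgue_on A)" for i
  proof -
    have "f i \<in> ?I" using f(1) by (rule subsetD) simp
    then show ?thesis by (rule imageE) (rule bexI)
  qed
  then obtain b where b: "\<And>i. b i \<in> B" "\<And>i. f i = (\<integral>\<^sup>+t. b i t \<partial>lebesgue_on A)" by metis
  define c where "c = (\<lambda>t. INF i. b i t)"
  have [measurable]: "b i \<in> borel_measurable (lebesgue_on A)" for i using b(1)[of i] by (simp add: B_def)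
  have "c \<in> borel_measurable (lebesgue_on A)" unfolding c_def by measurable
  then have c: "c \<in> B" using b(1) by (auto simp: c_def B_def intro!: INF_greatest)
  have "(\<integral>\<^sup>+t. c t \<partial>lebesgue_on A) \<le> f i" for i
    unfolding b(2) c_def by (intro nn_integral_mono INF_lower UNIV_I)
  then have "(\<integral>\<^sup>+t. c t \<partial>lebesgue_on A) \<le> Inf ?I" unfolding f(2) by (intro INF_greatest)
  moreover have "Inf ?I \<le> (\<integral>\<^sup>+t. c t \<partial>lebesgue_on A)" using c by (intro INF_lower)
  ultimately show ?thesis using c by (intro that[of c]) (auto simp: upper_lebesgue_integral_def B_def)
qed

lemma upper_integral_le:
  assumes "b \<in> borel_measurable (lebesgue_on A)" "\<And>t. t \<in> A \<Longrightarrow> a t \<le> b t"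
  shows "upper_lebesgue_integral A a \<le> (\<integral>\<^sup>+t. b t \<partial>lebesgue_on A)"
  unfolding upper_lebesgue_integral_def using assms by (intro INF_lower) auto

lemma upper_integral_mono:
  assumes "\<And>t. t \<in> A \<Longrightarrow> a t \<le> b t"
  shows "upper_lebesgue_integral A a \<le> upper_lebesgue_integral A b"
  unfolding upper_lebesgue_integral_def using assms by (intro INF_superset_mono) (auto intro: order_trans)

lemma upper_integral_suminf:
  "upper_lebesgue_integral A (\<lambda>t. \<Sum>n. a n t) \<le> (\<Sum>n. upper_lebesgue_integral A (a n))"
proof -
  have "\<exists>b. b \<in> borel_measurable (lebesgue_on A) \<and> (\<forall>t\<in>A. a n t \<le> b t) \<and>
     (\<integral>\<^sup>+t. b t \<partial>lebesgue_on A) = upper_lebesgue_integral A (a n)" for n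
    using upper_integral_attained[of A "a n"] by metis
  then obtain b where b: "\<And>n. b n \<in> borel_measurable (lebesgue_on A)" "\<And>n t. t \<in> A \<Longrightarrow> a n t \<le> b n t"
    "\<And>n. (\<integral>\<^sup>+t. b n t \<partial>lebesgue_on A) = upper_lebesgue_integral A (a n)" by metis
  note [measurable] = b(1)
  have "upper_lebesgue_integral A (\<lambda>t. \<Sum>n. a n t) \<le> (\<integral>\<^sup>+t. (\<Sum>n. b n t) \<partial>lebesgue_on A)"
    using b(2) by (intro upper_integral_le) (auto intro!: suminf_le)
  also have "\<dots> = (\<Sum>n. upper_lebesgue_integral A (a n))"
    by (subst nn_integral_suminf) (auto simp: b(3))
  finally show ?thesis .
qed

lemma upper_integral_cmult:
  "upper_lebesgue_integral A (\<lambda>t. c * a t) \<le> c * upper_lebesgue_integral A a"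
proof -
  obtain b where b: "b \<in> borel_measurable (lebesgue_on A)" "\<And>t. t \<in> A \<Longrightarrow> a t \<le> b t"
    "(\<integral>\<^sup>+t. b t \<partial>lebesgue_on A) = upper_lebesgue_integral A a"
    using upper_integral_attained[of A a] by metis
  note [measurable] = b(1)
  have "upper_lebesgue_integral A (\<lambda>t. c * a t) \<le> (\<integral>\<^sup>+t. c * b t \<partial>lebesgue_on A)"
    using b(2) by (intro upper_integral_le) (auto intro!: mult_left_mono)
  also have "\<dots> = c * upper_lebesgue_integral A a"
    by (subst nn_integral_cmult) (auto simp: b(3))
  finally show ?thesis .
qed

text \<open>Fatou's lemma for optimal majorants. Since \<open>H\<^sup>1\<close> is the limit of the contents at scale \<open>\<epsilon>\<close>,
this allows letting \<open>\<epsilon>\<close> tend to \<open>0\<close> under an upper integral.\<close>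

lemma upper_integral_liminf:
  fixes a :: "nat \<Rightarrow> real \<Rightarrow> ennreal"
  assumes "\<And>n. upper_lebesgue_integral A (a n) \<le> c"
  shows "upper_lebesgue_integral A (\<lambda>t. liminf (\<lambda>n. a n t)) \<le> c"
proof -
  have "\<exists>b. b \<in> borel_measurable (lebesgue_on A) \<and> (\<forall>t\<in>A. a n t \<le> b t) \<and>
     (\<integral>\<^sup>+t. b t \<partial>lebesgue_on A) = upper_lebesgue_integral A (a n)" for n
    using upper_integral_attained[of A "a n"] by metis
  then obtain b where b: "\<And>n. b n \<in> borel_measurable (lebesgue_on A)" "\<And>n t. t \<in> A \<Longrightarrow> a n t \<le> b n t"
    "\<And>n. (\<integral>\<^sup>+t. b n t \<partial>lebesgue_on A) = upper_lebesgue_integral A (a n)" by metis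
  note [measurable] = b(1)
  have "upper_lebesgue_integral A (\<lambda>t. liminf (\<lambda>n. a n t)) \<le> (\<integral>\<^sup>+t. liminf (\<lambda>n. b n t) \<partial>lebesgue_on A)"
    using b(2) by (intro upper_integral_le) (auto intro!: Liminf_mono)
  also have "\<dots> \<le> liminf (\<lambda>n. \<integral>\<^sup>+t. b n t \<partial>lebesgue_on A)" by (intro nn_integral_liminf) auto
  also have "\<dots> \<le> liminf (\<lambda>n::nat. c)" using assms by (intro Liminf_mono) (auto simp: b(3))
  finally show ?thesis by (simp add: Liminf_const)
qed

lemma upper_integral_finite_AE:
  assumes "upper_lebesgue_integral UNIV a < \<infinity>"
  shows "AE s in lebesgue. a s < \<infinity>"
proof -
  obtain b where b: "b \<in> borel_measurable lebesgue" "\<And>t. a t \<le> b t"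
    "(\<integral>\<^sup>+t. b t \<partial>lebesgue) = upper_lebesgue_integral UNIV a"
    using upper_integral_attained[of UNIV a] by (metis UNIV_I lebesgue_on_UNIV_eq)
  have "AE s in lebesgue. b s \<noteq> \<infinity>"
    using assms b by (intro nn_integral_noteq_infinite) auto
  then show ?thesis
    by (rule AE_mp) (use b(2) in \<open>auto simp: less_top intro!: AE_I2 intro: order.strict_trans1\<close>)
qed

lemma upper_integral_zero_AE:
  assumes "upper_lebesgue_integral UNIV a = 0"
  shows "AE s in lebesgue. a s = 0"
proof -
  obtain b where b: "b \<in> borel_measurable lebesgue" "\<And>t. a t \<le> b t"
    "(\<integral>\<^sup>+t. b t \<partial>lebesgue) = upper_lebesgue_integral UNIV a"
    using upper_integral_attained[of UNIV a] by (metis UNIV_I lebesgue_on_UNIV_eq)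
  have "AE s in lebesgue. b s = 0"
    using assms b nn_integral_0_iff_AE[OF b(1)] by simp
  then show ?thesis
    by (rule AE_mp) (use b(2) in \<open>auto intro!: AE_I2 simp: le_zero_eq[symmetric] simp del: le_zero_eq intro: order_trans\<close>)
qed

text \<open>Chebyshev's inequality; by contraposition, a small upper integral yields parameters with \<open>a s < c\<close>.\<close>

lemma upper_integral_ge_const:
  assumes "AE s in lebesgue. s \<in> {r<..<r'} \<longrightarrow> c \<le> a s" "r \<le> r'"
  shows "ennreal (r' - r) * c \<le> upper_lebesgue_integral UNIV a"
proof -
  obtain b where b: "b \<in> borel_measurable lebesgue" "\<And>t. a t \<le> b t"
    "(\<integral>\<^sup>+t. b t \<partial>lebesgue) = upper_lebesgue_integral UNIV a"
    using upper_integral_attained[of UNIV a] by (metis UNIV_I lebesgue_on_UNIV_eq)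
  have "ennreal (r' - r) * c = (\<integral>\<^sup>+s. c * indicator {r<..<r'} s \<partial>lebesgue)"
    using assms(2) by (subst nn_integral_cmult_indicator) (auto simp: mult.commute)
  also have "\<dots> \<le> (\<integral>\<^sup>+s. b s \<partial>lebesgue)"
    using assms(1) by (intro nn_integral_mono_AE, elim AE_mp)
      (auto intro!: AE_I2 intro: order_trans[OF _ b(2)] split: split_indicator)
  finally show ?thesis using b(3) by simp
qed

section \<open>Hausdorff contents\<close>

text \<open>A level set of \<open>f\<close> can meet \<open>A\<close> only at levels in \<open>J\<close>. This is how Lipschitz functions enter
estimates of the contents of their level sets.\<close>

lemma bounded_interval_of_ediam:
  fixes f :: "'a::metric_space \<Rightarrow> real"
  assumes "ediam A < \<infinity>" "\<And>x y. x \<in> A \<Longrightarrow> y \<in> A \<Longrightarrow> \<bar>f x - f y\<bar> \<le> dist x y"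
  obtains J where "J \<in> sets lborel" "f ` A \<subseteq> J" "emeasure lborel J \<le> ediam A"
proof (cases "A = {}")
  case True then show ?thesis by (intro that[of "{}"]) auto
next
  case False
  define D where "D = enn2real (ediam A)"
  have D: "ediam A = ennreal D" "0 \<le> D" using assms(1) by (auto simp: D_def less_top)
  have d: "f x - f y \<le> D" if "x \<in> A" "y \<in> A" for x y
  proof -
    have "ennreal (dist x y) \<le> ennreal D" using dist_le_ediam[OF that] D by simp
    then have "dist x y \<le> D" using D(2) by simp
    then show ?thesis using assms(2)[OF that] by linarith
  qed
  obtain x0 where x0: "x0 \<in> A" using False by blast
  have bdd: "bdd_below (f ` A)" "bdd_above (f ` A)"
    using d[OF x0] d[OF _ x0] by (auto intro!: bdd_belowI2[of _ "f x0 - D"] bdd_aboveI2[of _ _ "f x0 + D"] simp: algebra_simps)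
  have "Sup (f ` A) \<le> Inf (f ` A) + D"
  proof (rule cSUP_least[OF False])
    fix x assume x: "x \<in> A"
    have "f x - D \<le> Inf (f ` A)" using d[OF x] by (intro cINF_greatest[OF False]) (auto simp: algebra_simps)
    then show "f x \<le> Inf (f ` A) + D" by simp
  qed
  moreover have "Inf (f ` A) \<le> Sup (f ` A)"
    using x0 bdd by (meson cINF_lower cSUP_upper order_trans)
  moreover have "f ` A \<subseteq> {Inf (f ` A)..Sup (f ` A)}"
    using bdd by (auto intro: cINF_lower cSUP_upper)
  ultimately show ?thesis
    by (intro that[of "{Inf (f ` A)..Sup (f ` A)}"]) (auto simp: D intro!: ennreal_leI)
qed

lemma hausdorff_pre_le_outer: "0 < \<epsilon> \<Longrightarrow> hausdorff_pre k \<epsilon> E \<le> hausdorff_outer k E"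
  unfolding hausdorff_outer_eq_SUP by (intro SUP_upper) auto

lemma hausdorff_pre_le:
  assumes "E \<subseteq> (\<Union>j. A j)" "\<And>j. ediam (A j) < ennreal \<epsilon>"
  shows "hausdorff_pre k \<epsilon> E \<le> (\<Sum>j. ennreal (hausdorff_const k) * ediam (A j) ^ k)"
  unfolding hausdorff_pre_def using assms by (intro INF_lower) auto

lemma hausdorff_pre_mono: "E \<subseteq> F \<Longrightarrow> hausdorff_pre k \<epsilon> E \<le> hausdorff_pre k \<epsilon> F"
  unfolding hausdorff_pre_def by (intro INF_superset_mono) auto

lemma hausdorff_pre_cover:
  assumes "hausdorff_pre k \<epsilon> E < c"
  shows "\<exists>A :: nat \<Rightarrow> 'a::metric_space set. E \<subseteq> (\<Union>j. A j) \<and> (\<forall>j. ediam (A j) < ennreal \<epsilon>) \<and>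
    (\<Sum>j. ennreal (hausdorff_const k) * ediam (A j) ^ k) < c"
  using assms unfolding hausdorff_pre_def by (auto simp: INF_less_iff)

lemma hausdorff_outer_tendsto:
  "(\<lambda>n. hausdorff_pre k (1 / real (Suc n)) E) \<longlonglongrightarrow> hausdorff_outer k E"
proof -
  have "filterlim (\<lambda>n. 1 / real (Suc n)) (at_right 0) sequentially"
    by (intro tendsto_imp_filterlim_at_right LIMSEQ_Suc[OF lim_1_over_n]) auto
  from filterlim_compose[OF hausdorff_pre_tendsto this] show ?thesis
    by (simp add: hausdorff_outer_eq_SUP)
qed

text \<open>The images of the sets of a cover lie in intervals of at most the same diameters, and Lebesgue measure is
countably subadditive.\<close>

lemma hausdorff_outer_1_ge:
  fixes f :: "'a::metric_space \<Rightarrow> real"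
  assumes lip: "\<And>x y. x \<in> E \<Longrightarrow> y \<in> E \<Longrightarrow> \<bar>f x - f y\<bar> \<le> dist x y" and sub: "{a..b} \<subseteq> f ` E"
  shows "ennreal (b - a) \<le> hausdorff_outer 1 E"
proof -
  have "ennreal (b - a) \<le> hausdorff_pre 1 1 E"
    unfolding hausdorff_pre_def
  proof (intro INF_greatest, clarify)
    fix A :: "nat \<Rightarrow> 'a set" assume A: "E \<subseteq> (\<Union>j. A j)" "\<forall>j. ediam (A j) < ennreal 1"
    have "\<exists>J. J \<in> sets lborel \<and> f ` (A j \<inter> E) \<subseteq> J \<and> emeasure lborel J \<le> ediam (A j)" for j
    proof -
      have *: "ediam (A j \<inter> E) \<le> ediam (A j)" by (intro ediam_mono) auto
      have "ediam (A j \<inter> E) < \<infinity>"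
        using order.strict_trans[OF order.strict_trans1[OF * A(2)[rule_format]] ennreal_less_top] by simp
      then obtain J where "J \<in> sets lborel" "f ` (A j \<inter> E) \<subseteq> J" "emeasure lborel J \<le> ediam (A j \<inter> E)"
        using bounded_interval_of_ediam[of "A j \<inter> E" f] lip by blast
      then show ?thesis using order_trans[OF _ *] by blast
    qed
    then obtain J where J: "\<And>j. J j \<in> sets lborel" "\<And>j. f ` (A j \<inter> E) \<subseteq> J j" "\<And>j. emeasure lborel (J j) \<le> ediam (A j)"
      by metis
    have "{a..b} \<subseteq> (\<Union>j. J j)"
    proof
      fix v assume "v \<in> {a..b}"
      then obtain x where x: "x \<in> E" "v = f x" using sub by blast
      then obtain j where "x \<in> A j" using A(1) by blast
      then have "v \<in> J j" using x J(2)[of j] by blast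
      then show "v \<in> (\<Union>j. J j)" by blast
    qed
    have "ennreal (b - a) \<le> emeasure lborel {a..b}" by (cases "a \<le> b") (auto simp: ennreal_neg)
    also have "\<dots> \<le> emeasure lborel (\<Union>j. J j)" using J(1) \<open>{a..b} \<subseteq> (\<Union>j. J j)\<close> by (intro emeasure_mono) auto
    also have "\<dots> \<le> (\<Sum>j. emeasure lborel (J j))" using J(1) by (intro emeasure_subadditive_countably) auto
    also have "\<dots> \<le> (\<Sum>j. ediam (A j))" using J(3) by (intro suminf_le) auto
    finally show "ennreal (b - a) \<le> (\<Sum>j. ennreal (hausdorff_const 1) * ediam (A j) ^ 1)" by (simp add: hausdorff_const_def)
  qed
  then show ?thesis using hausdorff_pre_le_outer[of 1 1 E] by simp
qed

section \<open>Coarea inequalities\<close>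

text \<open>Finite Borel measures on euclidean spaces are outer regular, and the homeomorphism transports this to the
given space.\<close>

lemma outer_regular_homeomorphic_plane:
  fixes \<nu> :: "'a::metric_space measure"
  assumes h: "(UNIV :: 'a set) homeomorphic (UNIV :: (real ^ 2) set)"
    and \<nu>: "sets \<nu> = sets borel" "emeasure \<nu> UNIV < \<infinity>" and E: "E \<in> sets borel" and e: "e > (0::ennreal)"
  obtains U where "open U" "E \<subseteq> U" "emeasure \<nu> U \<le> emeasure \<nu> E + e"
proof -
  obtain f :: "'a \<Rightarrow> real^2" and g where fg: "homeomorphism UNIV UNIV f g"
    using h unfolding homeomorphic_def by (elim exE)
  then have c: "continuous_on UNIV f" "continuous_on UNIV g" and inv: "\<And>x. g (f x) = x" "\<And>y. f (g y) = y"
    by (auto simp: homeomorphism_def)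
  have [measurable]: "f \<in> \<nu> \<rightarrow>\<^sub>M borel"
    unfolding measurable_cong_sets[OF \<nu>(1) refl] by (rule borel_measurable_continuous_onI[OF c(1)])
  have [measurable]: "g \<in> borel \<rightarrow>\<^sub>M borel" by (rule borel_measurable_continuous_onI[OF c(2)])
  have sp: "space \<nu> = UNIV" using \<nu>(1) by (metis sets_eq_imp_space_eq space_borel)
  let ?N = "distr \<nu> borel f"
  have E': "g -` E \<in> sets borel" using measurable_sets[of g borel borel E] E by simp
  have pre: "f -` (g -` E) = E" by (auto simp: inv)
  have NE: "emeasure ?N (g -` E) = emeasure \<nu> E" using E' by (simp add: emeasure_distr sp pre)
  have fin: "emeasure \<nu> E \<noteq> \<infinity>"
    using \<nu> E by (metis emeasure_mono infinity_ennreal_def leD sets.top sp subset_UNIV top.not_eq_extremum)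
  have "emeasure ?N (space ?N) \<noteq> \<infinity>" using \<nu> by (simp add: emeasure_distr sp)
  from outer_regular[OF _ this E'] have "(INF U \<in> {U. g -` E \<subseteq> U \<and> open U}. emeasure ?N U) = emeasure \<nu> E"
    by (simp add: NE)
  moreover have "emeasure \<nu> E < emeasure \<nu> E + e" using fin e by (simp add: less_top)
  ultimately have "(INF U \<in> {U. g -` E \<subseteq> U \<and> open U}. emeasure ?N U) < emeasure \<nu> E + e" by simp
  then obtain U where U: "g -` E \<subseteq> U" "open U" "emeasure ?N U < emeasure \<nu> E + e"
    by (auto simp: INF_less_iff)
  show ?thesis
  proof (rule that[of "f -` U"])
    show "open (f -` U)" using U(2) c(1) by (simp add: open_vimage)
    show "E \<subseteq> f -` U" using U(1) inv by auto
    show "emeasure \<nu> (f -` U) \<le> emeasure \<nu> E + e" using U by (simp add: emeasure_distr sp)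
  qed
qed

text \<open>Fatou's lemma replaces the contents by \<open>H\<^sup>1\<close>, outer regularity replaces open by Borel sets, and
simple functions lead to \<open>g\<close>. All steps compare upper integrals, so no measurability in \<open>t\<close> has
to be established.\<close>

lemma coarea_extension:
  fixes L :: "real \<Rightarrow> 'a::metric_space set" and \<nu> :: "'a measure"
  assumes L: "\<And>t. t \<in> A \<Longrightarrow> L t \<in> sets borel"
    and \<nu>: "sets \<nu> = sets borel"
    and reg: "\<And>E e. E \<in> sets borel \<Longrightarrow> e > (0::ennreal) \<Longrightarrow> \<exists>U. open U \<and> E \<subseteq> U \<and> emeasure \<nu> U \<le> emeasure \<nu> E + e"
    and base: "\<And>U \<epsilon>. open U \<Longrightarrow> \<epsilon> > 0 \<Longrightarrow>
       upper_lebesgue_integral A (\<lambda>t. hausdorff_pre 1 \<epsilon> (L t \<inter> U)) \<le> ennreal C * emeasure \<nu> U"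
    and g: "g \<in> borel_measurable borel"
  shows "upper_lebesgue_integral A (\<lambda>t. \<integral>\<^sup>+x\<in>L t. g x \<partial>hausdorff 1) \<le> ennreal C * (\<integral>\<^sup>+x. g x \<partial>\<nu>)"
proof -
  have open_set: "upper_lebesgue_integral A (\<lambda>t. hausdorff_outer 1 (L t \<inter> U)) \<le> ennreal C * emeasure \<nu> U"
    if "open U" for U
  proof -
    have "upper_lebesgue_integral A (\<lambda>t. liminf (\<lambda>n. hausdorff_pre 1 (1 / real (Suc n)) (L t \<inter> U))) \<le> ennreal C * emeasure \<nu> U"
      by (intro upper_integral_liminf base that) auto
    moreover have "liminf (\<lambda>n. hausdorff_pre 1 (1 / real (Suc n)) (L t \<inter> U)) = hausdorff_outer 1 (L t \<inter> U)" for t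
      by (intro lim_imp_Liminf hausdorff_outer_tendsto) auto
    ultimately show ?thesis by simp
  qed
  have borel_set: "upper_lebesgue_integral A (\<lambda>t. hausdorff_outer 1 (L t \<inter> E)) \<le> ennreal C * emeasure \<nu> E"
    if E: "E \<in> sets borel" for E
  proof (rule ennreal_le_epsilon)
    fix e :: real assume e: "0 < e"
    define e' where "e' = e / (\<bar>C\<bar> + 1)"
    have e': "e' > 0" using e by (simp add: e'_def)
    have Ce: "ennreal C * ennreal e' \<le> ennreal e"
    proof -
      have "C * e \<le> \<bar>C\<bar> * e" using e by (intro mult_right_mono) auto
      then have "C * e \<le> e * (\<bar>C\<bar> + 1)" using e by (simp only: algebra_simps)
      then have "C * e' \<le> e" by (simp add: e'_def pos_divide_le_eq)
      then show ?thesis using e' by (cases "C \<ge> 0") (auto simp: ennreal_mult[symmetric] ennreal_neg intro!: ennreal_leI)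
    qed
    obtain U where U: "open U" "E \<subseteq> U" "emeasure \<nu> U \<le> emeasure \<nu> E + ennreal e'"
      using reg[OF E, of "ennreal e'"] e' by auto
    have "upper_lebesgue_integral A (\<lambda>t. hausdorff_outer 1 (L t \<inter> E)) \<le> upper_lebesgue_integral A (\<lambda>t. hausdorff_outer 1 (L t \<inter> U))"
      using U(2) by (intro upper_integral_mono hausdorff_outer_mono) auto
    also have "\<dots> \<le> ennreal C * (emeasure \<nu> E + ennreal e')"
      using open_set[OF U(1)] U(3) by (meson mult_left_mono order_trans zero_le)
    also have "\<dots> \<le> ennreal C * emeasure \<nu> E + ennreal e"
      using Ce by (simp add: distrib_left add_left_mono)
    finally show "upper_lebesgue_integral A (\<lambda>t. hausdorff_outer 1 (L t \<inter> E)) \<le> ennreal C * emeasure \<nu> E + ennreal e" .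
  qed
  obtain s :: "nat \<Rightarrow> 'a \<Rightarrow> ennreal" where s: "\<And>i. simple_function borel (s i)" "incseq s" "\<And>x. (SUP i. s i x) = g x"
    using borel_measurable_implies_simple_function_sequence'[OF g] by metis
  have simple: "upper_lebesgue_integral A (\<lambda>t. \<integral>\<^sup>+x\<in>L t. s i x \<partial>hausdorff 1) \<le> ennreal C * (\<integral>\<^sup>+x. s i x \<partial>\<nu>)" for i
  proof -
    have fin: "finite (range (s i))" using simple_functionD(1)[OF s(1)[of i]] by simp
    obtain f :: "nat \<Rightarrow> ennreal" and n where f: "bij_betw f {..<n} (range (s i))"
      using ex_bij_betw_nat_finite[OF fin] by (auto simp: atLeast0LessThan)
    define E where "E = (\<lambda>j. if j < n then s i -` {f j} else {})"
    have E [measurable]: "E j \<in> sets borel" for j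
      using simple_functionD(2)[OF s(1)[of i], of "{f j}"] by (auto simp: E_def)
    have si: "s i x = (\<Sum>j. f j * indicator (E j) x)" for x
    proof -
      obtain k where k: "k < n" "f k = s i x" using f by (metis bij_betw_def imageE lessThan_iff rangeI)
      have "(\<Sum>j. f j * indicator (E j) x) = (\<Sum>j\<in>{k}. f j * indicator (E j) x)"
      proof (rule suminf_finite, simp)
        fix j assume "j \<notin> {k}"
        have "x \<notin> E j"
        proof
          assume "x \<in> E j"
          then have "j < n" "f j = f k" using k by (auto simp: E_def split: if_splits)
          then show False using f k \<open>j \<notin> {k}\<close> by (auto simp: bij_betw_def inj_on_def)
        qed
        then show "f j * indicator (E j) x = 0" by simp
      qed
      then show ?thesis using k by (simp add: E_def)
    qed
    have "upper_lebesgue_integral A (\<lambda>t. \<integral>\<^sup>+x\<in>L t. s i x \<partial>hausdorff 1)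
      \<le> upper_lebesgue_integral A (\<lambda>t. \<Sum>j. f j * hausdorff_outer 1 (L t \<inter> E j))"
    proof (intro upper_integral_mono eq_refl)
      fix t assume t: "t \<in> A"
      note [measurable] = L[OF t]
      have "(\<integral>\<^sup>+x\<in>L t. s i x \<partial>hausdorff 1) = (\<integral>\<^sup>+x. (\<Sum>j. f j * indicator (L t \<inter> E j) x) \<partial>hausdorff 1)"
        unfolding si by (intro nn_integral_cong, rename_tac x, case_tac "x \<in> L t") (auto simp: indicator_def)
      also have "\<dots> = (\<Sum>j. f j * emeasure (hausdorff 1) (L t \<inter> E j))"
        by (subst nn_integral_suminf) (auto intro!: suminf_cong nn_integral_cmult_indicator)
      also have "\<dots> = (\<Sum>j. f j * hausdorff_outer 1 (L t \<inter> E j))"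
        by (intro suminf_cong) (subst emeasure_hausdorff, auto)
      finally show "(\<integral>\<^sup>+x\<in>L t. s i x \<partial>hausdorff 1) = \<dots>" .
    qed
    also have "\<dots> \<le> (\<Sum>j. upper_lebesgue_integral A (\<lambda>t. f j * hausdorff_outer 1 (L t \<inter> E j)))"
      by (rule upper_integral_suminf)
    also have "\<dots> \<le> (\<Sum>j. f j * (ennreal C * emeasure \<nu> (E j)))"
      by (intro suminf_le order_trans[OF upper_integral_cmult] mult_left_mono borel_set) auto
    also have "\<dots> = ennreal C * (\<Sum>j. f j * emeasure \<nu> (E j))"
      by (simp only: mult.left_commute[of _ "ennreal C"] ennreal_suminf_cmult)
    also have "(\<Sum>j. f j * emeasure \<nu> (E j)) = (\<integral>\<^sup>+x. s i x \<partial>\<nu>)"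
      unfolding si using E \<nu> by (subst nn_integral_suminf) (simp_all add: nn_integral_cmult_indicator)
    finally show ?thesis .
  qed
  have meas_s: "s i \<in> borel_measurable borel" for i using s(1) by (rule borel_measurable_simple_function)
  have lim: "(\<integral>\<^sup>+x\<in>L t. g x \<partial>hausdorff 1) = liminf (\<lambda>i. \<integral>\<^sup>+x\<in>L t. s i x \<partial>hausdorff 1)" if t: "t \<in> A" for t
  proof -
    note [measurable] = L[OF t] meas_s
    have "(\<integral>\<^sup>+x\<in>L t. g x \<partial>hausdorff 1) = (\<integral>\<^sup>+x. (SUP i. s i x * indicator (L t) x) \<partial>hausdorff 1)"
      unfolding s(3)[symmetric] by (intro nn_integral_cong) (auto split: split_indicator)
    also have "\<dots> = (SUP i. \<integral>\<^sup>+x\<in>L t. s i x \<partial>hausdorff 1)"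
      using s(2) by (intro nn_integral_monotone_convergence_SUP) (auto simp: incseq_def le_fun_def split: split_indicator)
    also have "\<dots> = liminf (\<lambda>i. \<integral>\<^sup>+x\<in>L t. s i x \<partial>hausdorff 1)"
      using s(2) by (intro lim_imp_Liminf[symmetric] LIMSEQ_SUP)
        (auto simp: incseq_def le_fun_def intro!: nn_integral_mono split: split_indicator)
    finally show ?thesis .
  qed
  have "upper_lebesgue_integral A (\<lambda>t. \<integral>\<^sup>+x\<in>L t. g x \<partial>hausdorff 1)
      \<le> upper_lebesgue_integral A (\<lambda>t. liminf (\<lambda>i. \<integral>\<^sup>+x\<in>L t. s i x \<partial>hausdorff 1))"
    by (intro upper_integral_mono) (simp only: lim order_refl)
  also have "\<dots> \<le> ennreal C * (\<integral>\<^sup>+x. g x \<partial>\<nu>)"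
  proof (rule upper_integral_liminf)
    fix i
    have "(\<integral>\<^sup>+x. s i x \<partial>\<nu>) \<le> (\<integral>\<^sup>+x. g x \<partial>\<nu>)"
      unfolding s(3)[symmetric] by (intro nn_integral_mono SUP_upper) auto
    then show "upper_lebesgue_integral A (\<lambda>t. \<integral>\<^sup>+x\<in>L t. s i x \<partial>hausdorff 1) \<le> ennreal C * (\<integral>\<^sup>+x. g x \<partial>\<nu>)"
      using simple[of i] by (meson mult_left_mono order_trans zero_le)
  qed
  finally show ?thesis .
qed

text \<open>Eilenberg's inequality. If sets \<open>A\<^sub>j\<close> cover the part of \<open>Q\<close> in an open set, then \<open>A\<^sub>j\<close> meets
the level sets of \<open>m\<close> only at levels in a set of measure at most its diameter, so that the contents of
the level sets integrate to at most the sum of the squares of the diameters. The factor \<open>4 / \<pi>\<close> undoes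
the normalisation of \<open>H\<^sup>2\<close>.\<close>

lemma lipschitz_coarea:
  fixes m :: "'a::metric_space \<Rightarrow> real"
  assumes h: "(UNIV :: 'a set) homeomorphic (UNIV :: (real ^ 2) set)"
    and Q: "Q \<in> sets borel" "emeasure (hausdorff 2) Q < \<infinity>"
    and lip: "\<And>x y. \<bar>m x - m y\<bar> \<le> dist x y"
    and g: "g \<in> borel_measurable borel"
  shows "upper_lebesgue_integral UNIV (\<lambda>s. \<integral>\<^sup>+x\<in>{x \<in> Q. m x = s}. g x \<partial>hausdorff 1)
     \<le> ennreal (4 / pi) * (\<integral>\<^sup>+x\<in>Q. g x \<partial>hausdorff 2)"
proof -
  have "1-lipschitz_on UNIV m" using lip by (auto simp: lipschitz_on_def dist_real_def)
  then have "continuous_on UNIV m" by (rule lipschitz_on_continuous_on)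
  then have [measurable]: "m \<in> borel_measurable borel" by (rule borel_measurable_continuous_onI)
  note [measurable] = Q(1) g
  define \<nu> where "\<nu> = density (hausdorff 2) (indicator Q)"
  have s\<nu>: "sets \<nu> = sets borel" by (simp add: \<nu>_def)
  have e\<nu>: "emeasure \<nu> E = hausdorff_outer 2 (E \<inter> Q)" if "E \<in> sets borel" for E
    using that Q(1) by (simp add: \<nu>_def emeasure_density emeasure_hausdorff[symmetric] indicator_inter_arith[symmetric]
      Int_commute)
  have "upper_lebesgue_integral UNIV (\<lambda>s. \<integral>\<^sup>+x\<in>{x \<in> Q. m x = s}. g x \<partial>hausdorff 1)
     \<le> ennreal (4 / pi) * (\<integral>\<^sup>+x. g x \<partial>\<nu>)"
  proof (rule coarea_extension[OF _ s\<nu> _ _ g])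
    have "emeasure \<nu> UNIV < \<infinity>" using Q by (simp add: e\<nu> emeasure_hausdorff)
    then show "\<exists>U. open U \<and> E \<subseteq> U \<and> emeasure \<nu> U \<le> emeasure \<nu> E + e" if "E \<in> sets borel" "e > 0" for E e
      using outer_regular_homeomorphic_plane[OF h s\<nu> _ that] by metis
    show "{x \<in> Q. m x = s} \<in> sets borel" for s by measurable
    fix U :: "'a set" and \<epsilon> :: real assume U: "open U" and \<epsilon>: "\<epsilon> > 0"
    show "upper_lebesgue_integral UNIV (\<lambda>t. hausdorff_pre 1 \<epsilon> ({x \<in> Q. m x = t} \<inter> U)) \<le> ennreal (4/pi) * emeasure \<nu> U"
    proof (rule ennreal_le_epsilon)
      fix e :: real assume fin: "ennreal (4/pi) * emeasure \<nu> U < top" and e: "0 < e"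
      have fin2: "hausdorff_outer 2 (U \<inter> Q) < top" using fin U by (auto simp: e\<nu> ennreal_mult_less_top)
      have "hausdorff_pre 2 \<epsilon> (U \<inter> Q) \<le> hausdorff_outer 2 (U \<inter> Q)" using \<epsilon> by (rule hausdorff_pre_le_outer)
      also have "\<dots> < hausdorff_outer 2 (U \<inter> Q) + ennreal (pi/4*e)" using fin2 e by (simp add: less_top)
      finally have cov: "hausdorff_pre 2 \<epsilon> (U \<inter> Q) < hausdorff_outer 2 (U \<inter> Q) + ennreal (pi/4*e)" .
      obtain A where A: "U \<inter> Q \<subseteq> (\<Union>j. A j)" "\<forall>j. ediam (A j) < ennreal \<epsilon>"
        "(\<Sum>j. ennreal (hausdorff_const 2) * ediam (A j) ^ 2) < hausdorff_outer 2 (U \<inter> Q) + ennreal (pi/4*e)"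
        using hausdorff_pre_cover[OF cov] by (elim exE conjE)
      have "\<exists>J. J \<in> sets lborel \<and> m ` A j \<subseteq> J \<and> emeasure lborel J \<le> ediam (A j)" for j
      proof -
        have "ediam (A j) < \<infinity>" using A(2)[rule_format, of j] ennreal_less_top[of \<epsilon>] unfolding infinity_ennreal_def by (rule order.strict_trans)
        then obtain J where "J \<in> sets lborel" "m ` A j \<subseteq> J" "emeasure lborel J \<le> ediam (A j)"
          by (rule bounded_interval_of_ediam[of "A j" m, OF _ lip])
        then show ?thesis by blast
      qed
      then obtain J where J: "\<And>j. J j \<in> sets lborel" "\<And>j. m ` A j \<subseteq> J j" "\<And>j. emeasure lborel (J j) \<le> ediam (A j)" by metis
      have [measurable]: "J j \<in> sets lebesgue" for j using J(1)[of j] by simp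
      have "upper_lebesgue_integral UNIV (\<lambda>t. hausdorff_pre 1 \<epsilon> ({x \<in> Q. m x = t} \<inter> U))
        \<le> (\<integral>\<^sup>+t. (\<Sum>j. ediam (A j) * indicator (J j) t) \<partial>lebesgue_on UNIV)"
      proof (rule upper_integral_le)
        show "(\<lambda>t. \<Sum>j. ediam (A j) * indicator (J j) t) \<in> borel_measurable (lebesgue_on UNIV)" unfolding lebesgue_on_UNIV_eq by measurable
        fix t
        define B where "B = (\<lambda>j. if t \<in> J j then A j else {})"
        have "hausdorff_pre 1 \<epsilon> ({x \<in> Q. m x = t} \<inter> U) \<le> (\<Sum>j. ennreal (hausdorff_const 1) * ediam (B j) ^ 1)"
        proof (rule hausdorff_pre_le)
          show "{x \<in> Q. m x = t} \<inter> U \<subseteq> (\<Union>j. B j)"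
          proof
            fix x assume x: "x \<in> {x \<in> Q. m x = t} \<inter> U"
            then obtain j where "x \<in> A j" using A(1) by auto
            then show "x \<in> (\<Union>j. B j)" using x J(2)[of j] by (auto simp: B_def intro!: exI[of _ j])
          qed
          show "ediam (B j) < ennreal \<epsilon>" for j using A(2) \<epsilon> by (simp add: B_def)
        qed
        also have "\<dots> = (\<Sum>j. ediam (A j) * indicator (J j) t)"
          by (intro suminf_cong) (auto simp: B_def hausdorff_const_def)
        finally show "hausdorff_pre 1 \<epsilon> ({x \<in> Q. m x = t} \<inter> U) \<le> \<dots>" .
      qed
      also have "\<dots> = (\<Sum>j. ediam (A j) * emeasure lebesgue (J j))"
        unfolding lebesgue_on_UNIV_eq by (subst nn_integral_suminf) (simp_all add: nn_integral_cmult_indicator)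
      also have "\<dots> \<le> (\<Sum>j. ediam (A j) ^ 2)"
        using J by (intro suminf_le) (auto simp: power2_eq_square intro!: mult_left_mono)
      also have "\<dots> = (\<Sum>j. ennreal (4/pi) * (ennreal (hausdorff_const 2) * ediam (A j) ^ 2))"
        by (intro suminf_cong) (auto simp: hausdorff_const_def mult.assoc[symmetric] ennreal_mult[symmetric])
      also have "\<dots> = ennreal (4/pi) * (\<Sum>j. ennreal (hausdorff_const 2) * ediam (A j) ^ 2)"
        by (rule ennreal_suminf_cmult)
      also have "\<dots> \<le> ennreal (4/pi) * (hausdorff_outer 2 (U \<inter> Q) + ennreal (pi/4*e))"
        using A(3) by (intro mult_left_mono) auto
      also have "\<dots> = ennreal (4/pi) * emeasure \<nu> U + ennreal e"
        using U e by (simp add: e\<nu> distrib_left ennreal_mult[symmetric])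
      finally show "upper_lebesgue_integral UNIV (\<lambda>t. hausdorff_pre 1 \<epsilon> ({x \<in> Q. m x = t} \<inter> U))
        \<le> ennreal (4/pi) * emeasure \<nu> U + ennreal e" .
    qed
  qed
  also have "(\<integral>\<^sup>+x. g x \<partial>\<nu>) = (\<integral>\<^sup>+x\<in>Q. g x \<partial>hausdorff 2)"
    unfolding \<nu>_def by (subst nn_integral_density) (auto simp: mult.commute)
  finally show ?thesis .
qed

section \<open>Length of curves\<close>

abbreviation polygon_length :: "(real \<Rightarrow> 'a::metric_space) \<Rightarrow> nat \<Rightarrow> (nat \<Rightarrow> real) \<Rightarrow> ennreal" where
  "polygon_length \<gamma> n p \<equiv> \<Sum>i<n. ennreal (dist (\<gamma> (p i)) (\<gamma> (p (Suc i))))"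

definition partition_of :: "real \<Rightarrow> real \<Rightarrow> nat \<Rightarrow> (nat \<Rightarrow> real) \<Rightarrow> bool" where
  "partition_of a b n p \<longleftrightarrow> (\<forall>i\<le>n. p i \<in> {a..b}) \<and> (\<forall>i<n. p i \<le> p (Suc i))"

lemma curve_length_eq:
  "curve_length \<gamma> a b = (SUP (n, p)\<in>{(n, p). partition_of a b n p}. polygon_length \<gamma> n p)"
  unfolding curve_length_def partition_of_def by simp

lemma polygon_length_le: "partition_of a b n p \<Longrightarrow> polygon_length \<gamma> n p \<le> curve_length \<gamma> a b"
  unfolding curve_length_eq by (rule SUP_upper2[of "(n, p)"]) auto

lemma curve_length_leI:
  "(\<And>n p. partition_of a b n p \<Longrightarrow> polygon_length \<gamma> n p \<le> c) \<Longrightarrow> curve_length \<gamma> a b \<le> c"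
  unfolding curve_length_eq by (intro SUP_least) auto

lemma curve_length_mono: "{a..b} \<subseteq> {c..d} \<Longrightarrow> curve_length \<gamma> a b \<le> curve_length \<gamma> c d"
  by (intro curve_length_leI polygon_length_le) (auto simp: partition_of_def)

lemma curve_length_cong:
  assumes "\<And>t. t \<in> {a..b} \<Longrightarrow> \<gamma> t = \<eta> t"
  shows "curve_length \<gamma> a b = curve_length \<eta> a b"
  unfolding curve_length_eq
proof (rule SUP_cong[OF refl], clarify)
  fix n p assume p: "partition_of a b n p"
  have "ennreal (dist (\<gamma> (p i)) (\<gamma> (p (Suc i)))) = ennreal (dist (\<eta> (p i)) (\<eta> (p (Suc i))))" if "i < n" for i
  proof -
    have "p i \<in> {a..b}" "p (Suc i) \<in> {a..b}" using p that by (auto simp: partition_of_def)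
    then show ?thesis using assms by simp
  qed
  then show "polygon_length \<gamma> n p = polygon_length \<eta> n p" by (intro sum.cong) auto
qed

lemma dist_le_curve_length:
  assumes "s \<in> {a..b}" "t \<in> {a..b}" "s \<le> t"
  shows "ennreal (dist (\<gamma> s) (\<gamma> t)) \<le> curve_length \<gamma> a b"
proof -
  have "partition_of a b 1 (\<lambda>i. if i = 0 then s else t)" using assms by (auto simp: partition_of_def)
  from polygon_length_le[OF this, of \<gamma>] show ?thesis by simp
qed

text \<open>Clamping at \<open>b\<close> splits a partition without changing the number of its points; the repeated points do
not contribute to polygon lengths.\<close>

lemma partition_clamp:
  assumes "partition_of a c n p" "a \<le> b" "b \<le> c"
  shows "partition_of a b n (\<lambda>i. min (p i) b)" "partition_of b c n (\<lambda>i. max (p i) b)"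
proof -
  have p: "a \<le> p i" "p i \<le> c" if "i \<le> n" for i using assms(1) that by (auto simp: partition_of_def)
  have m: "p i \<le> p (Suc i)" if "i < n" for i using assms(1) that by (auto simp: partition_of_def)
  show "partition_of a b n (\<lambda>i. min (p i) b)" "partition_of b c n (\<lambda>i. max (p i) b)"
    unfolding partition_of_def using p m assms(2,3) by (auto intro: min.coboundedI1 max.coboundedI1)
qed

lemma polygon_length_split:
  assumes "partition_of a c n p"
  shows "polygon_length \<gamma> n p \<le> polygon_length \<gamma> n (\<lambda>i. min (p i) b) + polygon_length \<gamma> n (\<lambda>i. max (p i) b)"
proof -
  have "ennreal (dist (\<gamma> (p i)) (\<gamma> (p (Suc i)))) \<le>
     ennreal (dist (\<gamma> (min (p i) b)) (\<gamma> (min (p (Suc i)) b))) + ennreal (dist (\<gamma> (max (p i) b)) (\<gamma> (max (p (Suc i)) b)))"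
    if "i < n" for i
  proof -
    have "p i \<le> p (Suc i)" using assms that by (auto simp: partition_of_def)
    then have "dist (\<gamma> (p i)) (\<gamma> (p (Suc i))) \<le>
     dist (\<gamma> (min (p i) b)) (\<gamma> (min (p (Suc i)) b)) + dist (\<gamma> (max (p i) b)) (\<gamma> (max (p (Suc i)) b))"
      by (auto simp: min_def max_def intro: dist_triangle)
    then show ?thesis by (simp add: ennreal_plus[symmetric] ennreal_leI del: ennreal_plus)
  qed
  then have "polygon_length \<gamma> n p \<le> (\<Sum>i<n. ennreal (dist (\<gamma> (min (p i) b)) (\<gamma> (min (p (Suc i)) b))) + ennreal (dist (\<gamma> (max (p i) b)) (\<gamma> (max (p (Suc i)) b))))"
    by (intro sum_mono) auto
  then show ?thesis by (simp add: sum.distrib)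
qed

lemma sum_lessThan_add: "(\<Sum>i<n + k. f i) = (\<Sum>i<n. f i) + (\<Sum>i<k. f (n + i))"
  for f :: "nat \<Rightarrow> 'b::comm_monoid_add"
  by (induction k) (auto simp: add.assoc)

lemma polygon_length_join:
  assumes p: "partition_of a b n p" and q: "partition_of b c m q"
  shows "polygon_length \<gamma> n p + polygon_length \<gamma> m q \<le> curve_length \<gamma> a c"
proof -
  define r where "r = (\<lambda>i. if i \<le> n then p i else q (i - Suc n))"
  have "p n \<in> {a..b}" "q 0 \<in> {b..c}" using p q by (auto simp: partition_of_def)
  then have pq: "p n \<le> q 0" and ab: "a \<le> b" "b \<le> c" by auto
  have "partition_of a c (n + Suc m) r"
    unfolding partition_of_def
  proof (intro conjI allI impI)
    fix i assume i: "i \<le> n + Suc m"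
    show "r i \<in> {a..c}"
    proof (cases "i \<le> n")
      case True
      then have "p i \<in> {a..b}" using p by (auto simp: partition_of_def)
      then show ?thesis using ab True by (auto simp: r_def)
    next
      case False
      then have "q (i - Suc n) \<in> {b..c}" using q i by (auto simp: partition_of_def)
      then show ?thesis using False ab by (auto simp: r_def)
    qed
  next
    fix i assume i: "i < n + Suc m"
    consider "i < n" | "i = n" | "i > n" by linarith
    then show "r i \<le> r (Suc i)"
    proof cases
      case 3
      then have "Suc (i - Suc n) = i - n" by simp
      moreover have "q (i - Suc n) \<le> q (Suc (i - Suc n))" using q i 3 by (auto simp: partition_of_def)
      ultimately show ?thesis using 3 by (simp add: r_def)
    qed (use p pq in \<open>auto simp: partition_of_def r_def\<close>)
  qed
  from polygon_length_le[OF this, of \<gamma>]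
  have le: "polygon_length \<gamma> (n + Suc m) r \<le> curve_length \<gamma> a c" .
  have "polygon_length \<gamma> n p = polygon_length \<gamma> n r" by (intro sum.cong) (auto simp: r_def)
  moreover have "polygon_length \<gamma> m q = (\<Sum>i<m. ennreal (dist (\<gamma> (r (n + Suc i))) (\<gamma> (r (Suc (n + Suc i))))))"
    by (intro sum.cong) (auto simp: r_def)
  moreover have "\<dots> \<le> (\<Sum>i<Suc m. ennreal (dist (\<gamma> (r (n + i))) (\<gamma> (r (Suc (n + i))))))"
    unfolding sum.lessThan_Suc_shift by simp
  ultimately have "polygon_length \<gamma> n p + polygon_length \<gamma> m q \<le> polygon_length \<gamma> (n + Suc m) r"
    unfolding sum_lessThan_add[of _ n "Suc m"] by (intro add_mono) auto
  then show ?thesis using le by simp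
qed

lemma partition_exists: "a \<le> b \<Longrightarrow> {(n, p). partition_of a b n p} \<noteq> {}"
proof -
  assume "a \<le> b"
  then have "(0, \<lambda>_. a) \<in> {(n, p). partition_of a b n p}" by (auto simp: partition_of_def)
  then show ?thesis by blast
qed

lemma curve_length_add:
  assumes "a \<le> b" "b \<le> c"
  shows "curve_length \<gamma> a c = curve_length \<gamma> a b + curve_length \<gamma> b c"
proof (rule antisym)
  show "curve_length \<gamma> a c \<le> curve_length \<gamma> a b + curve_length \<gamma> b c"
  proof (rule curve_length_leI)
    fix n p assume p: "partition_of a c n p"
    have "polygon_length \<gamma> n p \<le> polygon_length \<gamma> n (\<lambda>i. min (p i) b) + polygon_length \<gamma> n (\<lambda>i. max (p i) b)"
      by (rule polygon_length_split[OF p])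
    also have "\<dots> \<le> curve_length \<gamma> a b + curve_length \<gamma> b c"
      by (intro add_mono polygon_length_le partition_clamp[OF p assms])
    finally show "polygon_length \<gamma> n p \<le> curve_length \<gamma> a b + curve_length \<gamma> b c" .
  qed
  have "polygon_length \<gamma> n p + curve_length \<gamma> b c \<le> curve_length \<gamma> a c" if p: "partition_of a b n p" for n p
  proof -
    have "polygon_length \<gamma> n p + curve_length \<gamma> b c =
      (SUP x\<in>{(n, p). partition_of b c n p}. polygon_length \<gamma> n p + (case x of (m, q) \<Rightarrow> polygon_length \<gamma> m q))"
      unfolding curve_length_eq[of _ b c] ennreal_SUP_add_right[OF partition_exists[OF assms(2)]] ..
    also have "\<dots> \<le> curve_length \<gamma> a c"
      by (intro SUP_least) (use polygon_length_join[OF p] in auto)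
    finally show ?thesis .
  qed
  then have "(SUP x\<in>{(n, p). partition_of a b n p}. (case x of (m, q) \<Rightarrow> polygon_length \<gamma> m q) + curve_length \<gamma> b c) \<le> curve_length \<gamma> a c"
    by (intro SUP_least) auto
  then show "curve_length \<gamma> a b + curve_length \<gamma> b c \<le> curve_length \<gamma> a c"
    unfolding ennreal_SUP_add_left[OF partition_exists[OF assms(1)]] curve_length_eq[of _ a b] .
qed

lemma curve_length_same [simp]: "curve_length \<gamma> a a = 0"
proof -
  have "curve_length \<gamma> a a \<le> 0"
  proof (rule curve_length_leI)
    fix n p assume "partition_of a a n p"
    then have "p i = a" if "i \<le> n" for i using that by (auto simp: partition_of_def)
    then show "polygon_length \<gamma> n p \<le> 0" by simp
  qed
  then show ?thesis by simp
qed

lemma curve_length_const: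
  assumes "\<And>t. t \<in> {a..b} \<Longrightarrow> \<gamma> t = x" shows "curve_length \<gamma> a b = 0"
proof -
  have "curve_length \<gamma> a b \<le> 0"
  proof (rule curve_length_leI)
    fix n p assume "partition_of a b n p"
    then have "\<gamma> (p i) = x" if "i \<le> n" for i using that assms by (auto simp: partition_of_def)
    then show "polygon_length \<gamma> n p \<le> 0" by simp
  qed
  then show ?thesis by simp
qed

lemma curve_length_affine:
  assumes "\<alpha> > 0"
  shows "curve_length (\<lambda>t. \<gamma> (\<alpha> * t + \<beta>)) a b = curve_length \<gamma> (\<alpha> * a + \<beta>) (\<alpha> * b + \<beta>)"
proof -
  have le: "curve_length (\<lambda>t. \<eta> (\<alpha> * t + \<beta>)) a b \<le> curve_length \<eta> (\<alpha> * a + \<beta>) (\<alpha> * b + \<beta>)" if "\<alpha> > 0"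
    for \<eta> :: "real \<Rightarrow> 'a" and \<alpha> \<beta> a b
  proof (rule curve_length_leI)
    fix n p assume p: "partition_of a b n p"
    have "partition_of (\<alpha> * a + \<beta>) (\<alpha> * b + \<beta>) n (\<lambda>i. \<alpha> * p i + \<beta>)"
      using p \<open>\<alpha> > 0\<close> by (auto simp: partition_of_def)
    from polygon_length_le[OF this] show "polygon_length (\<lambda>t. \<eta> (\<alpha> * t + \<beta>)) n p \<le> curve_length \<eta> (\<alpha> * a + \<beta>) (\<alpha> * b + \<beta>)" .
  qed
  have "curve_length (\<lambda>t. \<gamma> (\<alpha> * ((1/\<alpha>) * t + (- \<beta>/\<alpha>)) + \<beta>)) (\<alpha> * a + \<beta>) (\<alpha> * b + \<beta>)
    \<le> curve_length (\<lambda>t. \<gamma> (\<alpha> * t + \<beta>)) ((1/\<alpha>) * (\<alpha> * a + \<beta>) + (- \<beta>/\<alpha>)) ((1/\<alpha>) * (\<alpha> * b + \<beta>) + (- \<beta>/\<alpha>))"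
    by (rule le[of "1/\<alpha>" "\<lambda>t. \<gamma> (\<alpha> * t + \<beta>)"]) (use assms in simp)
  moreover have "(1/\<alpha>) * (\<alpha> * x + \<beta>) + (- \<beta>/\<alpha>) = x" "\<alpha> * ((1/\<alpha>) * x + (- \<beta>/\<alpha>)) + \<beta> = x" for x
    using assms by (auto simp: field_simps)
  ultimately show ?thesis using le[OF assms, of \<gamma> \<beta> a b] by (simp only: antisym)
qed

lemma curve_length_reverse:
  "curve_length (\<lambda>t. \<gamma> (c - t)) (c - b) (c - a) = curve_length \<gamma> a b"
proof -
  have le: "curve_length (\<lambda>t. \<eta> (c - t)) (c - b) (c - a) \<le> curve_length \<eta> a b" for \<eta> :: "real \<Rightarrow> 'a" and a b
  proof (rule curve_length_leI)
    fix n p assume p: "partition_of (c - b) (c - a) n p"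
    define q where "q = (\<lambda>i. c - p (n - i))"
    have "partition_of a b n q"
      unfolding partition_of_def q_def
    proof (intro conjI allI impI)
      fix i assume "i \<le> n"
      have "p (n - i) \<in> {c - b..c - a}" using p by (auto simp: partition_of_def)
      then show "c - p (n - i) \<in> {a..b}" by auto
    next
      fix i assume "i < n"
      then have "p (n - Suc i) \<le> p (Suc (n - Suc i))" using p by (auto simp: partition_of_def)
      then show "c - p (n - i) \<le> c - p (n - Suc i)" using \<open>i < n\<close> by (simp add: Suc_diff_Suc)
    qed
    from polygon_length_le[OF this, of \<eta>]
    have "polygon_length \<eta> n q \<le> curve_length \<eta> a b" .
    moreover have "polygon_length \<eta> n q = (\<Sum>i<n. ennreal (dist (\<eta> (q (n - Suc i))) (\<eta> (q (Suc (n - Suc i))))))"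
      by (rule sum.nat_diff_reindex[symmetric])
    moreover have "\<dots> = polygon_length (\<lambda>t. \<eta> (c - t)) n p"
      by (intro sum.cong) (auto simp: q_def dist_commute Suc_diff_Suc)
    ultimately show "polygon_length (\<lambda>t. \<eta> (c - t)) n p \<le> curve_length \<eta> a b" by simp
  qed
  from le[of "\<lambda>t. \<gamma> (c - t)" "c - a" "c - b"] le[of \<gamma> b a] show ?thesis by (simp add: antisym)
qed

lemma rectifiable_subinterval: "rectifiable \<gamma> a b \<Longrightarrow> {c..d} \<subseteq> {a..b} \<Longrightarrow> rectifiable \<gamma> c d"
  unfolding rectifiable_def using curve_length_mono[of c d a b \<gamma>] by (rule order.strict_trans1)

abbreviation arc_len :: "(real \<Rightarrow> 'a::metric_space) \<Rightarrow> real \<Rightarrow> real \<Rightarrow> real" where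
  "arc_len \<gamma> a b \<equiv> enn2real (curve_length \<gamma> a b)"

lemma curve_length_eq_arc_len: "rectifiable \<gamma> a b \<Longrightarrow> curve_length \<gamma> a b = ennreal (arc_len \<gamma> a b)"
  by (simp add: rectifiable_def less_top)

lemma arc_len_add:
  assumes "rectifiable \<gamma> a c" "a \<le> b" "b \<le> c"
  shows "arc_len \<gamma> a c = arc_len \<gamma> a b + arc_len \<gamma> b c"
proof -
  have "rectifiable \<gamma> a b" "rectifiable \<gamma> b c"
    using assms by (auto intro: rectifiable_subinterval)
  then show ?thesis unfolding curve_length_add[OF assms(2,3)] by (intro enn2real_plus) (auto simp: rectifiable_def less_top)
qed

lemma dist_le_arc_len:
  assumes "rectifiable \<gamma> s t" "s \<le> t" shows "dist (\<gamma> s) (\<gamma> t) \<le> arc_len \<gamma> s t"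
proof -
  have "ennreal (dist (\<gamma> s) (\<gamma> t)) \<le> ennreal (arc_len \<gamma> s t)"
    using dist_le_curve_length[of s s t t \<gamma>] assms curve_length_eq_arc_len[OF assms(1)] by simp
  then show ?thesis by simp
qed

text \<open>Take a polygon whose length is within \<open>\<epsilon>\<close> of that of the curve. Adding two close parameters
\<open>s\<close> and \<open>t\<close> to its vertices splits it into three polygons. The outer two are no longer than the curve
outside \<open>[s,t]\<close>, and the middle one is short, having a fixed number of short edges; so the curve between
\<open>s\<close> and \<open>t\<close> has length at most \<open>2 * \<epsilon>\<close>.\<close>

lemma continuous_arc_len:
  assumes cont: "continuous_on {a..b} \<gamma>" and rect: "rectifiable \<gamma> a b"
  shows "continuous_on {a..b} (arc_len \<gamma> a)"
proof -
  have small: "\<exists>\<delta>>0. \<forall>s\<in>{a..b}. \<forall>t\<in>{a..b}. s \<le> t \<and> t - s < \<delta> \<longrightarrow> curve_length \<gamma> s t \<le> ennreal (2 * \<epsilon>)"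
    if \<epsilon>: "\<epsilon> > 0" and ab: "a \<le> b" for \<epsilon>
  proof -
    have "\<exists>n p. partition_of a b n p \<and> curve_length \<gamma> a b < polygon_length \<gamma> n p + ennreal \<epsilon>"
    proof (rule ccontr)
      assume "\<not> ?thesis"
      then have *: "polygon_length \<gamma> n p + ennreal \<epsilon> \<le> curve_length \<gamma> a b" if "partition_of a b n p" for n p
        using that by (meson not_le)
      have "(SUP x\<in>{(n, p). partition_of a b n p}. (case x of (m, q) \<Rightarrow> polygon_length \<gamma> m q) + ennreal \<epsilon>) \<le> curve_length \<gamma> a b"
        by (intro SUP_least) (use * in auto)
      then have "curve_length \<gamma> a b + ennreal \<epsilon> \<le> curve_length \<gamma> a b"
        unfolding ennreal_SUP_add_left[OF partition_exists[OF ab]] curve_length_eq[of _ a b] .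
      moreover have "curve_length \<gamma> a b < curve_length \<gamma> a b + ennreal \<epsilon>"
        using rect \<epsilon> by (simp add: rectifiable_def less_top)
      ultimately show False by simp
    qed
    then obtain n p where p: "partition_of a b n p" and close: "curve_length \<gamma> a b < polygon_length \<gamma> n p + ennreal \<epsilon>" by blast
    have "uniformly_continuous_on {a..b} \<gamma>" by (rule compact_uniformly_continuous[OF cont]) simp
    then obtain \<delta> where \<delta>: "\<delta> > 0" "\<And>s t. s \<in> {a..b} \<Longrightarrow> t \<in> {a..b} \<Longrightarrow> dist t s < \<delta> \<Longrightarrow> dist (\<gamma> t) (\<gamma> s) < \<epsilon> / (real n + 1)"
      unfolding uniformly_continuous_on_def using \<epsilon> by (metis add_nonneg_pos divide_pos_pos of_nat_0_le_iff zero_less_one)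
    show ?thesis
    proof (intro exI[of _ \<delta>] conjI ballI impI)
      show "\<delta> > 0" by (rule \<delta>)
      fix s t assume st: "s \<in> {a..b}" "t \<in> {a..b}" "s \<le> t \<and> t - s < \<delta>"
      let ?q = "\<lambda>i. min (max (p i) s) t"
      have p2: "partition_of s b n (\<lambda>i. max (p i) s)" and p1: "partition_of a s n (\<lambda>i. min (p i) s)"
        using partition_clamp[OF p, of s] st by auto
      have p3: "partition_of s t n ?q" and p4: "partition_of t b n (\<lambda>i. max (max (p i) s) t)"
        using partition_clamp[OF p2, of t] st by auto
      have "polygon_length \<gamma> n ?q \<le> (\<Sum>i<n. ennreal (\<epsilon> / (real n + 1)))"
      proof (intro sum_mono ennreal_leI less_imp_le)
        fix i assume i: "i \<in> {..<n}"
        have "?q i \<in> {s..t}" "?q (Suc i) \<in> {s..t}" using st by auto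
        then show "dist (\<gamma> (?q i)) (\<gamma> (?q (Suc i))) < \<epsilon> / (real n + 1)"
          using st by (intro \<delta>(2)) (auto simp: dist_real_def)
      qed
      also have "\<dots> = ennreal (real n * (\<epsilon> / (real n + 1)))"
        using \<epsilon> by (simp add: ennreal_mult[symmetric] ennreal_of_nat_eq_real_of_nat)
      also have "\<dots> \<le> ennreal \<epsilon>" using \<epsilon> by (intro ennreal_leI) (simp add: field_simps)
      finally have mid: "polygon_length \<gamma> n ?q \<le> ennreal \<epsilon>" .
      have "curve_length \<gamma> a s + curve_length \<gamma> t b + curve_length \<gamma> s t = curve_length \<gamma> a b"
        using st curve_length_add[of a s b \<gamma>] curve_length_add[of s t b \<gamma>] by (simp add: ac_simps)
      also have "\<dots> \<le> polygon_length \<gamma> n p + ennreal \<epsilon>" using close by simp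
      also have "polygon_length \<gamma> n p \<le> polygon_length \<gamma> n (\<lambda>i. min (p i) s) + polygon_length \<gamma> n (\<lambda>i. max (p i) s)"
        by (rule polygon_length_split[OF p])
      also have "polygon_length \<gamma> n (\<lambda>i. max (p i) s) \<le> polygon_length \<gamma> n ?q + polygon_length \<gamma> n (\<lambda>i. max (max (p i) s) t)"
        by (rule polygon_length_split[OF p2])
      also have "polygon_length \<gamma> n (\<lambda>i. min (p i) s) \<le> curve_length \<gamma> a s" by (rule polygon_length_le[OF p1])
      also have "polygon_length \<gamma> n (\<lambda>i. max (max (p i) s) t) \<le> curve_length \<gamma> t b" by (rule polygon_length_le[OF p4])
      also note mid
      also have "curve_length \<gamma> a s + (ennreal \<epsilon> + curve_length \<gamma> t b) + ennreal \<epsilon> = curve_length \<gamma> a s + curve_length \<gamma> t b + ennreal (2 * \<epsilon>)"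
        using \<epsilon> by (simp add: ac_simps ennreal_plus[symmetric] del: ennreal_plus)
      finally have le: "curve_length \<gamma> a s + curve_length \<gamma> t b + curve_length \<gamma> s t
         \<le> curve_length \<gamma> a s + curve_length \<gamma> t b + ennreal (2 * \<epsilon>)" by (simp add: add_left_mono add_right_mono)
      have "rectifiable \<gamma> a s" "rectifiable \<gamma> t b" using st by (auto intro!: rectifiable_subinterval[OF rect])
      then show "curve_length \<gamma> s t \<le> ennreal (2 * \<epsilon>)"
        using le unfolding ennreal_add_left_cancel_le by (auto simp: rectifiable_def less_top)
    qed
  qed
  show ?thesis
    unfolding continuous_on_iff
  proof (intro ballI allI impI)
    fix s e :: real assume s: "s \<in> {a..b}" and e: "0 < e"
    then have ab: "a \<le> b" by simp
    obtain \<delta> where \<delta>: "\<delta> > 0" "\<And>s t. s \<in> {a..b} \<Longrightarrow> t \<in> {a..b} \<Longrightarrow> s \<le> t \<Longrightarrow> t - s < \<delta> \<Longrightarrow> curve_length \<gamma> s t \<le> ennreal (2 * (e/4))"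
      using small[of "e/4"] e ab by auto
    have ord: "\<bar>arc_len \<gamma> a t - arc_len \<gamma> a s\<bar> < e" if "s \<in> {a..b}" "t \<in> {a..b}" "s \<le> t" "t - s < \<delta>" for s t
    proof -
      have r: "rectifiable \<gamma> a t" using that by (auto intro!: rectifiable_subinterval[OF rect])
      have "ennreal (arc_len \<gamma> s t) \<le> ennreal (e/2)"
        using \<delta>(2)[OF that] curve_length_eq_arc_len[of \<gamma> s t] that rectifiable_subinterval[OF rect, of s t] by auto
      then have "arc_len \<gamma> s t \<le> e/2" using e by simp
      then show ?thesis using arc_len_add[OF r, of s] that e by auto
    qed
    show "\<exists>d>0. \<forall>x'\<in>{a..b}. dist x' s < d \<longrightarrow> dist (arc_len \<gamma> a x') (arc_len \<gamma> a s) < e"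
    proof (intro exI[of _ \<delta>] conjI ballI impI)
      fix t assume t: "t \<in> {a..b}" "dist t s < \<delta>"
      show "dist (arc_len \<gamma> a t) (arc_len \<gamma> a s) < e"
      proof (cases "s \<le> t")
        case True then show ?thesis using ord[OF s t(1)] t by (auto simp: dist_real_def)
      next
        case False then show ?thesis using ord[OF t(1) s] t by (auto simp: dist_real_def abs_minus_commute)
      qed
    qed (rule \<delta>)
  qed
qed

section \<open>Arc length parametrisation\<close>

text \<open>Between two parameters at the same arc length the curve has length \<open>0\<close> and is constant, so the choice
made in the definition has no influence.\<close>

lemma arc_length_param_eq:
  assumes rect: "rectifiable \<gamma> a b" and t: "t \<in> {a..b}"
  shows "arc_length_param \<gamma> a b (arc_len \<gamma> a t) = \<gamma> t"
proof -
  have r: "rectifiable \<gamma> a s" if "s \<in> {a..b}" for s using that by (auto intro!: rectifiable_subinterval[OF rect])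
  define t' where "t' = (SOME t'. t' \<in> {a..b} \<and> curve_length \<gamma> a t' = ennreal (arc_len \<gamma> a t))"
  have "t' \<in> {a..b} \<and> curve_length \<gamma> a t' = ennreal (arc_len \<gamma> a t)"
    unfolding t'_def by (rule someI[of _ t]) (intro conjI t curve_length_eq_arc_len r)
  then have t': "t' \<in> {a..b}" "arc_len \<gamma> a t' = arc_len \<gamma> a t" by auto
  have eq: "\<gamma> x = \<gamma> y" if "x \<in> {a..b}" "y \<in> {a..b}" "x \<le> y" "arc_len \<gamma> a x = arc_len \<gamma> a y" for x y
  proof -
    have "arc_len \<gamma> a y = arc_len \<gamma> a x + arc_len \<gamma> x y"
      using that by (intro arc_len_add r) auto
    then have "arc_len \<gamma> x y = 0" using that(4) by linarith
    moreover have "rectifiable \<gamma> x y" using that by (auto intro!: rectifiable_subinterval[OF rect])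
    ultimately show ?thesis using dist_le_arc_len[of \<gamma> x y] that by auto
  qed
  have "\<gamma> t' = \<gamma> t"
  proof (cases "t \<le> t'")
    case True then show ?thesis using eq[OF t t'(1)] t'(2) by simp
  next
    case False then show ?thesis using eq[OF t'(1) t] t'(2) by simp
  qed
  then show ?thesis unfolding arc_length_param_def t'_def .
qed

lemma arc_len_surj:
  assumes cont: "continuous_on {a..b} \<gamma>" and rect: "rectifiable \<gamma> a b" and ab: "a \<le> b" and r: "r \<in> {0..arc_len \<gamma> a b}"
  obtains t where "t \<in> {a..b}" "arc_len \<gamma> a t = r"
proof -
  have "\<exists>t\<ge>a. t \<le> b \<and> arc_len \<gamma> a t = r"
    by (rule IVT'[of "arc_len \<gamma> a"]) (use continuous_arc_len[OF cont rect] ab r in auto)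
  then show ?thesis using that by auto
qed

lemma arc_len_mono:
  assumes "rectifiable \<gamma> a b" "a \<le> s" "s \<le> t" "t \<le> b"
  shows "arc_len \<gamma> a s \<le> arc_len \<gamma> a t"
proof -
  have "rectifiable \<gamma> a t" using assms(2-4) by (intro rectifiable_subinterval[OF assms(1)]) auto
  from arc_len_add[OF this assms(2,3)] show ?thesis by simp
qed

lemma arc_length_param_lipschitz:
  assumes cont: "continuous_on {a..b} \<gamma>" and rect: "rectifiable \<gamma> a b" and ab: "a \<le> b"
    and r: "r \<in> {0..arc_len \<gamma> a b}" "r' \<in> {0..arc_len \<gamma> a b}"
  shows "dist (arc_length_param \<gamma> a b r) (arc_length_param \<gamma> a b r') \<le> \<bar>r - r'\<bar>"
proof -
  have *: "dist (\<gamma> s) (\<gamma> t) \<le> \<bar>arc_len \<gamma> a s - arc_len \<gamma> a t\<bar>" if "s \<in> {a..b}" "t \<in> {a..b}" "s \<le> t" for s t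
  proof -
    have "dist (\<gamma> s) (\<gamma> t) \<le> arc_len \<gamma> s t"
      using that by (intro dist_le_arc_len rectifiable_subinterval[OF rect]) auto
    also have "\<dots> = arc_len \<gamma> a t - arc_len \<gamma> a s"
    proof -
      have "arc_len \<gamma> a t = arc_len \<gamma> a s + arc_len \<gamma> s t"
        using that by (intro arc_len_add rectifiable_subinterval[OF rect]) auto
      then show ?thesis by linarith
    qed
    finally show ?thesis by simp
  qed
  obtain s where s: "s \<in> {a..b}" "arc_len \<gamma> a s = r" using arc_len_surj[OF cont rect ab r(1)] .
  obtain t where t: "t \<in> {a..b}" "arc_len \<gamma> a t = r'" using arc_len_surj[OF cont rect ab r(2)] .
  have "dist (\<gamma> s) (\<gamma> t) \<le> \<bar>arc_len \<gamma> a s - arc_len \<gamma> a t\<bar>"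
  proof (cases "s \<le> t")
    case True then show ?thesis using *[OF s(1) t(1)] by simp
  next
    case False then show ?thesis using *[OF t(1) s(1)] by (simp add: dist_commute abs_minus_commute)
  qed
  then show ?thesis using arc_length_param_eq[OF rect s(1)] arc_length_param_eq[OF rect t(1)] s t by simp
qed

section \<open>Line integrals\<close>

lemma arc_length_param_left:
  assumes cont: "continuous_on {a..c} \<gamma>" and rect: "rectifiable \<gamma> a c" and ab: "a \<le> b" "b \<le> c"
    and r: "r \<in> {0..arc_len \<gamma> a b}"
  shows "arc_length_param \<gamma> a b r = arc_length_param \<gamma> a c r"
proof -
  have rect': "rectifiable \<gamma> a b" using ab by (intro rectifiable_subinterval[OF rect]) auto
  have cont': "continuous_on {a..b} \<gamma>" using ab by (intro continuous_on_subset[OF cont]) auto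
  obtain t where t: "t \<in> {a..b}" "arc_len \<gamma> a t = r" using arc_len_surj[OF cont' rect' ab(1) r] .
  then have "t \<in> {a..c}" using ab by auto
  from arc_length_param_eq[OF rect' t(1)] arc_length_param_eq[OF rect this] show ?thesis by (simp add: t(2))
qed

lemma arc_length_param_right:
  assumes cont: "continuous_on {a..c} \<gamma>" and rect: "rectifiable \<gamma> a c" and ab: "a \<le> b" "b \<le> c"
    and r: "r \<in> {0..arc_len \<gamma> b c}"
  shows "arc_length_param \<gamma> b c r = arc_length_param \<gamma> a c (arc_len \<gamma> a b + r)"
proof -
  have rect': "rectifiable \<gamma> b c" using ab by (intro rectifiable_subinterval[OF rect]) auto
  have cont': "continuous_on {b..c} \<gamma>" using ab by (intro continuous_on_subset[OF cont]) auto
  obtain t where t: "t \<in> {b..c}" "arc_len \<gamma> b t = r" using arc_len_surj[OF cont' rect' ab(2) r] .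
  then have tac: "t \<in> {a..c}" using ab by auto
  have "rectifiable \<gamma> a t" using tac by (intro rectifiable_subinterval[OF rect]) auto
  then have "arc_len \<gamma> a t = arc_len \<gamma> a b + r" using t ab arc_len_add[of \<gamma> a t b] by auto
  with arc_length_param_eq[OF rect' t(1)] arc_length_param_eq[OF rect tac] show ?thesis by (simp add: t(2))
qed

lemma arc_length_param_measurable:
  assumes cont: "continuous_on {a..b} \<gamma>" and rect: "rectifiable \<gamma> a b" and ab: "a \<le> b"
    and \<rho>: "\<rho> \<in> borel_measurable borel"
  shows "(\<lambda>r. \<rho> (arc_length_param \<gamma> a b r) * indicator {0..arc_len \<gamma> a b} r :: ennreal) \<in> borel_measurable borel"
proof -
  define L where "L = arc_len \<gamma> a b"
  have L: "L \<ge> 0" by (simp add: L_def)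
  define \<sigma> where "\<sigma> = (\<lambda>r. arc_length_param \<gamma> a b (max 0 (min L r)))"
  have "1-lipschitz_on UNIV \<sigma>"
    unfolding lipschitz_on_def
  proof (intro conjI ballI)
    fix r r' :: real
    have "dist (\<sigma> r) (\<sigma> r') \<le> \<bar>max 0 (min L r) - max 0 (min L r')\<bar>"
      unfolding \<sigma>_def using L by (intro arc_length_param_lipschitz[OF cont rect ab]) (auto simp: L_def)
    also have "\<dots> \<le> 1 * dist r r'" by (auto simp: dist_real_def max_def min_def)
    finally show "dist (\<sigma> r) (\<sigma> r') \<le> 1 * dist r r'" .
  qed simp
  then have "continuous_on UNIV \<sigma>" by (rule lipschitz_on_continuous_on)
  then have [measurable]: "\<sigma> \<in> borel_measurable borel" by (rule borel_measurable_continuous_onI)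
  note [measurable] = \<rho>
  have "(\<lambda>r. \<rho> (\<sigma> r) * indicator {0..L} r) \<in> borel_measurable borel" by measurable
  moreover have "(\<lambda>r. \<rho> (\<sigma> r) * indicator {0..L} r) = (\<lambda>r. \<rho> (arc_length_param \<gamma> a b r) * indicator {0..L} r)"
  proof
    fix r show "\<rho> (\<sigma> r) * indicator {0..L} r = \<rho> (arc_length_param \<gamma> a b r) * indicator {0..L} r"
      by (cases "r \<in> {0..L}") (auto simp: \<sigma>_def max_def min_def)
  qed
  ultimately show ?thesis by (simp only: L_def)
qed

lemma line_integral_same [simp]: "line_integral \<gamma> a a \<rho> = 0"
proof -
  have "AE r in lborel. \<rho> (arc_length_param \<gamma> a a r) * indicator {0..enn2real (curve_length \<gamma> a a)} r = 0"
    using AE_lborel_singleton[of "0::real"] by eventually_elim (auto split: split_indicator)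
  then have "line_integral \<gamma> a a \<rho> = (\<integral>\<^sup>+(r::real). 0 \<partial>lborel)"
    unfolding line_integral_def by (rule nn_integral_cong_AE)
  then show ?thesis by simp
qed

lemma line_integral_zero_length:
  assumes "curve_length \<gamma> a b = 0" shows "line_integral \<gamma> a b \<rho> = 0"
proof -
  have "AE r in lborel. \<rho> (arc_length_param \<gamma> a b r) * indicator {0..enn2real (curve_length \<gamma> a b)} r = 0"
    using AE_lborel_singleton[of "0::real"] by eventually_elim (auto split: split_indicator simp: assms)
  then have "line_integral \<gamma> a b \<rho> = (\<integral>\<^sup>+(r::real). 0 \<partial>lborel)"
    unfolding line_integral_def by (rule nn_integral_cong_AE)
  then show ?thesis by simp
qed

lemma line_integral_add:
  assumes cont: "continuous_on {a..c} \<gamma>" and rect: "rectifiable \<gamma> a c" and ab: "a \<le> b" "b \<le> c"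
    and \<rho>: "\<rho> \<in> borel_measurable borel"
  shows "line_integral \<gamma> a c \<rho> = line_integral \<gamma> a b \<rho> + line_integral \<gamma> b c \<rho>"
proof -
  have rect1: "rectifiable \<gamma> a b" and rect2: "rectifiable \<gamma> b c"
    using ab by (auto intro!: rectifiable_subinterval[OF rect])
  have cont1: "continuous_on {a..b} \<gamma>" and cont2: "continuous_on {b..c} \<gamma>"
    using ab by (auto intro!: continuous_on_subset[OF cont])
  define L1 L2 where "L1 = arc_len \<gamma> a b" and "L2 = arc_len \<gamma> b c"
  have L: "arc_len \<gamma> a c = L1 + L2" unfolding L1_def L2_def by (rule arc_len_add[OF rect ab])
  have L0: "L1 \<ge> 0" "L2 \<ge> 0" by (simp_all add: L1_def L2_def)
  let ?f = "\<lambda>r. \<rho> (arc_length_param \<gamma> a c r) * indicator {0..L1 + L2} r"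
  have [measurable]: "?f \<in> borel_measurable borel"
    using arc_length_param_measurable[OF cont rect order_trans[OF ab] \<rho>] by (simp add: L)
  have "line_integral \<gamma> a c \<rho> = (\<integral>\<^sup>+r. ?f r \<partial>lborel)" by (simp add: line_integral_def L)
  also have "\<dots> = (\<integral>\<^sup>+r. ?f r * indicator {0..L1} r + ?f r * indicator {L1..L1+L2} r \<partial>lborel)"
  proof (rule nn_integral_cong_AE)
    show "AE r in lborel. ?f r = ?f r * indicator {0..L1} r + ?f r * indicator {L1..L1+L2} r"
      using AE_lborel_singleton[of L1] by eventually_elim (use L0 in \<open>auto split: split_indicator\<close>)
  qed
  also have "\<dots> = (\<integral>\<^sup>+r. ?f r * indicator {0..L1} r \<partial>lborel) + (\<integral>\<^sup>+r. ?f r * indicator {L1..L1+L2} r \<partial>lborel)"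
    by (intro nn_integral_add) measurable
  also have "(\<integral>\<^sup>+r. ?f r * indicator {0..L1} r \<partial>lborel) = line_integral \<gamma> a b \<rho>"
    unfolding line_integral_def L1_def[symmetric]
  proof (intro nn_integral_cong)
    fix r
    show "?f r * indicator {0..L1} r = \<rho> (arc_length_param \<gamma> a b r) * indicator {0..L1} r"
      using arc_length_param_left[OF cont rect ab, of r] L0 by (cases "r \<in> {0..L1}") (auto simp: L1_def)
  qed
  also have "(\<integral>\<^sup>+r. ?f r * indicator {L1..L1+L2} r \<partial>lborel) = (\<integral>\<^sup>+r. ?f (L1 + 1 * r) * indicator {L1..L1+L2} (L1 + 1 * r) \<partial>lborel)"
    by (subst nn_integral_real_affine[where c = 1 and t = L1]) auto
  also have "\<dots> = line_integral \<gamma> b c \<rho>"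
    unfolding line_integral_def L2_def[symmetric]
  proof (intro nn_integral_cong)
    fix r
    show "?f (L1 + 1 * r) * indicator {L1..L1+L2} (L1 + 1 * r) = \<rho> (arc_length_param \<gamma> b c r) * indicator {0..L2} r"
    proof (cases "r \<in> {0..L2}")
      case True
      then have "arc_length_param \<gamma> b c r = arc_length_param \<gamma> a c (L1 + r)"
        unfolding L1_def by (intro arc_length_param_right[OF cont rect ab]) (auto simp: L2_def)
      then show ?thesis using True L0 by auto
    qed (use L0 in \<open>auto split: split_indicator\<close>)
  qed
  finally show ?thesis .
qed

lemma line_integral_cong:
  assumes "\<And>t. t \<in> {a..b} \<Longrightarrow> \<gamma> t = \<eta> t"
    and cont: "continuous_on {a..b} \<gamma>" and rect: "rectifiable \<gamma> a b" and ab: "a \<le> b"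
  shows "line_integral \<gamma> a b \<rho> = line_integral \<eta> a b \<rho>"
proof -
  have len: "curve_length \<gamma> a t = curve_length \<eta> a t" if "t \<in> {a..b}" for t
    using that assms(1) by (intro curve_length_cong) auto
  have rect': "rectifiable \<eta> a b" using rect len[of b] ab by (simp add: rectifiable_def)
  have "arc_length_param \<gamma> a b r = arc_length_param \<eta> a b r" if r: "r \<in> {0..arc_len \<gamma> a b}" for r
  proof -
    obtain t where t: "t \<in> {a..b}" "arc_len \<gamma> a t = r" using arc_len_surj[OF cont rect ab r] .
    have "arc_length_param \<gamma> a b r = \<gamma> t" using arc_length_param_eq[OF rect t(1)] t(2) by simp
    also have "\<gamma> t = \<eta> t" using assms(1)[OF t(1)] .
    also have "\<eta> t = arc_length_param \<eta> a b r" using arc_length_param_eq[OF rect' t(1)] t(2) len[OF t(1)] by simp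
    finally show ?thesis .
  qed
  moreover have "arc_len \<eta> a b = arc_len \<gamma> a b" using len[of b] ab by simp
  ultimately show ?thesis unfolding line_integral_def
    by (intro nn_integral_cong) (auto split: split_indicator)
qed

lemma line_integral_affine:
  assumes \<alpha>: "\<alpha> > 0" and ab: "a \<le> b"
    and cont: "continuous_on {\<alpha> * a + \<beta>..\<alpha> * b + \<beta>} \<gamma>" and rect: "rectifiable \<gamma> (\<alpha> * a + \<beta>) (\<alpha> * b + \<beta>)"
  shows "line_integral (\<lambda>t. \<gamma> (\<alpha> * t + \<beta>)) a b \<rho> = line_integral \<gamma> (\<alpha> * a + \<beta>) (\<alpha> * b + \<beta>) \<rho>"
proof -
  let ?\<eta> = "\<lambda>t. \<gamma> (\<alpha> * t + \<beta>)"
  have len: "curve_length ?\<eta> a t = curve_length \<gamma> (\<alpha> * a + \<beta>) (\<alpha> * t + \<beta>)" for t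
    by (rule curve_length_affine[OF \<alpha>])
  have rect': "rectifiable ?\<eta> a b" using rect by (simp add: rectifiable_def len)
  have ab': "\<alpha> * a + \<beta> \<le> \<alpha> * b + \<beta>" using ab \<alpha> by simp
  have "arc_length_param ?\<eta> a b r = arc_length_param \<gamma> (\<alpha> * a + \<beta>) (\<alpha> * b + \<beta>) r" if "r \<in> {0..arc_len ?\<eta> a b}" for r
  proof -
    have r: "r \<in> {0..arc_len \<gamma> (\<alpha> * a + \<beta>) (\<alpha> * b + \<beta>)}" using that by (simp add: len)
    obtain s where s: "s \<in> {\<alpha> * a + \<beta>..\<alpha> * b + \<beta>}" "arc_len \<gamma> (\<alpha> * a + \<beta>) s = r" using arc_len_surj[OF cont rect ab' r] .
    define t where "t = (s - \<beta>) / \<alpha>"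
    have st: "s = \<alpha> * t + \<beta>" using \<alpha> by (simp add: t_def)
    have t: "t \<in> {a..b}" using s(1) \<alpha> by (simp add: st)
    have "arc_length_param ?\<eta> a b r = ?\<eta> t" using arc_length_param_eq[OF rect' t] s(2) by (simp add: len st)
    also have "\<dots> = arc_length_param \<gamma> (\<alpha> * a + \<beta>) (\<alpha> * b + \<beta>) r"
      using arc_length_param_eq[OF rect s(1)] s(2) by (simp add: st)
    finally show ?thesis .
  qed
  then show ?thesis unfolding line_integral_def
    by (intro nn_integral_cong) (auto split: split_indicator simp: len)
qed

lemma line_integral_reverse:
  assumes ab: "a \<le> b" and cont: "continuous_on {a..b} \<gamma>" and rect: "rectifiable \<gamma> a b"
    and \<rho>: "\<rho> \<in> borel_measurable borel"
  shows "line_integral (\<lambda>t. \<gamma> (c - t)) (c - b) (c - a) \<rho> = line_integral \<gamma> a b \<rho>"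
proof -
  let ?\<eta> = "\<lambda>t. \<gamma> (c - t)"
  define L where "L = arc_len \<gamma> a b"
  have L0: "L \<ge> 0" by (simp add: L_def)
  have len: "curve_length ?\<eta> (c - b) (c - t) = curve_length \<gamma> t b" for t
    by (rule curve_length_reverse)
  have rect': "rectifiable ?\<eta> (c - b) (c - a)" using rect by (simp add: rectifiable_def len)
  have param: "arc_length_param ?\<eta> (c - b) (c - a) r = arc_length_param \<gamma> a b (L - r)" if "r \<in> {0..L}" for r
  proof -
    have "L - r \<in> {0..arc_len \<gamma> a b}" using that by (auto simp: L_def)
    then obtain t where t: "t \<in> {a..b}" "arc_len \<gamma> a t = L - r" using arc_len_surj[OF cont rect ab] by blast
    have "L = arc_len \<gamma> a t + arc_len \<gamma> t b" unfolding L_def using t(1) by (intro arc_len_add[OF rect]) auto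
    then have r: "arc_len \<gamma> t b = r" using t(2) by simp
    have "c - t \<in> {c - b..c - a}" using t(1) by auto
    from arc_length_param_eq[OF rect' this] have "arc_length_param ?\<eta> (c - b) (c - a) r = \<gamma> t" by (simp add: len r)
    also have "\<gamma> t = arc_length_param \<gamma> a b (L - r)" using arc_length_param_eq[OF rect t(1)] t(2) by simp
    finally show ?thesis .
  qed
  let ?f = "\<lambda>r. \<rho> (arc_length_param \<gamma> a b r) * indicator {0..L} r"
  have [measurable]: "?f \<in> borel_measurable borel"
    unfolding L_def by (rule arc_length_param_measurable[OF cont rect ab \<rho>])
  have "line_integral ?\<eta> (c - b) (c - a) \<rho> = (\<integral>\<^sup>+r. ?f (L + (-1) * r) \<partial>lborel)"
    unfolding line_integral_def len L_def[symmetric]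
  proof (intro nn_integral_cong)
    fix r show "\<rho> (arc_length_param ?\<eta> (c - b) (c - a) r) * indicator {0..L} r = ?f (L + (-1) * r)"
      using param[of r] by (cases "r \<in> {0..L}") (auto split: split_indicator)
  qed
  also have "\<dots> = (\<integral>\<^sup>+r. ?f r \<partial>lborel)"
    by (subst (2) nn_integral_real_affine[where c = "-1" and t = L]) auto
  finally show ?thesis by (simp add: line_integral_def L_def)
qed

text \<open>In terms of arc length the line integral is an indefinite integral of an integrable function, and arc length
depends continuously on the parameter.\<close>

lemma line_integral_continuous:
  assumes cont: "continuous_on {a..b} \<gamma>" and rect: "rectifiable \<gamma> a b" and ab: "a \<le> b"
    and \<rho>: "\<rho> \<in> borel_measurable borel" and fin: "line_integral \<gamma> a b \<rho> < \<infinity>"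
  shows "continuous_on {a..b} (\<lambda>t. enn2real (line_integral \<gamma> a t \<rho>))"
proof -
  define L where "L = arc_len \<gamma> a b"
  define f where "f = (\<lambda>r. \<rho> (arc_length_param \<gamma> a b r) * indicator {0..L} r)"
  have [measurable]: "f \<in> borel_measurable borel"
    unfolding f_def L_def by (rule arc_length_param_measurable[OF cont rect ab \<rho>])
  define h where "h = (\<lambda>r. enn2real (f r))"
  have [measurable]: "h \<in> borel_measurable borel" by (simp add: h_def)
  have ff: "(\<integral>\<^sup>+r. f r \<partial>lborel) < \<infinity>" using fin by (simp add: line_integral_def f_def L_def)
  then have "AE r in lborel. f r \<noteq> \<infinity>" by (intro nn_integral_noteq_infinite) auto
  then have hf: "AE r in lborel. ennreal (h r) = f r" by (elim AE_mp) (auto intro!: AE_I2 simp: h_def less_top)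
  have int: "integrable lborel h"
  proof (rule integrableI_nonneg)
    have "(\<integral>\<^sup>+r. ennreal (h r) \<partial>lborel) = (\<integral>\<^sup>+r. f r \<partial>lborel)" using hf by (intro nn_integral_cong_AE)
    then show "(\<integral>\<^sup>+r. ennreal (h r) \<partial>lborel) < \<infinity>" using ff by simp
  qed (auto simp: h_def)
  have sint: "set_integrable lborel {0..x} h" for x :: real
    using int integrable_mult_indicator[of "{0..x}" lborel h] by (simp add: set_integrable_def)
  have cF: "continuous_on {0..L} (\<lambda>x. integral {0..x} h)"
    using set_borel_integral_eq_integral(1)[OF sint[of L]] by (rule indefinite_integral_continuous_1)
  have F: "line_integral \<gamma> a t \<rho> = ennreal (integral {0..arc_len \<gamma> a t} h)" if t: "t \<in> {a..b}" for t
  proof -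
    have lt: "arc_len \<gamma> a t \<le> L" unfolding L_def using t by (intro arc_len_mono[OF rect]) auto
    have "line_integral \<gamma> a t \<rho> = (\<integral>\<^sup>+r. f r * indicator {0..arc_len \<gamma> a t} r \<partial>lborel)"
      unfolding line_integral_def
    proof (intro nn_integral_cong)
      fix r
      show "\<rho> (arc_length_param \<gamma> a t r) * indicator {0..arc_len \<gamma> a t} r = f r * indicator {0..arc_len \<gamma> a t} r"
      proof (cases "r \<in> {0..arc_len \<gamma> a t}")
        case True
        then have "arc_length_param \<gamma> a t r = arc_length_param \<gamma> a b r"
          using t by (intro arc_length_param_left[OF cont rect]) auto
        then show ?thesis using True lt by (auto simp: f_def)
      qed simp
    qed
    also have "\<dots> = (\<integral>\<^sup>+r. ennreal (indicator {0..arc_len \<gamma> a t} r *\<^sub>R h r) \<partial>lborel)"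
      using hf by (intro nn_integral_cong_AE) (elim AE_mp, auto intro!: AE_I2 split: split_indicator)
    also have "\<dots> = ennreal (\<integral>r. indicator {0..arc_len \<gamma> a t} r *\<^sub>R h r \<partial>lborel)"
      using sint[of "arc_len \<gamma> a t"] unfolding set_integrable_def
      by (intro nn_integral_eq_integral) (auto simp: h_def)
    also have "\<dots> = ennreal (integral {0..arc_len \<gamma> a t} h)"
      using set_borel_integral_eq_integral(2)[OF sint[of "arc_len \<gamma> a t"]] by (simp add: set_lebesgue_integral_def)
    finally show ?thesis .
  qed
  have "continuous_on {a..b} (\<lambda>t. integral {0..arc_len \<gamma> a t} h)"
    by (rule continuous_on_compose2[OF cF continuous_arc_len[OF cont rect]])
      (auto simp: L_def intro: arc_len_mono[OF rect])
  moreover have "integral {0..arc_len \<gamma> a t} h = enn2real (line_integral \<gamma> a t \<rho>)" if "t \<in> {a..b}" for t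
    using F[OF that] sint[of "arc_len \<gamma> a t"] by (auto intro!: enn2real_ennreal[symmetric] Henstock_Kurzweil_Integration.integral_nonneg set_borel_integral_eq_integral(1) simp: h_def)
  ultimately show ?thesis by (rule continuous_on_eq)
qed

section \<open>Lipschitz curves in compact sets\<close>

text \<open>Curves that are Lipschitz up to an additive error \<open>e\<close>. The error admits step functions, such as finite
chains of points. The values are constrained at all real parameters, not only on \<open>[0,1]\<close>, so that the
curves lie in a product of copies of \<open>K\<close>.\<close>

definition almost_lipschitz_curves :: "'a::metric_space set \<Rightarrow> 'a \<Rightarrow> 'a \<Rightarrow> real \<Rightarrow> real \<Rightarrow> (real \<Rightarrow> 'a) set" where
  "almost_lipschitz_curves K x y L e = {f. (\<forall>t. f t \<in> K) \<and> f 0 = x \<and> f 1 = y \<and>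
     (\<forall>s\<in>{0..1}. \<forall>t\<in>{0..1}. dist (f s) (f t) \<le> L * \<bar>s - t\<bar> + e)}"

lemma almost_lipschitz_curves_mono:
  assumes "L \<le> L'" "e \<le> e'"
  shows "almost_lipschitz_curves K x y L e \<subseteq> almost_lipschitz_curves K x y L' e'"
proof
  fix f assume f: "f \<in> almost_lipschitz_curves K x y L e"
  have "dist (f s) (f t) \<le> L' * \<bar>s - t\<bar> + e'" if "s \<in> {0..1}" "t \<in> {0..1}" for s t
  proof -
    have "dist (f s) (f t) \<le> L * \<bar>s - t\<bar> + e" using f that by (auto simp: almost_lipschitz_curves_def)
    moreover have "L * \<bar>s - t\<bar> \<le> L' * \<bar>s - t\<bar>" using assms(1) by (intro mult_right_mono) auto
    ultimately show ?thesis using assms(2) by linarith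
  qed
  then show "f \<in> almost_lipschitz_curves K x y L' e'" using f by (auto simp: almost_lipschitz_curves_def)
qed

lemma closed_almost_lipschitz_curves:
  assumes "closed K" shows "closed (almost_lipschitz_curves K x y L e)"
proof -
  have c: "continuous_on UNIV (\<lambda>f :: real \<Rightarrow> 'a. f t)" for t by simp
  have "almost_lipschitz_curves K x y L e = (\<Inter>t. (\<lambda>f. f t) -` K) \<inter> (\<lambda>f. f 0) -` {x} \<inter> (\<lambda>f. f 1) -` {y} \<inter>
     (\<Inter>s\<in>{0..1}. \<Inter>t\<in>{0..1}. {f. dist (f s) (f t) \<le> L * \<bar>s - t\<bar> + e})"
    by (auto simp: almost_lipschitz_curves_def)
  moreover have "closed ((\<Inter>t. (\<lambda>f. f t) -` K) \<inter> (\<lambda>f. f 0) -` {x} \<inter> (\<lambda>f. f 1) -` {y} \<inter>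
     (\<Inter>s\<in>{0..1}. \<Inter>t\<in>{0..1}. {f :: real \<Rightarrow> 'a. dist (f s) (f t) \<le> L * \<bar>s - t\<bar> + e}))"
    by (intro closed_Int closed_INT ballI closed_vimage closed_Collect_le continuous_on_dist c assms closed_singleton continuous_on_const)
  ultimately show ?thesis by simp
qed

text \<open>Tychonoff's theorem for the topology of pointwise convergence.\<close>

lemma compact_curves_in:
  assumes "compact K" shows "compact {f :: real \<Rightarrow> 'a::metric_space. \<forall>t. f t \<in> K}"
proof -
  have "compactin (product_topology (\<lambda>i::real. euclidean :: 'a topology) UNIV) (PiE UNIV (\<lambda>_. K))"
    using assms by (simp add: compactin_PiE)
  then have "compact (PiE UNIV (\<lambda>_::real. K))"
    unfolding euclidean_product_topology by simp
  moreover have "PiE UNIV (\<lambda>_::real. K) = {f. \<forall>t. f t \<in> K}" by (auto simp: PiE_UNIV_domain)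
  ultimately show ?thesis by simp
qed

text \<open>The sets of almost Lipschitz curves are closed and shrink with the error, so by compactness they have a common
element. The approximating curves may be discontinuous, unlike in the theorem of Arzela and Ascoli.\<close>

lemma lipschitz_curve_limit:
  assumes K: "compact K" and ne: "\<And>e. e > 0 \<Longrightarrow> almost_lipschitz_curves K x y (L + e) e \<noteq> {}"
  shows "almost_lipschitz_curves K x y L 0 \<noteq> {}"
proof -
  let ?F = "\<lambda>e. almost_lipschitz_curves K x y (L + e) e"
  have "{f. \<forall>t. f t \<in> K} \<inter> (\<Inter>e\<in>{0<..}. ?F e) \<noteq> {}"
  proof (rule compact_imp_fip_image[OF compact_curves_in[OF K]])
    show "closed (?F e)" for e by (rule closed_almost_lipschitz_curves[OF compact_imp_closed[OF K]])
    fix I' :: "real set" assume I: "finite I'" "I' \<subseteq> {0<..}"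
    define e where "e = Min (insert 1 I')"
    have e: "e > 0" "\<And>i. i \<in> I' \<Longrightarrow> e \<le> i" using I by (auto simp: e_def subset_iff)
    obtain f where f: "f \<in> ?F e" using ne[OF e(1)] by blast
    have "f \<in> ?F i" if "i \<in> I'" for i
      using almost_lipschitz_curves_mono[of "L + e" "L + i" e i K x y] e(2)[OF that] f by auto
    moreover have "\<forall>t. f t \<in> K" using f by (auto simp: almost_lipschitz_curves_def)
    ultimately show "{f. \<forall>t. f t \<in> K} \<inter> (\<Inter>i\<in>I'. ?F i) \<noteq> {}" by blast
  qed
  then obtain f where f: "\<And>e. e > 0 \<Longrightarrow> f \<in> ?F e" by auto
  have "dist (f s) (f t) \<le> L * \<bar>s - t\<bar> + 0" if st: "s \<in> {0..1}" "t \<in> {0..1}" for s t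
  proof (rule field_le_epsilon)
    fix e :: real assume e: "e > 0"
    have "dist (f s) (f t) \<le> (L + e/2) * \<bar>s - t\<bar> + e/2"
      using f[of "e/2"] e st by (auto simp: almost_lipschitz_curves_def)
    also have "\<dots> \<le> L * \<bar>s - t\<bar> + 0 + e"
    proof -
      have "\<bar>s - t\<bar> \<le> 1" using st by auto
      then have "e/2 * \<bar>s - t\<bar> \<le> e/2" using e by (simp add: mult_left_le)
      then show ?thesis by (simp add: algebra_simps)
    qed
    finally show "dist (f s) (f t) \<le> L * \<bar>s - t\<bar> + 0 + e" .
  qed
  then have "f \<in> almost_lipschitz_curves K x y L 0"
    using f[of 1] by (auto simp: almost_lipschitz_curves_def)
  then show ?thesis by blast
qed

lemma almost_lipschitz_curves_lower:
  assumes "f \<in> almost_lipschitz_curves K x y L 0" shows "dist x y \<le> L"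
proof -
  have lip: "\<forall>s\<in>{0..1}. \<forall>t\<in>{0..1}. dist (f s) (f t) \<le> L * \<bar>s - t\<bar> + 0" and f: "f 0 = x" "f 1 = y"
    using assms by (simp_all add: almost_lipschitz_curves_def)
  have "dist (f 0) (f 1) \<le> L * \<bar>0 - 1\<bar> + 0" by (rule lip[rule_format]) auto
  then show ?thesis using f by simp
qed

text \<open>The loop between \<open>s\<close> and \<open>t\<close> is removed, and the remaining curve is slowed down to the unit interval.\<close>

lemma shortcut_curve:
  assumes f: "f \<in> almost_lipschitz_curves K x y L 0" and st: "0 \<le> s" "s < t" "t \<le> 1" "f s = f t"
  shows "almost_lipschitz_curves K x y (L * (1 - (t - s))) 0 \<noteq> {}"
proof -
  have L0: "L \<ge> 0" using almost_lipschitz_curves_lower[OF f] zero_le_dist[of x y] by linarith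
  have lip: "dist (f a) (f b) \<le> L * \<bar>a - b\<bar>" if "a \<in> {0..1}" "b \<in> {0..1}" for a b
    using f that by (auto simp: almost_lipschitz_curves_def)
  define d where "d = t - s"
  have d: "0 < d" "d \<le> 1" using st by (auto simp: d_def)
  define h where "h = (\<lambda>w. if w \<le> s then f w else f (w + d))"
  define g where "g = (\<lambda>r. h (r * (1 - d)))"
  have ord: "dist (h v) (h w) \<le> L * (w - v)" if "0 \<le> v" "v \<le> w" "w \<le> 1 - d" for v w
  proof -
    consider "w \<le> s" | "s < v" | "v \<le> s" "s < w" by linarith
    then show ?thesis
    proof cases
      case 1
      have "v \<in> {0..1}" "w \<in> {0..1}" using that d by auto
      from lip[OF this] show ?thesis using 1 that by (simp add: h_def abs_if split: if_splits)
    next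
      case 2
      have "v + d \<in> {0..1}" "w + d \<in> {0..1}" using that d by auto
      from lip[OF this] show ?thesis using 2 that by (simp add: h_def abs_if split: if_splits)
    next
      case 3
      have mem: "v \<in> {0..1}" "s \<in> {0..1}" "t \<in> {0..1}" "w + d \<in> {0..1}" using that d st by auto
      have "dist (f v) (f (w + d)) \<le> dist (f v) (f s) + dist (f t) (f (w + d))"
        using dist_triangle[of "f v" "f (w + d)" "f s"] st(4) by simp
      also have "\<dots> \<le> L * \<bar>v - s\<bar> + L * \<bar>t - (w + d)\<bar>" by (intro add_mono lip mem)
      also have "\<dots> = L * (w - v)" using 3 by (simp add: d_def abs_if algebra_simps)
      finally show ?thesis using 3 by (simp add: h_def)
    qed
  qed
  have "g \<in> almost_lipschitz_curves K x y (L * (1 - d)) 0"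
    unfolding almost_lipschitz_curves_def
  proof (intro CollectI conjI ballI allI)
    show "g r \<in> K" for r using f by (auto simp: almost_lipschitz_curves_def g_def h_def)
    show "g 0 = x" using f st by (auto simp: almost_lipschitz_curves_def g_def h_def)
    show "g 1 = y"
    proof (cases "1 - d \<le> s")
      case True
      then have "t = 1" "1 - d = s" using st by (auto simp: d_def)
      then show ?thesis using f st by (auto simp: almost_lipschitz_curves_def g_def h_def)
    next
      case False
      then show ?thesis using f by (auto simp: almost_lipschitz_curves_def g_def h_def)
    qed
    fix a b :: real assume ab: "a \<in> {0..1}" "b \<in> {0..1}"
    have *: "dist (g a) (g b) \<le> L * (1 - d) * (b - a)" if "a \<in> {0..1}" "b \<in> {0..1}" "a \<le> b" for a b
    proof -
      have "a * (1 - d) \<le> b * (1 - d)" using that d by (intro mult_right_mono) auto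
      moreover have "b * (1 - d) \<le> 1 * (1 - d)" using that d by (intro mult_right_mono) auto
      moreover have "0 \<le> a * (1 - d)" using that d by simp
      ultimately have "dist (h (a * (1 - d))) (h (b * (1 - d))) \<le> L * (b * (1 - d) - a * (1 - d))"
        by (intro ord) auto
      then show ?thesis by (simp add: g_def algebra_simps)
    qed
    show "dist (g a) (g b) \<le> L * (1 - d) * \<bar>a - b\<bar> + 0"
    proof (cases "a \<le> b")
      case True then show ?thesis using *[OF ab True] by simp
    next
      case False then show ?thesis using *[OF ab(2,1)] by (simp add: dist_commute)
    qed
  qed
  then show ?thesis unfolding d_def by blast
qed

text \<open>By compactness a curve with the least Lipschitz constant exists. If it passed twice through a point, removing
the loop in between would lower the constant.\<close>

lemma injective_lipschitz_curve:
  assumes K: "compact K" and xy: "x \<noteq> y" and ne: "almost_lipschitz_curves K x y L 0 \<noteq> {}"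
  obtains f L0 where "f \<in> almost_lipschitz_curves K x y L0 0" "inj_on f {0..1}"
proof -
  define S where "S = {L. almost_lipschitz_curves K x y L 0 \<noteq> {}}"
  have Sne: "S \<noteq> {}" using ne by (auto simp: S_def)
  have low: "dist x y \<le> l" if "l \<in> S" for l using that almost_lipschitz_curves_lower by (fastforce simp: S_def)
  then have bdd: "bdd_below S" by (rule bdd_belowI)
  define L0 where "L0 = Inf S"
  have L0: "L0 > 0"
  proof -
    have "dist x y \<le> L0" unfolding L0_def using low by (intro cInf_greatest[OF Sne])
    then show ?thesis using xy zero_less_dist_iff[of x y] by linarith
  qed
  have "almost_lipschitz_curves K x y L0 0 \<noteq> {}"
  proof (rule lipschitz_curve_limit[OF K])
    fix e :: real assume e: "e > 0"
    obtain l where l: "l \<in> S" "l < L0 + e" using cInf_lessD[OF Sne, of "L0 + e"] e by (auto simp: L0_def)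
    then obtain f where "f \<in> almost_lipschitz_curves K x y l 0" by (auto simp: S_def)
    then have "f \<in> almost_lipschitz_curves K x y (L0 + e) e"
      using almost_lipschitz_curves_mono[of l "L0 + e" 0 e K x y] l(2) e by auto
    then show "almost_lipschitz_curves K x y (L0 + e) e \<noteq> {}" by blast
  qed
  then obtain f where f: "f \<in> almost_lipschitz_curves K x y L0 0" by blast
  have no: False if st: "0 \<le> s" "s < t" "t \<le> 1" "f s = f t" for s t
  proof -
    have "L0 * (1 - (t - s)) \<in> S" using shortcut_curve[OF f st] by (simp add: S_def)
    then have "L0 \<le> L0 * (1 - (t - s))" unfolding L0_def by (rule cInf_lower[OF _ bdd])
    moreover have "L0 * (t - s) > 0" using L0 st by simp
    ultimately show False by (simp add: algebra_simps)
  qed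
  have "inj_on f {0..1}"
  proof (rule inj_onI)
    fix s t :: real assume "s \<in> {0..1}" "t \<in> {0..1}" "f s = f t"
    then show "s = t" using no[of s t] no[of t s] by (cases s t rule: linorder_cases) auto
  qed
  then show ?thesis using f that by blast
qed

section \<open>Arcs in continua of finite length\<close>

text \<open>By connectedness the distance from \<open>p\<close>, which is a Lipschitz function, takes on \<open>K\<close> all values
between \<open>0\<close> and \<open>r\<close>.\<close>

lemma hausdorff_outer_1_ball_ge:
  assumes K: "connected K" and p: "p \<in> K" "z \<in> K" "r \<le> dist p z"
  shows "ennreal r \<le> hausdorff_outer 1 (K \<inter> cball p r)"
proof (cases "r \<ge> 0")
  case True
  have "connected (dist p ` K)" by (intro connected_continuous_image continuous_intros K)
  then have sub: "{dist p p..dist p z} \<subseteq> dist p ` K" using p by (intro connected_contains_Icc) auto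
  have dd: "\<bar>dist p u - dist p v\<bar> \<le> dist u v" for u v
    using dist_triangle[of p u v] dist_triangle[of p v u] by (auto simp: dist_commute)
  have "{0..r} \<subseteq> dist p ` (K \<inter> cball p r)"
  proof
    fix v assume v: "v \<in> {0..r}"
    then have "v \<in> {dist p p..dist p z}" using p(3) by auto
    then obtain u where "u \<in> K" "dist p u = v" using sub by blast
    then show "v \<in> dist p ` (K \<inter> cball p r)" using v by auto
  qed
  then have "ennreal (r - 0) \<le> hausdorff_outer 1 (K \<inter> cball p r)"
    by (intro hausdorff_outer_1_ge[of _ "dist p"] dd)
  then show ?thesis by simp
qed (simp add: ennreal_neg)

text \<open>The balls of radius \<open>\<epsilon>\<close> around the points are disjoint, and \<open>K\<close> has length at least
\<open>\<epsilon>\<close> in each of them because it reaches out of the ball.\<close>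

lemma separated_card_le:
  assumes K: "compact K" "connected K" and xy: "x \<in> K" "y \<in> K" "2 * \<epsilon> \<le> dist x y" "\<epsilon> > 0"
    and M: "hausdorff_outer 1 K \<le> ennreal M" "M \<ge> 0"
    and P: "finite P" "P \<subseteq> K" "\<And>p q. p \<in> P \<Longrightarrow> q \<in> P \<Longrightarrow> p \<noteq> q \<Longrightarrow> 2 * \<epsilon> < dist p q"
  shows "real (card P) * \<epsilon> \<le> M"
proof -
  have Kb: "K \<in> sets borel" using compact_imp_closed[OF K(1)] by simp
  have far: "\<exists>z\<in>K. \<epsilon> \<le> dist p z" for p
  proof -
    have "2 * \<epsilon> \<le> dist p x + dist p y" using xy(3) dist_triangle[of x y p] by (simp add: dist_commute)
    then have "\<epsilon> \<le> dist p x \<or> \<epsilon> \<le> dist p y" by linarith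
    then show ?thesis using xy(1,2) by blast
  qed
  have disj: "disjoint_family_on (\<lambda>p. K \<inter> cball p \<epsilon>) P"
    unfolding disjoint_family_on_def
  proof (intro ballI impI)
    fix p q assume pq: "p \<in> P" "q \<in> P" "p \<noteq> q"
    show "(K \<inter> cball p \<epsilon>) \<inter> (K \<inter> cball q \<epsilon>) = {}"
    proof (rule ccontr)
      assume "\<not> ?thesis"
      then obtain z where "dist p z \<le> \<epsilon>" "dist q z \<le> \<epsilon>" by auto
      then have "dist p q \<le> 2 * \<epsilon>" using dist_triangle[of p q z] by (simp add: dist_commute)
      then show False using P(3)[OF pq] by simp
    qed
  qed
  have "ennreal (real (card P) * \<epsilon>) = (\<Sum>p\<in>P. ennreal \<epsilon>)"
    using xy(4) by (simp add: ennreal_mult ennreal_of_nat_eq_real_of_nat)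
  also have "\<dots> \<le> (\<Sum>p\<in>P. emeasure (hausdorff 1) (K \<inter> cball p \<epsilon>))"
  proof (intro sum_mono)
    fix p assume "p \<in> P"
    then have "p \<in> K" using P(2) by blast
    moreover obtain z where "z \<in> K" "\<epsilon> \<le> dist p z" using far by blast
    ultimately have "ennreal \<epsilon> \<le> hausdorff_outer 1 (K \<inter> cball p \<epsilon>)"
      by (intro hausdorff_outer_1_ball_ge[OF K(2)])
    then show "ennreal \<epsilon> \<le> emeasure (hausdorff 1) (K \<inter> cball p \<epsilon>)"
      using Kb by (subst emeasure_hausdorff) auto
  qed
  also have "\<dots> = emeasure (hausdorff 1) (\<Union>p\<in>P. K \<inter> cball p \<epsilon>)"
    using Kb disj P(1) by (intro sum_emeasure) auto
  also have "\<dots> \<le> emeasure (hausdorff 1) K" using Kb by (intro emeasure_mono) auto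
  also have "\<dots> \<le> ennreal M" using M Kb by (subst emeasure_hausdorff) auto
  finally show ?thesis using M(2) by simp
qed

text \<open>Injectivity bounds the number of steps by the number of available points.\<close>

lemma shortest_chain_inj:
  assumes "(a, b) \<in> R\<^sup>*"
  obtains n f where "f 0 = a" "f n = b" "\<And>i. i < n \<Longrightarrow> (f i, f (Suc i)) \<in> R" "inj_on f {..n}"
proof -
  define n where "n = (LEAST n. (a, b) \<in> R ^^ n)"
  have n: "(a, b) \<in> R ^^ n" unfolding n_def using assms by (auto simp: rtrancl_power intro: LeastI)
  have least: "n \<le> m" if "(a, b) \<in> R ^^ m" for m unfolding n_def using that by (rule Least_le)
  obtain f where f: "f 0 = a" "f n = b" "\<And>i. i < n \<Longrightarrow> (f i, f (Suc i)) \<in> R"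
    using n unfolding relpow_fun_conv by blast
  have no: False if ij: "i < j" "j \<le> n" "f i = f j" for i j
  proof -
    have "(a, f i) \<in> R ^^ i" unfolding relpow_fun_conv using f ij by (intro exI[of _ f]) auto
    moreover have "(f j, b) \<in> R ^^ (n - j)"
      unfolding relpow_fun_conv using f ij by (intro exI[of _ "\<lambda>k. f (j + k)"]) auto
    ultimately have "(a, b) \<in> R ^^ (i + (n - j))" unfolding relpow_add using ij(3) by auto
    from least[OF this] show False using ij by simp
  qed
  have "inj_on f {..n}"
  proof (rule inj_onI)
    fix i j assume "i \<in> {..n}" "j \<in> {..n}" "f i = f j"
    then show "i = j" using no[of i j] no[of j i] by (cases i j rule: linorder_cases) auto
  qed
  with f show ?thesis using that by blast
qed

text \<open>A maximal separated subset of \<open>K\<close> has few points and is dense in \<open>K\<close> up to \<open>2 * \<epsilon>\<close>. If the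
steps of size \<open>4 * \<epsilon>\<close> did not connect it, the balls around the points that are reached and those
around the remaining ones would disconnect \<open>K\<close>.\<close>

lemma chain_exists:
  assumes K: "compact K" "connected K" and xy: "x \<in> K" "y \<in> K" "2 * \<epsilon> \<le> dist x y" "\<epsilon> > 0"
    and M: "hausdorff_outer 1 K \<le> ennreal M" "M \<ge> 0"
  obtains N q where "N > (0::nat)" "q 0 = x" "q N = y" "\<And>i. i \<le> N \<Longrightarrow> q i \<in> K"
    "\<And>i. i < N \<Longrightarrow> dist (q i) (q (Suc i)) \<le> 4 * \<epsilon>" "real N * \<epsilon> \<le> M + \<epsilon>"
proof -
  define sep where "sep = (\<lambda>P. finite P \<and> P \<subseteq> K \<and> (\<forall>p\<in>P. \<forall>q\<in>P. p \<noteq> q \<longrightarrow> 2 * \<epsilon> < dist p q))"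
  have bound: "real (card P) * \<epsilon> \<le> M" if "sep P" for P
    using that by (intro separated_card_le[OF K xy M]) (auto simp: sep_def)
  have "\<exists>P. sep P \<and> (\<forall>P'. sep P' \<longrightarrow> card P' \<le> card P)"
  proof (rule ex_has_greatest_nat[where b = "nat \<lceil>M / \<epsilon>\<rceil> + 1"])
    show "sep {}" by (simp add: sep_def)
    show "\<forall>P. sep P \<longrightarrow> card P < nat \<lceil>M / \<epsilon>\<rceil> + 1"
    proof (intro allI impI)
      fix P assume "sep P"
      then have "real (card P) \<le> M / \<epsilon>" using bound xy(4) by (simp add: field_simps)
      then show "card P < nat \<lceil>M / \<epsilon>\<rceil> + 1" by linarith
    qed
  qed
  then obtain P where P: "sep P" "\<And>P'. sep P' \<Longrightarrow> card P' \<le> card P" by blast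
  have cover: "\<exists>p\<in>P. dist p z \<le> 2 * \<epsilon>" if z: "z \<in> K" for z
  proof (rule ccontr)
    assume a: "\<not> ?thesis"
    then have zP: "z \<notin> P" using xy(4) by force
    have "sep (insert z P)" using P(1) z a by (auto simp: sep_def dist_commute)
    from P(2)[OF this] show False using zP P(1) by (simp add: sep_def)
  qed
  define R where "R = {(p, q). p \<in> P \<and> q \<in> P \<and> dist p q \<le> 4 * \<epsilon>}"
  obtain px where px: "px \<in> P" "dist px x \<le> 2 * \<epsilon>" using cover[OF xy(1)] by blast
  obtain py where py: "py \<in> P" "dist py y \<le> 2 * \<epsilon>" using cover[OF xy(2)] by blast
  have "(px, py) \<in> R\<^sup>*"
  proof (rule ccontr)
    assume n: "(px, py) \<notin> R\<^sup>*"
    define A where "A = {p \<in> P. (px, p) \<in> R\<^sup>*}"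
    let ?A = "\<Union>p\<in>A. cball p (2 * \<epsilon>)" and ?B = "\<Union>p\<in>P - A. cball p (2 * \<epsilon>)"
    have fin: "finite P" using P(1) by (simp add: sep_def)
    have cl: "closed ?A" "closed ?B" using fin by (auto intro!: closed_UN simp: A_def)
    have cov: "K \<subseteq> ?A \<union> ?B"
    proof
      fix z assume "z \<in> K"
      then obtain p where "p \<in> P" "dist p z \<le> 2 * \<epsilon>" using cover by blast
      then show "z \<in> ?A \<union> ?B" by (cases "p \<in> A") auto
    qed
    have pA: "px \<in> A" "py \<in> P - A" "px \<in> K" "py \<in> K" using px py n P(1) by (auto simp: A_def sep_def)
    have "px \<in> cball px (2 * \<epsilon>)" "py \<in> cball py (2 * \<epsilon>)" using xy(4) by auto
    then have "?A \<inter> K \<noteq> {}" "?B \<inter> K \<noteq> {}" using pA by blast+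
    then have "?A \<inter> ?B \<inter> K \<noteq> {}"
      using connected_closedD[OF K(2) _ cov cl] by blast
    then obtain z p q where "p \<in> A" "q \<in> P - A" "z \<in> cball p (2 * \<epsilon>)" "z \<in> cball q (2 * \<epsilon>)" by blast
    then have z: "p \<in> A" "q \<in> P - A" "dist p z \<le> 2 * \<epsilon>" "dist q z \<le> 2 * \<epsilon>" by simp_all
    have "dist p q \<le> 4 * \<epsilon>" using z dist_triangle[of p q z] by (simp add: dist_commute)
    then have "(p, q) \<in> R" using z by (auto simp: R_def A_def)
    then have "q \<in> A" using z by (auto simp: A_def intro: rtrancl_into_rtrancl)
    then show False using z by blast
  qed
  from shortest_chain_inj[OF this] obtain n f where f: "f 0 = px" "f n = py" "\<And>i. i < n \<Longrightarrow> (f i, f (Suc i)) \<in> R" "inj_on f {..n}"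
    by metis
  have fP: "f i \<in> P" if "i \<le> n" for i
    using f(2,3) py(1) that by (cases "i = n") (auto simp: R_def dest: le_neq_implies_less)
  have "card {..n} \<le> card P"
    using fP f(4) P(1) by (intro card_inj_on_le[of f]) (auto simp: sep_def)
  then have cn: "Suc n \<le> card P" by simp
  define q where "q = (\<lambda>i. if i = 0 then x else if i \<le> Suc n then f (i - 1) else y)"
  show ?thesis
  proof (rule that[of "n + 2" q])
    show "0 < n + 2" "q 0 = x" "q (n + 2) = y" by (auto simp: q_def)
    show "q i \<in> K" if "i \<le> n + 2" for i
      using fP[of "i - 1"] P(1) xy by (auto simp: q_def sep_def)
    show "dist (q i) (q (Suc i)) \<le> 4 * \<epsilon>" if i: "i < n + 2" for i
    proof -
      consider "i = 0" | "i = Suc n" | "0 < i" "i \<le> n" using i by linarith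
      then show ?thesis
      proof cases
        case 1 then show ?thesis using px f(1) xy(4) by (simp add: q_def dist_commute)
      next
        case 2 then show ?thesis using py f(2) xy(4) by (simp add: q_def)
      next
        case 3
        then have "(f (i - 1), f (Suc (i - 1))) \<in> R" by (intro f(3)) auto
        then show ?thesis using 3 by (simp add: q_def R_def)
      qed
    qed
    have "real (n + 2) * \<epsilon> \<le> (real (card P) + 1) * \<epsilon>" using cn xy(4) by (intro mult_right_mono) auto
    also have "\<dots> \<le> M + \<epsilon>" using bound[OF P(1)] by (simp add: algebra_simps)
    finally show "real (n + 2) * \<epsilon> \<le> M + \<epsilon>" .
  qed
qed

lemma chain_dist:
  fixes q :: "nat \<Rightarrow> 'a::metric_space"
  assumes "\<And>i. i < N \<Longrightarrow> dist (q i) (q (Suc i)) \<le> c" "i \<le> j" "j \<le> N"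
  shows "dist (q i) (q j) \<le> real (j - i) * c"
  using assms(2,3)
proof (induction j rule: dec_induct)
  case (step k)
  have "dist (q i) (q (Suc k)) \<le> dist (q i) (q k) + dist (q k) (q (Suc k))" by (rule dist_triangle)
  also have "\<dots> \<le> real (k - i) * c + c" using step assms(1)[of k] by auto
  finally show ?case using step by (simp add: Suc_diff_le algebra_simps)
qed simp

text \<open>A chain of \<open>N\<close> steps of size \<open>4 * \<epsilon>\<close>, run through at constant speed, is an almost Lipschitz
curve with constant about \<open>4 * N * \<epsilon>\<close>, which is bounded in terms of the length of \<open>K\<close>.\<close>

lemma lipschitz_curve_exists:
  assumes K: "compact K" "connected K" and xy: "x \<in> K" "y \<in> K" "x \<noteq> y"
    and M: "hausdorff_outer 1 K \<le> ennreal M" "M \<ge> 0"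
  shows "almost_lipschitz_curves K x y (4 * M + 4) 0 \<noteq> {}"
proof (rule lipschitz_curve_limit[OF K(1)])
  fix e :: real assume e: "e > 0"
  define \<epsilon> where "\<epsilon> = min 1 (min (e/4) (dist x y / 2))"
  have \<epsilon>: "\<epsilon> > 0" "\<epsilon> \<le> 1" "4 * \<epsilon> \<le> e" "2 * \<epsilon> \<le> dist x y" using e xy(3) by (auto simp: \<epsilon>_def)
  obtain N q where q: "N > (0::nat)" "q 0 = x" "q N = y" "\<And>i. i \<le> N \<Longrightarrow> q i \<in> K"
    "\<And>i. i < N \<Longrightarrow> dist (q i) (q (Suc i)) \<le> 4 * \<epsilon>" "real N * \<epsilon> \<le> M + \<epsilon>"
    using chain_exists[OF K xy(1,2) \<epsilon>(4,1) M] by metis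
  define k where "k = (\<lambda>t::real. min N (nat \<lfloor>t * N\<rfloor>))"
  define f where "f = (\<lambda>t. q (k t))"
  have ord: "dist (f s) (f t) \<le> (4 * M + 4) * (t - s) + e" if "0 \<le> s" "s \<le> t" "t \<le> 1" for s t
  proof -
    have "s * N \<le> t * N" using that by (intro mult_right_mono) auto
    moreover have "t * N \<le> 1 * real N" using that by (intro mult_right_mono) auto
    moreover have "0 \<le> s * N" using that by simp
    ultimately have b: "nat \<lfloor>s * N\<rfloor> \<le> nat \<lfloor>t * N\<rfloor>" "nat \<lfloor>t * N\<rfloor> \<le> N" "real (nat \<lfloor>t * N\<rfloor>) \<le> t * N"
      "s * N - 1 \<le> real (nat \<lfloor>s * N\<rfloor>)" by linarith+
    then have "k s = nat \<lfloor>s * N\<rfloor>" "k t = nat \<lfloor>t * N\<rfloor>" by (simp_all add: k_def)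
    with b have k: "k s \<le> k t" "k t \<le> N" "real (k t) \<le> t * N" "real (k s) \<ge> s * N - 1" by simp_all
    have "dist (f s) (f t) \<le> real (k t - k s) * (4 * \<epsilon>)"
      unfolding f_def by (rule chain_dist[of N q]) (use q k in auto)
    also have "\<dots> \<le> ((t - s) * N + 1) * (4 * \<epsilon>)"
      using k \<epsilon> by (intro mult_right_mono) (auto simp: algebra_simps of_nat_diff)
    also have "\<dots> = 4 * (t - s) * (N * \<epsilon>) + 4 * \<epsilon>" by (simp add: algebra_simps)
    also have "\<dots> \<le> 4 * (t - s) * (M + 1) + e"
      using that q(6) \<epsilon> by (intro add_mono mult_left_mono) auto
    finally show ?thesis by (simp add: algebra_simps)
  qed
  have "f \<in> almost_lipschitz_curves K x y (4 * M + 4 + e) e"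
    unfolding almost_lipschitz_curves_def
  proof (intro CollectI conjI ballI allI)
    show "f t \<in> K" for t using q(4)[of "k t"] by (simp add: f_def k_def)
    show "f 0 = x" "f 1 = y" using q by (auto simp: f_def k_def)
    fix s t :: real assume st: "s \<in> {0..1}" "t \<in> {0..1}"
    have "dist (f s) (f t) \<le> (4 * M + 4) * \<bar>s - t\<bar> + e"
    proof (cases "s \<le> t")
      case True then show ?thesis using ord[of s t] st by simp
    next
      case False then show ?thesis using ord[of t s] st by (simp add: dist_commute)
    qed
    also have "\<dots> \<le> (4 * M + 4 + e) * \<bar>s - t\<bar> + e"
    proof -
      have "(4 * M + 4) * \<bar>s - t\<bar> \<le> (4 * M + 4 + e) * \<bar>s - t\<bar>" by (rule mult_right_mono) (use e in auto)
      then show ?thesis by simp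
    qed
    finally show "dist (f s) (f t) \<le> (4 * M + 4 + e) * \<bar>s - t\<bar> + e" .
  qed
  then show "almost_lipschitz_curves K x y (4 * M + 4 + e) e \<noteq> {}" by blast
qed

lemma lipschitz_rectifiable:
  assumes lip: "\<And>s t. s \<in> {a..b} \<Longrightarrow> t \<in> {a..b} \<Longrightarrow> dist (\<gamma> s) (\<gamma> t) \<le> L * \<bar>s - t\<bar>" and L: "L \<ge> 0"
  shows "rectifiable \<gamma> a b"
proof -
  have "curve_length \<gamma> a b \<le> ennreal (L * (b - a))"
  proof (rule curve_length_leI)
    fix n p assume p: "partition_of a b n p"
    have "polygon_length \<gamma> n p \<le> (\<Sum>i<n. ennreal (L * (p (Suc i) - p i)))"
    proof (intro sum_mono ennreal_leI)
      fix i assume "i \<in> {..<n}"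
      then have "p i \<in> {a..b}" "p (Suc i) \<in> {a..b}" "p i \<le> p (Suc i)" using p by (auto simp: partition_of_def)
      then show "dist (\<gamma> (p i)) (\<gamma> (p (Suc i))) \<le> L * (p (Suc i) - p i)" using lip[of "p i" "p (Suc i)"] by simp
    qed
    also have "\<dots> = ennreal (\<Sum>i<n. L * (p (Suc i) - p i))"
      using p L by (intro sum_ennreal) (auto simp: partition_of_def)
    also have "(\<Sum>i<n. L * (p (Suc i) - p i)) = L * (p n - p 0)"
      unfolding sum_distrib_left[symmetric] by (simp add: sum_lessThan_telescope)
    also have "ennreal \<dots> \<le> ennreal (L * (b - a))"
    proof -
      have "p n \<in> {a..b}" "p 0 \<in> {a..b}" using p by (auto simp: partition_of_def)
      then show ?thesis using L by (intro ennreal_leI mult_left_mono) auto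
    qed
    finally show "polygon_length \<gamma> n p \<le> ennreal (L * (b - a))" .
  qed
  then show ?thesis unfolding rectifiable_def by (simp add: order.strict_trans1)
qed

text \<open>Chains with ever smaller steps have a Lipschitz curve as their limit, and a curve with the least Lipschitz
constant is injective.\<close>

theorem rectifiable_arc_in_continuum:
  assumes K: "compact K" "connected K" and fin: "hausdorff_outer 1 K < \<infinity>" and xy: "x \<in> K" "y \<in> K" "x \<noteq> y"
  obtains \<gamma> where "arc \<gamma>" "path_image \<gamma> \<subseteq> K" "pathstart \<gamma> = x" "pathfinish \<gamma> = y" "rectifiable \<gamma> 0 1"
proof -
  obtain M where M: "hausdorff_outer 1 K = ennreal M" "M \<ge> 0"
    using fin by (cases "hausdorff_outer 1 K") auto
  have "almost_lipschitz_curves K x y (4 * M + 4) 0 \<noteq> {}"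
    by (rule lipschitz_curve_exists[OF K xy]) (use M in auto)
  then obtain f L0 where f: "f \<in> almost_lipschitz_curves K x y L0 0" "inj_on f {0..1}"
    using injective_lipschitz_curve[OF K(1) xy(3)] by metis
  have L0: "L0 \<ge> 0" using almost_lipschitz_curves_lower[OF f(1)] zero_le_dist[of x y] by linarith
  have lip: "dist (f s) (f t) \<le> L0 * \<bar>s - t\<bar>" if "s \<in> {0..1}" "t \<in> {0..1}" for s t
    using f(1) that by (auto simp: almost_lipschitz_curves_def)
  have "L0-lipschitz_on {0..1} f" using lip L0 by (auto simp: lipschitz_on_def dist_real_def)
  then have "continuous_on {0..1} f" by (rule lipschitz_on_continuous_on)
  then have "arc f" using f(2) by (simp add: arc_def path_def)
  moreover have "path_image f \<subseteq> K" "pathstart f = x" "pathfinish f = y"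
    using f(1) by (auto simp: almost_lipschitz_curves_def path_image_def pathstart_def pathfinish_def)
  moreover have "rectifiable f 0 1" by (rule lipschitz_rectifiable[OF lip L0])
  ultimately show ?thesis using that by blast
qed

section \<open>Hausdorff measure along arcs\<close>

lemma hausdorff_outer_1_lipschitz_le:
  fixes \<sigma> :: "real \<Rightarrow> 'a::metric_space"
  assumes lip: "\<And>s t. s \<in> {a..b} \<Longrightarrow> t \<in> {a..b} \<Longrightarrow> dist (\<sigma> s) (\<sigma> t) \<le> \<bar>s - t\<bar>" and ab: "a \<le> b"
  shows "hausdorff_outer 1 (\<sigma> ` {a..b}) \<le> ennreal (b - a)"
  unfolding hausdorff_outer_eq_SUP
proof (rule SUP_least)
  fix \<epsilon> :: real assume "\<epsilon> \<in> {0<..}"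
  then have \<epsilon>: "\<epsilon> > 0" by simp
  obtain N :: nat where N: "(b - a) / \<epsilon> < real N" using reals_Archimedean2 by blast
  have N0: "N > 0" using N ab \<epsilon> by (cases "N = 0") (auto simp: divide_less_0_iff)
  define h where "h = (b - a) / N"
  have h: "0 \<le> h" "h < \<epsilon>" "N * h = b - a" using ab N N0 \<epsilon> by (auto simp: h_def field_simps)
  define A where "A = (\<lambda>j. if j < N then \<sigma> ` ({a + j * h..a + (real j + 1) * h} \<inter> {a..b}) else {})"
  have Ah: "ediam (A j) \<le> (if j < N then ennreal h else 0)" for j
  proof (cases "j < N")
    case True
    have "dist x y \<le> h" if xy: "x \<in> A j" "y \<in> A j" for x y
    proof -
      obtain s t where st: "s \<in> {a + j * h..a + (real j + 1) * h} \<inter> {a..b}" "t \<in> {a + j * h..a + (real j + 1) * h} \<inter> {a..b}"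
        "x = \<sigma> s" "y = \<sigma> t" using xy unfolding A_def if_P[OF True] by blast
      have "dist x y \<le> \<bar>s - t\<bar>" using st lip by simp
      also have "\<dots> \<le> h" using st(1,2) by (auto simp: algebra_simps abs_le_iff)
      finally show ?thesis .
    qed
    then show ?thesis using True unfolding ediam_def by (auto intro!: SUP_least ennreal_leI)
  qed (simp add: A_def)
  have "hausdorff_pre 1 \<epsilon> (\<sigma> ` {a..b}) \<le> (\<Sum>j. ennreal (hausdorff_const 1) * ediam (A j) ^ 1)"
  proof (rule hausdorff_pre_le)
    show "ediam (A j) < ennreal \<epsilon>" for j
      using Ah[of j] h \<epsilon> by (auto split: if_splits intro: order.strict_trans1 simp: ennreal_lessI)
    show "\<sigma> ` {a..b} \<subseteq> (\<Union>j. A j)"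
    proof
      fix x assume "x \<in> \<sigma> ` {a..b}"
      then obtain t where t: "t \<in> {a..b}" "x = \<sigma> t" by blast
      show "x \<in> (\<Union>j. A j)"
      proof (cases "h = 0")
        case True
        then have "x \<in> A 0" using t h N0 by (auto simp: A_def)
        then show ?thesis by blast
      next
        case False
        then have hp: "h > 0" using h by simp
        define j where "j = min (N - 1) (nat \<lfloor>(t - a) / h\<rfloor>)"
        have jN: "j < N" using N0 by (simp add: j_def)
        have q0: "0 \<le> (t - a) / h" using t hp by simp
        have qN: "(t - a) / h \<le> N" using t hp h(3) by (simp add: field_simps)
        have "real j \<le> (t - a) / h" unfolding j_def using q0 by linarith
        then have "a + j * h \<le> t" using hp by (simp add: field_simps)
        moreover have "(t - a) / h \<le> real j + 1" unfolding j_def using q0 qN N0 by linarith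
        then have "t \<le> a + (real j + 1) * h" using hp by (simp add: field_simps)
        ultimately have "t \<in> {a + j * h..a + (real j + 1) * h} \<inter> {a..b}" using t(1) by simp
        then have "x \<in> A j" using t(2) jN unfolding A_def by simp
        then show ?thesis by blast
      qed
    qed
  qed
  also have "\<dots> \<le> (\<Sum>j. if j < N then ennreal h else 0)"
    by (intro suminf_le) (use Ah in \<open>auto simp: hausdorff_const_def\<close>)
  also have "\<dots> = (\<Sum>j<N. ennreal h)" by (subst suminf_finite[of "{..<N}"]) auto
  also have "\<dots> = ennreal (b - a)"
    using h by (simp add: ennreal_of_nat_eq_real_of_nat ennreal_mult[symmetric])
  finally show "hausdorff_pre 1 \<epsilon> (\<sigma> ` {a..b}) \<le> ennreal (b - a)" .
qed

text \<open>The pieces are half-open so that consecutive pieces of an arc are disjoint and their measures add up.\<close>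

lemma hausdorff_1_half_open_arc_ge:
  fixes \<gamma> :: "real \<Rightarrow> 'a::metric_space"
  assumes cont: "continuous_on {s..t} \<gamma>" and st: "s \<le> t"
  shows "ennreal (dist (\<gamma> s) (\<gamma> t)) \<le> hausdorff_outer 1 (\<gamma> ` {s<..t})"
proof (rule ennreal_le_epsilon)
  fix e :: real assume e: "e > 0"
  let ?f = "dist (\<gamma> s)"
  have "connected (?f ` \<gamma> ` {s..t})"
    by (intro connected_continuous_image continuous_intros cont connected_Icc)
  then have sub: "{?f (\<gamma> s)..?f (\<gamma> t)} \<subseteq> ?f ` \<gamma> ` {s..t}" using st by (intro connected_contains_Icc) auto
  have dd: "\<bar>?f u - ?f v\<bar> \<le> dist u v" for u v
    using dist_triangle[of "\<gamma> s" u v] dist_triangle[of "\<gamma> s" v u] by (auto simp: dist_commute)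
  have "{e..?f (\<gamma> t)} \<subseteq> ?f ` \<gamma> ` {s<..t}"
  proof
    fix v assume v: "v \<in> {e..?f (\<gamma> t)}"
    then have "v \<in> {?f (\<gamma> s)..?f (\<gamma> t)}" using e by auto
    then obtain r where r: "r \<in> {s..t}" "v = ?f (\<gamma> r)" using sub by blast
    then have "r \<noteq> s" using v e by auto
    then show "v \<in> ?f ` \<gamma> ` {s<..t}" using r by auto
  qed
  then have "ennreal (?f (\<gamma> t) - e) \<le> hausdorff_outer 1 (\<gamma> ` {s<..t})"
    by (intro hausdorff_outer_1_ge[of _ ?f] dd)
  then have "ennreal (?f (\<gamma> t) - e) + ennreal e \<le> hausdorff_outer 1 (\<gamma> ` {s<..t}) + ennreal e"
    by (rule add_right_mono)
  moreover have "ennreal (?f (\<gamma> t)) \<le> ennreal (?f (\<gamma> t) - e) + ennreal e"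
    using e by (cases "?f (\<gamma> t) - e \<ge> 0") (auto simp: ennreal_plus[symmetric] ennreal_neg intro!: ennreal_leI simp del: ennreal_plus)
  ultimately show "ennreal (dist (\<gamma> s) (\<gamma> t)) \<le> hausdorff_outer 1 (\<gamma> ` {s<..t}) + ennreal e" by (meson order_trans)
qed

lemma borel_arc_images:
  fixes \<gamma> :: "real \<Rightarrow> 'a::metric_space"
  assumes cont: "continuous_on {a..b} \<gamma>" and inj: "inj_on \<gamma> {a..b}" and st: "a \<le> s" "t \<le> b"
  shows "\<gamma> ` {s..t} \<in> sets borel" "\<gamma> ` {s<..t} \<in> sets borel"
proof -
  have "{s..t} \<subseteq> {a..b}" using st by auto
  then have "compact (\<gamma> ` {s..t})" by (intro compact_continuous_image continuous_on_subset[OF cont]) auto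
  then have "closed (\<gamma> ` {s..t})" by (rule compact_imp_closed)
  then show b: "\<gamma> ` {s..t} \<in> sets borel" by (rule borel_closed)
  show "\<gamma> ` {s<..t} \<in> sets borel"
  proof (cases "s \<le> t")
    case True
    have "\<gamma> ` {s<..t} = \<gamma> ` {s..t} - {\<gamma> s}"
    proof -
      have "\<gamma> r \<noteq> \<gamma> s" if "r \<in> {s<..t}" for r
      proof
        assume "\<gamma> r = \<gamma> s"
        then have "r = s" using inj_onD[OF inj] that st True by auto
        then show False using that by simp
      qed
      moreover have "{s..t} = insert s {s<..t}" using True by auto
      ultimately show ?thesis by auto
    qed
    then show ?thesis using b by auto
  qed auto
qed

lemma curve_length_le_hausdorff:
  fixes \<gamma> :: "real \<Rightarrow> 'a::metric_space"
  assumes cont: "continuous_on {a..b} \<gamma>" and inj: "inj_on \<gamma> {a..b}" and st: "a \<le> s" "t \<le> b"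
  shows "curve_length \<gamma> s t \<le> hausdorff_outer 1 (\<gamma> ` {s..t})"
proof (rule curve_length_leI)
  fix n p assume p: "partition_of s t n p"
  have mono: "p 0 \<le> p k" if "k \<le> n" for k using that
  proof (induction k)
    case (Suc k)
    have "p k \<le> p (Suc k)" using p Suc.prems by (auto simp: partition_of_def)
    then show ?case using Suc by simp
  qed simp
  have mem: "p k \<in> {s..t}" if "k \<le> n" for k using p that by (auto simp: partition_of_def)
  have "polygon_length \<gamma> k p \<le> emeasure (hausdorff 1) (\<gamma> ` {p 0<..p k})" if "k \<le> n" for k using that
  proof (induction k)
    case (Suc k)
    have k: "p 0 \<le> p k" "p k \<le> p (Suc k)" "p 0 \<in> {s..t}" "p k \<in> {s..t}" "p (Suc k) \<in> {s..t}"
      using mono[of k] mem[of k] mem[of "Suc k"] mem[of 0] p Suc.prems by (auto simp: partition_of_def)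
    have b1: "\<gamma> ` {p 0<..p k} \<in> sets borel" and b2: "\<gamma> ` {p k<..p (Suc k)} \<in> sets borel"
      using borel_arc_images[OF cont inj] k st by auto
    have "continuous_on {p k..p (Suc k)} \<gamma>" using k st by (intro continuous_on_subset[OF cont]) auto
    from hausdorff_1_half_open_arc_ge[OF this k(2)]
    have d: "ennreal (dist (\<gamma> (p k)) (\<gamma> (p (Suc k)))) \<le> emeasure (hausdorff 1) (\<gamma> ` {p k<..p (Suc k)})"
      using b2 by (simp add: emeasure_hausdorff)
    have "inj_on \<gamma> ({p 0<..p k} \<union> {p k<..p (Suc k)})" using k st by (intro inj_on_subset[OF inj]) auto
    then have disj: "\<gamma> ` {p 0<..p k} \<inter> \<gamma> ` {p k<..p (Suc k)} = {}"
      using inj_on_image_Int[of \<gamma> "{p 0<..p k} \<union> {p k<..p (Suc k)}" "{p 0<..p k}" "{p k<..p (Suc k)}"] by auto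
    have "polygon_length \<gamma> (Suc k) p \<le> emeasure (hausdorff 1) (\<gamma> ` {p 0<..p k}) + emeasure (hausdorff 1) (\<gamma> ` {p k<..p (Suc k)})"
      using Suc d by (auto intro!: add_mono)
    also have "\<dots> = emeasure (hausdorff 1) (\<gamma> ` {p 0<..p k} \<union> \<gamma> ` {p k<..p (Suc k)})"
      using b1 b2 disj by (intro plus_emeasure) auto
    also have "\<gamma> ` {p 0<..p k} \<union> \<gamma> ` {p k<..p (Suc k)} = \<gamma> ` {p 0<..p (Suc k)}"
      using k(1,2) by (auto simp: image_Un[symmetric] ivl_disj_un_two)
    finally show ?case .
  qed simp
  then have "polygon_length \<gamma> n p \<le> emeasure (hausdorff 1) (\<gamma> ` {p 0<..p n})" by simp
  also have "\<dots> \<le> emeasure (hausdorff 1) (\<gamma> ` {s..t})"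
    using mem[of 0] mem[of n] borel_arc_images[OF cont inj st] by (intro emeasure_mono image_mono) auto
  finally show "polygon_length \<gamma> n p \<le> hausdorff_outer 1 (\<gamma> ` {s..t})"
    using borel_arc_images[OF cont inj st] by (simp add: emeasure_hausdorff)
qed

text \<open>Let \<open>\<sigma>\<close> be the arc length parametrisation. The image under \<open>\<sigma>\<close> of an interval has
\<open>H\<^sup>1\<close>-measure at most the length of the interval, since \<open>\<sigma>\<close> is 1-Lipschitz, and at least this
length by the preceding lemma. So \<open>H\<^sup>1\<close> on the arc corresponds to Lebesgue measure under \<open>\<sigma>\<close>.\<close>

lemma line_integral_arc:
  fixes \<gamma> :: "real \<Rightarrow> 'a::metric_space"
  assumes cont: "continuous_on {a..b} \<gamma>" and inj: "inj_on \<gamma> {a..b}" and rect: "rectifiable \<gamma> a b"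
    and ab: "a \<le> b" and \<rho>: "\<rho> \<in> borel_measurable borel"
  shows "line_integral \<gamma> a b \<rho> = (\<integral>\<^sup>+x\<in>\<gamma> ` {a..b}. \<rho> x \<partial>hausdorff 1)"
proof -
  define L where "L = arc_len \<gamma> a b"
  define \<sigma> where "\<sigma> = arc_length_param \<gamma> a b"
  have L0: "L \<ge> 0" by (simp add: L_def)
  have lip: "dist (\<sigma> r) (\<sigma> r') \<le> \<bar>r - r'\<bar>" if "r \<in> {0..L}" "r' \<in> {0..L}" for r r'
    unfolding \<sigma>_def by (rule arc_length_param_lipschitz[OF cont rect ab]) (use that in \<open>auto simp: L_def\<close>)
  have "1-lipschitz_on {0..L} \<sigma>" using lip by (auto simp: lipschitz_on_def dist_real_def)
  then have c\<sigma>: "continuous_on {0..L} \<sigma>" by (rule lipschitz_on_continuous_on)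
  have at: "\<sigma> (arc_len \<gamma> a t) = \<gamma> t" if "t \<in> {a..b}" for t
    unfolding \<sigma>_def by (rule arc_length_param_eq[OF rect that])
  have surj: "\<exists>t\<in>{a..b}. arc_len \<gamma> a t = r" if r: "r \<in> {0..L}" for r
  proof -
    obtain t where "t \<in> {a..b}" "arc_len \<gamma> a t = r"
      using arc_len_surj[OF cont rect ab r[unfolded L_def]] .
    then show ?thesis by blast
  qed
  have amono: "arc_len \<gamma> a s \<le> arc_len \<gamma> a t" if "a \<le> s" "s \<le> t" "t \<le> b" for s t
    by (rule arc_len_mono[OF rect that])
  have inj\<sigma>: "inj_on \<sigma> {0..L}"
  proof (rule inj_onI)
    fix r r' assume r: "r \<in> {0..L}" "r' \<in> {0..L}" "\<sigma> r = \<sigma> r'"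
    obtain t t' where t: "t \<in> {a..b}" "arc_len \<gamma> a t = r" "t' \<in> {a..b}" "arc_len \<gamma> a t' = r'"
      using surj[OF r(1)] surj[OF r(2)] by blast
    then have "\<gamma> t = \<gamma> t'" using r(3) at[OF t(1)] at[OF t(3)] by simp
    then have "t = t'" using inj_onD[OF inj] t by blast
    then show "r = r'" using t by simp
  qed
  have im: "\<sigma> ` {arc_len \<gamma> a t..L} = \<gamma> ` {t..b}" if t: "t \<in> {a..b}" for t
  proof (intro equalityI subsetI)
    fix x assume "x \<in> \<sigma> ` {arc_len \<gamma> a t..L}"
    then obtain r where r: "r \<in> {arc_len \<gamma> a t..L}" "x = \<sigma> r" by blast
    have "0 \<le> r" using r(1) by (intro order_trans[OF enn2real_nonneg[of "curve_length \<gamma> a t"]]) simp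
    then have "r \<in> {0..L}" using r(1) by simp
    then obtain u where u: "u \<in> {a..b}" "arc_len \<gamma> a u = r" using surj by blast
    show "x \<in> \<gamma> ` {t..b}"
    proof (cases "t \<le> u")
      case True then show ?thesis using u at[OF u(1)] r(2) by auto
    next
      case False
      then have "arc_len \<gamma> a u = arc_len \<gamma> a t" using amono[of u t] u t r by auto
      then have "x = \<gamma> t" using at[OF t] u r by simp
      then show ?thesis using t by auto
    qed
  next
    fix x assume "x \<in> \<gamma> ` {t..b}"
    then obtain u where u: "u \<in> {t..b}" "x = \<gamma> u" by blast
    then have "u \<in> {a..b}" using t by auto
    then have "x = \<sigma> (arc_len \<gamma> a u)" using at u by simp
    moreover have "arc_len \<gamma> a u \<in> {arc_len \<gamma> a t..L}" using u t amono[of t u] amono[of u b] by (auto simp: L_def)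
    ultimately show "x \<in> \<sigma> ` {arc_len \<gamma> a t..L}" by blast
  qed
  define I where "I = \<gamma> ` {a..b}"
  have I: "\<sigma> ` {0..L} = I" using im[of a] ab by (simp add: I_def)
  have Ib [measurable]: "I \<in> sets borel" unfolding I_def using borel_arc_images[OF cont inj, of a b] by simp
  have closed_meas: "emeasure (hausdorff 1) (\<sigma> ` {r..L}) = ennreal (L - r)" if r: "r \<in> {0..L}" for r
  proof -
    obtain t where t: "t \<in> {a..b}" "arc_len \<gamma> a t = r" using surj[OF r] by blast
    have b: "\<sigma> ` {r..L} \<in> sets borel" using borel_arc_images[OF c\<sigma> inj\<sigma>, of r L] r by simp
    have "hausdorff_outer 1 (\<sigma> ` {r..L}) \<le> ennreal (L - r)"
      using r by (intro hausdorff_outer_1_lipschitz_le lip) auto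
    moreover have "ennreal (L - r) \<le> hausdorff_outer 1 (\<sigma> ` {r..L})"
    proof -
      have "L = r + arc_len \<gamma> t b" unfolding L_def t(2)[symmetric] using t(1) by (intro arc_len_add[OF rect]) auto
      moreover have "rectifiable \<gamma> t b" using t(1) by (intro rectifiable_subinterval[OF rect]) auto
      ultimately have "ennreal (L - r) = curve_length \<gamma> t b" using curve_length_eq_arc_len[of \<gamma> t b] by simp
      also have "\<dots> \<le> hausdorff_outer 1 (\<gamma> ` {t..b})" using t(1) by (intro curve_length_le_hausdorff[OF cont inj]) auto
      also have "\<gamma> ` {t..b} = \<sigma> ` {r..L}" using im[OF t(1)] t(2) by simp
      finally show ?thesis .
    qed
    ultimately show ?thesis using b by (simp add: emeasure_hausdorff)
  qed
  have point: "emeasure (hausdorff 1) {x} = 0" for x :: 'a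
  proof -
    have "hausdorff_outer 1 ((\<lambda>_::real. x) ` {0..0}) \<le> ennreal (0 - 0)" by (rule hausdorff_outer_1_lipschitz_le) auto
    then show ?thesis by (simp add: emeasure_hausdorff)
  qed
  have open_meas: "emeasure (hausdorff 1) (\<sigma> ` {r<..L}) = ennreal (L - r)" if r: "r \<in> {0..L}" for r
  proof -
    have b: "\<sigma> ` {r<..L} \<in> sets borel" using borel_arc_images[OF c\<sigma> inj\<sigma>, of r L] r by simp
    have "{r..L} = {r} \<union> {r<..L}" using r by auto
    then have "\<sigma> ` {r..L} = {\<sigma> r} \<union> \<sigma> ` {r<..L}" by auto
    then have "emeasure (hausdorff 1) (\<sigma> ` {r..L}) = emeasure (hausdorff 1) (\<sigma> ` {r<..L})"
      using emeasure_Un_null_set[of "\<sigma> ` {r<..L}" "hausdorff 1" "{\<sigma> r}"] b point by (simp add: null_sets_def Un_commute)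
    then show ?thesis using closed_meas[OF r] by simp
  qed
  obtain \<tau> where \<tau>: "homeomorphism {0..L} I \<sigma> \<tau>"
    using homeomorphism_compact[OF compact_Icc c\<sigma> I inj\<sigma>] by blast
  then have c\<tau>: "continuous_on I \<tau>" and \<tau>\<sigma>: "\<And>r. r \<in> {0..L} \<Longrightarrow> \<tau> (\<sigma> r) = r" and \<sigma>\<tau>: "\<And>x. x \<in> I \<Longrightarrow> \<sigma> (\<tau> x) = x"
    and \<tau>I: "\<tau> ` I = {0..L}" by (auto simp: homeomorphism_def)
  define N where "N = restrict_space (hausdorff 1) I"
  have spN: "space N = I" by (simp add: N_def space_restrict_space)
  have "\<tau> \<in> borel_measurable (restrict_space borel I)" using c\<tau> by (rule borel_measurable_continuous_on_restrict)
  moreover have "sets N = sets (restrict_space borel I)" by (simp add: N_def sets_restrict_space)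
  ultimately have [measurable]: "\<tau> \<in> borel_measurable N" using measurable_cong_sets by blast
  define M where "M = distr N borel \<tau>"
  define M' where "M' = density lborel (indicator {0..L} :: real \<Rightarrow> ennreal)"
  have M: "emeasure M {r<..} = emeasure M' {r<..}" for r
  proof -
    have pre: "\<tau> -` {r<..} \<inter> I = \<sigma> ` ({0..L} \<inter> {r<..})"
    proof (intro equalityI subsetI)
      fix x assume "x \<in> \<tau> -` {r<..} \<inter> I"
      then have "\<tau> x \<in> {0..L} \<inter> {r<..}" "x = \<sigma> (\<tau> x)" using \<tau>I \<sigma>\<tau> by auto
      then show "x \<in> \<sigma> ` ({0..L} \<inter> {r<..})" by blast
    next
      fix x assume "x \<in> \<sigma> ` ({0..L} \<inter> {r<..})"
      then obtain v where "v \<in> {0..L}" "r < v" "x = \<sigma> v" by auto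
      then show "x \<in> \<tau> -` {r<..} \<inter> I" using \<tau>\<sigma> I by auto
    qed
    have "emeasure M {r<..} = emeasure N (\<tau> -` {r<..} \<inter> I)"
      unfolding M_def by (subst emeasure_distr) (auto simp: spN)
    also have "\<dots> = emeasure (hausdorff 1) (\<sigma> ` ({0..L} \<inter> {r<..}))"
      unfolding N_def pre using I Ib by (subst emeasure_restrict_space) auto
    also have "\<dots> = emeasure lborel ({0..L} \<inter> {r<..})"
    proof -
      consider "r < 0" | "r \<in> {0..L}" | "L < r" by fastforce
      then show ?thesis
      proof cases
        case 1
        then have "{0..L} \<inter> {r<..} = {0..L}" by auto
        then show ?thesis using closed_meas[of 0] L0 by simp
      next
        case 2
        then have "{0..L} \<inter> {r<..} = {r<..L}" by auto
        then show ?thesis using open_meas[OF 2] 2 by simp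
      next
        case 3
        then have "{0..L} \<inter> {r<..} = {}" by auto
        then show ?thesis by simp
      qed
    qed
    also have "\<dots> = emeasure M' {r<..}"
      unfolding M'_def by (subst emeasure_density) (auto simp: indicator_inter_arith[symmetric])
    finally show ?thesis .
  qed
  have "M = M'"
  proof (rule measure_eqI_lessThan)
    show "sets M = sets borel" "sets M' = sets borel" by (simp_all add: M_def M'_def)
    show "emeasure M {r<..} = emeasure M' {r<..}" for r by (rule M)
    show "emeasure M {r<..} < \<infinity>" for r
    proof -
      have "emeasure M {r<..} = emeasure lborel ({0..L} \<inter> {r<..})"
        unfolding M M'_def by (subst emeasure_density) (auto simp: indicator_inter_arith[symmetric])
      also have "\<dots> \<le> emeasure lborel {0..L}" by (intro emeasure_mono) auto
      finally show ?thesis using L0 by (simp add: order.strict_trans1)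
    qed
  qed
  let ?F = "\<lambda>r. \<rho> (\<sigma> r) * indicator {0..L} r"
  have [measurable]: "?F \<in> borel_measurable borel"
    unfolding \<sigma>_def L_def by (rule arc_length_param_measurable[OF cont rect ab \<rho>])
  have "line_integral \<gamma> a b \<rho> = (\<integral>\<^sup>+r. ?F r \<partial>M')"
    unfolding M'_def line_integral_def L_def[symmetric] \<sigma>_def[symmetric]
    by (subst nn_integral_density) (auto intro!: nn_integral_cong split: split_indicator)
  also have "\<dots> = (\<integral>\<^sup>+x. ?F (\<tau> x) \<partial>N)"
    unfolding \<open>M = M'\<close>[symmetric] M_def by (subst nn_integral_distr) auto
  also have "\<dots> = (\<integral>\<^sup>+x. \<rho> x \<partial>N)"
  proof (intro nn_integral_cong)
    fix x assume "x \<in> space N"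
    then have "x \<in> I" by (simp add: spN)
    then have "\<sigma> (\<tau> x) = x" "\<tau> x \<in> {0..L}" using \<sigma>\<tau> \<tau>I by blast+
    then show "?F (\<tau> x) = \<rho> x" by simp
  qed
  also have "\<dots> = (\<integral>\<^sup>+x\<in>I. \<rho> x \<partial>hausdorff 1)"
    unfolding N_def by (subst nn_integral_restrict_space) auto
  finally show ?thesis by (simp add: I_def)
qed

section \<open>Separation in topological squares\<close>

abbreviation unit_square :: "(real \<times> real) set" where "unit_square \<equiv> {0..1} \<times> {0..1}"

text \<open>Topological facts are pulled back to the unit square by \<open>\<psi>\<close> and pushed forward to \<open>Q\<close> by
\<open>\<phi>\<close>.\<close>

locale topological_square =
  fixes Q :: "'a::metric_space set" and \<phi> :: "real \<times> real \<Rightarrow> 'a" and \<psi> :: "'a \<Rightarrow> real \<times> real"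
  assumes hom: "homeomorphism unit_square Q \<phi> \<psi>"
begin

lemma cont_\<phi>: "continuous_on unit_square \<phi>" and cont_\<psi>: "continuous_on Q \<psi>"
  and image_\<phi>: "\<phi> ` unit_square = Q" and image_\<psi>: "\<psi> ` Q = unit_square"
  and \<psi>_\<phi>: "p \<in> unit_square \<Longrightarrow> \<psi> (\<phi> p) = p" and \<phi>_\<psi>: "x \<in> Q \<Longrightarrow> \<phi> (\<psi> x) = x"
  using hom by (auto simp: homeomorphism_def)

lemma \<phi>_in: "p \<in> unit_square \<Longrightarrow> \<phi> p \<in> Q" using image_\<phi> by blast
lemma \<psi>_in: "x \<in> Q \<Longrightarrow> \<psi> x \<in> unit_square" using image_\<psi> by blast

lemma compact_unit_square: "compact unit_square" by (intro compact_Times compact_Icc)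

lemma convex_unit_square: "convex unit_square" by (intro convex_Times convex_real_interval)

lemma compact_Q: "compact Q"
  using compact_continuous_image[OF cont_\<phi> compact_unit_square] image_\<phi> by simp

lemma closed_Q: "closed Q" by (rule compact_imp_closed[OF compact_Q])

lemma borel_Q [measurable]: "Q \<in> sets borel" using closed_Q by simp

lemma connected_image_\<phi>: "connected T \<Longrightarrow> T \<subseteq> unit_square \<Longrightarrow> connected (\<phi> ` T)"
  using connected_continuous_image continuous_on_subset[OF cont_\<phi>] by blast

lemma connected_image_\<psi>: "connected T \<Longrightarrow> T \<subseteq> Q \<Longrightarrow> connected (\<psi> ` T)"
  using connected_continuous_image continuous_on_subset[OF cont_\<psi>] by blast

lemma compact_image_\<phi>: "compact T \<Longrightarrow> T \<subseteq> unit_square \<Longrightarrow> compact (\<phi> ` T)"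
  using compact_continuous_image continuous_on_subset[OF cont_\<phi>] by blast

text \<open>In the plane, two points that are separated by a closed set are separated by one of its components. The
plane retracts onto the square, so \<open>S\<close> pulls back to a closed subset of the plane that separates the
corresponding points, and the separating component is mapped into a component of \<open>S\<close>.\<close>

lemma component_separates:
  assumes S: "closed S" "S \<subseteq> Q" and y: "y \<in> Q" and w: "w \<in> Q"
    and sep: "\<And>T. connected T \<Longrightarrow> T \<subseteq> Q \<Longrightarrow> y \<in> T \<Longrightarrow> w \<in> T \<Longrightarrow> T \<inter> S \<noteq> {}"
  obtains C where "C \<in> components S"
    "\<And>T. connected T \<Longrightarrow> T \<subseteq> Q \<Longrightarrow> y \<in> T \<Longrightarrow> w \<in> T \<Longrightarrow> T \<inter> C \<noteq> {}"
proof -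
  define r where "r = closest_point unit_square"
  have cl: "closed unit_square" by (rule compact_imp_closed[OF compact_unit_square])
  have ne: "unit_square \<noteq> {}" by auto
  have contr: "continuous_on UNIV r"
    unfolding r_def by (rule continuous_on_closest_point[OF convex_unit_square cl ne])
  have rin: "r p \<in> unit_square" for p
    unfolding r_def by (rule closest_point_in_set[OF cl ne])
  have rid: "r p = p" if "p \<in> unit_square" for p
    unfolding r_def by (rule closest_point_self[OF that])
  have contf: "continuous_on UNIV (\<lambda>p. \<phi> (r p))"
    by (rule continuous_on_compose2[OF cont_\<phi> contr]) (use rin in blast)
  define S' where "S' = (\<lambda>p. \<phi> (r p)) -` S"
  have clS': "closed S'" unfolding S'_def using contf S(1) by (simp add: closed_vimage continuous_on_eq_continuous_at continuous_at_imp_continuous_on)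
  have nc: "\<not> connected_component (- S') (\<psi> y) (\<psi> w)"
  proof
    assume "connected_component (- S') (\<psi> y) (\<psi> w)"
    then obtain T where T: "connected T" "T \<subseteq> - S'" "\<psi> y \<in> T" "\<psi> w \<in> T"
      unfolding connected_component_def by blast
    let ?T = "(\<lambda>p. \<phi> (r p)) ` T"
    have "connected ?T" by (rule connected_continuous_image[OF continuous_on_subset[OF contf] T(1)]) simp
    moreover have "?T \<subseteq> Q" using rin \<phi>_in by blast
    moreover have "y \<in> ?T" "w \<in> ?T"
      using rid[OF \<psi>_in[OF y]] \<phi>_\<psi>[OF y] rid[OF \<psi>_in[OF w]] \<phi>_\<psi>[OF w] T(3,4)
      by (auto intro: image_eqI[where x = "\<psi> y"] image_eqI[where x = "\<psi> w"])
    moreover have "?T \<inter> S = {}" using T(2) unfolding S'_def by blast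
    ultimately show False using sep by blast
  qed
  obtain C' where C': "C' \<in> components S'" "\<not> connected_component (- C') (\<psi> y) (\<psi> w)"
    by (rule separation_by_component_closed_pointwise[OF clS' nc])
  let ?D = "(\<lambda>p. \<phi> (r p)) ` C'"
  have "connected ?D"
    by (rule connected_continuous_image[OF continuous_on_subset[OF contf]]) (use C'(1) in_components_connected in auto)
  moreover have "?D \<subseteq> S" using in_components_subset[OF C'(1)] unfolding S'_def by blast
  moreover have "?D \<noteq> {}" using in_components_nonempty[OF C'(1)] by blast
  ultimately obtain C where C: "C \<in> components S" "?D \<subseteq> C"
    by (metis exists_component_superset bot.extremum_uniqueI)
  show ?thesis
  proof (rule that[OF C(1)])
    fix T assume T: "connected T" "T \<subseteq> Q" "y \<in> T" "w \<in> T"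
    have "connected (\<psi> ` T)" by (rule connected_image_\<psi>[OF T(1,2)])
    then have "\<not> \<psi> ` T \<subseteq> - C'"
      using C'(2) T(3,4) unfolding connected_component_def by blast
    then obtain x where x: "x \<in> T" "\<psi> x \<in> C'" by blast
    then have xQ: "x \<in> Q" using T(2) by blast
    have "\<phi> (r (\<psi> x)) = x" using rid[OF \<psi>_in[OF xQ]] \<phi>_\<psi>[OF xQ] by simp
    moreover have "\<phi> (r (\<psi> x)) \<in> C" using C(2) x(2) by blast
    ultimately have "x \<in> C" by simp
    then show "T \<inter> C \<noteq> {}" using x(1) by blast
  qed
qed

text \<open>By the intermediate value theorem the level set separates \<open>Z\<close> from \<open>P\<close>, so one of its components
separates a point of \<open>Z\<close> from a point of \<open>P\<close>. It then separates all of \<open>Z\<close> from all of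
\<open>P\<close>, as these sets are connected and do not meet the level set.\<close>

lemma level_component_separates:
  fixes m :: "'a \<Rightarrow> real"
  assumes m: "continuous_on UNIV m" and Z: "connected Z" "Z \<subseteq> Q" "Z \<noteq> {}" "\<And>z. z \<in> Z \<Longrightarrow> m z < s"
    and P: "connected P" "P \<subseteq> Q" "P \<noteq> {}" "\<And>z. z \<in> P \<Longrightarrow> s < m z"
  obtains C where "C \<in> components {x \<in> Q. m x = s}"
    "\<And>T. connected T \<Longrightarrow> T \<subseteq> Q \<Longrightarrow> T \<inter> Z \<noteq> {} \<Longrightarrow> T \<inter> P \<noteq> {} \<Longrightarrow> T \<inter> C \<noteq> {}"
proof -
  obtain y w where y: "y \<in> Z" and w: "w \<in> P" using Z(3) P(3) by blast
  let ?S = "{x \<in> Q. m x = s}"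
  have "?S = Q \<inter> m -` {s}" by auto
  then have clS: "closed ?S" using continuous_closed_vimage[of "{s}" m] m closed_Q
    by (metis closed_Int closed_singleton closed_vimage)
  obtain C where C: "C \<in> components ?S"
    "\<And>T. connected T \<Longrightarrow> T \<subseteq> Q \<Longrightarrow> y \<in> T \<Longrightarrow> w \<in> T \<Longrightarrow> T \<inter> C \<noteq> {}"
  proof (rule component_separates[of ?S y w])
    show "closed ?S" "?S \<subseteq> Q" "y \<in> Q" "w \<in> Q" using clS y w Z(2) P(2) by auto
    fix T assume T: "connected T" "T \<subseteq> Q" "y \<in> T" "w \<in> T"
    have "connected (m ` T)" using m T(1) connected_continuous_image continuous_on_subset by blast
    then have "s \<in> m ` T"
      using connected_contains_Icc[of "m ` T" "m y" "m w"] T Z(4)[OF y] P(4)[OF w] by force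
    then show "T \<inter> ?S \<noteq> {}" using T(2) by blast
  qed blast
  show ?thesis
  proof (rule that[OF C(1)])
    fix T assume T: "connected T" "T \<subseteq> Q" "T \<inter> Z \<noteq> {}" "T \<inter> P \<noteq> {}"
    have "connected (T \<union> Z)" using connected_Un[OF T(1) Z(1)] T(3) by blast
    then have "connected (T \<union> Z \<union> P)" using connected_Un[OF _ P(1), of "T \<union> Z"] T(4) by blast
    then have "(T \<union> Z \<union> P) \<inter> C \<noteq> {}" using C(2)[of "T \<union> Z \<union> P"] T(2) Z(2) P(2) y w by blast
    moreover have "C \<subseteq> ?S" by (rule in_components_subset[OF C(1)])
    ultimately show "T \<inter> C \<noteq> {}" using Z(4) P(4) by fastforce
  qed
qed

lemma locally_connected_Q: "locally connected Q"
proof -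
  have "unit_square homeomorphic Q" using hom unfolding homeomorphic_def by blast
  from homeomorphic_locally[OF this, of connected connected] show ?thesis
    using homeomorphic_connectedness convex_imp_locally_connected[OF convex_unit_square] by blast
qed

lemma openin_component_diff:
  assumes "closed K" shows "openin (top_of_set Q) (connected_component_set (Q - K) y)"
proof (cases "y \<in> Q - K")
  case True
  have "openin (top_of_set Q) (Q - K)" using assms by (simp add: Diff_eq openin_open_Int open_Compl)
  then show ?thesis using locally_connected_2[OF locally_connected_Q _ True] by blast
next
  case False
  then have "connected_component_set (Q - K) y = {}" using connected_component_eq_empty by blast
  then show ?thesis by (simp only: openin_empty)
qed

text \<open>The square remains path connected when a point is removed.\<close>

lemma connected_avoiding_point:
  assumes "x \<in> Q" "p \<in> Q" "w \<in> Q" "p \<noteq> x" "w \<noteq> x"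
  obtains P where "compact P" "connected P" "P \<subseteq> Q" "x \<notin> P" "p \<in> P" "w \<in> P"
proof -
  have "\<not> collinear unit_square"
  proof
    assume "collinear unit_square"
    then obtain u where u: "\<And>x y. x \<in> unit_square \<Longrightarrow> y \<in> unit_square \<Longrightarrow> \<exists>c. x - y = c *\<^sub>R u"
      unfolding collinear_def by blast
    obtain c where "(0,1) - (0,0) = c *\<^sub>R u" using u[of "(0,1)" "(0,0)"] by auto
    moreover obtain c' where "(1,0) - (0,0) = c' *\<^sub>R u" using u[of "(1,0)" "(0,0)"] by auto
    ultimately show False by (cases u) auto
  qed
  then have "path_connected (unit_square - {\<psi> x})"
    by (intro path_connected_convex_diff_countable convex_unit_square) auto
  moreover have "\<psi> p \<in> unit_square - {\<psi> x}" "\<psi> w \<in> unit_square - {\<psi> x}"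
    using assms \<psi>_in \<phi>_\<psi> by (metis DiffI singletonD)+
  ultimately obtain g where g: "path g" "path_image g \<subseteq> unit_square - {\<psi> x}" "pathstart g = \<psi> p" "pathfinish g = \<psi> w"
    unfolding path_connected_def by metis
  show ?thesis
  proof (rule that[of "\<phi> ` path_image g"])
    show "compact (\<phi> ` path_image g)" using g by (intro compact_image_\<phi> compact_path_image) auto
    show "connected (\<phi> ` path_image g)" using g by (intro connected_image_\<phi> connected_path_image) auto
    show "\<phi> ` path_image g \<subseteq> Q" using g(2) \<phi>_in by blast
    show "x \<notin> \<phi> ` path_image g"
    proof
      assume "x \<in> \<phi> ` path_image g"
      then obtain t where "t \<in> path_image g" "x = \<phi> t" by blast
      moreover from this have "t \<in> unit_square" "t \<noteq> \<psi> x" using g(2) by blast+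
      ultimately show False using \<psi>_\<phi>[of t] by simp
    qed
    have "\<phi> (pathstart g) \<in> \<phi> ` path_image g" "\<phi> (pathfinish g) \<in> \<phi> ` path_image g"
      by (intro imageI pathstart_in_path_image pathfinish_in_path_image)+
    then show "p \<in> \<phi> ` path_image g" "w \<in> \<phi> ` path_image g"
      unfolding g(3,4) using \<phi>_\<psi>[OF assms(2)] \<phi>_\<psi>[OF assms(3)] by simp_all
  qed
qed

text \<open>Two parallel segments in the square, so close to each other that both run between the given open sets.\<close>

lemma disjoint_connectors:
  assumes Y: "openin (top_of_set Q) Y" "Y \<noteq> {}" and W: "openin (top_of_set Q) W" "W \<noteq> {}"
  obtains Z P where "compact Z" "connected Z" "Z \<subseteq> Q" "compact P" "connected P" "P \<subseteq> Q" "Z \<inter> P = {}"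
    "Z \<inter> Y \<noteq> {}" "Z \<inter> W \<noteq> {}" "P \<inter> Y \<noteq> {}" "P \<inter> W \<noteq> {}"
proof -
  have int: "\<exists>p e. e > 0 \<and> ball p e \<subseteq> unit_square \<and> \<phi> ` ball p e \<subseteq> B"
    if B: "openin (top_of_set Q) B" "B \<noteq> {}" for B
  proof -
    have "openin (top_of_set unit_square) (unit_square \<inter> \<phi> -` B)"
      using continuous_openin_preimage[OF cont_\<phi> _ B(1)] \<phi>_in by auto
    then obtain U where U: "open U" "unit_square \<inter> \<phi> -` B = unit_square \<inter> U" by (auto simp: openin_open)
    obtain x where "x \<in> B" using B by blast
    then have "x \<in> Q" using B(1) openin_imp_subset by blast
    then have "\<psi> x \<in> U \<inter> unit_square" using U(2) \<open>x \<in> B\<close> \<psi>_in \<phi>_\<psi> by fastforce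
    moreover have "unit_square = closure ({0<..<1} \<times> {0<..<1})" by (simp add: closure_Times)
    ultimately have "U \<inter> ({0<..<1} \<times> {0<..<1}) \<noteq> {}"
      using U(1) open_Int_closure_eq_empty by (metis Int_iff empty_iff)
    moreover have "open (U \<inter> ({0<..<1} \<times> {0<..<1}))" using U(1) by (intro open_Int open_Times) auto
    ultimately obtain p e where pe: "e > 0" "ball p e \<subseteq> U \<inter> ({0<..<1} \<times> {0<..<1})"
      by (metis all_not_in_conv openE)
    have "({0<..<1} \<times> {0<..<1}) \<subseteq> unit_square" by auto
    then have "ball p e \<subseteq> unit_square" using pe(2) by blast
    moreover have "\<phi> ` ball p e \<subseteq> B" using U(2) pe(2) calculation by blast
    ultimately show ?thesis using pe(1) by blast
  qed
  obtain p e where p: "e > 0" "ball p e \<subseteq> unit_square" "\<phi> ` ball p e \<subseteq> Y" using int[OF Y] by blast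
  obtain q e' where q: "e' > 0" "ball q e' \<subseteq> unit_square" "\<phi> ` ball q e' \<subseteq> W" using int[OF W] by blast
  define d where "d = q - p"
  define n where "n = (if d = 0 then (1::real,0::real) else (- snd d, fst d))"
  have n: "n \<noteq> 0" "n \<bullet> d = 0"
    by (auto simp: n_def inner_prod_def prod_eq_iff zero_prod_def)
  define c where "c = min e e' / (2 * norm n)"
  have c: "c > 0" using p(1) q(1) n(1) by (simp add: c_def)
  define v where "v = c *\<^sub>R n"
  have nv: "norm v = min e e' / 2" using n(1) p(1) q(1) by (simp add: v_def c_def)
  have v: "norm v < e" "norm v < e'" using p(1) q(1) unfolding nv by auto
  have inp: "p \<in> ball p e" "p + v \<in> ball p e" using p(1) v by (auto simp: dist_norm)
  have inq: "q \<in> ball q e'" "q + v \<in> ball q e'" using q(1) v by (auto simp: dist_norm)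
  let ?Z = "closed_segment p q" and ?P = "closed_segment (p + v) (q + v)"
  have subs: "?Z \<subseteq> unit_square" "?P \<subseteq> unit_square"
    by (rule closed_segment_subset[OF _ _ convex_unit_square], use inp inq p(2) q(2) in blast, use inp inq p(2) q(2) in blast)+
  have cst: "n \<bullet> z = n \<bullet> a" if "z \<in> closed_segment a (a + d)" for z a
    using that n(2) by (auto simp: in_segment algebra_simps)
  have "?Z \<inter> ?P = {}"
  proof (rule ccontr)
    assume "?Z \<inter> ?P \<noteq> {}"
    then obtain z where z: "z \<in> closed_segment p (p + d)" "z \<in> closed_segment (p + v) (p + v + d)"
      by (auto simp: d_def algebra_simps)
    have "n \<bullet> v = 0" using cst[OF z(1)] cst[OF z(2)] by (simp add: inner_add_right)
    then show False using c n(1) by (simp add: v_def)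
  qed
  then have disj: "\<phi> ` ?Z \<inter> \<phi> ` ?P = {}" 
    using inj_on_image_Int[OF inj_on_inverseI[of unit_square \<psi> \<phi>, OF \<psi>_\<phi>] subs] by simp
  show ?thesis
  proof (rule that[of "\<phi> ` ?Z" "\<phi> ` ?P"])
    show "\<phi> ` ?Z \<inter> \<phi> ` ?P = {}" by (rule disj)
    show "compact (\<phi> ` ?Z)" "compact (\<phi> ` ?P)" using subs by (auto intro!: compact_image_\<phi>)
    show "connected (\<phi> ` ?Z)" "connected (\<phi> ` ?P)" using subs by (auto intro!: connected_image_\<phi>)
    show "\<phi> ` ?Z \<subseteq> Q" "\<phi> ` ?P \<subseteq> Q" using subs \<phi>_in by blast+
    show "\<phi> ` ?Z \<inter> Y \<noteq> {}" "\<phi> ` ?P \<inter> Y \<noteq> {}" using inp p(3) by blast+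
    show "\<phi> ` ?Z \<inter> W \<noteq> {}" "\<phi> ` ?P \<inter> W \<noteq> {}" using inq q(3) by blast+
  qed
qed

text \<open>The set \<open>W\<close> is the union of the images of two adjacent sides, namely of the vertical and of the
horizontal side of the unit square that lie farther away from \<open>\<psi> x\<close>. It serves as the outside of the small circles around
\<open>x\<close>: it contains \<open>\<zeta>\<^sub>1\<close> or \<open>\<zeta>\<^sub>3\<close>, so that every curve between these sides meets it.\<close>

lemma far_cross:
  obtains r0 where "r0 > 0" "\<And>x. x \<in> Q \<Longrightarrow> \<exists>W. connected W \<and> W \<subseteq> Q \<and> W \<inter> cball x r0 = {} \<and>
    W \<inter> \<zeta>\<^sub>1 \<phi> \<noteq> {} \<and> W \<inter> \<zeta>\<^sub>3 \<phi> \<noteq> {} \<and> (\<zeta>\<^sub>1 \<phi> \<subseteq> W \<or> \<zeta>\<^sub>3 \<phi> \<subseteq> W)"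
proof -
  have "uniformly_continuous_on Q \<psi>" by (rule compact_uniformly_continuous[OF cont_\<psi> compact_Q])
  then obtain d where d: "d > 0" "\<And>x x'. x \<in> Q \<Longrightarrow> x' \<in> Q \<Longrightarrow> dist x' x < d \<Longrightarrow> dist (\<psi> x') (\<psi> x) < 1/4"
    unfolding uniformly_continuous_on_def by (metis divide_pos_pos zero_less_numeral zero_less_one)
  show ?thesis
  proof (rule that[of "d/2"])
    show "d/2 > 0" using d by simp
    fix x assume x: "x \<in> Q"
    obtain p1 p2 where p: "\<psi> x = (p1, p2)" by fastforce
    have pI: "p1 \<in> {0..1}" "p2 \<in> {0..1}" using \<psi>_in[OF x] p by auto
    define v h where "v = (if p1 \<le> 1/2 then (1::real) else 0)" and "h = (if p2 \<le> 1/2 then (1::real) else 0)"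
    let ?V = "{v} \<times> {0..1} :: (real\<times>real) set" and ?H = "{0..1} \<times> {h} :: (real\<times>real) set"
    have vh: "v \<in> {0..1}" "h \<in> {0..1}" "h = 0 \<or> h = 1" by (auto simp: v_def h_def)
    have sub: "?V \<union> ?H \<subseteq> unit_square" using vh by auto
    have "connected (?V \<union> ?H)"
    proof (rule connected_Un)
      show "connected ?V" "connected ?H" by (auto intro!: connected_Times)
      have "(v, h) \<in> ?V \<inter> ?H" using vh by auto
      then show "?V \<inter> ?H \<noteq> {}" by blast
    qed
    then have con: "connected (\<phi> ` (?V \<union> ?H))" by (rule connected_image_\<phi>[OF _ sub])
    have disj: "\<phi> ` (?V \<union> ?H) \<inter> cball x (d/2) = {}"
    proof (rule ccontr)
      assume "\<not> ?thesis"
      then obtain q0 where "q0 \<in> ?V \<union> ?H" "\<phi> q0 \<in> cball x (d/2)" by blast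
      moreover obtain q1 q2 where "q0 = (q1, q2)" by (cases q0)
      ultimately have q: "(q1, q2) \<in> ?V \<union> ?H" "dist x (\<phi> (q1,q2)) \<le> d/2" by auto
      have qQ: "(q1,q2) \<in> unit_square" using q(1) sub by blast
      have "dist (\<psi> (\<phi> (q1,q2))) (\<psi> x) < 1/4"
        using d(2)[OF x \<phi>_in[OF qQ]] q(2) d(1) by (simp add: dist_commute)
      then have lt: "dist (q1,q2) (p1,p2) < 1/4" using \<psi>_\<phi>[OF qQ] p by simp
      have "dist q1 p1 \<le> dist (q1,q2) (p1,p2)" "dist q2 p2 \<le> dist (q1,q2) (p1,p2)"
        using dist_fst_le[of "(q1,q2)" "(p1,p2)"] dist_snd_le[of "(q1,q2)" "(p1,p2)"] by auto
      with lt have "\<bar>q1 - p1\<bar> < 1/4" "\<bar>q2 - p2\<bar> < 1/4" by (auto simp: dist_real_def)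
      moreover have "q1 = v \<or> q2 = h" using q(1) by auto
      ultimately show False using pI by (auto simp: v_def h_def split: if_splits)
    qed
    have "\<phi> (v, 0) \<in> \<phi> ` (?V \<union> ?H) \<inter> \<zeta>\<^sub>1 \<phi>" "\<phi> (v, 1) \<in> \<phi> ` (?V \<union> ?H) \<inter> \<zeta>\<^sub>3 \<phi>"
      unfolding \<zeta>\<^sub>1_def \<zeta>\<^sub>3_def using vh by (auto intro!: imageI)
    moreover have "\<zeta>\<^sub>1 \<phi> \<subseteq> \<phi> ` (?V \<union> ?H) \<or> \<zeta>\<^sub>3 \<phi> \<subseteq> \<phi> ` (?V \<union> ?H)"
      unfolding \<zeta>\<^sub>1_def \<zeta>\<^sub>3_def using vh(3) by auto
    moreover have "\<phi> ` (?V \<union> ?H) \<subseteq> Q" using sub \<phi>_in by blast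
    ultimately show "\<exists>W. connected W \<and> W \<subseteq> Q \<and> W \<inter> cball x (d/2) = {} \<and>
      W \<inter> \<zeta>\<^sub>1 \<phi> \<noteq> {} \<and> W \<inter> \<zeta>\<^sub>3 \<phi> \<noteq> {} \<and> (\<zeta>\<^sub>1 \<phi> \<subseteq> W \<or> \<zeta>\<^sub>3 \<phi> \<subseteq> W)"
      using con disj by (intro exI[of _ "\<phi> ` (?V \<union> ?H)"]) blast
  qed
qed

lemma zeta_properties:
  shows "connected (\<zeta>\<^sub>1 \<phi>)" "connected (\<zeta>\<^sub>3 \<phi>)" "\<zeta>\<^sub>1 \<phi> \<subseteq> Q" "\<zeta>\<^sub>3 \<phi> \<subseteq> Q" "\<zeta>\<^sub>1 \<phi> \<inter> \<zeta>\<^sub>3 \<phi> = {}"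
proof -
  have sub: "({0..1} \<times> {0} :: (real\<times>real) set) \<subseteq> unit_square" "({0..1} \<times> {1} :: (real\<times>real) set) \<subseteq> unit_square" by auto
  show "connected (\<zeta>\<^sub>1 \<phi>)" "connected (\<zeta>\<^sub>3 \<phi>)"
    unfolding \<zeta>\<^sub>1_def \<zeta>\<^sub>3_def using sub by (auto intro!: connected_image_\<phi> connected_Times)
  show "\<zeta>\<^sub>1 \<phi> \<subseteq> Q" "\<zeta>\<^sub>3 \<phi> \<subseteq> Q" unfolding \<zeta>\<^sub>1_def \<zeta>\<^sub>3_def using sub \<phi>_in by blast+
  show "\<zeta>\<^sub>1 \<phi> \<inter> \<zeta>\<^sub>3 \<phi> = {}"
  proof (rule ccontr)
    assume "\<not> ?thesis"
    then obtain a b where "a \<in> {0..1}" "b \<in> {0..1}" "\<phi> (a, 0) = \<phi> (b, 1)" unfolding \<zeta>\<^sub>1_def \<zeta>\<^sub>3_def by blast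
    then have "(a, 0::real) = (b, 1)" using \<psi>_\<phi>[of "(a,0)"] \<psi>_\<phi>[of "(b,1)"] by auto
    then show False by simp
  qed
qed

end

section \<open>Curves along which the line integrals converge\<close>

text \<open>The restriction to \<open>[s,t]\<close>, rescaled to \<open>[0,1]\<close>. For \<open>s = t\<close> this is a constant path, which
represents the degenerate subcurves in the definition of \<open>u\<close>.\<close>

definition subcurve :: "real \<Rightarrow> real \<Rightarrow> (real \<Rightarrow> 'a) \<Rightarrow> real \<Rightarrow> 'a" where
  "subcurve s t \<gamma> r = \<gamma> ((t - s) * r + s)"

lemma subcurve_ends [simp]: "pathstart (subcurve s t \<gamma>) = \<gamma> s" "pathfinish (subcurve s t \<gamma>) = \<gamma> t"
  by (simp_all add: pathstart_def pathfinish_def subcurve_def)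

lemma affine_unit_interval:
  fixes r s t :: real
  assumes "0 \<le> s" "s \<le> t" "t \<le> 1" "0 \<le> r" "r \<le> 1"
  shows "(t - s) * r + s \<in> {0..1}"
proof -
  have "(t - s) * r \<le> (t - s) * 1" using assms by (intro mult_left_mono) auto
  moreover have "0 \<le> (t - s) * r" using assms by simp
  ultimately show ?thesis using assms by auto
qed

lemma path_subcurve:
  assumes "path \<gamma>" "0 \<le> s" "s \<le> t" "t \<le> 1"
  shows "path (subcurve s t \<gamma>)" "path_image (subcurve s t \<gamma>) \<subseteq> path_image \<gamma>"
proof -
  have im: "(\<lambda>r. (t - s) * r + s) ` {0..1} \<subseteq> {0..1}" using affine_unit_interval[OF assms(2-4)] by auto
  have "continuous_on {0..1} (\<lambda>r. (t - s) * r + s)" by (intro continuous_intros)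
  from continuous_on_compose2[OF assms(1)[unfolded path_def] this im]
  show "path (subcurve s t \<gamma>)" unfolding path_def subcurve_def .
  show "path_image (subcurve s t \<gamma>) \<subseteq> path_image \<gamma>"
    using im unfolding path_image_def subcurve_def by blast
qed

locale minimizing_square = topological_square Q \<phi> \<psi>
  for Q :: "'a::metric_space set" and \<phi> \<psi> +
  fixes \<rho>k :: "nat \<Rightarrow> 'a \<Rightarrow> ennreal" and \<rho> :: "'a \<Rightarrow> ennreal"
  assumes plane: "(UNIV :: 'a set) homeomorphic (UNIV :: (real ^ 2) set)"
    and locally_finite: "\<forall>x :: 'a. \<exists>U. open U \<and> x \<in> U \<and> emeasure (hausdorff 2) U < \<infinity>"
    and minimizing: "minimizing_function Q \<phi> \<rho>k \<rho>"
begin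

lemma \<rho>_borel [measurable]: "\<rho> \<in> borel_measurable borel"
  and \<rho>k_borel [measurable]: "\<rho>k k \<in> borel_measurable borel"
  using minimizing by (auto simp: minimizing_function_def admissible_def)

abbreviation converges :: "(real \<Rightarrow> 'a) \<Rightarrow> real \<Rightarrow> real \<Rightarrow> bool" where
  "converges \<equiv> line_integrals_converge \<rho>k \<rho>"

text \<open>The paths in \<open>Q\<close> outside \<open>\<Gamma>\<^sub>0\<close>, together with the constant ones. They are closed under
restriction, reversal and concatenation, and with respect to them \<open>u\<close> is the distance from
\<open>\<zeta>\<^sub>1\<close> for the length element \<open>\<rho> ds\<close>.\<close>

definition tame_path :: "(real \<Rightarrow> 'a) \<Rightarrow> bool" where
  "tame_path \<gamma> \<longleftrightarrow> path \<gamma> \<and> path_image \<gamma> \<subseteq> Q \<and> (\<forall>a b. 0 \<le> a \<longrightarrow> a \<le> b \<longrightarrow> b \<le> 1 \<longrightarrow> converges \<gamma> a b)"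

lemma tame_path_converges: "tame_path \<gamma> \<Longrightarrow> 0 \<le> a \<Longrightarrow> a \<le> b \<Longrightarrow> b \<le> 1 \<Longrightarrow> converges \<gamma> a b"
  by (simp add: tame_path_def)

lemma tame_path_cont: "tame_path \<gamma> \<Longrightarrow> 0 \<le> a \<Longrightarrow> b \<le> 1 \<Longrightarrow> continuous_on {a..b} \<gamma>"
  unfolding tame_path_def path_def by (metis atLeastatMost_subset_iff continuous_on_subset)

lemma tame_path_rect: "tame_path \<gamma> \<Longrightarrow> 0 \<le> a \<Longrightarrow> a \<le> b \<Longrightarrow> b \<le> 1 \<Longrightarrow> rectifiable \<gamma> a b"
  using tame_path_converges line_integrals_converge_def by metis

lemma tame_path_finite: "tame_path \<gamma> \<Longrightarrow> 0 \<le> a \<Longrightarrow> a \<le> b \<Longrightarrow> b \<le> 1 \<Longrightarrow> line_integral \<gamma> a b \<rho> < \<infinity>"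
  using tame_path_converges line_integrals_converge_def by metis

lemma tame_path_add:
  assumes "tame_path \<gamma>" "0 \<le> a" "a \<le> b" "b \<le> c" "c \<le> 1"
  shows "line_integral \<gamma> a c \<rho> = line_integral \<gamma> a b \<rho> + line_integral \<gamma> b c \<rho>"
  by (rule line_integral_add) (use assms tame_path_cont[of \<gamma> a c] tame_path_rect[of \<gamma> a c] in auto)

lemma tame_path_in_Q: "tame_path \<gamma> \<Longrightarrow> t \<in> {0..1} \<Longrightarrow> \<gamma> t \<in> Q"
  by (auto simp: tame_path_def path_image_def)

lemma converges_join:
  assumes cont: "continuous_on {a..b} \<gamma>" and am: "a \<le> m" "m \<le> b" and c: "converges \<gamma> a m" "converges \<gamma> m b"
  shows "converges \<gamma> a b"
proof -
  have rect: "rectifiable \<gamma> a b"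
    using c curve_length_add[OF am, of \<gamma>] by (auto simp: line_integrals_converge_def rectifiable_def)
  have add: "line_integral \<gamma> a b f = line_integral \<gamma> a m f + line_integral \<gamma> m b f" if "f \<in> borel_measurable borel" for f
    by (rule line_integral_add[OF cont rect am that])
  show ?thesis
    using c unfolding line_integrals_converge_def add[OF \<rho>_borel] add[OF \<rho>k_borel]
    by (auto simp: rect intro!: tendsto_add)
qed

lemma tame_path_subcurve_le:
  assumes \<gamma>: "tame_path \<gamma>" and st: "0 \<le> s" "s \<le> t" "t \<le> 1"
  shows "tame_path (subcurve s t \<gamma>)" "line_integral (subcurve s t \<gamma>) 0 1 \<rho> = line_integral \<gamma> s t \<rho>"
proof -
  have p: "path (subcurve s t \<gamma>)" using path_subcurve(1)[OF _ st, of \<gamma>] \<gamma> by (simp add: tame_path_def)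
  have "path_image (subcurve s t \<gamma>) \<subseteq> path_image \<gamma>" using path_subcurve(2)[OF _ st, of \<gamma>] \<gamma> by (simp add: tame_path_def)
  then have q: "path_image (subcurve s t \<gamma>) \<subseteq> Q" using \<gamma> by (auto simp: tame_path_def)
  have "tame_path (subcurve s t \<gamma>) \<and> line_integral (subcurve s t \<gamma>) 0 1 \<rho> = line_integral \<gamma> s t \<rho>"
  proof (cases "s = t")
    case True
    have len: "curve_length (subcurve s t \<gamma>) a b = 0" for a b
      by (rule curve_length_const[where x = "\<gamma> t"]) (simp add: subcurve_def True)
    then have li: "line_integral (subcurve s t \<gamma>) a b f = 0" for a b f by (rule line_integral_zero_length)
    have "converges (subcurve s t \<gamma>) a b" for a b
      unfolding line_integrals_converge_def li by (simp add: rectifiable_def len)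
    then show ?thesis using p q li True by (simp add: tame_path_def)
  next
    case False
    then have pos: "t - s > 0" using st by simp
    have sp: "subcurve s t \<gamma> = (\<lambda>r. \<gamma> ((t - s) * r + s))" by (rule ext) (rule subcurve_def)
    have in01: "0 \<le> (t - s) * a + s" "(t - s) * a + s \<le> (t - s) * b + s" "(t - s) * b + s \<le> 1" if "0 \<le> a" "a \<le> b" "b \<le> 1" for a b
    proof -
      show "0 \<le> (t - s) * a + s" using that st by simp
      show "(t - s) * a + s \<le> (t - s) * b + s" using that pos by simp
      have "(t - s) * b \<le> (t - s) * 1" using that pos by (intro mult_left_mono) auto
      then show "(t - s) * b + s \<le> 1" using st by simp
    qed
    have li: "line_integral (subcurve s t \<gamma>) a b f = line_integral \<gamma> ((t - s) * a + s) ((t - s) * b + s) f"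
      if "0 \<le> a" "a \<le> b" "b \<le> 1" for a b f
      unfolding sp using in01[OF that] that by (intro line_integral_affine[OF pos] tame_path_cont[OF \<gamma>] tame_path_rect[OF \<gamma>]) auto
    have "converges (subcurve s t \<gamma>) a b" if ab: "0 \<le> a" "a \<le> b" "b \<le> 1" for a b
    proof -
      have r: "rectifiable \<gamma> ((t - s) * a + s) ((t - s) * b + s)" using in01[OF ab] by (intro tame_path_rect[OF \<gamma>])
      then have r': "rectifiable (subcurve s t \<gamma>) a b" unfolding rectifiable_def sp curve_length_affine[OF pos] .
      show ?thesis using tame_path_converges[OF \<gamma> in01[OF ab]] r' li[OF ab] unfolding line_integrals_converge_def by simp
    qed
    then show ?thesis using p q li[of 0 1 \<rho>] by (simp add: tame_path_def)
  qed
  then show "tame_path (subcurve s t \<gamma>)" "line_integral (subcurve s t \<gamma>) 0 1 \<rho> = line_integral \<gamma> s t \<rho>" by blast+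
qed

lemma tame_path_reversepath:
  assumes \<gamma>: "tame_path \<gamma>"
  shows "tame_path (reversepath \<gamma>)" "line_integral (reversepath \<gamma>) 0 1 \<rho> = line_integral \<gamma> 0 1 \<rho>"
proof -
  have rp: "reversepath \<gamma> = (\<lambda>t. \<gamma> (1 - t))" by (simp add: reversepath_def fun_eq_iff)
  have li: "line_integral (reversepath \<gamma>) a b f = line_integral \<gamma> (1 - b) (1 - a) f"
    if "0 \<le> a" "a \<le> b" "b \<le> 1" "f \<in> borel_measurable borel" for a b f
    unfolding rp using line_integral_reverse[of "1 - b" "1 - a" \<gamma> f 1] that tame_path_cont[OF \<gamma>, of "1 - b" "1 - a"]
      tame_path_rect[OF \<gamma>, of "1 - b" "1 - a"] by simp
  have "converges (reversepath \<gamma>) a b" if ab: "0 \<le> a" "a \<le> b" "b \<le> 1" for a b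
  proof -
    have c: "converges \<gamma> (1 - b) (1 - a)" using ab by (intro tame_path_converges[OF \<gamma>]) auto
    have "curve_length (reversepath \<gamma>) a b = curve_length \<gamma> (1 - b) (1 - a)"
      unfolding rp using curve_length_reverse[of \<gamma> 1 "1 - a" "1 - b"] by simp
    then have "rectifiable (reversepath \<gamma>) a b" using c by (simp add: rectifiable_def line_integrals_converge_def)
    then show ?thesis using c li[OF ab] by (simp add: line_integrals_converge_def)
  qed
  then show "tame_path (reversepath \<gamma>)" using \<gamma> by (simp add: tame_path_def)
  show "line_integral (reversepath \<gamma>) 0 1 \<rho> = line_integral \<gamma> 0 1 \<rho>" using li[of 0 1 \<rho>] by simp
qed

lemma tame_path_joinpaths:
  assumes g1: "tame_path g1" and g2: "tame_path g2" and eq: "pathfinish g1 = pathstart g2"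
  shows "tame_path (g1 +++ g2)" "line_integral (g1 +++ g2) 0 1 \<rho> = line_integral g1 0 1 \<rho> + line_integral g2 0 1 \<rho>"
    "line_integral (g1 +++ g2) 0 (1/2) \<rho> = line_integral g1 0 1 \<rho>"
proof -
  let ?g = "g1 +++ g2"
  have p: "path ?g" using g1 g2 eq by (simp add: tame_path_def)
  have q: "path_image ?g \<subseteq> Q" using g1 g2 eq by (auto simp: tame_path_def path_image_join)
  have cont: "continuous_on {a..b} ?g" if "0 \<le> a" "b \<le> 1" for a b
    using p that unfolding path_def by (meson atLeastatMost_subset_iff continuous_on_subset)
  have left: "?g t = g1 (2 * t + 0)" if "t \<le> 1/2" for t using that by (simp add: joinpaths_def)
  have right: "?g t = g2 (2 * t + (-1))" if "t \<ge> 1/2" for t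
  proof (cases "t = 1/2")
    case True show ?thesis using eq unfolding True by (simp add: joinpaths_def pathfinish_def pathstart_def)
  qed (use that in \<open>simp add: joinpaths_def\<close>)
  have L: "converges ?g a b \<and> line_integral ?g a b \<rho> = line_integral g1 (2 * a) (2 * b) \<rho>"
    if ab: "0 \<le> a" "a \<le> b" "b \<le> 1/2" for a b
  proof -
    have c: "converges g1 (2 * a + 0) (2 * b + 0)" using ab by (intro tame_path_converges[OF g1]) auto
    have r: "rectifiable g1 (2 * a + 0) (2 * b + 0)" using c by (simp add: line_integrals_converge_def)
    have len: "curve_length ?g a b = curve_length g1 (2 * a + 0) (2 * b + 0)"
      using curve_length_cong[of a b ?g "\<lambda>t. g1 (2 * t + 0)"] left ab curve_length_affine[of 2 g1 0 a b] by auto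
    then have r': "rectifiable ?g a b" using r by (simp add: rectifiable_def)
    have "line_integral ?g a b f = line_integral g1 (2 * a + 0) (2 * b + 0) f" for f
    proof -
      have "line_integral ?g a b f = line_integral (\<lambda>t. g1 (2 * t + 0)) a b f"
        by (rule line_integral_cong) (use left ab cont r' in auto)
      also have "\<dots> = line_integral g1 (2 * a + 0) (2 * b + 0) f"
        by (rule line_integral_affine) (use ab r tame_path_cont[OF g1, of "2 * a + 0" "2 * b + 0"] in auto)
      finally show ?thesis .
    qed
    then show ?thesis using c r' by (simp add: line_integrals_converge_def)
  qed
  have R: "converges ?g a b \<and> line_integral ?g a b \<rho> = line_integral g2 (2 * a - 1) (2 * b - 1) \<rho>"
    if ab: "1/2 \<le> a" "a \<le> b" "b \<le> 1" for a b
  proof -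
    have c: "converges g2 (2 * a + (-1)) (2 * b + (-1))" using ab by (intro tame_path_converges[OF g2]) auto
    have r: "rectifiable g2 (2 * a + (-1)) (2 * b + (-1))" using c by (simp add: line_integrals_converge_def)
    have len: "curve_length ?g a b = curve_length g2 (2 * a + (-1)) (2 * b + (-1))"
      using curve_length_cong[of a b ?g "\<lambda>t. g2 (2 * t + (-1))"] right ab curve_length_affine[of 2 g2 "-1" a b] by auto
    then have r': "rectifiable ?g a b" using r by (simp add: rectifiable_def)
    have "line_integral ?g a b f = line_integral g2 (2 * a + (-1)) (2 * b + (-1)) f" for f
    proof -
      have "line_integral ?g a b f = line_integral (\<lambda>t. g2 (2 * t + (-1))) a b f"
        by (rule line_integral_cong) (use right ab cont r' in auto)
      also have "\<dots> = line_integral g2 (2 * a + (-1)) (2 * b + (-1)) f"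
        by (rule line_integral_affine) (use ab r tame_path_cont[OF g2, of "2 * a + (-1)" "2 * b + (-1)"] in auto)
      finally show ?thesis .
    qed
    then show ?thesis using c r' by (simp add: line_integrals_converge_def)
  qed
  have "converges ?g a b" if ab: "0 \<le> a" "a \<le> b" "b \<le> 1" for a b
  proof -
    consider "b \<le> 1/2" | "1/2 \<le> a" | "a \<le> 1/2" "1/2 \<le> b" by linarith
    then show ?thesis
    proof cases
      case 3
      show ?thesis by (rule converges_join[of a b _ "1/2"]) (use L[of a "1/2"] R[of "1/2" b] cont ab 3 in auto)
    qed (use L R ab in auto)
  qed
  then show tame_path: "tame_path ?g" using p q by (simp add: tame_path_def)
  show half: "line_integral ?g 0 (1/2) \<rho> = line_integral g1 0 1 \<rho>" using L[of 0 "1/2"] by simp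
  show "line_integral ?g 0 1 \<rho> = line_integral g1 0 1 \<rho> + line_integral g2 0 1 \<rho>"
    using tame_path_add[OF tame_path, of 0 "1/2" 1] half R[of "1/2" 1] by simp
qed

section \<open>The function \<open>u\<close> as a distance\<close>

abbreviation E :: "'a set" where "E \<equiv> E\<^sub>u Q \<phi> \<rho>k \<rho>"
abbreviation v :: "'a \<Rightarrow> ennreal" where "v \<equiv> u_inf Q \<phi> \<rho>k \<rho>"

definition joins :: "(real \<Rightarrow> 'a) \<Rightarrow> 'a set \<Rightarrow> 'a set \<Rightarrow> bool" where
  "joins \<gamma> A B \<longleftrightarrow> tame_path \<gamma> \<and> pathstart \<gamma> \<in> A \<and> pathfinish \<gamma> \<in> B"

lemma joins_reverse: "joins \<gamma> A B \<Longrightarrow> joins (reversepath \<gamma>) B A"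
  by (simp add: joins_def tame_path_reversepath)

text \<open>A tame path that joins \<open>\<zeta>\<^sub>1\<close> and \<open>\<zeta>\<^sub>3\<close> cannot be constant, as these sides are disjoint.\<close>

lemma admissible_curves_iff:
  "\<gamma> \<in> \<Gamma>\<^sub>1 Q \<phi> - \<Gamma>\<^sub>0 Q \<rho>k \<rho> \<longleftrightarrow> joins \<gamma> (\<zeta>\<^sub>1 \<phi>) (\<zeta>\<^sub>3 \<phi>) \<or> joins \<gamma> (\<zeta>\<^sub>3 \<phi>) (\<zeta>\<^sub>1 \<phi>)"
proof
  assume "\<gamma> \<in> \<Gamma>\<^sub>1 Q \<phi> - \<Gamma>\<^sub>0 Q \<rho>k \<rho>"
  then show "joins \<gamma> (\<zeta>\<^sub>1 \<phi>) (\<zeta>\<^sub>3 \<phi>) \<or> joins \<gamma> (\<zeta>\<^sub>3 \<phi>) (\<zeta>\<^sub>1 \<phi>)"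
    by (auto simp: \<Gamma>\<^sub>1_def \<Gamma>\<^sub>0_def curves_joining_def curves_in_def joins_def tame_path_def)
next
  assume j: "joins \<gamma> (\<zeta>\<^sub>1 \<phi>) (\<zeta>\<^sub>3 \<phi>) \<or> joins \<gamma> (\<zeta>\<^sub>3 \<phi>) (\<zeta>\<^sub>1 \<phi>)"
  then have "\<gamma> 0 \<noteq> \<gamma> 1" using zeta_properties(5) by (auto simp: joins_def pathstart_def pathfinish_def)
  then have "\<not> \<gamma> constant_on {0..1}" unfolding constant_on_def by (metis atLeastAtMost_iff order_refl zero_le_one)
  then show "\<gamma> \<in> \<Gamma>\<^sub>1 Q \<phi> - \<Gamma>\<^sub>0 Q \<rho>k \<rho>"
    using j by (auto simp: \<Gamma>\<^sub>1_def \<Gamma>\<^sub>0_def curves_joining_def curves_in_def joins_def tame_path_def)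
qed

lemma E_subset: "E \<subseteq> Q" by (auto simp: E\<^sub>u_def)

text \<open>Being in \<open>E\<close> amounts to two independent conditions, one for each side, because tame paths can be cut
and concatenated.\<close>

lemma in_E_D:
  assumes "x \<in> E" obtains g g' where "joins g (\<zeta>\<^sub>1 \<phi>) {x}" "joins g' {x} (\<zeta>\<^sub>3 \<phi>)"
proof -
  obtain \<gamma> where \<gamma>: "\<gamma> \<in> \<Gamma>\<^sub>1 Q \<phi> - \<Gamma>\<^sub>0 Q \<rho>k \<rho>" "x \<in> path_image \<gamma>" using assms by (auto simp: E\<^sub>u_def)
  obtain \<eta> where \<eta>: "joins \<eta> (\<zeta>\<^sub>1 \<phi>) (\<zeta>\<^sub>3 \<phi>)" "x \<in> path_image \<eta>"
    using \<gamma> joins_reverse[of \<gamma>] path_image_reversepath[of \<gamma>] unfolding admissible_curves_iff by metis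
  then obtain t where t: "t \<in> {0..1}" "\<eta> t = x" by (auto simp: path_image_def)
  show ?thesis
  proof (rule that)
    show "joins (subcurve 0 t \<eta>) (\<zeta>\<^sub>1 \<phi>) {x}" "joins (subcurve t 1 \<eta>) {x} (\<zeta>\<^sub>3 \<phi>)"
      using \<eta> t tame_path_subcurve_le[of \<eta>] by (auto simp: joins_def pathstart_def[of \<eta>] pathfinish_def[of \<eta>])
  qed
qed

lemma in_E_I:
  assumes "joins g (\<zeta>\<^sub>1 \<phi>) {x}" "joins g' {x} (\<zeta>\<^sub>3 \<phi>)" shows "x \<in> E"
proof -
  have eq: "pathfinish g = pathstart g'" using assms by (auto simp: joins_def)
  have "joins (g +++ g') (\<zeta>\<^sub>1 \<phi>) (\<zeta>\<^sub>3 \<phi>)"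
    using assms tame_path_joinpaths(1)[OF _ _ eq] by (auto simp: joins_def)
  moreover have "x \<in> path_image (g +++ g')"
    using assms eq pathfinish_in_path_image[of g] by (auto simp: joins_def path_image_join)
  moreover have "x \<in> Q"
    using assms pathfinish_in_path_image[of g] by (auto simp: joins_def tame_path_def)
  ultimately show ?thesis using admissible_curves_iff by (auto simp: E\<^sub>u_def)
qed

text \<open>A path from \<open>\<zeta>\<^sub>1\<close> to a point of \<open>E\<close> can be continued to \<open>\<zeta>\<^sub>3\<close>, so it takes part in
the infimum that defines \<open>u\<close>.\<close>

lemma v_le:
  assumes "x \<in> E" "joins g (\<zeta>\<^sub>1 \<phi>) {x}" shows "v x \<le> line_integral g 0 1 \<rho>"
proof -
  obtain g' where g': "joins g' {x} (\<zeta>\<^sub>3 \<phi>)" using in_E_D[OF assms(1)] by metis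
  have eq: "pathfinish g = pathstart g'" using assms g' by (auto simp: joins_def)
  let ?\<gamma> = "g +++ g'"
  have tame_path: "tame_path g" "tame_path g'" using assms g' by (auto simp: joins_def)
  have "joins ?\<gamma> (\<zeta>\<^sub>1 \<phi>) (\<zeta>\<^sub>3 \<phi>)"
    using assms g' tame_path_joinpaths(1)[OF tame_path eq] by (auto simp: joins_def)
  then have 1: "?\<gamma> \<in> \<Gamma>\<^sub>1 Q \<phi> - \<Gamma>\<^sub>0 Q \<rho>k \<rho>" using admissible_curves_iff by blast
  have 2: "?\<gamma> 0 \<in> \<zeta>\<^sub>1 \<phi>" "?\<gamma> (1/2) = x" using assms by (auto simp: joins_def joinpaths_def pathstart_def pathfinish_def)
  have "v x \<le> line_integral ?\<gamma> 0 (1/2) \<rho>"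
    unfolding u_inf_def by (rule INF_lower2[of "(?\<gamma>, 0, 1/2)"]) (use 1 2 in auto)
  then show ?thesis using tame_path_joinpaths(3)[OF tame_path eq] by simp
qed

lemma v_less:
  assumes "v x < c" obtains g where "joins g (\<zeta>\<^sub>1 \<phi>) {x}" "line_integral g 0 1 \<rho> < c"
proof -
  obtain \<gamma> a b where g: "\<gamma> \<in> \<Gamma>\<^sub>1 Q \<phi> - \<Gamma>\<^sub>0 Q \<rho>k \<rho>" "0 \<le> a" "a \<le> b" "b \<le> 1"
    "\<gamma> a \<in> \<zeta>\<^sub>1 \<phi> \<and> \<gamma> b = x \<or> \<gamma> a = x \<and> \<gamma> b \<in> \<zeta>\<^sub>1 \<phi>" "line_integral \<gamma> a b \<rho> < c"
    using assms unfolding u_inf_def INF_less_iff by auto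
  have tame_path: "tame_path \<gamma>" using g(1) admissible_curves_iff by (auto simp: joins_def)
  let ?h = "subcurve a b \<gamma>"
  have h: "tame_path ?h" "line_integral ?h 0 1 \<rho> < c" using tame_path_subcurve_le[OF tame_path g(2,3,4)] g(6) by auto
  have ends: "pathstart ?h = \<gamma> a" "pathfinish ?h = \<gamma> b" by auto
  from g(5) show ?thesis
  proof
    assume "\<gamma> a \<in> \<zeta>\<^sub>1 \<phi> \<and> \<gamma> b = x"
    then show ?thesis using h ends by (intro that[of ?h]) (auto simp: joins_def)
  next
    assume "\<gamma> a = x \<and> \<gamma> b \<in> \<zeta>\<^sub>1 \<phi>"
    then have "joins ?h {x} (\<zeta>\<^sub>1 \<phi>)" using h ends by (auto simp: joins_def)
    then show ?thesis using joins_reverse h tame_path_reversepath[OF h(1)] by (intro that[of "reversepath ?h"]) auto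
  qed
qed

lemma v_finite: "x \<in> E \<Longrightarrow> v x < \<infinity>"
proof -
  assume x: "x \<in> E"
  obtain g where g: "joins g (\<zeta>\<^sub>1 \<phi>) {x}" using in_E_D[OF x] by metis
  have "v x \<le> line_integral g 0 1 \<rho>" by (rule v_le[OF x g])
  also have "\<dots> < \<infinity>" using g by (intro tame_path_finite) (auto simp: joins_def)
  finally show ?thesis .
qed

lemma E_tame_path:
  assumes x: "x \<in> E" and g: "joins g {x} {y}"
  shows "y \<in> E" "v y \<le> v x + line_integral g 0 1 \<rho>"
proof -
  obtain h h' where h: "joins h (\<zeta>\<^sub>1 \<phi>) {x}" "joins h' {x} (\<zeta>\<^sub>3 \<phi>)" using in_E_D[OF x] .
  have "joins (reversepath g) {y} {x}" using g by (rule joins_reverse)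
  then have "joins (reversepath g +++ h') {y} (\<zeta>\<^sub>3 \<phi>)"
    using h(2) tame_path_joinpaths(1)[of "reversepath g" h'] by (auto simp: joins_def)
  moreover have ext: "joins (k +++ g) (\<zeta>\<^sub>1 \<phi>) {y}" "line_integral (k +++ g) 0 1 \<rho> = line_integral k 0 1 \<rho> + line_integral g 0 1 \<rho>"
    if "joins k (\<zeta>\<^sub>1 \<phi>) {x}" for k
    using that g tame_path_joinpaths(1,2)[of k g] by (auto simp: joins_def)
  ultimately show y: "y \<in> E" using h(1) in_E_I by blast
  show "v y \<le> v x + line_integral g 0 1 \<rho>"
  proof (rule ennreal_le_epsilon)
    fix e :: real assume e: "0 < e"
    have "v x < v x + ennreal e" using v_finite[OF x] e by (simp add: less_top)
    then obtain k where k: "joins k (\<zeta>\<^sub>1 \<phi>) {x}" "line_integral k 0 1 \<rho> < v x + ennreal e" by (rule v_less)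
    have "v y \<le> line_integral k 0 1 \<rho> + line_integral g 0 1 \<rho>" using v_le[OF y ext(1)[OF k(1)]] ext(2)[OF k(1)] by simp
    also have "\<dots> \<le> v x + line_integral g 0 1 \<rho> + ennreal e" using add_right_mono[OF less_imp_le[OF k(2)], of "line_integral g 0 1 \<rho>"] by (simp add: ac_simps)
    finally show "v y \<le> v x + line_integral g 0 1 \<rho> + ennreal e" .
  qed
qed

lemma v_zero: assumes "x \<in> E" "x \<in> \<zeta>\<^sub>1 \<phi>" shows "v x = 0"
proof -
  obtain g where g: "joins g (\<zeta>\<^sub>1 \<phi>) {x}" using in_E_D[OF assms(1)] by metis
  then have tame_path: "tame_path g" and g1: "g 1 = x" by (auto simp: joins_def pathfinish_def)
  have "joins (subcurve 1 1 g) (\<zeta>\<^sub>1 \<phi>) {x}" "line_integral (subcurve 1 1 g) 0 1 \<rho> = 0"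
    using tame_path_subcurve_le[OF tame_path, of 1 1] assms(2) g1 by (auto simp: joins_def)
  then have "v x \<le> 0" using v_le[OF assms(1)] by metis
  then show ?thesis by simp
qed

text \<open>The functions \<open>\<rho>\<^sub>k\<close> are admissible, and along tame paths their line integrals converge to that of
\<open>\<rho>\<close>.\<close>

lemma line_integral_ge_1:
  assumes "joins g (\<zeta>\<^sub>1 \<phi>) (\<zeta>\<^sub>3 \<phi>)" shows "1 \<le> line_integral g 0 1 \<rho>"
proof -
  have "converges g 0 1" using assms by (intro tame_path_converges) (auto simp: joins_def)
  then have lim: "(\<lambda>k. line_integral g 0 1 (\<rho>k k)) \<longlonglongrightarrow> line_integral g 0 1 \<rho>" and r: "rectifiable g 0 1"
    by (auto simp: line_integrals_converge_def)
  have "g \<in> \<Gamma>\<^sub>1 Q \<phi>" using assms admissible_curves_iff by blast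
  then have "1 \<le> line_integral g 0 1 (\<rho>k k)" for k
    using minimizing r by (auto simp: minimizing_function_def admissible_def)
  then show ?thesis by (intro LIMSEQ_le_const[OF lim]) auto
qed

lemma v_ge_1: assumes "x \<in> \<zeta>\<^sub>3 \<phi>" shows "1 \<le> v x"
proof (rule ccontr)
  assume "\<not> 1 \<le> v x"
  then have "v x < 1" by simp
  then obtain g where g: "joins g (\<zeta>\<^sub>1 \<phi>) {x}" "line_integral g 0 1 \<rho> < 1" by (rule v_less)
  then have "joins g (\<zeta>\<^sub>1 \<phi>) (\<zeta>\<^sub>3 \<phi>)" using assms by (auto simp: joins_def)
  from line_integral_ge_1[OF this] g(2) show False by simp
qed

text \<open>The function \<open>u\<close> as a real-valued function on \<open>E\<close>, where it is finite.\<close>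

definition U :: "'a \<Rightarrow> real" where "U x = enn2real (v x)"

lemma v_eq_U: "x \<in> E \<Longrightarrow> v x = ennreal (U x)"
  using v_finite[of x] by (simp add: U_def less_top)

lemma U_nonneg: "0 \<le> U x" by (simp add: U_def)

lemma U_zero: "x \<in> E \<Longrightarrow> x \<in> \<zeta>\<^sub>1 \<phi> \<Longrightarrow> U x = 0" by (simp add: U_def v_zero)

lemma U_ge_1: "x \<in> E \<Longrightarrow> x \<in> \<zeta>\<^sub>3 \<phi> \<Longrightarrow> 1 \<le> U x"
  using v_ge_1[of x] v_eq_U[of x] ennreal_le_iff[OF U_nonneg, of 1 x] by simp

lemma tame_path_in_E:
  assumes \<gamma>: "tame_path \<gamma>" and s: "s \<in> {0..1}" "\<gamma> s \<in> E" and t: "t \<in> {0..1}" shows "\<gamma> t \<in> E"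
proof (cases "s \<le> t")
  case True
  then have "joins (subcurve s t \<gamma>) {\<gamma> s} {\<gamma> t}" using tame_path_subcurve_le(1)[OF \<gamma>, of s t] s t by (auto simp: joins_def)
  then show ?thesis using E_tame_path(1)[OF s(2)] by blast
next
  case False
  then have "joins (subcurve t s \<gamma>) {\<gamma> t} {\<gamma> s}" using tame_path_subcurve_le(1)[OF \<gamma>, of t s] s t by (auto simp: joins_def)
  then show ?thesis using E_tame_path(1)[OF s(2)] joins_reverse by blast
qed

text \<open>The triangle inequality for the distance \<open>u\<close>, applied to the path and to its reversal.\<close>

lemma U_upper_gradient:
  assumes \<gamma>: "tame_path \<gamma>" and st: "0 \<le> s" "s \<le> t" "t \<le> 1" and E: "\<gamma> s \<in> E"
  shows "ennreal \<bar>U (\<gamma> s) - U (\<gamma> t)\<bar> \<le> line_integral \<gamma> s t \<rho>"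
proof -
  let ?I = "line_integral \<gamma> s t \<rho>"
  have Et: "\<gamma> t \<in> E" using tame_path_in_E[OF \<gamma> _ E] st by auto
  let ?g = "subcurve s t \<gamma>"
  have tame_path: "tame_path ?g" "line_integral ?g 0 1 \<rho> = ?I" using tame_path_subcurve_le[OF \<gamma> st] by auto
  have j: "joins ?g {\<gamma> s} {\<gamma> t}" using tame_path by (auto simp: joins_def)
  have 1: "v (\<gamma> t) \<le> v (\<gamma> s) + ?I" using E_tame_path(2)[OF E j] tame_path by simp
  have 2: "v (\<gamma> s) \<le> v (\<gamma> t) + ?I"
    using E_tame_path(2)[OF Et joins_reverse[OF j]] tame_path_reversepath(2)[OF tame_path(1)] tame_path(2) by simp
  have fin: "?I < \<infinity>" by (rule tame_path_finite[OF \<gamma> st])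
  then obtain i where i: "?I = ennreal i" "i \<ge> 0" by (cases ?I) auto
  have "U (\<gamma> t) \<le> U (\<gamma> s) + i" "U (\<gamma> s) \<le> U (\<gamma> t) + i"
    using 1 2 i U_nonneg unfolding v_eq_U[OF E] v_eq_U[OF Et] by (auto simp: ennreal_plus[symmetric] simp del: ennreal_plus)
  then show ?thesis unfolding i(1) by (intro ennreal_leI) auto
qed

lemma U_continuous_along:
  assumes \<gamma>: "tame_path \<gamma>" and E: "\<gamma> 0 \<in> E"
  shows "continuous_on {0..1} (\<lambda>t. U (\<gamma> t))"
proof -
  let ?F = "\<lambda>t. enn2real (line_integral \<gamma> 0 t \<rho>)"
  have F: "continuous_on {0..1} ?F"
    by (rule line_integral_continuous) (use tame_path_cont[OF \<gamma>] tame_path_rect[OF \<gamma>] tame_path_finite[OF \<gamma>] in auto)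
  have ord: "\<bar>U (\<gamma> s) - U (\<gamma> t)\<bar> \<le> \<bar>?F s - ?F t\<bar>" if st: "s \<in> {0..1}" "t \<in> {0..1}" "s \<le> t" for s t
  proof -
    have st': "0 \<le> s" "s \<le> t" "t \<le> 1" using st by auto
    have "\<gamma> s \<in> E" using tame_path_in_E[OF \<gamma> _ E] st by auto
    from U_upper_gradient[OF \<gamma> st' this] have le: "ennreal \<bar>U (\<gamma> s) - U (\<gamma> t)\<bar> \<le> line_integral \<gamma> s t \<rho>" .
    have fin: "line_integral \<gamma> 0 s \<rho> < top" "line_integral \<gamma> s t \<rho> < top"
      using tame_path_finite[OF \<gamma>, of 0 s] tame_path_finite[OF \<gamma>, of s t] st' by auto
    have "?F t = ?F s + enn2real (line_integral \<gamma> s t \<rho>)"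
      using tame_path_add[OF \<gamma>, of 0 s t] st' fin by (simp add: enn2real_plus)
    moreover have "\<bar>U (\<gamma> s) - U (\<gamma> t)\<bar> \<le> enn2real (line_integral \<gamma> s t \<rho>)"
      using enn2real_mono[OF le fin(2)] by simp
    ultimately show ?thesis by simp
  qed
  have dist: "dist (U (\<gamma> s)) (U (\<gamma> t)) \<le> dist (?F s) (?F t)" if "s \<in> {0..1}" "t \<in> {0..1}" for s t
  proof (cases "s \<le> t")
    case True then show ?thesis using ord[OF that True] by (simp add: dist_real_def)
  next
    case False then show ?thesis using ord[OF that(2,1)] by (simp add: dist_real_def abs_minus_commute)
  qed
  show ?thesis
    unfolding continuous_on_iff
  proof (intro ballI allI impI)
    fix t e :: real assume t: "t \<in> {0..1}" and e: "0 < e"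
    obtain d where d: "d > 0" "\<And>s. s \<in> {0..1} \<Longrightarrow> dist s t < d \<Longrightarrow> dist (?F s) (?F t) < e"
      using F t e unfolding continuous_on_iff by blast
    then show "\<exists>d>0. \<forall>x'\<in>{0..1}. dist x' t < d \<longrightarrow> dist (U (\<gamma> x')) (U (\<gamma> t)) < e"
      using dist[OF _ t] by (intro exI[of _ d] conjI ballI impI) (auto intro: le_less_trans[OF dist[OF _ t]])
  qed
qed

section \<open>Exceptional curves and tame continua\<close>

lemma hausdorff_2_Q_finite: "emeasure (hausdorff 2) Q < \<infinity>"
proof -
  obtain O' :: "'a \<Rightarrow> 'a set" where O': "\<forall>x. open (O' x) \<and> x \<in> O' x \<and> emeasure (hausdorff 2) (O' x) < \<infinity>"
    using choice[OF locally_finite] by blast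
  have "Q \<subseteq> (\<Union>c\<in>Q. O' c)" using O' by blast
  then obtain D where D: "D \<subseteq> Q" "finite D" "Q \<subseteq> (\<Union>c\<in>D. O' c)"
    using compactE_image[OF compact_Q, of Q O'] O' by metis
  have "emeasure (hausdorff 2) Q \<le> emeasure (hausdorff 2) (\<Union>c\<in>D. O' c)"
    using D O' by (intro emeasure_mono) (auto intro!: borel_open open_UN)
  also have "\<dots> \<le> (\<Sum>c\<in>D. emeasure (hausdorff 2) (O' c))"
    using D O' by (intro emeasure_subadditive_finite) auto
  also have "\<dots> < \<infinity>" using D O' by (simp add: ennreal_sum_less_top)
  finally show ?thesis .
qed

abbreviation exceptional :: "(real \<Rightarrow> 'a) set" where
  "exceptional \<equiv> {\<gamma> \<in> curves_in Q. \<not> converges \<gamma> 0 1}"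

lemma exceptional_small:
  assumes "e > (0::ennreal)"
  obtains h where "admissible exceptional h" "(\<integral>\<^sup>+x. h x ^ 2 \<partial>hausdorff 2) < e"
proof -
  have "modulus exceptional = 0" using minimizing by (simp add: minimizing_function_def)
  then have "modulus exceptional < e" using assms by simp
  then show ?thesis using that unfolding modulus_def INF_less_iff by auto
qed

lemma ennreal_am_gm: "d > 0 \<Longrightarrow> (x::ennreal) \<le> ennreal d + ennreal (1/d) * x ^ 2"
proof (cases x)
  case (real r)
  assume d: "d > 0"
  have "0 \<le> (r - d) ^ 2 / d + r" using d real by simp
  also have "(r - d) ^ 2 / d + r = d + (1/d) * r ^ 2 - r" using d by (simp add: power2_eq_square field_simps)
  finally have "ennreal r \<le> ennreal (d + (1/d) * r ^ 2)" by (intro ennreal_leI) simp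
  also have "\<dots> = ennreal d + ennreal ((1/d) * r ^ 2)" using d by (intro ennreal_plus) auto
  also have "ennreal ((1/d) * r ^ 2) = ennreal (1/d) * ennreal (r ^ 2)" using d by (intro ennreal_mult) auto
  finally show ?thesis using real by (simp add: ennreal_power)
qed (auto simp: power2_eq_square ennreal_mult_top)

text \<open>The Cauchy-Schwarz inequality in additive form; the free weight \<open>d\<close> makes it usable for series.\<close>

lemma set_integral_le_square:
  assumes f: "f \<in> borel_measurable borel" and d: "d > 0"
  shows "(\<integral>\<^sup>+x\<in>Q. f x \<partial>hausdorff 2) \<le> ennreal d * emeasure (hausdorff 2) Q + ennreal (1/d) * (\<integral>\<^sup>+x\<in>Q. f x ^ 2 \<partial>hausdorff 2)"
proof -
  have [measurable]: "f \<in> borel_measurable (hausdorff 2)" "Q \<in> sets (hausdorff 2)"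
    using f by (simp_all cong: measurable_cong_sets)
  have "(\<integral>\<^sup>+x\<in>Q. f x \<partial>hausdorff 2) \<le> (\<integral>\<^sup>+x. ennreal d * indicator Q x + ennreal (1/d) * (f x ^ 2 * indicator Q x) \<partial>hausdorff 2)"
    using ennreal_am_gm[OF d] by (intro nn_integral_mono) (auto split: split_indicator)
  also have "\<dots> = ennreal d * emeasure (hausdorff 2) Q + ennreal (1/d) * (\<integral>\<^sup>+x\<in>Q. f x ^ 2 \<partial>hausdorff 2)"
    by (subst nn_integral_add) (auto simp: nn_integral_cmult nn_integral_cmult_indicator)
  finally show ?thesis .
qed

lemma \<rho>_integrable: "(\<integral>\<^sup>+x\<in>Q. \<rho> x \<partial>hausdorff 2) < \<infinity>"
proof -
  have "(\<integral>\<^sup>+x\<in>Q. \<rho> x ^ 2 \<partial>hausdorff 2) < \<infinity>" using minimizing unfolding minimizing_function_def by blast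
  then have "ennreal 1 * emeasure (hausdorff 2) Q + ennreal (1/1) * (\<integral>\<^sup>+x\<in>Q. \<rho> x ^ 2 \<partial>hausdorff 2) < \<infinity>"
    using hausdorff_2_Q_finite by simp
  then show ?thesis by (rule order.strict_trans1[OF set_integral_le_square[OF \<rho>_borel zero_less_one]])
qed

lemma line_integral_suminf:
  assumes cont: "continuous_on {a..b} \<gamma>" and rect: "rectifiable \<gamma> a b" and ab: "a \<le> b"
    and f: "\<And>n. f n \<in> borel_measurable borel"
  shows "line_integral \<gamma> a b (\<lambda>x. \<Sum>n. f n x) = (\<Sum>n. line_integral \<gamma> a b (f n))"
proof -
  note [measurable] = arc_length_param_measurable[OF cont rect ab f]
  have "line_integral \<gamma> a b (\<lambda>x. \<Sum>n. f n x) =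
    (\<integral>\<^sup>+r. (\<Sum>n. f n (arc_length_param \<gamma> a b r) * indicator {0..arc_len \<gamma> a b} r) \<partial>lborel)"
    unfolding line_integral_def by (intro nn_integral_cong) (auto split: split_indicator)
  also have "\<dots> = (\<Sum>n. line_integral \<gamma> a b (f n))"
    unfolding line_integral_def by (subst nn_integral_suminf) auto
  finally show ?thesis .
qed

text \<open>The sum of functions that are admissible for the exceptional curves and whose norms tend to \<open>0\<close> rapidly.
Each summand adds at least \<open>1\<close> to the integral over an exceptional curve. Integrability of the sum, rather
than of its square, is what the coarea inequality asks for.\<close>

lemma exceptional_function_exists:
  "\<exists>h. h \<in> borel_measurable borel \<and> (\<integral>\<^sup>+x\<in>Q. h x \<partial>hausdorff 2) < \<infinity> \<and>
     (\<forall>\<gamma>\<in>exceptional. rectifiable \<gamma> 0 1 \<longrightarrow> line_integral \<gamma> 0 1 h = \<infinity>)"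
proof -
  have ex: "\<exists>h. admissible exceptional h \<and> (\<integral>\<^sup>+x. h x ^ 2 \<partial>hausdorff 2) < ennreal ((1/4) ^ n)" for n :: nat
  proof -
    have "(0::ennreal) < ennreal ((1/4) ^ n)" by simp
    then obtain h where "admissible exceptional h" "(\<integral>\<^sup>+x. h x ^ 2 \<partial>hausdorff 2) < ennreal ((1/4) ^ n)"
      by (rule exceptional_small)
    then show ?thesis by blast
  qed
  have "\<exists>h. \<forall>n. admissible exceptional (h n) \<and> (\<integral>\<^sup>+x. h n x ^ 2 \<partial>hausdorff 2) < ennreal ((1/4) ^ n)"
    by (rule choice) (intro allI ex)
  then obtain h where h: "\<And>n. admissible exceptional (h n)" "\<And>n. (\<integral>\<^sup>+x. h n x ^ 2 \<partial>hausdorff 2) < ennreal ((1/4) ^ n)" by blast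
  have hb [measurable]: "h n \<in> borel_measurable borel" for n using h(1) by (auto simp: admissible_def)
  obtain q where q: "emeasure (hausdorff 2) Q = ennreal q" "q \<ge> 0"
    using hausdorff_2_Q_finite by (cases "emeasure (hausdorff 2) Q") auto
  have each: "(\<integral>\<^sup>+x\<in>Q. h n x \<partial>hausdorff 2) \<le> ennreal ((1/2) ^ n * (q + 1))" for n
  proof -
    have sq: "(\<integral>\<^sup>+x\<in>Q. h n x ^ 2 \<partial>hausdorff 2) \<le> ennreal ((1/4) ^ n)"
    proof -
      have "(\<integral>\<^sup>+x\<in>Q. h n x ^ 2 \<partial>hausdorff 2) \<le> (\<integral>\<^sup>+x. h n x ^ 2 \<partial>hausdorff 2)"
        by (intro nn_integral_mono) (auto split: split_indicator)
      then show ?thesis using h(2)[of n] by (rule order_trans[OF _ less_imp_le])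
    qed
    have pw: "(1/(1/2) ^ n) * (1/4) ^ n = (1/2 :: real) ^ n"
    proof -
      have "(1/4 :: real) ^ n = (1/2) ^ n * (1/2) ^ n" by (simp add: power_mult_distrib[symmetric])
      then show ?thesis by simp
    qed
    have "(\<integral>\<^sup>+x\<in>Q. h n x \<partial>hausdorff 2) \<le> ennreal ((1/2) ^ n) * emeasure (hausdorff 2) Q + ennreal (1/(1/2) ^ n) * (\<integral>\<^sup>+x\<in>Q. h n x ^ 2 \<partial>hausdorff 2)"
      by (rule set_integral_le_square) auto
    also have "\<dots> \<le> ennreal ((1/2) ^ n) * ennreal q + ennreal (1/(1/2) ^ n) * ennreal ((1/4) ^ n)"
      unfolding q(1) by (intro add_left_mono mult_left_mono sq) auto
    also have "\<dots> = ennreal ((1/2) ^ n * q) + ennreal ((1/(1/2) ^ n) * (1/4) ^ n)"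
      using q(2) by (subst (1 2) ennreal_mult) auto
    also have "\<dots> = ennreal ((1/2) ^ n * q + (1/2) ^ n)"
      unfolding pw using q(2) by (intro ennreal_plus[symmetric]) auto
    finally show ?thesis by (simp add: algebra_simps)
  qed
  define H where "H = (\<lambda>x. \<Sum>n. h n x)"
  have "(\<integral>\<^sup>+x\<in>Q. H x \<partial>hausdorff 2) = (\<integral>\<^sup>+x. (\<Sum>n. h n x * indicator Q x) \<partial>hausdorff 2)"
    unfolding H_def by (intro nn_integral_cong) (auto split: split_indicator)
  also have "\<dots> = (\<Sum>n. \<integral>\<^sup>+x\<in>Q. h n x \<partial>hausdorff 2)" by (subst nn_integral_suminf) auto
  also have "\<dots> \<le> (\<Sum>n. ennreal ((1/2) ^ n * (q + 1)))" by (intro suminf_le each) auto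
  also have "\<dots> = ennreal (\<Sum>n. (1/2) ^ n * (q + 1))"
    using q by (intro suminf_ennreal2) (auto intro!: summable_mult2 summable_geometric)
  also have "\<dots> < \<infinity>" by simp
  finally have fin: "(\<integral>\<^sup>+x\<in>Q. H x \<partial>hausdorff 2) < \<infinity>" .
  have inf: "line_integral \<gamma> 0 1 H = \<infinity>" if \<gamma>: "\<gamma> \<in> exceptional" "rectifiable \<gamma> 0 1" for \<gamma>
  proof -
    have cont: "continuous_on {0..1} \<gamma>" using \<gamma> by (auto simp: curves_in_def path_def)
    have "line_integral \<gamma> 0 1 H = (\<Sum>n. line_integral \<gamma> 0 1 (h n))"
      unfolding H_def by (rule line_integral_suminf[OF cont \<gamma>(2) _ hb]) simp
    also have "\<dots> \<ge> (\<Sum>n. 1 :: ennreal)"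
      using h(1) \<gamma> by (intro suminf_le) (auto simp: admissible_def)
    finally have "(\<Sum>n. 1 :: ennreal) \<le> line_integral \<gamma> 0 1 H" .
    moreover have "(\<Sum>n::nat. 1 :: ennreal) = \<infinity>"
    proof (rule ccontr)
      assume "(\<Sum>n::nat. 1 :: ennreal) \<noteq> \<infinity>"
      then obtain r where r: "(\<Sum>n::nat. 1 :: ennreal) = ennreal r" "r \<ge> 0" by (cases "(\<Sum>n::nat. 1 :: ennreal)") auto
      obtain N :: nat where N: "r < real N" using reals_Archimedean2 by blast
      have "(\<Sum>n<N. 1 :: ennreal) \<le> (\<Sum>n::nat. 1 :: ennreal)" by (intro sum_le_suminf) auto
      then have "ennreal (real N) \<le> ennreal r" using r by (simp add: ennreal_of_nat_eq_real_of_nat)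
      then show False using N r by simp
    qed
    ultimately show ?thesis by (simp add: top_unique)
  qed
  have "H \<in> borel_measurable borel" unfolding H_def by measurable
  then show ?thesis using fin inf by blast
qed

text \<open>A curve along which this function has a finite integral is not exceptional.\<close>

definition barrier :: "'a \<Rightarrow> ennreal" where
  "barrier = (SOME h. h \<in> borel_measurable borel \<and> (\<integral>\<^sup>+x\<in>Q. h x \<partial>hausdorff 2) < \<infinity> \<and>
     (\<forall>\<gamma>\<in>exceptional. rectifiable \<gamma> 0 1 \<longrightarrow> line_integral \<gamma> 0 1 h = \<infinity>))"

lemma barrier_borel [measurable]: "barrier \<in> borel_measurable borel"
  and barrier_integrable: "(\<integral>\<^sup>+x\<in>Q. barrier x \<partial>hausdorff 2) < \<infinity>"
  and barrier_exceptional: "\<gamma> \<in> exceptional \<Longrightarrow> rectifiable \<gamma> 0 1 \<Longrightarrow> line_integral \<gamma> 0 1 barrier = \<infinity>"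
  using someI_ex[OF exceptional_function_exists] unfolding barrier_def[symmetric] by auto

text \<open>Almost all level sets of a Lipschitz function consist of such continua, and these are connected by tame arcs.\<close>

definition tame_continuum :: "'a set \<Rightarrow> bool" where
  "tame_continuum K \<longleftrightarrow> compact K \<and> connected K \<and> K \<subseteq> Q \<and> hausdorff_outer 1 K < \<infinity> \<and> (\<integral>\<^sup>+x\<in>K. barrier x \<partial>hausdorff 1) < \<infinity>"

text \<open>A subarc that violates the convergence of line integrals would be exceptional, so the barrier would have an
infinite integral over it; but this integral is at most the one over \<open>K\<close>. On arcs, line integrals are
integrals against \<open>H\<^sup>1\<close>.\<close>

lemma tame_continuum_arc:
  assumes K: "tame_continuum K" and xy: "x \<in> K" "y \<in> K" "x \<noteq> y"
  obtains \<gamma> where "joins \<gamma> {x} {y}" "path_image \<gamma> \<subseteq> K"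
    "\<And>a b f. 0 \<le> a \<Longrightarrow> a \<le> b \<Longrightarrow> b \<le> 1 \<Longrightarrow> f \<in> borel_measurable borel \<Longrightarrow>
       line_integral \<gamma> a b f = (\<integral>\<^sup>+z\<in>\<gamma> ` {a..b}. f z \<partial>hausdorff 1)"
proof -
  have K': "compact K" "connected K" "hausdorff_outer 1 K < \<infinity>" "K \<subseteq> Q" using K by (auto simp: tame_continuum_def)
  obtain \<gamma> where \<gamma>: "arc \<gamma>" "path_image \<gamma> \<subseteq> K" "pathstart \<gamma> = x" "pathfinish \<gamma> = y" "rectifiable \<gamma> 0 1"
    using rectifiable_arc_in_continuum[OF K'(1,2,3) xy] .
  have p: "path \<gamma>" and inj: "inj_on \<gamma> {0..1}" using \<gamma>(1) by (auto simp: arc_def)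
  have cont: "continuous_on {a..b} \<gamma>" if "0 \<le> a" "b \<le> 1" for a b
    using p that unfolding path_def by (meson atLeastatMost_subset_iff continuous_on_subset)
  have rect: "rectifiable \<gamma> a b" if "0 \<le> a" "b \<le> 1" for a b
    using that by (intro rectifiable_subinterval[OF \<gamma>(5)]) auto
  have li: "line_integral \<gamma> a b f = (\<integral>\<^sup>+z\<in>\<gamma> ` {a..b}. f z \<partial>hausdorff 1)"
    if "0 \<le> a" "a \<le> b" "b \<le> 1" "f \<in> borel_measurable borel" for a b f
    using that by (intro line_integral_arc cont rect inj_on_subset[OF inj]) auto
  have "converges \<gamma> a b" if ab: "0 \<le> a" "a \<le> b" "b \<le> 1" for a b
  proof (cases "a = b")
    case True
    then show ?thesis using rect[of a b] ab by (simp add: line_integrals_converge_def)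
  next
    case False
    then have pos: "b - a > 0" using ab by simp
    let ?\<eta> = "subcurve a b \<gamma>"
    have \<eta>: "?\<eta> = (\<lambda>r. \<gamma> ((b - a) * r + a))" by (rule ext) (rule subcurve_def)
    have li\<eta>: "line_integral ?\<eta> 0 1 f = line_integral \<gamma> a b f" for f
      unfolding \<eta> using line_integral_affine[OF pos, of 0 1 a \<gamma> f] cont[of a b] rect[of a b] ab by simp
    have len\<eta>: "curve_length ?\<eta> 0 1 = curve_length \<gamma> a b"
      unfolding \<eta> using curve_length_affine[OF pos, of \<gamma> a 0 1] by simp
    then have r\<eta>: "rectifiable ?\<eta> 0 1" using rect[of a b] ab by (simp add: rectifiable_def)
    show ?thesis
    proof (rule ccontr)
      assume n: "\<not> converges \<gamma> a b"
      then have n\<eta>: "\<not> converges ?\<eta> 0 1"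
        using r\<eta> rect[of a b] ab unfolding line_integrals_converge_def li\<eta> by simp
      have "?\<eta> 0 \<noteq> ?\<eta> 1" using inj_onD[OF inj, of a b] False ab by (auto simp: subcurve_def)
      then have "\<not> ?\<eta> constant_on {0..1}" unfolding constant_on_def by (metis atLeastAtMost_iff order_refl zero_le_one)
      moreover have "path_image ?\<eta> \<subseteq> Q" using path_subcurve(2)[OF p ab] \<gamma>(2) K'(4) by blast
      ultimately have "?\<eta> \<in> exceptional" using path_subcurve(1)[OF p ab] n\<eta> by (simp add: curves_in_def)
      from barrier_exceptional[OF this r\<eta>] have "line_integral \<gamma> a b barrier = \<infinity>" by (simp add: li\<eta>)
      moreover have "line_integral \<gamma> a b barrier \<le> (\<integral>\<^sup>+x\<in>K. barrier x \<partial>hausdorff 1)"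
      proof -
        have "\<gamma> ` {a..b} \<subseteq> K" using \<gamma>(2) ab by (auto simp: path_image_def)
        then show ?thesis unfolding li[OF ab barrier_borel] by (intro nn_integral_mono) (auto split: split_indicator)
      qed
      ultimately show False using K by (simp add: tame_continuum_def top_unique)
    qed
  qed
  then have "tame_path \<gamma>" using p \<gamma>(2) K'(4) by (auto simp: tame_path_def)
  then have "joins \<gamma> {x} {y}" using \<gamma> by (simp add: joins_def)
  then show ?thesis using \<gamma>(2) li by (rule that)
qed

lemma tame_continuum_borel: "tame_continuum K \<Longrightarrow> K \<in> sets borel"
  unfolding tame_continuum_def by (meson borel_closed compact_imp_closed)

text \<open>By concatenation with an arc in \<open>K\<close>, tame paths from \<open>q\<close> to the sides yield such paths from every
other point of \<open>K\<close>.\<close>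

lemma tame_continuum_subset_E:
  assumes K: "tame_continuum K" and q: "q \<in> K" "q \<in> E" shows "K \<subseteq> E"
proof
  fix p assume p: "p \<in> K"
  show "p \<in> E"
  proof (cases "p = q")
    case False
    obtain \<gamma> where "joins \<gamma> {q} {p}" using tame_continuum_arc[OF K q(1) p] False by metis
    then show ?thesis using E_tame_path(1)[OF q(2)] by blast
  qed (use q in simp)
qed

lemma tame_continuum_oscillation:
  assumes K: "tame_continuum K" "K \<subseteq> E" and pq: "p \<in> K" "q \<in> K"
  shows "ennreal \<bar>U p - U q\<bar> \<le> (\<integral>\<^sup>+x\<in>K. \<rho> x \<partial>hausdorff 1)"
proof (cases "p = q")
  case False
  obtain \<gamma> where \<gamma>: "joins \<gamma> {p} {q}" "path_image \<gamma> \<subseteq> K"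
    "\<And>a b f. 0 \<le> a \<Longrightarrow> a \<le> b \<Longrightarrow> b \<le> 1 \<Longrightarrow> f \<in> borel_measurable borel \<Longrightarrow>
       line_integral \<gamma> a b f = (\<integral>\<^sup>+z\<in>\<gamma> ` {a..b}. f z \<partial>hausdorff 1)"
    using tame_continuum_arc[OF K(1) pq False] by metis
  have g: "tame_path \<gamma>" "\<gamma> 0 = p" "\<gamma> 1 = q" using \<gamma>(1) by (auto simp: joins_def pathstart_def pathfinish_def)
  have "ennreal \<bar>U (\<gamma> 0) - U (\<gamma> 1)\<bar> \<le> line_integral \<gamma> 0 1 \<rho>"
    using g pq K(2) by (intro U_upper_gradient) auto
  also have "\<dots> = (\<integral>\<^sup>+z\<in>\<gamma> ` {0..1}. \<rho> z \<partial>hausdorff 1)" by (rule \<gamma>(3)) auto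
  also have "\<dots> \<le> (\<integral>\<^sup>+x\<in>K. \<rho> x \<partial>hausdorff 1)"
    using \<gamma>(2) by (intro nn_integral_mono) (auto split: split_indicator simp: path_image_def)
  finally show ?thesis using g by simp
qed simp

lemma coarea_Q:
  assumes "\<And>x y. \<bar>m x - m y\<bar> \<le> dist x y" "f \<in> borel_measurable borel"
  shows "upper_lebesgue_integral UNIV (\<lambda>s. \<integral>\<^sup>+x\<in>{x \<in> Q. m x = s}. f x \<partial>hausdorff 1)
     \<le> ennreal (4 / pi) * (\<integral>\<^sup>+x\<in>Q. f x \<partial>hausdorff 2)"
  by (rule lipschitz_coarea[OF plane borel_Q hausdorff_2_Q_finite assms])

lemma coarea_AE_finite:
  assumes "\<And>x y. \<bar>m x - m y\<bar> \<le> dist x y" "f \<in> borel_measurable borel" "(\<integral>\<^sup>+x\<in>Q. f x \<partial>hausdorff 2) < \<infinity>"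
  shows "AE s in lebesgue. (\<integral>\<^sup>+x\<in>{x \<in> Q. m x = s}. f x \<partial>hausdorff 1) < \<infinity>"
proof (rule upper_integral_finite_AE)
  have "ennreal (4 / pi) * (\<integral>\<^sup>+x\<in>Q. f x \<partial>hausdorff 2) < \<infinity>" using assms(3) by (simp add: ennreal_mult_less_top)
  then show "upper_lebesgue_integral UNIV (\<lambda>s. \<integral>\<^sup>+x\<in>{x \<in> Q. m x = s}. f x \<partial>hausdorff 1) < \<infinity>"
    using coarea_Q[OF assms(1,2)] by (rule order.strict_trans1[rotated])
qed

lemma coarea_AE_zero:
  assumes "\<And>x y. \<bar>m x - m y\<bar> \<le> dist x y" "f \<in> borel_measurable borel" "(\<integral>\<^sup>+x\<in>Q. f x \<partial>hausdorff 2) = 0"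
  shows "AE s in lebesgue. (\<integral>\<^sup>+x\<in>{x \<in> Q. m x = s}. f x \<partial>hausdorff 1) = 0"
proof (rule upper_integral_zero_AE)
  show "upper_lebesgue_integral UNIV (\<lambda>s. \<integral>\<^sup>+x\<in>{x \<in> Q. m x = s}. f x \<partial>hausdorff 1) = 0"
    using coarea_Q[OF assms(1,2)] assms(3) by simp
qed

lemma level_set_closed:
  assumes "\<And>x y. \<bar>m x - m y\<bar> \<le> dist x y"
  shows "closed {x \<in> Q. m x = (s::real)}" "continuous_on UNIV m"
proof -
  have "1-lipschitz_on UNIV m" using assms by (auto simp: lipschitz_on_def dist_real_def)
  then show m: "continuous_on UNIV m" by (rule lipschitz_on_continuous_on)
  have "{x \<in> Q. m x = s} = Q \<inter> m -` {s}" by auto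
  then show "closed {x \<in> Q. m x = s}"
    using closed_Q m by (metis closed_Int closed_singleton closed_vimage)
qed

text \<open>By the coarea inequality, the finite area of \<open>Q\<close> and the integrability of the barrier bound the length
and the integral of the barrier on almost every level set.\<close>

lemma AE_level_components_tame:
  assumes lip: "\<And>x y. \<bar>m x - m y\<bar> \<le> dist x y"
  shows "AE s in lebesgue. \<forall>K\<in>components {x \<in> Q. m x = s}. tame_continuum K"
proof -
  have 1: "AE s in lebesgue. (\<integral>\<^sup>+x\<in>{x \<in> Q. m x = s}. 1 \<partial>hausdorff 1) < \<infinity>"
    by (rule coarea_AE_finite[OF lip]) (use hausdorff_2_Q_finite in simp_all)
  have 2: "AE s in lebesgue. (\<integral>\<^sup>+x\<in>{x \<in> Q. m x = s}. barrier x \<partial>hausdorff 1) < \<infinity>"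
    by (rule coarea_AE_finite[OF lip barrier_borel barrier_integrable])
  from 1 2 show ?thesis
  proof eventually_elim
    case (elim s)
    let ?S = "{x \<in> Q. m x = s}"
    have clS: "closed ?S" by (rule level_set_closed[OF lip])
    then have Sb: "?S \<in> sets borel" by simp
    then have S1: "hausdorff_outer 1 ?S < \<infinity>" using elim(1) by (simp add: emeasure_hausdorff)
    show ?case
    proof
      fix K assume K: "K \<in> components ?S"
      have sub: "K \<subseteq> ?S" by (rule in_components_subset[OF K])
      have "closed K" by (rule closed_components[OF clS K])
      then have "compact (Q \<inter> K)" by (rule compact_Int_closed[OF compact_Q])
      moreover have "Q \<inter> K = K" using sub by blast
      ultimately have "compact K" by simp
      moreover have "hausdorff_outer 1 K < \<infinity>" using hausdorff_outer_mono[OF _ sub, of 1] S1 by (auto intro: order.strict_trans1)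
      moreover have "(\<integral>\<^sup>+x\<in>K. barrier x \<partial>hausdorff 1) \<le> (\<integral>\<^sup>+x\<in>?S. barrier x \<partial>hausdorff 1)"
        using sub by (intro nn_integral_mono) (auto split: split_indicator)
      then have "(\<integral>\<^sup>+x\<in>K. barrier x \<partial>hausdorff 1) < \<infinity>" using elim(2) by (rule order.strict_trans1)
      ultimately show "tame_continuum K" using sub in_components_connected[OF K] by (auto simp: tame_continuum_def)
    qed
  qed
qed

lemma infdist_lipschitz: "\<bar>infdist x A - infdist y A\<bar> \<le> dist x (y :: 'b::metric_space)"
  using infdist_triangle[of x A y] infdist_triangle[of y A x] by (auto simp: dist_commute)

text \<open>Tame continua are so plentiful that they can be made to cross any connection between \<open>Z\<close> and \<open>P\<close>,
with the level \<open>s\<close> still free to vary in a set of full measure.\<close>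

lemma generic_separator:
  assumes Z: "connected Z" "Z \<subseteq> Q" "Z \<noteq> {}" and P: "connected P" "P \<subseteq> Q" "P \<noteq> {}"
    and far: "\<And>z. z \<in> P \<Longrightarrow> d \<le> infdist z Z"
  shows "AE s in lebesgue. s \<in> {0<..<d} \<longrightarrow> (\<exists>K. tame_continuum K \<and> K \<subseteq> {x \<in> Q. infdist x Z = s} \<and>
     (\<forall>T. connected T \<longrightarrow> T \<subseteq> Q \<longrightarrow> T \<inter> Z \<noteq> {} \<longrightarrow> T \<inter> P \<noteq> {} \<longrightarrow> T \<inter> K \<noteq> {}))"
proof -
  have lip: "\<bar>infdist x Z - infdist y Z\<bar> \<le> dist x y" for x y by (rule infdist_lipschitz)
  show ?thesis
    using AE_level_components_tame[OF lip]
  proof eventually_elim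
    case (elim s)
    show ?case
    proof
      assume s: "s \<in> {0<..<d}"
      obtain C where C: "C \<in> components {x \<in> Q. infdist x Z = s}"
        "\<And>T. connected T \<Longrightarrow> T \<subseteq> Q \<Longrightarrow> T \<inter> Z \<noteq> {} \<Longrightarrow> T \<inter> P \<noteq> {} \<Longrightarrow> T \<inter> C \<noteq> {}"
      proof (rule level_component_separates[OF level_set_closed(2)[OF lip] Z _ P, of s])
        show "infdist z Z < s" if "z \<in> Z" for z using that s by simp
        show "s < infdist z Z" if "z \<in> P" for z using far[OF that] s by simp
      qed blast
      then have "tame_continuum C" using elim by blast
      then show "\<exists>K. tame_continuum K \<and> K \<subseteq> {x \<in> Q. infdist x Z = s} \<and>
     (\<forall>T. connected T \<longrightarrow> T \<subseteq> Q \<longrightarrow> T \<inter> Z \<noteq> {} \<longrightarrow> T \<inter> P \<noteq> {} \<longrightarrow> T \<inter> K \<noteq> {})"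
        using C in_components_subset[OF C(1)] by blast
    qed
  qed
qed

lemma compact_positive_infdist:
  assumes "compact Z" "compact P" "Z \<inter> P = {}" "Z \<noteq> {}"
  obtains d where "d > 0" "\<And>z. z \<in> P \<Longrightarrow> d \<le> infdist z (Z :: 'b::metric_space set)"
proof (cases "P = {}")
  case True then show ?thesis using that[of 1] by simp
next
  case False
  have "continuous_on P (\<lambda>z. infdist z Z)" by (intro continuous_intros)
  then obtain p where p: "p \<in> P" "\<And>z. z \<in> P \<Longrightarrow> infdist p Z \<le> infdist z Z"
    using continuous_attains_inf[OF assms(2) False] by metis
  have "p \<notin> Z" using p(1) assms(3) by blast
  then have "infdist p Z > 0" using infdist_pos_not_in_closed[OF compact_imp_closed[OF assms(1)] assms(4)] by blast
  then show ?thesis using that p(2) by blast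
qed

end

lemma AE_interval_witness:
  assumes "AE s in lebesgue. s \<in> {0<..<d} \<longrightarrow> P s" "(d::real) > 0"
  obtains s where "s \<in> {0<..<d}" "P s"
proof (rule ccontr)
  assume n: "\<not> thesis"
  then have no: "\<not> (s \<in> {0<..<d} \<and> P s)" for s using that by blast
  have "AE s in lebesgue. s \<in> {0<..<d} \<longrightarrow> (1::ennreal) \<le> 0"
    using assms(1) by eventually_elim (use no in blast)
  then have "ennreal (d - 0) * 1 \<le> upper_lebesgue_integral UNIV (\<lambda>_. 0)"
    using assms(2) by (intro upper_integral_ge_const) auto
  also have "\<dots> \<le> (\<integral>\<^sup>+(t::real). 0 \<partial>lebesgue_on UNIV)" by (rule upper_integral_le) auto
  finally show False using assms(2) by simp
qed

context minimizing_square
begin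

section \<open>The minimum principle\<close>

lemma tame_path_to:
  assumes z: "z \<in> E" and W: "\<zeta>\<^sub>1 \<phi> \<subseteq> W \<or> \<zeta>\<^sub>3 \<phi> \<subseteq> W"
  obtains \<gamma> where "joins \<gamma> {z} W"
proof -
  obtain g g' where g: "joins g (\<zeta>\<^sub>1 \<phi>) {z}" "joins g' {z} (\<zeta>\<^sub>3 \<phi>)" using in_E_D[OF z] .
  from W show ?thesis
  proof
    assume "\<zeta>\<^sub>1 \<phi> \<subseteq> W"
    then have "joins (reversepath g) {z} W" using joins_reverse[OF g(1)] by (auto simp: joins_def)
    then show ?thesis by (rule that)
  next
    assume "\<zeta>\<^sub>3 \<phi> \<subseteq> W"
    then have "joins g' {z} W" using g(2) by (auto simp: joins_def)
    then show ?thesis by (rule that)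
  qed
qed

lemma joins_connected_image:
  assumes "joins \<gamma> A B" shows "connected (path_image \<gamma>)" "path_image \<gamma> \<subseteq> Q"
  using assms by (auto simp: joins_def tame_path_def intro: connected_path_image)

text \<open>If \<open>u(y) < c\<close>, some path from \<open>\<zeta>\<^sub>1\<close> to \<open>y\<close> has length less than \<open>c\<close> and so does not
meet \<open>K\<close>. Together with \<open>\<zeta>\<^sub>1\<close> it connects \<open>y\<close> with \<open>W\<close>. Hence \<open>K\<close> meets
\<open>\<zeta>\<^sub>1\<close>, where \<open>u\<close> vanishes.\<close>

lemma minimum_principle:
  assumes KE: "K \<subseteq> E" and y: "y \<in> E" and W: "W \<inter> K = {}" "W \<inter> \<zeta>\<^sub>1 \<phi> \<noteq> {}"
    and sep: "\<And>T. connected T \<Longrightarrow> T \<subseteq> Q \<Longrightarrow> y \<in> T \<Longrightarrow> T \<inter> W \<noteq> {} \<Longrightarrow> T \<inter> K \<noteq> {}"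
    and c: "\<And>q. q \<in> K \<Longrightarrow> c \<le> U q"
  shows "c \<le> U y"
proof (rule ccontr)
  assume "\<not> c \<le> U y"
  then have less: "U y < c" by simp
  then have c0: "c > 0" using U_nonneg[of y] by linarith
  have "v y < ennreal c" using less U_nonneg[of y] by (simp add: v_eq_U[OF y] ennreal_lessI c0)
  then obtain g where g: "joins g (\<zeta>\<^sub>1 \<phi>) {y}" "line_integral g 0 1 \<rho> < ennreal c" by (rule v_less)
  have gg: "tame_path g" using g by (simp add: joins_def)
  have yg: "y \<in> path_image g" using g(1) pathfinish_in_path_image[of g] by (auto simp: joins_def)
  have "path_image g \<inter> K = {}"
  proof (rule ccontr)
    assume "path_image g \<inter> K \<noteq> {}"
    then obtain t where t: "t \<in> {0..1}" "g t \<in> K" unfolding path_image_def by blast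
    have gtE: "g t \<in> E" using t KE by blast
    have "joins (subcurve 0 t g) (\<zeta>\<^sub>1 \<phi>) {g t}" and li: "line_integral (subcurve 0 t g) 0 1 \<rho> = line_integral g 0 t \<rho>"
      using tame_path_subcurve_le[OF gg, of 0 t] t g(1) by (auto simp: joins_def pathstart_def[of g])
    from v_le[OF gtE this(1)] have "v (g t) \<le> line_integral g 0 t \<rho>" by (simp add: li)
    also have "\<dots> \<le> line_integral g 0 1 \<rho>" using tame_path_add[OF gg, of 0 t 1] t by simp
    also have "\<dots> < ennreal c" by (rule g(2))
    finally have "U (g t) < c" using U_nonneg by (simp add: v_eq_U[OF gtE] ennreal_less_iff)
    then show False using c[OF t(2)] by simp
  qed
  moreover have con: "connected (path_image g \<union> \<zeta>\<^sub>1 \<phi>)"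
  proof (rule connected_Un[OF joins_connected_image(1)[OF g(1)] zeta_properties(1)])
    show "path_image g \<inter> \<zeta>\<^sub>1 \<phi> \<noteq> {}" using g(1) pathstart_in_path_image[of g] by (auto simp: joins_def)
  qed
  moreover have "(path_image g \<union> \<zeta>\<^sub>1 \<phi>) \<inter> K \<noteq> {}"
    using joins_connected_image(2)[OF g(1)] zeta_properties(3) yg W(2) by (intro sep con) auto
  ultimately obtain q where q: "q \<in> K" "q \<in> \<zeta>\<^sub>1 \<phi>" by blast
  then have "U q = 0" using KE by (intro U_zero) auto
  then show False using c[OF q(1)] c0 by simp
qed

text \<open>As \<open>u\<close> is continuous along the path, it has to leave its starting point before \<open>u\<close> can drop by
\<open>e\<close>.\<close>

lemma leaving_time:
  assumes \<gamma>: "tame_path \<gamma>" "\<gamma> 0 \<in> E" "\<gamma> 1 \<noteq> \<gamma> 0" and e: "e > 0"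
  obtains t where "t \<in> {0..1}" "\<gamma> t \<noteq> \<gamma> 0" "\<And>s. s \<in> {0..t} \<Longrightarrow> U (\<gamma> 0) - e \<le> U (\<gamma> s)"
proof -
  let ?f = "\<lambda>t. U (\<gamma> t)"
  have f: "continuous_on {0..1} ?f" by (rule U_continuous_along[OF \<gamma>(1,2)])
  show ?thesis
  proof (cases "\<exists>t\<in>{0..1}. ?f t \<le> ?f 0 - e")
    case False
    then show ?thesis using \<gamma>(3) by (intro that[of 1]) (auto simp: not_le intro: less_imp_le)
  next
    case True
    then obtain t0 where t0: "t0 \<in> {0..1}" "?f t0 \<le> ?f 0 - e" by blast
    have "\<exists>x\<ge>0. x \<le> t0 \<and> ?f x = ?f 0 - e"
      by (rule IVT2') (use t0 e f in \<open>auto intro: continuous_on_subset\<close>)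
    define B where "B = {t \<in> {0..1}. ?f t = ?f 0 - e}"
    have Bne: "B \<noteq> {}" using \<open>\<exists>x\<ge>0. x \<le> t0 \<and> ?f x = ?f 0 - e\<close> t0 by (force simp: B_def)
    have "closed B" unfolding B_def using continuous_closed_preimage[OF f closed_atLeastAtMost closed_singleton[of "?f 0 - e"]]
      by (simp add: vimage_def Int_def)
    moreover have "bounded B" by (rule bounded_subset[OF compact_imp_bounded[OF compact_Icc[of 0 1]]]) (auto simp: B_def)
    ultimately have "compact B" by (simp add: compact_eq_bounded_closed)
    then obtain t where t: "t \<in> B" "\<And>s. s \<in> B \<Longrightarrow> t \<le> s" using compact_attains_inf[OF _ Bne] by metis
    have tt: "t \<in> {0..1}" "?f t = ?f 0 - e" using t(1) by (auto simp: B_def)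
    show ?thesis
    proof (rule that[OF tt(1)])
      show "\<gamma> t \<noteq> \<gamma> 0" using tt(2) e by auto
      fix s assume s: "s \<in> {0..t}"
      show "?f 0 - e \<le> ?f s"
      proof (rule ccontr)
        assume "\<not> ?thesis"
        then have "?f s \<le> ?f 0 - e" by simp
        have "\<exists>x\<ge>0. x \<le> s \<and> ?f x = ?f 0 - e"
          by (rule IVT2') (use \<open>?f s \<le> ?f 0 - e\<close> s tt e f in \<open>auto intro: continuous_on_subset\<close>)
        then obtain x where x: "0 \<le> x" "x \<le> s" "?f x = ?f 0 - e" by blast
        then have "x \<in> B" using s tt by (auto simp: B_def)
        then have "t \<le> x" by (rule t(2))
        then have "s = t" using x s by auto
        then show False using \<open>\<not> ?f 0 - e \<le> ?f s\<close> tt(2) by simp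
      qed
    qed
  qed
qed

section \<open>Points around which \<open>\<rho>\<close> has large mass\<close>

definition \<nu> :: "'a measure" where "\<nu> = density (hausdorff 2) (\<lambda>x. \<rho> x * indicator Q x)"

lemma sets_\<nu> [simp, measurable_cong]: "sets \<nu> = sets borel" by (simp add: \<nu>_def)
lemma space_\<nu> [simp]: "space \<nu> = UNIV" by (simp add: \<nu>_def)

lemma emeasure_\<nu>: "S \<in> sets borel \<Longrightarrow> emeasure \<nu> S = (\<integral>\<^sup>+x\<in>Q. \<rho> x * indicator S x \<partial>hausdorff 2)"
  unfolding \<nu>_def by (subst emeasure_density) (auto intro!: nn_integral_cong split: split_indicator)

lemma \<nu>_finite: "emeasure \<nu> UNIV < \<infinity>"
  using \<rho>_integrable by (simp add: emeasure_\<nu>)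

lemma \<nu>_finite': "emeasure \<nu> S < \<infinity>"
proof -
  have "emeasure \<nu> S \<le> emeasure \<nu> (space \<nu>)" by (rule emeasure_space)
  then show ?thesis using \<nu>_finite by (auto intro: order.strict_trans1)
qed

text \<open>If \<open>z\<close> is close to \<open>l\<close>, the closed ball of radius \<open>r\<close> around \<open>z\<close> lies in a slightly larger
ball around \<open>l\<close>, and the masses of such balls decrease to that of the closed ball of radius \<open>r\<close>.\<close>

lemma closed_mass_ge: "closed {z. c \<le> emeasure \<nu> (cball z r)}"
  unfolding closed_sequential_limits
proof (intro allI impI, elim conjE)
  fix x l assume x: "\<forall>n. x n \<in> {z. c \<le> emeasure \<nu> (cball z r)}" and lim: "x \<longlonglongrightarrow> l"
  have big: "c \<le> emeasure \<nu> (cball l (r + 1 / real (Suc j)))" for j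
  proof -
    have "\<forall>\<^sub>F n in sequentially. dist (x n) l < 1 / real (Suc j)"
      using lim by (intro tendstoD) auto
    then obtain n where n: "dist (x n) l < 1 / real (Suc j)" by (auto simp: eventually_sequentially)
    have "cball (x n) r \<subseteq> cball l (r + 1 / real (Suc j))"
    proof
      fix u assume "u \<in> cball (x n) r"
      then show "u \<in> cball l (r + 1 / real (Suc j))"
        using n dist_triangle[of l u "x n"] by (simp add: dist_commute)
    qed
    then have "emeasure \<nu> (cball (x n) r) \<le> emeasure \<nu> (cball l (r + 1 / real (Suc j)))" by (intro emeasure_mono) auto
    then show ?thesis using x by (auto intro: order_trans)
  qed
  have "(\<Inter>j. cball l (r + 1 / real (Suc j))) = cball l r"
  proof (intro equalityI subsetI)
    fix u assume u: "u \<in> (\<Inter>j. cball l (r + 1 / real (Suc j)))"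
    have "dist l u \<le> r"
    proof (rule field_le_epsilon)
      fix e :: real assume "e > 0"
      then obtain j where "1 / real (Suc j) < e" using reals_Archimedean[of e] by (auto simp: inverse_eq_divide)
      moreover have "dist l u \<le> r + 1 / real (Suc j)" using u by auto
      ultimately show "dist l u \<le> r + e" by linarith
    qed
    then show "u \<in> cball l r" by simp
  qed (auto intro: order_trans)
  moreover have "emeasure \<nu> (\<Inter>j. cball l (r + 1 / real (Suc j))) = (INF j. emeasure \<nu> (cball l (r + 1 / real (Suc j))))"
  proof (rule INF_emeasure_decseq[symmetric])
    show "decseq (\<lambda>j. cball l (r + 1 / real (Suc j)))"
      unfolding decseq_def
    proof (intro allI impI subsetI)
      fix m n :: nat and u assume mn: "m \<le> n" and "u \<in> cball l (r + 1 / real (Suc n))"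
      moreover have "1 / real (Suc n) \<le> 1 / real (Suc m)" using mn by (intro divide_left_mono) auto
      ultimately show "u \<in> cball l (r + 1 / real (Suc m))" by auto
    qed
  qed (use \<nu>_finite' in \<open>auto simp: less_top\<close>)
  ultimately show "l \<in> {z. c \<le> emeasure \<nu> (cball z r)}" using big by (auto intro: INF_greatest)
qed

text \<open>The points where the mass of every small ball is at least a fixed multiple of its radius. Elsewhere there are arbitrarily
small circles on which \<open>\<rho>\<close> has a small integral.\<close>

definition heavy :: "nat \<Rightarrow> 'a set" where
  "heavy k = {z \<in> Q. \<forall>r. 0 < r \<and> r < 1 / real (Suc k) \<longrightarrow> ennreal (r / real (Suc k)) \<le> emeasure \<nu> (cball z r)}"

lemma closed_heavy: "closed (heavy k)"
proof -
  have "heavy k = Q \<inter> (\<Inter>r\<in>{0<..<1 / real (Suc k)}. {z. ennreal (r / real (Suc k)) \<le> emeasure \<nu> (cball z r)})"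
    by (auto simp: heavy_def)
  then show ?thesis by (simp only:) (intro closed_Int closed_Q closed_INT ballI closed_mass_ge)
qed

text \<open>By disjointness of balls, separated subsets of \<open>heavy k\<close> at scale \<open>r\<close> have \<open>O(1/r)\<close> points. So the
set is covered by \<open>O(1/r)\<close> balls of radius \<open>2 * r\<close>, whose areas add up to \<open>O(r)\<close>.\<close>

lemma heavy_null: "emeasure (hausdorff 2) (heavy k) = 0"
proof -
  obtain n where n: "emeasure \<nu> UNIV = ennreal n" "n \<ge> 0" using \<nu>_finite by (cases "emeasure \<nu> UNIV") auto
  define C where "C = 4 * pi * real (Suc k) * n"
  have C0: "C \<ge> 0" using n by (simp add: C_def)
  have pre: "hausdorff_pre 2 (5 * r) (heavy k) \<le> ennreal (C * r)" if r: "0 < r" "r < 1 / real (Suc k)" for r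
  proof -
    define sep where "sep = (\<lambda>P. finite P \<and> P \<subseteq> heavy k \<and> (\<forall>p\<in>P. \<forall>q\<in>P. p \<noteq> q \<longrightarrow> 2 * r < dist p q))"
    have bound: "real (card P) * r \<le> real (Suc k) * n" if P: "sep P" for P
    proof -
      have disj: "disjoint_family_on (\<lambda>p. cball p r) P"
        unfolding disjoint_family_on_def
      proof (intro ballI impI)
        fix p q assume pq: "p \<in> P" "q \<in> P" "p \<noteq> q"
        show "cball p r \<inter> cball q r = {}"
        proof (rule ccontr)
          assume "\<not> ?thesis"
          then obtain z where "dist p z \<le> r" "dist q z \<le> r" by auto
          then have "dist p q \<le> 2 * r" using dist_triangle[of p q z] by (simp add: dist_commute)
          moreover have "2 * r < dist p q" using P pq unfolding sep_def by blast
          ultimately show False by simp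
        qed
      qed
      have "ennreal (real (card P) * (r / real (Suc k))) = (\<Sum>p\<in>P. ennreal (r / real (Suc k)))"
        using r by (subst ennreal_mult) (auto simp: ennreal_of_nat_eq_real_of_nat)
      also have "\<dots> \<le> (\<Sum>p\<in>P. emeasure \<nu> (cball p r))"
        using P r by (intro sum_mono) (auto simp: sep_def heavy_def)
      also have "\<dots> = emeasure \<nu> (\<Union>p\<in>P. cball p r)"
        using disj P by (intro sum_emeasure) (auto simp: sep_def)
      also have "\<dots> \<le> emeasure \<nu> (space \<nu>)" by (rule emeasure_space)
      finally have "real (card P) * (r / real (Suc k)) \<le> n" using n by simp
      then show ?thesis by (simp add: field_simps)
    qed
    have "\<exists>P. sep P \<and> (\<forall>P'. sep P' \<longrightarrow> card P' \<le> card P)"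
    proof (rule ex_has_greatest_nat[where b = "nat \<lceil>real (Suc k) * n / r\<rceil> + 1"])
      show "sep {}" by (simp add: sep_def)
      show "\<forall>P. sep P \<longrightarrow> card P < nat \<lceil>real (Suc k) * n / r\<rceil> + 1"
      proof (intro allI impI)
        fix P assume "sep P"
        then have "real (card P) \<le> real (Suc k) * n / r" using bound r by (simp add: field_simps)
        then show "card P < nat \<lceil>real (Suc k) * n / r\<rceil> + 1" by linarith
      qed
    qed
    then obtain P where P: "sep P" "\<And>P'. sep P' \<Longrightarrow> card P' \<le> card P" by blast
    have fin: "finite P" using P(1) by (simp add: sep_def)
    have cover: "\<exists>p\<in>P. dist p z \<le> 2 * r" if z: "z \<in> heavy k" for z
    proof (rule ccontr)
      assume a: "\<not> ?thesis"
      then have zP: "z \<notin> P" using r by force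
      have "sep (insert z P)" using P(1) z a by (auto simp: sep_def dist_commute)
      from P(2)[OF this] show False using zP fin by simp
    qed
    obtain f where f: "bij_betw f {..<card P} P" using ex_bij_betw_nat_finite[OF fin] by (auto simp: atLeast0LessThan)
    define A where "A = (\<lambda>j. if j < card P then cball (f j) (2 * r) else {})"
    have Ad: "ediam (A j) \<le> (if j < card P then ennreal (4 * r) else 0)" for j
    proof (cases "j < card P")
      case True
      have "dist x y \<le> 4 * r" if "x \<in> A j" "y \<in> A j" for x y
        using that True dist_triangle[of x y "f j"] by (auto simp: A_def dist_commute)
      then show ?thesis using True unfolding ediam_def by (auto intro!: SUP_least ennreal_leI)
    qed (simp add: A_def)
    have "hausdorff_pre 2 (5 * r) (heavy k) \<le> (\<Sum>j. ennreal (hausdorff_const 2) * ediam (A j) ^ 2)"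
    proof (rule hausdorff_pre_le)
      show "heavy k \<subseteq> (\<Union>j. A j)"
      proof
        fix z assume "z \<in> heavy k"
        then obtain p where p: "p \<in> P" "dist p z \<le> 2 * r" using cover by blast
        have "p \<in> f ` {..<card P}" using p(1) f by (simp add: bij_betw_def)
        then obtain j where "j < card P" "f j = p" by blast
        then have "z \<in> A j" using p by (simp add: A_def)
        then show "z \<in> (\<Union>j. A j)" by blast
      qed
      show "ediam (A j) < ennreal (5 * r)" for j
      proof -
        have "(if j < card P then ennreal (4 * r) else 0) < ennreal (5 * r)" using r by (simp add: ennreal_lessI)
        then show ?thesis using Ad[of j] by (rule order.strict_trans1[rotated])
      qed
    qed
    also have "\<dots> \<le> (\<Sum>j. if j < card P then ennreal (pi / 4 * (4 * r) ^ 2) else 0)"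
    proof (intro suminf_le)
      fix j
      have "ennreal (hausdorff_const 2) * ediam (A j) ^ 2 \<le> ennreal (pi / 4) * (if j < card P then ennreal (4 * r) else 0) ^ 2"
        using Ad[of j] by (auto simp: hausdorff_const_def intro!: mult_left_mono power_mono)
      also have "\<dots> = (if j < card P then ennreal (pi / 4 * (4 * r) ^ 2) else 0)"
        using r by (simp add: ennreal_power ennreal_mult[symmetric])
      finally show "ennreal (hausdorff_const 2) * ediam (A j) ^ 2 \<le> (if j < card P then ennreal (pi / 4 * (4 * r) ^ 2) else 0)" .
    qed auto
    also have "\<dots> = (\<Sum>j<card P. ennreal (pi / 4 * (4 * r) ^ 2))" by (subst suminf_finite[of "{..<card P}"]) auto
    also have "\<dots> = ennreal (real (card P) * (pi / 4 * (4 * r) ^ 2))"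
      using r by (simp add: ennreal_of_nat_eq_real_of_nat ennreal_mult[symmetric])
    also have "\<dots> \<le> ennreal (C * r)"
    proof (rule ennreal_leI)
      have "real (card P) * (pi / 4 * (4 * r) ^ 2) = (real (card P) * r) * (4 * pi * r)" by (simp add: power2_eq_square)
      also have "\<dots> \<le> (real (Suc k) * n) * (4 * pi * r)" using bound[OF P(1)] r by (intro mult_right_mono) auto
      finally show "real (card P) * (pi / 4 * (4 * r) ^ 2) \<le> C * r" by (simp add: C_def ac_simps)
    qed
    finally show ?thesis .
  qed
  have "hausdorff_pre 2 \<epsilon> (heavy k) \<le> 0" if \<epsilon>: "\<epsilon> > 0" for \<epsilon>
  proof (rule ennreal_le_epsilon)
    fix e :: real assume e: "e > 0"
    \<comment> \<open>The radius is small enough for covers at scale \<open>\<epsilon>\<close>, for the definition of \<open>heavy k\<close>, and for \<open>C * r \<le> e\<close>.\<close>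
    define r where "r = min (\<epsilon> / 5) (min (1 / (2 * real (Suc k))) (e / (C + 1)))"
    have r: "0 < r" "r < 1 / real (Suc k)" "5 * r \<le> \<epsilon>" using \<epsilon> e C0 by (auto simp: r_def min_less_iff_disj field_simps)
    have "r \<le> e / (C + 1)" by (simp add: r_def)
    then have "r * (C + 1) \<le> e" using C0 by (simp add: field_simps)
    then have Cr: "C * r \<le> e" using r(1) by (simp add: algebra_simps)
    have "hausdorff_pre 2 \<epsilon> (heavy k) \<le> hausdorff_pre 2 (5 * r) (heavy k)" by (rule hausdorff_pre_antimono[OF r(3)])
    also have "\<dots> \<le> ennreal (C * r)" by (rule pre[OF r(1,2)])
    also have "\<dots> \<le> 0 + ennreal e" using Cr by (simp add: ennreal_leI)
    finally show "hausdorff_pre 2 \<epsilon> (heavy k) \<le> 0 + ennreal e" .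
  qed
  then have "hausdorff_outer 2 (heavy k) \<le> 0" unfolding hausdorff_outer_eq_SUP by (intro SUP_least) auto
  then show ?thesis using closed_heavy by (simp add: emeasure_hausdorff)
qed

definition heavy_set :: "'a set" where "heavy_set = (\<Union>k. heavy k)"

lemma heavy_set_borel [measurable]: "heavy_set \<in> sets borel"
  unfolding heavy_set_def using closed_heavy by (intro sets.countable_UN) auto

lemma heavy_set_null: "emeasure (hausdorff 2) heavy_set = 0"
  unfolding heavy_set_def using heavy_null closed_heavy by (intro emeasure_UN_eq_0) auto

section \<open>Lower semicontinuity of \<open>u\<close> off a null set\<close>

lemma circle_around:
  assumes z: "z \<in> Q" "z \<notin> P" and P: "compact P" "connected P" "P \<subseteq> Q" "P \<noteq> {}"
  obtains d where "d > 0" "AE s in lebesgue. s \<in> {0<..<d} \<longrightarrow> (\<exists>K. tame_continuum K \<and> K \<subseteq> {x \<in> Q. infdist x {z} = s} \<and>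
     (\<forall>T. connected T \<longrightarrow> T \<subseteq> Q \<longrightarrow> z \<in> T \<longrightarrow> T \<inter> P \<noteq> {} \<longrightarrow> T \<inter> K \<noteq> {}))"
proof -
  have "compact {z}" "{z} \<inter> P = {}" "{z} \<noteq> {}" using z(2) by auto
  from compact_positive_infdist[OF this(1) P(1) this(2,3)]
  obtain d where d: "d > 0" "\<And>w. w \<in> P \<Longrightarrow> d \<le> infdist w {z}" by metis
  have "AE s in lebesgue. s \<in> {0<..<d} \<longrightarrow> (\<exists>K. tame_continuum K \<and> K \<subseteq> {x \<in> Q. infdist x {z} = s} \<and>
     (\<forall>T. connected T \<longrightarrow> T \<subseteq> Q \<longrightarrow> T \<inter> {z} \<noteq> {} \<longrightarrow> T \<inter> P \<noteq> {} \<longrightarrow> T \<inter> K \<noteq> {}))"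
    by (rule generic_separator[OF _ _ _ P(2,3,4) d(2)]) (use z in auto)
  then have "AE s in lebesgue. s \<in> {0<..<d} \<longrightarrow> (\<exists>K. tame_continuum K \<and> K \<subseteq> {x \<in> Q. infdist x {z} = s} \<and>
     (\<forall>T. connected T \<longrightarrow> T \<subseteq> Q \<longrightarrow> z \<in> T \<longrightarrow> T \<inter> P \<noteq> {} \<longrightarrow> T \<inter> K \<noteq> {}))"
    by simp
  then show ?thesis using d(1) that by blast
qed

text \<open>The circles around \<open>z\<close> are taken so small that a tame path from \<open>z\<close> to \<open>W\<close> meets them before
\<open>u\<close> has dropped by \<open>e\<close>.\<close>

lemma short_circle:
  assumes z: "z \<in> E" and W: "\<zeta>\<^sub>1 \<phi> \<subseteq> W \<or> \<zeta>\<^sub>3 \<phi> \<subseteq> W" "z \<notin> W" and e: "e > 0"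
  obtains w \<gamma> t d where "w \<in> W" "t \<in> {0..1}" "tame_path \<gamma>" "\<gamma> 0 = z" "\<And>s. s \<in> {0..t} \<Longrightarrow> U z - e \<le> U (\<gamma> s)"
    "d > 0" "AE s in lebesgue. s \<in> {0<..<d} \<longrightarrow> (\<exists>K. tame_continuum K \<and> K \<subseteq> {x \<in> Q. infdist x {z} = s} \<and> \<gamma> ` {0..t} \<inter> K \<noteq> {} \<and>
     (\<forall>T. connected T \<longrightarrow> T \<subseteq> Q \<longrightarrow> z \<in> T \<longrightarrow> w \<in> T \<longrightarrow> T \<inter> K \<noteq> {}))"
proof -
  obtain \<gamma> where j: "joins \<gamma> {z} W" using tame_path_to[OF z W(1)] .
  then have \<gamma>: "tame_path \<gamma>" "\<gamma> 0 = z" "\<gamma> 1 \<in> W" by (auto simp: joins_def pathstart_def pathfinish_def)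
  have zQ: "z \<in> Q" using z E_subset by blast
  have "\<gamma> 1 \<noteq> \<gamma> 0" using \<gamma> W(2) by auto
  then obtain t where t: "t \<in> {0..1}" "\<gamma> t \<noteq> z" "\<And>s. s \<in> {0..t} \<Longrightarrow> U z - e \<le> U (\<gamma> s)"
    using leaving_time[OF \<gamma>(1) _ _ e] z \<gamma>(2) by metis
  obtain P where P: "compact P" "connected P" "P \<subseteq> Q" "z \<notin> P" "\<gamma> t \<in> P" "\<gamma> 1 \<in> P"
    using connected_avoiding_point[OF zQ tame_path_in_Q[OF \<gamma>(1) t(1)] tame_path_in_Q[OF \<gamma>(1), of 1] t(2)] \<gamma>(3) W(2) by (metis atLeastAtMost_iff order_refl zero_le_one)
  obtain d where d: "d > 0" and ae: "AE s in lebesgue. s \<in> {0<..<d} \<longrightarrow> (\<exists>K. tame_continuum K \<and> K \<subseteq> {x \<in> Q. infdist x {z} = s} \<and>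
     (\<forall>T. connected T \<longrightarrow> T \<subseteq> Q \<longrightarrow> z \<in> T \<longrightarrow> T \<inter> P \<noteq> {} \<longrightarrow> T \<inter> K \<noteq> {}))"
    using circle_around[OF zQ P(4) P(1,2,3)] P(5) by blast
  have J: "connected (\<gamma> ` {0..t})" "\<gamma> ` {0..t} \<subseteq> Q" "z \<in> \<gamma> ` {0..t}" "\<gamma> ` {0..t} \<inter> P \<noteq> {}"
  proof -
    show "connected (\<gamma> ` {0..t})" using t by (intro connected_continuous_image tame_path_cont[OF \<gamma>(1)] connected_Icc) auto
    show "\<gamma> ` {0..t} \<subseteq> Q" using tame_path_in_Q[OF \<gamma>(1)] t by auto
    show "z \<in> \<gamma> ` {0..t}" using \<gamma>(2) t by (intro image_eqI[of _ _ 0]) auto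
    have "\<gamma> t \<in> \<gamma> ` {0..t}" using t by auto
    then show "\<gamma> ` {0..t} \<inter> P \<noteq> {}" using P(5) by blast
  qed
  have "AE s in lebesgue. s \<in> {0<..<d} \<longrightarrow> (\<exists>K. tame_continuum K \<and> K \<subseteq> {x \<in> Q. infdist x {z} = s} \<and> \<gamma> ` {0..t} \<inter> K \<noteq> {} \<and>
     (\<forall>T. connected T \<longrightarrow> T \<subseteq> Q \<longrightarrow> z \<in> T \<longrightarrow> \<gamma> 1 \<in> T \<longrightarrow> T \<inter> K \<noteq> {}))"
    using ae
  proof eventually_elim
    case (elim s)
    show ?case
    proof
      assume "s \<in> {0<..<d}"
      from elim[rule_format, OF this]
      obtain K where K: "tame_continuum K" "K \<subseteq> {x \<in> Q. infdist x {z} = s}"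
        "\<forall>T. connected T \<longrightarrow> T \<subseteq> Q \<longrightarrow> z \<in> T \<longrightarrow> T \<inter> P \<noteq> {} \<longrightarrow> T \<inter> K \<noteq> {}" by (elim exE conjE)
      have "\<gamma> ` {0..t} \<inter> K \<noteq> {}" by (rule K(3)[rule_format, OF J])
      moreover have "\<forall>T. connected T \<longrightarrow> T \<subseteq> Q \<longrightarrow> z \<in> T \<longrightarrow> \<gamma> 1 \<in> T \<longrightarrow> T \<inter> K \<noteq> {}" using K(3) P(6) by blast
      ultimately show "\<exists>K. tame_continuum K \<and> K \<subseteq> {x \<in> Q. infdist x {z} = s} \<and> \<gamma> ` {0..t} \<inter> K \<noteq> {} \<and>
     (\<forall>T. connected T \<longrightarrow> T \<subseteq> Q \<longrightarrow> z \<in> T \<longrightarrow> \<gamma> 1 \<in> T \<longrightarrow> T \<inter> K \<noteq> {})" using K(1,2) by blast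
    qed
  qed
  then show ?thesis using that[OF \<gamma>(3) t(1) \<gamma>(1,2) t(3) d] by blast
qed

text \<open>If \<open>z\<close> is not heavy, the mass of some small ball around \<open>z\<close> is much smaller than its radius, so a
circle in this ball has a component \<open>K\<close> around \<open>z\<close> over which \<open>\<rho>\<close> has a small integral. A path
from \<open>z\<close> meets \<open>K\<close> at a point where \<open>u\<close> is almost as large as at \<open>z\<close>, and \<open>u\<close> is almost
constant on \<open>K\<close>. The minimum principle carries the lower bound to the inside of \<open>K\<close>.\<close>

lemma lower_semicontinuous_off_heavy_set:
  assumes z: "z \<in> E" "z \<notin> heavy_set" and c: "c < U z"
  obtains N where "open N" "z \<in> N" "\<And>w. w \<in> N \<inter> E \<Longrightarrow> c < U w"
proof -
  define \<eta> where "\<eta> = (U z - c) / 3"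
  have \<eta>: "\<eta> > 0" "c = U z - 3 * \<eta>" using c by (simp_all add: \<eta>_def field_simps)
  have zQ: "z \<in> Q" using z E_subset by blast
  obtain r0 where r0: "r0 > 0" "\<And>x. x \<in> Q \<Longrightarrow> \<exists>W. connected W \<and> W \<subseteq> Q \<and> W \<inter> cball x r0 = {} \<and>
    W \<inter> \<zeta>\<^sub>1 \<phi> \<noteq> {} \<and> W \<inter> \<zeta>\<^sub>3 \<phi> \<noteq> {} \<and> (\<zeta>\<^sub>1 \<phi> \<subseteq> W \<or> \<zeta>\<^sub>3 \<phi> \<subseteq> W)" by (rule far_cross) blast
  obtain W where W: "connected W" "W \<subseteq> Q" "W \<inter> cball z r0 = {}" "W \<inter> \<zeta>\<^sub>1 \<phi> \<noteq> {}" "\<zeta>\<^sub>1 \<phi> \<subseteq> W \<or> \<zeta>\<^sub>3 \<phi> \<subseteq> W"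
    using r0(2)[OF zQ] by blast
  have "z \<in> cball z r0" using r0(1) by simp
  then have zW: "z \<notin> W" using W(3) by blast
  obtain w0 \<gamma> t d where sg: "w0 \<in> W" "t \<in> {0..1}" "tame_path \<gamma>" "\<gamma> 0 = z" "\<And>s. s \<in> {0..t} \<Longrightarrow> U z - \<eta> \<le> U (\<gamma> s)" "d > 0"
    and ae: "AE s in lebesgue. s \<in> {0<..<d} \<longrightarrow> (\<exists>K. tame_continuum K \<and> K \<subseteq> {x \<in> Q. infdist x {z} = s} \<and> \<gamma> ` {0..t} \<inter> K \<noteq> {} \<and>
     (\<forall>T. connected T \<longrightarrow> T \<subseteq> Q \<longrightarrow> z \<in> T \<longrightarrow> w0 \<in> T \<longrightarrow> T \<inter> K \<noteq> {}))"
    by (rule short_circle[OF z(1) W(5) zW \<eta>(1)]) blast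
  have lip: "\<bar>infdist x {z} - infdist y {z}\<bar> \<le> dist x y" for x y by (rule infdist_lipschitz)
  have [measurable]: "cball z r \<in> sets borel" for r by simp
  obtain k :: nat where k: "1 / real (Suc k) < min d (min r0 (\<eta> * pi / 4))"
    using reals_Archimedean[of "min d (min r0 (\<eta> * pi / 4))"] sg(6) r0(1) \<eta>(1) by (auto simp: inverse_eq_divide)
  obtain r where r: "0 < r" "r < 1 / real (Suc k)" "emeasure \<nu> (cball z r) < ennreal (r / real (Suc k))"
    using z(2) zQ unfolding heavy_set_def heavy_def by (auto simp: not_le)
  have rd: "r < d" "r < r0" using r(2) k by auto
  let ?I = "\<lambda>s. \<integral>\<^sup>+x\<in>{x \<in> Q. infdist x {z} = s}. \<rho> x * indicator (cball z r) x \<partial>hausdorff 1"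
  have "\<exists>s\<in>{0<..<r}. ?I s < ennreal \<eta> \<and> (\<exists>K. tame_continuum K \<and> K \<subseteq> {x \<in> Q. infdist x {z} = s} \<and> \<gamma> ` {0..t} \<inter> K \<noteq> {} \<and>
     (\<forall>T. connected T \<longrightarrow> T \<subseteq> Q \<longrightarrow> z \<in> T \<longrightarrow> w0 \<in> T \<longrightarrow> T \<inter> K \<noteq> {}))"
  proof (rule ccontr)
    assume no: "\<not> ?thesis"
    have "AE s in lebesgue. s \<in> {0<..<r} \<longrightarrow> ennreal \<eta> \<le> ?I s"
      using ae
    proof eventually_elim
      case (elim s)
      show ?case
      proof
        assume s: "s \<in> {0<..<r}"
        then have "s \<in> {0<..<d}" using rd by auto
        from elim[rule_format, OF this] no s show "ennreal \<eta> \<le> ?I s" by (meson not_le)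
      qed
    qed
    then have "ennreal (r - 0) * ennreal \<eta> \<le> upper_lebesgue_integral UNIV ?I"
      using r(1) by (intro upper_integral_ge_const) auto
    also have "\<dots> \<le> ennreal (4 / pi) * (\<integral>\<^sup>+x\<in>Q. \<rho> x * indicator (cball z r) x \<partial>hausdorff 2)"
      by (rule coarea_Q[OF lip]) measurable
    also have "\<dots> = ennreal (4 / pi) * emeasure \<nu> (cball z r)" by (simp add: emeasure_\<nu>)
    also have "\<dots> \<le> ennreal (4 / pi) * ennreal (r / real (Suc k))" using r(3) by (intro mult_left_mono) auto
    also have "\<dots> = ennreal ((4 / pi) * (r / real (Suc k)))" using r(1) by (intro ennreal_mult[symmetric]) auto
    finally have "ennreal (r * \<eta>) \<le> ennreal ((4 / pi) * (r / real (Suc k)))"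
      using r(1) \<eta>(1) by (simp add: ennreal_mult)
    then have "r * \<eta> \<le> (4 / pi) * (r / real (Suc k))" using r(1) by (subst (asm) ennreal_le_iff) auto
    also have "\<dots> = r * ((4 / pi) * (1 / real (Suc k)))" by simp
    also have "\<dots> < r * ((4 / pi) * (\<eta> * pi / 4))" using k r(1) by (intro mult_strict_left_mono) auto
    also have "\<dots> = r * \<eta>" by simp
    finally show False by simp
  qed
  then obtain s K where s: "s \<in> {0<..<r}" "?I s < ennreal \<eta>" and K: "tame_continuum K" "K \<subseteq> {x \<in> Q. infdist x {z} = s}" "\<gamma> ` {0..t} \<inter> K \<noteq> {}"
    "\<forall>T. connected T \<longrightarrow> T \<subseteq> Q \<longrightarrow> z \<in> T \<longrightarrow> w0 \<in> T \<longrightarrow> T \<inter> K \<noteq> {}" by (elim bexE exE conjE)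
  obtain q where q: "q \<in> K" "U z - \<eta> \<le> U q" "q \<in> E"
  proof -
    obtain s' where s': "s' \<in> {0..t}" "\<gamma> s' \<in> K" using K(3) by blast
    moreover have "\<gamma> s' \<in> E" using tame_path_in_E[OF sg(3), of 0 s'] sg(4) z(1) s' sg(2) by auto
    ultimately show ?thesis using that sg(5) by blast
  qed
  have KE: "K \<subseteq> E" by (rule tame_continuum_subset_E[OF K(1) q(1,3)])
  have Kball: "K \<subseteq> cball z r"
  proof
    fix x assume "x \<in> K"
    then have "dist x z = s" using K(2) by (auto simp: infdist_singleton)
    then show "x \<in> cball z r" using s(1) by (simp add: dist_commute)
  qed
  have low: "c + \<eta> \<le> U p" if p: "p \<in> K" for p
  proof -
    have "ennreal \<bar>U p - U q\<bar> \<le> (\<integral>\<^sup>+x\<in>K. \<rho> x \<partial>hausdorff 1)" by (rule tame_continuum_oscillation[OF K(1) KE p q(1)])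
    also have "\<dots> \<le> ?I s" using K(2) Kball by (intro nn_integral_mono) (auto split: split_indicator)
    also note s(2)
    finally have "\<bar>U p - U q\<bar> < \<eta>" using \<eta>(1) by (simp add: ennreal_less_iff)
    then show ?thesis using q(2) \<eta>(2) by linarith
  qed
  have WK: "W \<inter> K = {}"
  proof -
    have "cball z r \<subseteq> cball z r0" using rd by auto
    then show ?thesis using Kball W(3) by blast
  qed
  have clK: "closed K" using K(1) by (auto simp: tame_continuum_def intro: compact_imp_closed)
  let ?V = "connected_component_set (Q - K) z"
  have zK: "z \<notin> K" using K(2) s(1) by (auto simp: infdist_singleton)
  have "openin (top_of_set Q) ?V" by (rule openin_component_diff[OF clK])
  then obtain N where N: "open N" "?V = Q \<inter> N" by (auto simp: openin_open)
  have zV: "z \<in> ?V" using zQ zK by (simp add: connected_component_refl)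
  have Vsub: "?V \<subseteq> Q - K" by (rule connected_component_subset)
  show ?thesis
  proof (rule that[OF N(1)])
    show "z \<in> N" using zV N(2) by blast
    fix w assume w: "w \<in> N \<inter> E"
    then have wV: "w \<in> ?V" using N(2) E_subset by blast
    have "c + \<eta> \<le> U w"
    proof (rule minimum_principle[OF KE _ WK W(4) _ low])
      show "w \<in> E" using w by blast
      fix T assume T: "connected T" "T \<subseteq> Q" "w \<in> T" "T \<inter> W \<noteq> {}"
      have "connected (?V \<union> T)" using wV T(1,3) connected_Un[OF connected_connected_component] by blast
      then have "connected (?V \<union> T \<union> W)" using connected_Un[OF _ W(1)] T(4) by blast
      then have "(?V \<union> T \<union> W) \<inter> K \<noteq> {}" using K(4)[rule_format, of "?V \<union> T \<union> W"] Vsub T(2) W(2) zV sg(1) by blast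
      then show "T \<inter> K \<noteq> {}" using Vsub WK by blast
    qed
    then show "c < U w" using \<eta>(1) by linarith
  qed
qed

end

section \<open>Erasing parts of the minimizer\<close>

lemma line_integral_cong_on:
  assumes cont: "continuous_on {a..b} \<gamma>" and rect: "rectifiable \<gamma> a b" and ab: "a \<le> b"
    and eq: "\<And>t. t \<in> {a..b} \<Longrightarrow> f (\<gamma> t) = g (\<gamma> t)"
  shows "line_integral \<gamma> a b f = line_integral \<gamma> a b g"
proof -
  have "f (arc_length_param \<gamma> a b r) = g (arc_length_param \<gamma> a b r)" if r: "r \<in> {0..arc_len \<gamma> a b}" for r
  proof -
    obtain t where t: "t \<in> {a..b}" "arc_len \<gamma> a t = r" using arc_len_surj[OF cont rect ab r] .
    have "arc_length_param \<gamma> a b r = \<gamma> t" using arc_length_param_eq[OF rect t(1)] t(2) by simp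
    then show ?thesis using eq[OF t(1)] by simp
  qed
  then show ?thesis unfolding line_integral_def by (intro nn_integral_cong) (auto split: split_indicator)
qed

lemma line_integral_mono: "(\<And>x. f x \<le> g x) \<Longrightarrow> line_integral \<gamma> a b f \<le> line_integral \<gamma> a b g"
  unfolding line_integral_def by (intro nn_integral_mono mult_right_mono) auto

lemma square_add_le:
  assumes "\<epsilon> > 0"
  shows "((a::ennreal) + b) ^ 2 \<le> ennreal (1 + \<epsilon>) * a ^ 2 + ennreal (1 + 1/\<epsilon>) * b ^ 2"
proof (cases "a = top \<or> b = top")
  case True
  then show ?thesis using assms by (auto simp: power2_eq_square ennreal_mult_top ennreal_top_mult)
next
  case False
  then obtain x z where xz: "a = ennreal x" "x \<ge> 0" "b = ennreal z" "z \<ge> 0" by (cases a; cases b) auto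
  have "0 \<le> (\<epsilon> * x - z) ^ 2 / \<epsilon>" using assms by simp
  also have "\<dots> = \<epsilon> * x ^ 2 + (1/\<epsilon>) * z ^ 2 - 2 * x * z" using assms by (simp add: power2_eq_square field_simps)
  finally have "(x + z) ^ 2 \<le> (1 + \<epsilon>) * x ^ 2 + (1 + 1/\<epsilon>) * z ^ 2" by (simp add: power2_eq_square algebra_simps)
  then have "ennreal ((x + z) ^ 2) \<le> ennreal ((1 + \<epsilon>) * x ^ 2 + (1 + 1/\<epsilon>) * z ^ 2)" by (rule ennreal_leI)
  also have "\<dots> = ennreal ((1 + \<epsilon>) * x ^ 2) + ennreal ((1 + 1/\<epsilon>) * z ^ 2)" using assms by (intro ennreal_plus) auto
  also have "\<dots> = ennreal (1 + \<epsilon>) * ennreal (x ^ 2) + ennreal (1 + 1/\<epsilon>) * ennreal (z ^ 2)"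
    using assms by (intro arg_cong2[where f = "(+)"] ennreal_mult) auto
  finally show ?thesis using xz by (simp add: ennreal_power[symmetric] ennreal_plus)
qed

context minimizing_square
begin

text \<open>A function that is admissible for the exceptional curves and has arbitrarily small energy can be added to
\<open>\<sigma>\<close>. The sum is admissible for all curves, as each of them is tame or contains an exceptional subcurve.\<close>

lemma weakly_admissible_energy:
  assumes \<sigma> [measurable]: "\<sigma> \<in> borel_measurable borel"
    and adm: "\<And>\<gamma>. joins \<gamma> (\<zeta>\<^sub>1 \<phi>) (\<zeta>\<^sub>3 \<phi>) \<Longrightarrow> 1 \<le> line_integral \<gamma> 0 1 \<sigma>"
  shows "modulus (\<Gamma>\<^sub>1 Q \<phi>) \<le> (\<integral>\<^sup>+x. \<sigma> x ^ 2 \<partial>hausdorff 2)"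
proof -
  have adm_sum: "admissible (\<Gamma>\<^sub>1 Q \<phi>) (\<lambda>x. \<sigma> x + k x)" if k: "admissible exceptional k" for k
  proof -
    have [measurable]: "k \<in> borel_measurable borel" using k by (simp add: admissible_def)
    have "1 \<le> line_integral \<gamma> 0 1 (\<lambda>x. \<sigma> x + k x)" if \<gamma>: "\<gamma> \<in> \<Gamma>\<^sub>1 Q \<phi>" and rect: "rectifiable \<gamma> 0 1" for \<gamma>
    proof (cases "\<gamma> \<in> \<Gamma>\<^sub>0 Q \<rho>k \<rho>")
      case False
      then have "joins \<gamma> (\<zeta>\<^sub>1 \<phi>) (\<zeta>\<^sub>3 \<phi>) \<or> joins \<gamma> (\<zeta>\<^sub>3 \<phi>) (\<zeta>\<^sub>1 \<phi>)" using \<gamma> admissible_curves_iff by blast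
      then have "1 \<le> line_integral \<gamma> 0 1 \<sigma>"
      proof
        assume j: "joins \<gamma> (\<zeta>\<^sub>3 \<phi>) (\<zeta>\<^sub>1 \<phi>)"
        then have g: "tame_path \<gamma>" by (simp add: joins_def)
        have "line_integral (\<lambda>t. \<gamma> (1 - t)) (1 - 1) (1 - 0) \<sigma> = line_integral \<gamma> 0 1 \<sigma>"
          by (rule line_integral_reverse) (use tame_path_cont[OF g, of 0 1] rect in auto)
        moreover have "reversepath \<gamma> = (\<lambda>t. \<gamma> (1 - t))" by (simp add: reversepath_def fun_eq_iff)
        ultimately show ?thesis using adm[OF joins_reverse[OF j]] by simp
      qed (rule adm)
      also have "\<dots> \<le> line_integral \<gamma> 0 1 (\<lambda>x. \<sigma> x + k x)" by (rule line_integral_mono) simp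
      finally show ?thesis .
    next
      case True
      then obtain a b where ab: "0 \<le> a" "a \<le> b" "b \<le> 1" and nc: "\<not> converges \<gamma> a b" and cur: "\<gamma> \<in> curves_in Q"
        by (auto simp: \<Gamma>\<^sub>0_def)
      have p: "path \<gamma>" "path_image \<gamma> \<subseteq> Q" using cur by (auto simp: curves_in_def)
      have cont: "continuous_on {s..t} \<gamma>" if "0 \<le> s" "t \<le> 1" for s t
        using p(1) that unfolding path_def by (meson atLeastatMost_subset_iff continuous_on_subset)
      have rect': "rectifiable \<gamma> s t" if "0 \<le> s" "t \<le> 1" for s t
        using that by (intro rectifiable_subinterval[OF rect]) auto
      have "a \<noteq> b" using nc rect'[of a b] ab by (auto simp: line_integrals_converge_def)
      then have pos: "b - a > 0" using ab by simp
      let ?\<eta> = "subcurve a b \<gamma>"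
      have \<eta>: "?\<eta> = (\<lambda>r. \<gamma> ((b - a) * r + a))" by (rule ext) (rule subcurve_def)
      have li\<eta>: "line_integral ?\<eta> 0 1 f = line_integral \<gamma> a b f" for f
        unfolding \<eta> using line_integral_affine[OF pos, of 0 1 a \<gamma> f] cont[of a b] rect'[of a b] ab by simp
      have len\<eta>: "curve_length ?\<eta> 0 1 = curve_length \<gamma> a b"
        unfolding \<eta> using curve_length_affine[OF pos, of \<gamma> a 0 1] by simp
      have r\<eta>: "rectifiable ?\<eta> 0 1" using rect'[of a b] ab len\<eta> by (simp add: rectifiable_def)
      have n\<eta>: "\<not> converges ?\<eta> 0 1"
        using nc r\<eta> rect'[of a b] ab unfolding line_integrals_converge_def li\<eta> by simp
      have "\<not> ?\<eta> constant_on {0..1}"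
      proof
        assume "?\<eta> constant_on {0..1}"
        then obtain c where "\<And>t. t \<in> {0..1} \<Longrightarrow> ?\<eta> t = c" unfolding constant_on_def by blast
        then have "curve_length ?\<eta> 0 1 = 0" by (rule curve_length_const)
        then have "line_integral ?\<eta> 0 1 f = 0" for f by (rule line_integral_zero_length)
        then show False using n\<eta> r\<eta> by (simp add: line_integrals_converge_def)
      qed
      then have "?\<eta> \<in> exceptional" using path_subcurve[OF p(1) ab] p(2) n\<eta> by (auto simp: curves_in_def)
      then have "1 \<le> line_integral \<gamma> a b k" using k r\<eta> li\<eta>[of k] by (auto simp: admissible_def)
      also have "\<dots> \<le> line_integral \<gamma> 0 1 k"
      proof -
        have "line_integral \<gamma> 0 1 k = line_integral \<gamma> 0 a k + (line_integral \<gamma> a b k + line_integral \<gamma> b 1 k)"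
          using line_integral_add[of 0 1 \<gamma> a k] line_integral_add[of a 1 \<gamma> b k] cont rect' ab by simp
        then show ?thesis by (simp add: add_increasing add_increasing2)
      qed
      also have "\<dots> \<le> line_integral \<gamma> 0 1 (\<lambda>x. \<sigma> x + k x)" by (rule line_integral_mono) simp
      finally show ?thesis .
    qed
    then show ?thesis by (simp add: admissible_def)
  qed
  show ?thesis
  proof (cases "(\<integral>\<^sup>+x. \<sigma> x ^ 2 \<partial>hausdorff 2)")
    case (real s)
    have bound: "modulus (\<Gamma>\<^sub>1 Q \<phi>) \<le> ennreal ((1 + \<epsilon>) * s + (1 + 1/\<epsilon>) * \<epsilon> ^ 2)" if \<epsilon>: "\<epsilon> > 0" for \<epsilon>
    proof -
      have "(0::ennreal) < ennreal (\<epsilon> ^ 2)" using \<epsilon> by simp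
      then obtain k where k: "admissible exceptional k" "(\<integral>\<^sup>+x. k x ^ 2 \<partial>hausdorff 2) < ennreal (\<epsilon> ^ 2)"
        by (rule exceptional_small)
      have [measurable]: "k \<in> borel_measurable borel" using k(1) by (simp add: admissible_def)
      have "modulus (\<Gamma>\<^sub>1 Q \<phi>) \<le> (\<integral>\<^sup>+x. (\<sigma> x + k x) ^ 2 \<partial>hausdorff 2)"
        unfolding modulus_def by (rule INF_lower) (use adm_sum[OF k(1)] in simp)
      also have "\<dots> \<le> (\<integral>\<^sup>+x. ennreal (1 + \<epsilon>) * \<sigma> x ^ 2 + ennreal (1 + 1/\<epsilon>) * k x ^ 2 \<partial>hausdorff 2)"
        by (intro nn_integral_mono square_add_le \<epsilon>)
      also have "\<dots> = ennreal (1 + \<epsilon>) * (\<integral>\<^sup>+x. \<sigma> x ^ 2 \<partial>hausdorff 2) + ennreal (1 + 1/\<epsilon>) * (\<integral>\<^sup>+x. k x ^ 2 \<partial>hausdorff 2)"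
        by (subst nn_integral_add) (auto simp: nn_integral_cmult)
      also have "\<dots> \<le> ennreal (1 + \<epsilon>) * ennreal s + ennreal (1 + 1/\<epsilon>) * ennreal (\<epsilon> ^ 2)"
        using k(2) real by (intro add_mono mult_left_mono) auto
      also have "\<dots> = ennreal ((1 + \<epsilon>) * s) + ennreal ((1 + 1/\<epsilon>) * \<epsilon> ^ 2)"
        using \<epsilon> real by (intro arg_cong2[where f = "(+)"] ennreal_mult[symmetric]) auto
      also have "\<dots> = ennreal ((1 + \<epsilon>) * s + (1 + 1/\<epsilon>) * \<epsilon> ^ 2)"
        using \<epsilon> real by (intro ennreal_plus[symmetric]) auto
      finally show ?thesis .
    qed
    have step: "modulus (\<Gamma>\<^sub>1 Q \<phi>) \<le> ennreal s + ennreal e" if e: "e > 0" for e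
    proof -
      define \<epsilon> where "\<epsilon> = min 1 (e / (s + 2))"
      have s0: "s + 2 > 0" using real by simp
      have \<epsilon>: "\<epsilon> > 0" "\<epsilon> \<le> 1" "\<epsilon> * (s + 2) \<le> e"
      proof -
        show "\<epsilon> > 0" "\<epsilon> \<le> 1" using e s0 by (auto simp: \<epsilon>_def)
        have "\<epsilon> \<le> e / (s + 2)" by (simp add: \<epsilon>_def)
        then show "\<epsilon> * (s + 2) \<le> e" using s0 by (simp add: pos_le_divide_eq)
      qed
      have "(1 + \<epsilon>) * s + (1 + 1/\<epsilon>) * \<epsilon> ^ 2 = s + \<epsilon> * (s + 1 + \<epsilon>)" using \<epsilon>(1) by (simp add: power2_eq_square field_simps)
      also have "\<dots> \<le> s + \<epsilon> * (s + 2)" using \<epsilon> by (intro add_left_mono mult_left_mono) auto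
      also have "\<dots> \<le> s + e" using \<epsilon>(3) by simp
      finally have le: "(1 + \<epsilon>) * s + (1 + 1/\<epsilon>) * \<epsilon> ^ 2 \<le> s + e" .
      have "modulus (\<Gamma>\<^sub>1 Q \<phi>) \<le> ennreal (s + e)" by (rule order_trans[OF bound[OF \<epsilon>(1)] ennreal_leI[OF le]])
      also have "ennreal (s + e) = ennreal s + ennreal e" using real e by (intro ennreal_plus) auto
      finally show ?thesis .
    qed
    have "modulus (\<Gamma>\<^sub>1 Q \<phi>) \<le> ennreal s" by (rule ennreal_le_epsilon) (rule step)
    then show ?thesis using real by simp
  qed simp
qed

text \<open>Otherwise \<open>\<rho>\<close> restricted to the complement of \<open>G\<close> would have less energy than the modulus.\<close>

lemma minimizer_vanishes:
  assumes G: "G \<in> sets borel"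
    and adm: "\<And>\<gamma>. joins \<gamma> (\<zeta>\<^sub>1 \<phi>) (\<zeta>\<^sub>3 \<phi>) \<Longrightarrow> 1 \<le> line_integral \<gamma> 0 1 (\<lambda>x. \<rho> x * indicator (- G) x)"
  shows "(\<integral>\<^sup>+x\<in>Q. \<rho> x * indicator G x \<partial>hausdorff 2) = 0"
proof -
  note [measurable] = G
  let ?\<sigma> = "\<lambda>x. \<rho> x * indicator (- G) x"
  have \<rho>0: "\<rho> x = 0" if "x \<notin> Q" for x using minimizing that by (simp add: minimizing_function_def)
  have fin: "(\<integral>\<^sup>+x\<in>Q. \<rho> x ^ 2 \<partial>hausdorff 2) < \<infinity>" and mod: "(\<integral>\<^sup>+x\<in>Q. \<rho> x ^ 2 \<partial>hausdorff 2) = modulus (\<Gamma>\<^sub>1 Q \<phi>)"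
    using minimizing unfolding minimizing_function_def by blast+
  have "(\<integral>\<^sup>+x\<in>Q. \<rho> x ^ 2 \<partial>hausdorff 2) \<le> (\<integral>\<^sup>+x. ?\<sigma> x ^ 2 \<partial>hausdorff 2)"
    unfolding mod by (rule weakly_admissible_energy[OF _ adm]) measurable
  moreover have "(\<integral>\<^sup>+x\<in>Q. \<rho> x ^ 2 \<partial>hausdorff 2) = (\<integral>\<^sup>+x. ?\<sigma> x ^ 2 + \<rho> x ^ 2 * indicator (Q \<inter> G) x \<partial>hausdorff 2)"
  proof (intro nn_integral_cong)
    fix x show "\<rho> x ^ 2 * indicator Q x = ?\<sigma> x ^ 2 + \<rho> x ^ 2 * indicator (Q \<inter> G) x"
      using \<rho>0[of x] by (cases "x \<in> Q"; cases "x \<in> G") auto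
  qed
  moreover have "\<dots> = (\<integral>\<^sup>+x. ?\<sigma> x ^ 2 \<partial>hausdorff 2) + (\<integral>\<^sup>+x. \<rho> x ^ 2 * indicator (Q \<inter> G) x \<partial>hausdorff 2)"
    by (rule nn_integral_add) measurable
  ultimately have "(\<integral>\<^sup>+x. ?\<sigma> x ^ 2 \<partial>hausdorff 2) + (\<integral>\<^sup>+x. \<rho> x ^ 2 * indicator (Q \<inter> G) x \<partial>hausdorff 2) \<le> (\<integral>\<^sup>+x. ?\<sigma> x ^ 2 \<partial>hausdorff 2) + 0"
    "(\<integral>\<^sup>+x. ?\<sigma> x ^ 2 \<partial>hausdorff 2) \<noteq> top" using fin by auto
  then have "(\<integral>\<^sup>+x. \<rho> x ^ 2 * indicator (Q \<inter> G) x \<partial>hausdorff 2) = 0"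
    unfolding ennreal_add_left_cancel_le by auto
  then have "AE x in hausdorff 2. \<rho> x ^ 2 * indicator (Q \<inter> G) x = 0"
    by (subst (asm) nn_integral_0_iff_AE) auto
  then have "AE x in hausdorff 2. \<rho> x * indicator G x * indicator Q x = 0"
    by eventually_elim (auto split: split_indicator_asm split_indicator)
  then show ?thesis by (subst nn_integral_0_iff_AE) auto
qed

text \<open>The components of \<open>Q - K\<close> are relatively open, so that none of them contains boundary points of another.\<close>

lemma component_boundary:
  fixes \<gamma> :: "real \<Rightarrow> 'a"
  assumes K: "closed K" and V: "V = connected_component_set (Q - K) y"
    and g: "continuous_on {a..b} \<gamma>" "\<gamma> ` {a..b} \<subseteq> Q" and t: "t \<in> {a..b}" "t \<in> closure {s \<in> {a..b}. \<gamma> s \<in> V}"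
  shows "\<gamma> t \<in> V \<union> K"
proof (rule ccontr)
  assume n: "\<gamma> t \<notin> V \<union> K"
  have gt: "\<gamma> t \<in> Q - K" using n g(2) t(1) by blast
  let ?V' = "connected_component_set (Q - K) (\<gamma> t)"
  have "openin (top_of_set Q) ?V'" by (rule openin_component_diff[OF K])
  then obtain N where N: "open N" "?V' = Q \<inter> N" by (auto simp: openin_open)
  have "\<gamma> t \<in> N" using gt N(2) connected_component_refl[of "\<gamma> t" "Q - K"] by blast
  then obtain d where d: "d > 0" "\<And>s. s \<in> {a..b} \<Longrightarrow> dist s t < d \<Longrightarrow> \<gamma> s \<in> N"
  proof -
    obtain e where e: "e > 0" "ball (\<gamma> t) e \<subseteq> N" using N(1) \<open>\<gamma> t \<in> N\<close> openE by blast
    obtain d where d: "d > 0" "\<forall>s\<in>{a..b}. dist s t < d \<longrightarrow> dist (\<gamma> s) (\<gamma> t) < e"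
      using g(1) t(1) e(1) unfolding continuous_on_iff by blast
    have "\<gamma> s \<in> N" if "s \<in> {a..b}" "dist s t < d" for s
    proof -
      have "\<gamma> s \<in> ball (\<gamma> t) e" using d(2) that by (simp add: dist_commute)
      then show ?thesis using e(2) by blast
    qed
    then show thesis using that d(1) by blast
  qed
  obtain s where s: "s \<in> {a..b}" "\<gamma> s \<in> V" "dist s t < d"
    using t(2) d(1) unfolding closure_approachable by blast
  have "\<gamma> s \<in> ?V'" using d(2)[OF s(1,3)] N(2) g(2) s(1) by blast
  then have "connected_component (Q - K) (\<gamma> t) (\<gamma> s)" by simp
  moreover have "connected_component (Q - K) y (\<gamma> s)" using s(2) V by simp
  ultimately have "connected_component (Q - K) y (\<gamma> t)" by (meson connected_component_sym connected_component_trans)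
  then show False using n V by simp
qed

lemma superlevel_times_open:
  assumes V: "openin (top_of_set Q) V" and \<gamma>: "tame_path \<gamma>" "\<gamma> 0 \<in> E" and t: "t \<in> {0..1}" "\<gamma> t \<in> V" "M < U (\<gamma> t)"
  obtains d where "d > 0" "\<And>s. s \<in> {0..1} \<Longrightarrow> \<bar>s - t\<bar> < d \<Longrightarrow> \<gamma> s \<in> V \<and> M < U (\<gamma> s)"
proof -
  obtain N where N: "open N" "V = Q \<inter> N" using V by (auto simp: openin_open)
  obtain e where e: "e > 0" "ball (\<gamma> t) e \<subseteq> N" using N t(2) openE by blast
  have c: "continuous_on {0..1} \<gamma>" by (rule tame_path_cont[OF \<gamma>(1)]) auto
  obtain d1 where d1: "d1 > 0" "\<forall>s\<in>{0..1}. dist s t < d1 \<longrightarrow> dist (\<gamma> s) (\<gamma> t) < e"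
    using c t(1) e(1) unfolding continuous_on_iff by blast
  have "U (\<gamma> t) - M > 0" using t(3) by simp
  then obtain d2 where d2: "d2 > 0" "\<forall>s\<in>{0..1}. dist s t < d2 \<longrightarrow> dist (U (\<gamma> s)) (U (\<gamma> t)) < U (\<gamma> t) - M"
    using U_continuous_along[OF \<gamma>] t(1) unfolding continuous_on_iff by blast
  show ?thesis
  proof (rule that[of "min d1 d2"])
    show "min d1 d2 > 0" using d1 d2 by simp
    fix s :: real assume s: "s \<in> {0..1}" "\<bar>s - t\<bar> < min d1 d2"
    have "dist (\<gamma> t) (\<gamma> s) < e" using d1(2) s by (simp add: dist_real_def dist_commute)
    then have "\<gamma> s \<in> N" using e(2) by auto
    moreover have "\<bar>U (\<gamma> s) - U (\<gamma> t)\<bar> < U (\<gamma> t) - M" using d2(2) s by (simp add: dist_real_def)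
    ultimately show "\<gamma> s \<in> V \<and> M < U (\<gamma> s)" using N(2) tame_path_in_Q[OF \<gamma>(1) s(1)] by auto
  qed
qed

text \<open>Consider the first and the last time at which the path is in \<open>V\<close> with \<open>u > M\<close>. Before the first one,
\<open>u\<close> has risen from \<open>0\<close> to \<open>M\<close>. After the last one, \<open>u\<close> has to rise from at most \<open>M\<close> to at
least \<open>1\<close>, since the path leaves \<open>V\<close> through \<open>K\<close> or at the level \<open>M\<close>. On these two parts
nothing has been erased, and they account for a total of \<open>1\<close>.\<close>

lemma truncation_admissible:
  assumes K: "closed K" "\<And>q. q \<in> K \<inter> E \<Longrightarrow> U q \<le> M" and V: "V = connected_component_set (Q - K) y"
    and V3: "V \<inter> \<zeta>\<^sub>3 \<phi> = {}" and M: "0 \<le> M" "M < 1"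
    and G: "G \<in> sets borel" "\<And>w. w \<in> G \<inter> E \<Longrightarrow> w \<in> V \<and> M < U w"
    and j: "joins \<gamma> (\<zeta>\<^sub>1 \<phi>) (\<zeta>\<^sub>3 \<phi>)"
  shows "1 \<le> line_integral \<gamma> 0 1 (\<lambda>x. \<rho> x * indicator (- G) x)"
proof -
  note [measurable] = G(1)
  let ?\<sigma> = "\<lambda>x. \<rho> x * indicator (- G) x"
  let ?f = "\<lambda>t. U (\<gamma> t)"
  have \<gamma>: "tame_path \<gamma>" "\<gamma> 0 \<in> \<zeta>\<^sub>1 \<phi>" "\<gamma> 1 \<in> \<zeta>\<^sub>3 \<phi>" using j by (auto simp: joins_def pathstart_def pathfinish_def)
  have E0: "\<gamma> 0 \<in> E"
  proof -
    have "joins (subcurve 0 0 \<gamma>) (\<zeta>\<^sub>1 \<phi>) {\<gamma> 0}" using tame_path_subcurve_le(1)[OF \<gamma>(1), of 0 0] \<gamma>(2) by (auto simp: joins_def)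
    moreover have "joins \<gamma> {\<gamma> 0} (\<zeta>\<^sub>3 \<phi>)" using j by (auto simp: joins_def pathstart_def)
    ultimately show ?thesis by (rule in_E_I)
  qed
  have inE: "\<gamma> t \<in> E" if "t \<in> {0..1}" for t using tame_path_in_E[OF \<gamma>(1) _ E0 that] by simp
  have f0: "?f 0 = 0" using U_zero[OF E0 \<gamma>(2)] .
  have f1: "1 \<le> ?f 1" using U_ge_1[OF inE[of 1] \<gamma>(3)] by simp
  have fc: "continuous_on {0..1} ?f" by (rule U_continuous_along[OF \<gamma>(1) E0])
  have cont: "continuous_on {a..b} \<gamma>" if "0 \<le> a" "b \<le> 1" for a b using tame_path_cont[OF \<gamma>(1) that] .
  have rect: "rectifiable \<gamma> a b" if "0 \<le> a" "a \<le> b" "b \<le> 1" for a b using tame_path_rect[OF \<gamma>(1) that] .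
  have Vop: "openin (top_of_set Q) V" unfolding V by (rule openin_component_diff[OF K(1)])
  define T where "T = {t \<in> {0..1}. \<gamma> t \<in> V \<and> M < ?f t}"
  have offT: "?\<sigma> (\<gamma> t) = \<rho> (\<gamma> t)" if "t \<in> {0..1}" "t \<notin> T" for t
    using that G(2)[of "\<gamma> t"] inE[of t] by (auto simp: T_def split: split_indicator)
  have sub: "line_integral \<gamma> a b ?\<sigma> = line_integral \<gamma> a b \<rho>" if "0 \<le> a" "a \<le> b" "b \<le> 1" "{a..b} \<inter> T = {}" for a b
  proof (rule line_integral_cong_on[OF cont[OF that(1,3)] rect[OF that(1-3)] that(2)])
    fix t assume "t \<in> {a..b}"
    then have "t \<in> {0..1}" "t \<notin> T" using that by auto
    then show "?\<sigma> (\<gamma> t) = \<rho> (\<gamma> t)" by (rule offT)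
  qed
  show ?thesis
  proof (cases "T = {}")
    case True
    then show ?thesis using sub[of 0 1] line_integral_ge_1[OF j] by simp
  next
    case False
    define a b where "a = Inf T" and "b = Sup T"
    have bdd: "bdd_below T" "bdd_above T" by (auto simp: T_def intro!: bdd_belowI[of _ 0] bdd_aboveI[of _ 1])
    have Tab: "T \<subseteq> {a..b}" using bdd by (auto simp: a_def b_def intro: cInf_lower cSup_upper)
    have T01: "T \<subseteq> {0..1}" by (auto simp: T_def)
    have ab: "0 \<le> a" "a \<le> b" "b \<le> 1"
    proof -
      show "0 \<le> a" unfolding a_def by (rule cInf_greatest[OF False]) (use T01 in auto)
      show "b \<le> 1" unfolding b_def by (rule cSup_least[OF False]) (use T01 in auto)
      show "a \<le> b" using False Tab by fastforce
    qed
    have acl: "a \<in> closure T" unfolding a_def by (rule closure_contains_Inf[OF False bdd(1)])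
    have bcl: "b \<in> closure T" unfolding b_def by (rule closure_contains_Sup[OF False bdd(2)])
    have open_T: "\<exists>d>0. \<forall>s\<in>{0..1}. \<bar>s - t\<bar> < d \<longrightarrow> s \<in> T" if t: "t \<in> T" for t
    proof -
      have "t \<in> {0..1}" "\<gamma> t \<in> V" "M < ?f t" using t by (auto simp: T_def)
      then obtain d where "d > 0" "\<And>s. s \<in> {0..1} \<Longrightarrow> \<bar>s - t\<bar> < d \<Longrightarrow> \<gamma> s \<in> V \<and> M < ?f s"
        using superlevel_times_open[OF Vop \<gamma>(1) E0] by metis
      then show ?thesis by (intro exI[of _ d]) (auto simp: T_def)
    qed
    have aT: "a \<notin> T"
    proof
      assume "a \<in> T"
      then obtain d where d: "d > 0" "\<And>s. s \<in> {0..1} \<Longrightarrow> \<bar>s - a\<bar> < d \<Longrightarrow> s \<in> T" using open_T by blast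
      have "a \<noteq> 0" using \<open>a \<in> T\<close> f0 M by (auto simp: T_def)
      then have a0: "a > 0" using ab by simp
      define s where "s = max 0 (a - d/2)"
      have "s < a" "s \<in> {0..1}" "\<bar>s - a\<bar> < d" using a0 d(1) ab by (auto simp: s_def)
      then have "s \<in> T" using d(2) by blast
      then show False using Tab \<open>s < a\<close> by auto
    qed
    have bT: "b \<notin> T"
    proof
      assume "b \<in> T"
      then obtain d where d: "d > 0" "\<And>s. s \<in> {0..1} \<Longrightarrow> \<bar>s - b\<bar> < d \<Longrightarrow> s \<in> T" using open_T by blast
      have "b \<noteq> 1" using \<open>b \<in> T\<close> V3 \<gamma>(3) by (auto simp: T_def)
      then have b1: "b < 1" using ab by simp
      define s where "s = min 1 (b + d/2)"
      have "b < s" "s \<in> {0..1}" "\<bar>s - b\<bar> < d" using b1 d(1) ab by (auto simp: s_def)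
      then have "s \<in> T" using d(2) by blast
      then show False using Tab \<open>b < s\<close> by auto
    qed
    have a01: "a \<in> {0..1}" using ab by auto
    have fa: "M \<le> ?f a"
    proof (rule ccontr)
      assume "\<not> M \<le> ?f a"
      then have "M - ?f a > 0" by simp
      then obtain d where d: "d > 0" "\<forall>s\<in>{0..1}. dist s a < d \<longrightarrow> dist (?f s) (?f a) < M - ?f a"
        using fc[unfolded continuous_on_iff, rule_format, OF a01] by blast
      obtain s where "s \<in> T" "dist s a < d" using acl d(1) unfolding closure_approachable by blast
      then have "dist (?f s) (?f a) < M - ?f a" "M < ?f s" using d(2) T01 by (auto simp: T_def)
      then show False by (simp add: dist_real_def)
    qed
    have fb: "?f b \<le> M"
    proof -
      have "b \<in> closure {s \<in> {0..1}. \<gamma> s \<in> V}" using bcl closure_mono[of T "{s \<in> {0..1}. \<gamma> s \<in> V}"] by (auto simp: T_def)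
      then have "\<gamma> b \<in> V \<union> K"
        using tame_path_in_Q[OF \<gamma>(1)] ab by (intro component_boundary[OF K(1) V cont[of 0 1]]) auto
      then show ?thesis
      proof
        assume "\<gamma> b \<in> V" then show ?thesis using bT ab by (auto simp: T_def)
      next
        assume "\<gamma> b \<in> K" then show ?thesis using K(2) inE[of b] ab by auto
      qed
    qed
    have "{0..a} \<inter> T = {}"
    proof -
      have "t \<notin> T" if "t \<in> {0..a}" for t using that aT Tab by (cases "t = a") force+
      then show ?thesis by blast
    qed
    then have sa: "line_integral \<gamma> 0 a ?\<sigma> = line_integral \<gamma> 0 a \<rho>" using ab by (intro sub) auto
    have "{b..1} \<inter> T = {}"
    proof -
      have "t \<notin> T" if "t \<in> {b..1}" for t using that bT Tab by (cases "t = b") force+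
      then show ?thesis by blast
    qed
    then have sb: "line_integral \<gamma> b 1 ?\<sigma> = line_integral \<gamma> b 1 \<rho>" using ab by (intro sub) auto
    have "ennreal M \<le> ennreal \<bar>?f 0 - ?f a\<bar>" using fa f0 by (intro ennreal_leI) auto
    also have "\<dots> \<le> line_integral \<gamma> 0 a \<rho>" using ab inE[of 0] by (intro U_upper_gradient[OF \<gamma>(1)]) auto
    finally have la: "ennreal M \<le> line_integral \<gamma> 0 a \<rho>" .
    have "ennreal (1 - M) \<le> ennreal \<bar>?f b - ?f 1\<bar>" using fb f1 by (intro ennreal_leI) auto
    also have "\<dots> \<le> line_integral \<gamma> b 1 \<rho>" using ab inE[of b] by (intro U_upper_gradient[OF \<gamma>(1)]) auto
    finally have lb: "ennreal (1 - M) \<le> line_integral \<gamma> b 1 \<rho>" .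
    have \<sigma>b: "?\<sigma> \<in> borel_measurable borel" by measurable
    have "line_integral \<gamma> 0 1 ?\<sigma> = line_integral \<gamma> 0 a ?\<sigma> + line_integral \<gamma> a 1 ?\<sigma>"
      by (rule line_integral_add[OF cont rect _ _ \<sigma>b]) (use ab in auto)
    also have "line_integral \<gamma> a 1 ?\<sigma> = line_integral \<gamma> a b ?\<sigma> + line_integral \<gamma> b 1 ?\<sigma>"
      by (rule line_integral_add[OF cont rect _ _ \<sigma>b]) (use ab in auto)
    finally have eq: "line_integral \<gamma> 0 1 ?\<sigma> = line_integral \<gamma> 0 a \<rho> + (line_integral \<gamma> a b ?\<sigma> + line_integral \<gamma> b 1 \<rho>)"
      by (simp add: sa sb)
    have "1 = ennreal M + ennreal (1 - M)" using M by (simp add: ennreal_plus[symmetric] del: ennreal_plus)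
    also have "\<dots> \<le> line_integral \<gamma> 0 a \<rho> + line_integral \<gamma> b 1 \<rho>" by (intro add_mono la lb)
    also have "\<dots> \<le> line_integral \<gamma> 0 1 ?\<sigma>" unfolding eq by (intro add_left_mono) (simp add: add_increasing)
    finally show ?thesis .
  qed
qed

section \<open>The maximum principle\<close>

text \<open>Along an arc in \<open>K'\<close> the function \<open>u\<close> is constant as long as the arc stays in the superlevel set,
because there the integral of \<open>\<rho>\<close> over it vanishes. So the arc can leave the superlevel set only by
leaving \<open>V\<close>, that is through \<open>K\<close>, where \<open>u\<close> is smaller.\<close>

lemma superlevel_propagates:
  assumes K: "closed K" "\<And>q. q \<in> K \<inter> E \<Longrightarrow> U q \<le> M" and V: "V = connected_component_set (Q - K) y"
    and G: "G \<in> sets borel" "\<And>z. z \<in> V \<inter> E \<Longrightarrow> M < U z \<Longrightarrow> z \<in> G \<union> heavy_set"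
    and K': "tame_continuum K'" "(\<integral>\<^sup>+x\<in>K'. \<rho> x * indicator G x \<partial>hausdorff 1) = 0" "(\<integral>\<^sup>+x\<in>K'. indicator heavy_set x \<partial>hausdorff 1) = 0"
    and q: "q \<in> K'" "q \<in> V" "q \<in> E" "M < U q" and p: "p \<in> K'"
  shows "p \<in> V \<and> M < U p"
proof (rule ccontr)
  assume n: "\<not> (p \<in> V \<and> M < U p)"
  note [measurable] = G(1) tame_continuum_borel[OF K'(1)]
  have K'E: "K' \<subseteq> E" by (rule tame_continuum_subset_E[OF K'(1) q(1,3)])
  have "q \<noteq> p" using n q by auto
  then obtain \<gamma> where j: "joins \<gamma> {q} {p}" and im: "path_image \<gamma> \<subseteq> K'"
    and li: "\<And>a b f. 0 \<le> a \<Longrightarrow> a \<le> b \<Longrightarrow> b \<le> 1 \<Longrightarrow> f \<in> borel_measurable borel \<Longrightarrow>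
       line_integral \<gamma> a b f = (\<integral>\<^sup>+z\<in>\<gamma> ` {a..b}. f z \<partial>hausdorff 1)"
    using tame_continuum_arc[OF K'(1) q(1) p] by metis
  have \<gamma>: "tame_path \<gamma>" "\<gamma> 0 = q" "\<gamma> 1 = p" using j by (auto simp: joins_def pathstart_def pathfinish_def)
  have E0: "\<gamma> 0 \<in> E" using \<gamma>(2) q(3) by simp
  have inK': "\<gamma> t \<in> K'" if "t \<in> {0..1}" for t using im that by (auto simp: path_image_def)
  have Vop: "openin (top_of_set Q) V" unfolding V by (rule openin_component_diff[OF K(1)])
  have fc: "continuous_on {0..1} (\<lambda>t. U (\<gamma> t))" by (rule U_continuous_along[OF \<gamma>(1) E0])
  define T where "T = {t \<in> {0..1}. \<not> (\<gamma> t \<in> V \<and> M < U (\<gamma> t))}"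
  have T1: "1 \<in> T" using n \<gamma>(3) by (simp add: T_def)
  have bdd: "bdd_below T" by (auto simp: T_def intro!: bdd_belowI[of _ 0])
  define b where "b = Inf T"
  have b01: "b \<in> {0..1}"
  proof -
    have "0 \<le> b" unfolding b_def by (rule cInf_greatest) (use T1 in \<open>auto simp: T_def\<close>)
    moreover have "b \<le> 1" unfolding b_def by (rule cInf_lower[OF T1 bdd])
    ultimately show ?thesis by simp
  qed
  have bcl: "b \<in> closure T" unfolding b_def using T1 by (intro closure_contains_Inf[OF _ bdd]) auto
  have bT: "b \<in> T"
  proof (rule ccontr)
    assume "b \<notin> T"
    then have "\<gamma> b \<in> V" "M < U (\<gamma> b)" using b01 by (auto simp: T_def)
    from superlevel_times_open[OF Vop \<gamma>(1) E0 b01 this]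
    obtain d where d: "d > 0" "\<And>s. s \<in> {0..1} \<Longrightarrow> \<bar>s - b\<bar> < d \<Longrightarrow> \<gamma> s \<in> V \<and> M < U (\<gamma> s)" by metis
    obtain s where "s \<in> T" "dist s b < d" using bcl d(1) unfolding closure_approachable by blast
    then show False using d(2)[of s] by (auto simp: T_def dist_real_def)
  qed
  have before: "\<gamma> t \<in> V \<and> M < U (\<gamma> t)" if t: "t \<in> {0..<b}" for t
  proof (rule ccontr)
    assume "\<not> ?thesis"
    then have "t \<in> T" using t b01 by (auto simp: T_def)
    then have "b \<le> t" unfolding b_def by (rule cInf_lower[OF _ bdd])
    then show False using t by simp
  qed
  have b0: "b > 0"
  proof (rule ccontr)
    assume "\<not> b > 0"
    then have "b = 0" using b01 by simp
    then show False using bT \<gamma>(2) q by (auto simp: T_def)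
  qed
  have null1: "AE x in hausdorff 1. \<rho> x * indicator G x * indicator K' x = 0"
    using K'(2) by (subst (asm) nn_integral_0_iff_AE) auto
  have null2: "AE x in hausdorff 1. (indicator heavy_set x :: ennreal) * indicator K' x = 0"
    using K'(3) by (subst (asm) nn_integral_0_iff_AE) auto
  have const: "U (\<gamma> t) = U q" if t: "t \<in> {0..<b}" for t
  proof -
    have t': "0 \<le> t" "t \<le> 1" using t b01 by auto
    have sub: "\<gamma> ` {0..t} \<subseteq> K' \<inter> (G \<union> heavy_set)"
    proof
      fix z assume "z \<in> \<gamma> ` {0..t}"
      then obtain s where s: "s \<in> {0..t}" "z = \<gamma> s" by blast
      then have "s \<in> {0..<b}" "s \<in> {0..1}" using t t' by auto
      then show "z \<in> K' \<inter> (G \<union> heavy_set)" using before inK' G(2) K'E s(2) by blast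
    qed
    have "AE x in hausdorff 1. \<rho> x * indicator (\<gamma> ` {0..t}) x = 0"
      using null1 null2 by eventually_elim (use sub in \<open>auto split: split_indicator_asm split_indicator\<close>)
    then have "(\<integral>\<^sup>+x\<in>\<gamma> ` {0..t}. \<rho> x \<partial>hausdorff 1) = (\<integral>\<^sup>+x. 0 \<partial>(hausdorff 1 :: 'a measure))"
      by (rule nn_integral_cong_AE)
    then have "line_integral \<gamma> 0 t \<rho> = 0" using li[of 0 t \<rho>] t' by simp
    moreover have "ennreal \<bar>U (\<gamma> 0) - U (\<gamma> t)\<bar> \<le> line_integral \<gamma> 0 t \<rho>"
      using t' E0 by (intro U_upper_gradient[OF \<gamma>(1)]) auto
    ultimately show ?thesis using \<gamma>(2) by (simp add: ennreal_eq_0_iff)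
  qed
  have "closure {0..<b} = {0..b}" using b0 by simp
  then have "U (\<gamma> b) = U q"
    using continuous_constant_on_closure[of "{0..<b}" "\<lambda>t. U (\<gamma> t)" "U q" b] const continuous_on_subset[OF fc, of "{0..b}"] b0 b01
    by auto
  then have Mb: "M < U (\<gamma> b)" using q(4) by simp
  have "\<gamma> b \<in> V \<union> K"
  proof (rule component_boundary[OF K(1) V tame_path_cont[OF \<gamma>(1), of 0 1] _ b01])
    show "\<gamma> ` {0..1} \<subseteq> Q" using tame_path_in_Q[OF \<gamma>(1)] by auto
    have "{0..<b} \<subseteq> {s \<in> {0..1}. \<gamma> s \<in> V}" using before b01 by auto
    from closure_mono[OF this] show "b \<in> closure {s \<in> {0..1}. \<gamma> s \<in> V}" using \<open>closure {0..<b} = {0..b}\<close> b0 by auto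
  qed auto
  moreover have "\<gamma> b \<in> E" using inK'[OF b01] K'E by blast
  then have "\<gamma> b \<notin> K" using K(2)[of "\<gamma> b"] Mb by auto
  ultimately show False using bT Mb by (auto simp: T_def)
qed

text \<open>Suppose that \<open>u(y) > M\<close>, and let \<open>V\<close> be the component of \<open>y\<close> in the complement of \<open>K\<close>. On the
interior \<open>G\<close> of the superlevel set in \<open>V\<close> the minimizer vanishes, so generic tame continua that start
in the superlevel set remain in it. In particular this holds for a small circle \<open>L\<close> around \<open>y\<close>. Two
disjoint continua \<open>Z\<close> and \<open>P\<close> that run from the inside of \<open>L\<close> to the outside of \<open>K\<close> both
meet \<open>L\<close> and \<open>K\<close>; therefore each of \<open>L\<close> and \<open>K\<close> connects \<open>Z\<close> with \<open>P\<close>, and a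
generic continuum that separates \<open>Z\<close> from \<open>P\<close> meets both. But then it leads from the superlevel
set to \<open>K\<close>.\<close>

lemma maximum_principle:
  assumes K: "tame_continuum K" "K \<subseteq> E" and y: "y \<in> E" and W: "connected W" "W \<subseteq> Q" "W \<inter> K = {}" "W \<inter> \<zeta>\<^sub>3 \<phi> \<noteq> {}"
      "\<zeta>\<^sub>1 \<phi> \<subseteq> W \<or> \<zeta>\<^sub>3 \<phi> \<subseteq> W"
    and sep: "\<And>T. connected T \<Longrightarrow> T \<subseteq> Q \<Longrightarrow> y \<in> T \<Longrightarrow> T \<inter> W \<noteq> {} \<Longrightarrow> T \<inter> K \<noteq> {}"
    and M: "\<And>q. q \<in> K \<Longrightarrow> U q \<le> M" "M < 1"
  shows "U y \<le> M"
proof (rule ccontr)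
  assume "\<not> U y \<le> M"
  then have My: "M < U y" by simp
  have clK: "closed K" using K(1) by (auto simp: tame_continuum_def intro: compact_imp_closed)
  have conK: "connected K" "K \<subseteq> Q" using K(1) by (auto simp: tame_continuum_def)
  have yQ: "y \<in> Q" using y E_subset by blast
  have yK: "y \<notin> K" using M(1)[of y] My by auto
  define V where "V = connected_component_set (Q - K) y"
  have Vop: "openin (top_of_set Q) V" unfolding V_def by (rule openin_component_diff[OF clK])
  have Vcon: "connected V" unfolding V_def by simp
  have Vsub: "V \<subseteq> Q" "V \<inter> K = {}" using connected_component_subset[of "Q - K" y] by (auto simp: V_def)
  have yV: "y \<in> V" using yQ yK by (simp add: V_def connected_component_refl)
  have VW: "V \<inter> W = {}" using sep[OF Vcon Vsub(1) yV] Vsub(2) by blast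
  have V3: "V \<inter> \<zeta>\<^sub>3 \<phi> = {}"
  proof (rule ccontr)
    assume "V \<inter> \<zeta>\<^sub>3 \<phi> \<noteq> {}"
    then have "connected (V \<union> \<zeta>\<^sub>3 \<phi>)" by (rule connected_Un[OF Vcon zeta_properties(2)])
    then have "(V \<union> \<zeta>\<^sub>3 \<phi>) \<inter> K \<noteq> {}" using Vsub(1) zeta_properties(4) yV W(4) by (intro sep) auto
    then obtain q where q: "q \<in> K" "q \<in> \<zeta>\<^sub>3 \<phi>" using Vsub(2) by blast
    then have "1 \<le> U q" using K(2) by (intro U_ge_1) auto
    then show False using M(1)[OF q(1)] M(2) by simp
  qed
  have conQ: "connected Q" using connected_image_\<phi>[OF convex_connected[OF convex_unit_square]] image_\<phi> by simp
  have M0: "0 \<le> M"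
  proof -
    have "Q \<inter> K \<noteq> {}" using sep[OF conQ order_refl yQ] W(2,4) by blast
    then obtain q where "q \<in> K" by blast
    then show ?thesis using M(1)[of q] U_nonneg[of q] by linarith
  qed
  \<comment> \<open>The set \<open>V \<inter> N\<close> is the largest relatively open part of \<open>V\<close> where \<open>u > M\<close> at all points of \<open>E\<close>.\<close>
  define N where "N = \<Union>{N. open N \<and> (\<forall>w\<in>N \<inter> V \<inter> E. M < U w)}"
  define G where "G = V \<inter> N"
  have Nop: "open N" unfolding N_def by (rule open_Union) blast
  have Gb [measurable]: "G \<in> sets borel"
  proof -
    obtain N' where N': "open N'" "V = Q \<inter> N'" using Vop by (auto simp: openin_open)
    then have "V \<in> sets borel" by simp
    then show ?thesis using Nop by (simp add: G_def)
  qed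
  have G1: "w \<in> V \<and> M < U w" if "w \<in> G \<inter> E" for w using that by (auto simp: G_def N_def)
  have UK: "U q \<le> M" if "q \<in> K \<inter> E" for q using M(1) that by blast
  have vanish: "(\<integral>\<^sup>+x\<in>Q. \<rho> x * indicator G x \<partial>hausdorff 2) = 0"
    by (rule minimizer_vanishes[OF Gb truncation_admissible[OF clK UK V_def V3 M0 M(2) Gb G1]])
  have heavy0: "(\<integral>\<^sup>+x\<in>Q. indicator heavy_set x \<partial>hausdorff 2) = 0"
  proof -
    have "(\<integral>\<^sup>+x\<in>Q. indicator heavy_set x \<partial>hausdorff 2) \<le> (\<integral>\<^sup>+x. indicator heavy_set x \<partial>(hausdorff 2 :: 'a measure))"
      by (intro nn_integral_mono) (auto split: split_indicator)
    also have "\<dots> = 0" using heavy_set_null by simp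
    finally show ?thesis by simp
  qed
  have G2: "z \<in> G \<union> heavy_set" if z: "z \<in> V \<inter> E" "M < U z" for z
  proof (cases "z \<in> heavy_set")
    case False
    have "z \<in> E" using z by blast
    then obtain N' where "open N'" "z \<in> N'" "\<And>w. w \<in> N' \<inter> E \<Longrightarrow> M < U w"
      using lower_semicontinuous_off_heavy_set[OF _ False z(2)] by metis
    then have "z \<in> N" unfolding N_def by blast
    then show ?thesis using z by (simp add: G_def)
  qed simp
  \<comment> \<open>Almost every level set of a distance function carries no mass of \<open>\<rho>\<close> on \<open>G\<close>, and no heavy points.\<close>
  have generic: "AE s in lebesgue. \<forall>K'. K' \<subseteq> {x \<in> Q. infdist x Z = s} \<longrightarrow>
      (\<integral>\<^sup>+x\<in>K'. \<rho> x * indicator G x \<partial>hausdorff 1) = 0 \<and> (\<integral>\<^sup>+x\<in>K'. indicator heavy_set x \<partial>hausdorff 1) = 0" for Z :: "'a set"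
  proof -
    have lip: "\<bar>infdist x Z - infdist x' Z\<bar> \<le> dist x x'" for x x' by (rule infdist_lipschitz)
    have "AE s in lebesgue. (\<integral>\<^sup>+x\<in>{x \<in> Q. infdist x Z = s}. \<rho> x * indicator G x \<partial>hausdorff 1) = 0"
      by (rule coarea_AE_zero[OF lip _ vanish]) measurable
    moreover have "AE s in lebesgue. (\<integral>\<^sup>+x\<in>{x \<in> Q. infdist x Z = s}. indicator heavy_set x \<partial>hausdorff 1) = 0"
      by (rule coarea_AE_zero[OF lip _ heavy0]) measurable
    ultimately show ?thesis
    proof eventually_elim
      case (elim s)
      show ?case
      proof (intro allI impI)
        fix K' assume K': "K' \<subseteq> {x \<in> Q. infdist x Z = s}"
        have mono: "(\<integral>\<^sup>+x\<in>K'. f x \<partial>hausdorff 1) \<le> (\<integral>\<^sup>+x\<in>{x \<in> Q. infdist x Z = s}. f x \<partial>hausdorff 1)" for f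
          using K' by (intro nn_integral_mono) (auto split: split_indicator)
        show "(\<integral>\<^sup>+x\<in>K'. \<rho> x * indicator G x \<partial>hausdorff 1) = 0 \<and> (\<integral>\<^sup>+x\<in>K'. indicator heavy_set x \<partial>hausdorff 1) = 0"
          using mono[of "\<lambda>x. \<rho> x * indicator G x"] mono[of "indicator heavy_set"] elim by simp
      qed
    qed
  qed
  have propagates: "p \<in> V \<and> M < U p"
    if "tame_continuum K'" "(\<integral>\<^sup>+x\<in>K'. \<rho> x * indicator G x \<partial>hausdorff 1) = 0" "(\<integral>\<^sup>+x\<in>K'. indicator heavy_set x \<partial>hausdorff 1) = 0"
      "q \<in> K'" "q \<in> V" "q \<in> E" "M < U q" "p \<in> K'" for K' q p
    using UK G2 by (rule superlevel_propagates[OF clK _ V_def Gb _ that])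
  define e where "e = (U y - M) / 2"
  have e: "e > 0" "M < U y - e" using My by (auto simp: e_def field_simps)
  have yW: "y \<notin> W" using yV VW by blast
  obtain w0 \<gamma> t d where sg: "w0 \<in> W" "t \<in> {0..1}" "tame_path \<gamma>" "\<gamma> 0 = y" "\<And>s. s \<in> {0..t} \<Longrightarrow> U y - e \<le> U (\<gamma> s)" "d > 0"
    and ae: "AE s in lebesgue. s \<in> {0<..<d} \<longrightarrow> (\<exists>K. tame_continuum K \<and> K \<subseteq> {x \<in> Q. infdist x {y} = s} \<and> \<gamma> ` {0..t} \<inter> K \<noteq> {} \<and>
     (\<forall>T. connected T \<longrightarrow> T \<subseteq> Q \<longrightarrow> y \<in> T \<longrightarrow> w0 \<in> T \<longrightarrow> T \<inter> K \<noteq> {}))"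
    by (rule short_circle[OF y W(5) yW e(1)]) blast
  obtain s L where s: "s \<in> {0<..<d}" and L: "tame_continuum L" "L \<subseteq> {x \<in> Q. infdist x {y} = s}" "\<gamma> ` {0..t} \<inter> L \<noteq> {}"
    and Lsep: "\<forall>T. connected T \<longrightarrow> T \<subseteq> Q \<longrightarrow> y \<in> T \<longrightarrow> w0 \<in> T \<longrightarrow> T \<inter> L \<noteq> {}"
    and Lzero: "(\<integral>\<^sup>+x\<in>L. \<rho> x * indicator G x \<partial>hausdorff 1) = 0" "(\<integral>\<^sup>+x\<in>L. indicator heavy_set x \<partial>hausdorff 1) = 0"
  proof -
    have "AE s in lebesgue. s \<in> {0<..<d} \<longrightarrow> (\<exists>K. tame_continuum K \<and> K \<subseteq> {x \<in> Q. infdist x {y} = s} \<and> \<gamma> ` {0..t} \<inter> K \<noteq> {} \<and>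
     (\<forall>T. connected T \<longrightarrow> T \<subseteq> Q \<longrightarrow> y \<in> T \<longrightarrow> w0 \<in> T \<longrightarrow> T \<inter> K \<noteq> {}) \<and>
     (\<integral>\<^sup>+x\<in>K. \<rho> x * indicator G x \<partial>hausdorff 1) = 0 \<and> (\<integral>\<^sup>+x\<in>K. indicator heavy_set x \<partial>hausdorff 1) = 0)"
      using ae generic[of "{y}"]
    proof eventually_elim
      case (elim s)
      show ?case
      proof
        assume "s \<in> {0<..<d}"
        from elim(1)[rule_format, OF this] obtain K where K: "tame_continuum K" "K \<subseteq> {x \<in> Q. infdist x {y} = s}" "\<gamma> ` {0..t} \<inter> K \<noteq> {}"
          "\<forall>T. connected T \<longrightarrow> T \<subseteq> Q \<longrightarrow> y \<in> T \<longrightarrow> w0 \<in> T \<longrightarrow> T \<inter> K \<noteq> {}" by (elim exE conjE)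
        show "\<exists>K. tame_continuum K \<and> K \<subseteq> {x \<in> Q. infdist x {y} = s} \<and> \<gamma> ` {0..t} \<inter> K \<noteq> {} \<and>
     (\<forall>T. connected T \<longrightarrow> T \<subseteq> Q \<longrightarrow> y \<in> T \<longrightarrow> w0 \<in> T \<longrightarrow> T \<inter> K \<noteq> {}) \<and>
     (\<integral>\<^sup>+x\<in>K. \<rho> x * indicator G x \<partial>hausdorff 1) = 0 \<and> (\<integral>\<^sup>+x\<in>K. indicator heavy_set x \<partial>hausdorff 1) = 0"
          by (rule exI[of _ K]) (intro conjI K elim(2)[rule_format, OF K(2), THEN conjunct1] elim(2)[rule_format, OF K(2), THEN conjunct2])
      qed
    qed
    from AE_interval_witness[OF this sg(6)] obtain s where "s \<in> {0<..<d}" "(\<exists>K. tame_continuum K \<and> K \<subseteq> {x \<in> Q. infdist x {y} = s} \<and> \<gamma> ` {0..t} \<inter> K \<noteq> {} \<and>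
     (\<forall>T. connected T \<longrightarrow> T \<subseteq> Q \<longrightarrow> y \<in> T \<longrightarrow> w0 \<in> T \<longrightarrow> T \<inter> K \<noteq> {}) \<and>
     (\<integral>\<^sup>+x\<in>K. \<rho> x * indicator G x \<partial>hausdorff 1) = 0 \<and> (\<integral>\<^sup>+x\<in>K. indicator heavy_set x \<partial>hausdorff 1) = 0)" .
    then show thesis by (elim exE conjE) (rule that)
  qed
  have LE: "L \<subseteq> E" and LV: "\<And>p. p \<in> L \<Longrightarrow> p \<in> V \<and> M < U p"
  proof -
    have J: "connected (\<gamma> ` {0..t})" "\<gamma> ` {0..t} \<subseteq> Q" "y \<in> \<gamma> ` {0..t}"
    proof -
      show "connected (\<gamma> ` {0..t})" using sg(2) by (intro connected_continuous_image tame_path_cont[OF sg(3)] connected_Icc) auto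
      show "\<gamma> ` {0..t} \<subseteq> Q" using tame_path_in_Q[OF sg(3)] sg(2) by auto
      show "y \<in> \<gamma> ` {0..t}" using sg(2,4) by (intro image_eqI[of _ _ 0]) auto
    qed
    have JE: "\<gamma> s' \<in> E" "M < U (\<gamma> s')" if "s' \<in> {0..t}" for s'
      using tame_path_in_E[OF sg(3), of 0 s'] sg(2,4) sg(5)[OF that] that y e(2) by auto
    have "\<gamma> ` {0..t} \<inter> K = {}" using JE(2) M(1) by (fastforce simp: not_less[symmetric])
    then have JV: "\<gamma> ` {0..t} \<subseteq> V" unfolding V_def using J by (intro connected_component_maximal) auto
    obtain s' where s': "s' \<in> {0..t}" "\<gamma> s' \<in> L" using L(3) by blast
    show "L \<subseteq> E" by (rule tame_continuum_subset_E[OF L(1) s'(2) JE(1)[OF s'(1)]])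
    have "\<gamma> s' \<in> V" using JV s'(1) by blast
    then show "p \<in> V \<and> M < U p" if "p \<in> L" for p using propagates[OF L(1) Lzero s'(2) _ JE[OF s'(1)] that] by blast
  qed
  have clL: "closed L" using L(1) by (auto simp: tame_continuum_def intro: compact_imp_closed)
  have conL: "connected L" "L \<subseteq> Q" using L(1) by (auto simp: tame_continuum_def)
  have yL: "y \<notin> L" using L(2) s by (auto simp: infdist_singleton)
  have w0: "w0 \<in> Q" "w0 \<notin> L" "w0 \<notin> K" using sg(1) W(2,3) VW LV by blast+
  let ?Ly = "connected_component_set (Q - L) y" and ?Lw = "connected_component_set (Q - L) w0" and ?Kw = "connected_component_set (Q - K) w0"
  have yw: "y \<in> ?Ly" "w0 \<in> ?Lw" "w0 \<in> ?Kw" using yQ yL w0 by (auto simp: connected_component_refl)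
  have subs: "?Ly \<subseteq> Q - L" "?Lw \<subseteq> Q - L" "?Kw \<subseteq> Q - K" by (rule connected_component_subset)+
  have o1: "openin (top_of_set Q) (?Ly \<inter> V)" by (intro openin_Int openin_component_diff clL Vop)
  have o2: "openin (top_of_set Q) (?Lw \<inter> ?Kw)" by (intro openin_Int openin_component_diff clL clK)
  have "?Ly \<inter> V \<noteq> {}" "?Lw \<inter> ?Kw \<noteq> {}" using yw yV by blast+
  then obtain Z P where Z: "compact Z" "connected Z" "Z \<subseteq> Q" and P: "compact P" "connected P" "P \<subseteq> Q" and ZP: "Z \<inter> P = {}"
    and meet: "Z \<inter> (?Ly \<inter> V) \<noteq> {}" "Z \<inter> (?Lw \<inter> ?Kw) \<noteq> {}" "P \<inter> (?Ly \<inter> V) \<noteq> {}" "P \<inter> (?Lw \<inter> ?Kw) \<noteq> {}"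
    using disjoint_connectors[OF o1 _ o2] by metis
  \<comment> \<open>Such a set joins the components of \<open>y\<close> and \<open>w0\<close> in \<open>Q - L\<close> and in \<open>Q - K\<close>, and both \<open>L\<close> and \<open>K\<close> separate these points.\<close>
  have hit: "B \<inter> L \<noteq> {}" "B \<inter> K \<noteq> {}"
    if B: "connected B" "B \<subseteq> Q" "B \<inter> (?Ly \<inter> V) \<noteq> {}" "B \<inter> (?Lw \<inter> ?Kw) \<noteq> {}" for B
  proof -
    have three: "connected (X \<union> B \<union> Y)" if "connected X" "connected Y" "X \<inter> B \<noteq> {}" "B \<inter> Y \<noteq> {}" for X Y
      using that B(1) by (intro connected_Un) blast+
    have "connected (?Ly \<union> B \<union> ?Lw)" using B(3,4) by (intro three) auto
    then have "(?Ly \<union> B \<union> ?Lw) \<inter> L \<noteq> {}" using subs B(2) yw by (intro Lsep[rule_format]) blast+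
    then show "B \<inter> L \<noteq> {}" using subs by blast
    have "connected (V \<union> B \<union> ?Kw)" using B(3,4) Vcon by (intro three) auto
    then have "(V \<union> B \<union> ?Kw) \<inter> K \<noteq> {}" using subs B(2) yw yV Vsub(1) sg(1) by (intro sep) blast+
    then show "B \<inter> K \<noteq> {}" using subs Vsub by blast
  qed
  have Zne: "Z \<noteq> {}" "P \<noteq> {}" using meet by blast+
  obtain d' where d': "d' > 0" "\<And>z. z \<in> P \<Longrightarrow> d' \<le> infdist z Z" using compact_positive_infdist[OF Z(1) P(1) ZP Zne(1)] by metis
  have "AE s in lebesgue. s \<in> {0<..<d'} \<longrightarrow> (\<exists>K'. tame_continuum K' \<and> K' \<subseteq> {x \<in> Q. infdist x Z = s} \<and>
     (\<forall>T. connected T \<longrightarrow> T \<subseteq> Q \<longrightarrow> T \<inter> Z \<noteq> {} \<longrightarrow> T \<inter> P \<noteq> {} \<longrightarrow> T \<inter> K' \<noteq> {}))"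
    using d'(2) by (rule generic_separator[OF Z(2,3) Zne(1) P(2,3) Zne(2)])
  then have "AE s in lebesgue. s \<in> {0<..<d'} \<longrightarrow> False"
    using generic[of Z]
  proof eventually_elim
    case (elim s)
    show ?case
    proof
      assume "s \<in> {0<..<d'}"
      from elim(1)[rule_format, OF this] obtain K' where K': "tame_continuum K'" "K' \<subseteq> {x \<in> Q. infdist x Z = s}"
        "\<forall>T. connected T \<longrightarrow> T \<subseteq> Q \<longrightarrow> T \<inter> Z \<noteq> {} \<longrightarrow> T \<inter> P \<noteq> {} \<longrightarrow> T \<inter> K' \<noteq> {}" by (elim exE conjE)
      have zero: "(\<integral>\<^sup>+x\<in>K'. \<rho> x * indicator G x \<partial>hausdorff 1) = 0" "(\<integral>\<^sup>+x\<in>K'. indicator heavy_set x \<partial>hausdorff 1) = 0"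
        using elim(2) K'(2) by blast+
      have "L \<inter> Z \<noteq> {}" "L \<inter> P \<noteq> {}" "K \<inter> Z \<noteq> {}" "K \<inter> P \<noteq> {}"
        using hit[OF Z(2,3) meet(1,2)] hit[OF P(2,3) meet(3,4)] by blast+
      then have "L \<inter> K' \<noteq> {}" "K \<inter> K' \<noteq> {}" using K'(3) conL conK by blast+
      then obtain q p where q: "q \<in> L" "q \<in> K'" and p: "p \<in> K" "p \<in> K'" by blast
      have "p \<in> V"
        using propagates[OF K'(1) zero q(2) _ _ _ p(2)] LV[OF q(1)] LE q(1) by blast
      then show False using p(1) Vsub(2) by blast
    qed
  qed
  from AE_interval_witness[OF this d'(1)] show False by blast
qed

section \<open>Oscillation of \<open>u\<close> on small balls\<close>

text \<open>The closure accounts for the points outside \<open>E\<close>, where \<open>u\<close> is a lower limit of values on \<open>E\<close>. Values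
above \<open>1\<close> are discarded because the maximum principle does not control them.\<close>

definition values_near :: "'a \<Rightarrow> real \<Rightarrow> real set" where
  "values_near x r = closure (U ` (E \<inter> ball x r)) \<inter> {..1}"

lemma closed_values_near: "closed (values_near x r)"
  unfolding values_near_def by (intro closed_Int closed_closure closed_atMost)

lemma emeasure_finite_cover_intervals:
  assumes fin: "finite I" and sub: "S \<subseteq> {1..} \<union> (\<Union>i\<in>I. {a i..b i})" and le: "\<And>i. i \<in> I \<Longrightarrow> a i \<le> (b i :: real)"
  shows "emeasure lborel (closure S \<inter> {..1}) \<le> (\<Sum>i\<in>I. ennreal (b i - a i))"
proof -
  have "closure S \<subseteq> {1..} \<union> (\<Union>i\<in>I. {a i..b i})"
    by (rule closure_minimal[OF sub]) (use fin in auto)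
  then have "closure S \<inter> {..1} \<subseteq> {1} \<union> (\<Union>i\<in>I. {a i..b i})" by auto
  then have "emeasure lborel (closure S \<inter> {..1}) \<le> emeasure lborel ({1} \<union> (\<Union>i\<in>I. {a i..b i}))"
    using fin by (intro emeasure_mono) (auto intro!: sets.Un sets.finite_UN simp del: Un_insert_left)
  also have "\<dots> \<le> emeasure lborel {1::real} + emeasure lborel (\<Union>i\<in>I. {a i..b i})"
    using fin by (intro emeasure_subadditive) auto
  also have "\<dots> \<le> 0 + (\<Sum>i\<in>I. emeasure lborel {a i..b i})"
    using fin by (intro add_mono emeasure_subadditive_finite) auto
  also have "\<dots> = (\<Sum>i\<in>I. ennreal (b i - a i))" using le by (auto intro: sum.cong)
  finally show ?thesis .
qed

lemma tame_continuum_range: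
  assumes K: "tame_continuum K" "K \<subseteq> E" "K \<noteq> {}" and fin: "(\<integral>\<^sup>+x\<in>K. \<rho> x \<partial>hausdorff 1) < \<infinity>"
  obtains a b where "a \<le> b" "\<And>q. q \<in> K \<Longrightarrow> a \<le> U q \<and> U q \<le> b" "ennreal (b - a) \<le> (\<integral>\<^sup>+x\<in>K. \<rho> x \<partial>hausdorff 1)"
proof -
  obtain c where c: "(\<integral>\<^sup>+x\<in>K. \<rho> x \<partial>hausdorff 1) = ennreal c" "c \<ge> 0"
    using fin by (cases "\<integral>\<^sup>+x\<in>K. \<rho> x \<partial>hausdorff 1") auto
  have osc: "\<bar>U p - U q\<bar> \<le> c" if "p \<in> K" "q \<in> K" for p q
    using tame_continuum_oscillation[OF K(1,2) that] c by simp
  obtain q0 where q0: "q0 \<in> K" using K(3) by blast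
  have le: "U p \<le> U q + c" if "p \<in> K" "q \<in> K" for p q using osc[OF that] by linarith
  have bdd: "bdd_below (U ` K)" "bdd_above (U ` K)"
  proof -
    have "U q0 - c \<le> U q" "U q \<le> U q0 + c" if "q \<in> K" for q using le[OF q0 that] le[OF that q0] by linarith+
    then show "bdd_below (U ` K)" "bdd_above (U ` K)" by (auto intro!: bdd_belowI2[of K "U q0 - c"] bdd_aboveI2[of K _ "U q0 + c"])
  qed
  have ne: "U ` K \<noteq> {}" using q0 by blast
  have bounds: "Inf (U ` K) \<le> U q \<and> U q \<le> Sup (U ` K)" if "q \<in> K" for q
    using that bdd by (intro conjI cInf_lower cSup_upper) auto
  have "Sup (U ` K) - c \<le> Inf (U ` K)"
  proof (rule cInf_greatest[OF ne])
    fix z assume "z \<in> U ` K"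
    then obtain q where q: "q \<in> K" "z = U q" by blast
    have "Sup (U ` K) \<le> U q + c" by (rule cSup_least[OF ne]) (use le q in auto)
    then show "Sup (U ` K) - c \<le> z" using q by simp
  qed
  then have "ennreal (Sup (U ` K) - Inf (U ` K)) \<le> ennreal c" by (intro ennreal_leI) simp
  moreover have "Inf (U ` K) \<le> Sup (U ` K)" using bounds[OF q0] by linarith
  ultimately show ?thesis using that bounds c(1) by metis
qed

text \<open>Every point near \<open>x\<close> is separated from \<open>W\<close> by a component of the circle, and by compactness finitely
many components suffice. If the point is in \<open>E\<close>, a tame path from it to \<open>W\<close> meets the component, which
then lies in \<open>E\<close>, and by the minimum and the maximum principle \<open>u\<close> at the point is between the
extremal values of \<open>u\<close> on the component or at least \<open>1\<close>. These values differ by at most the integral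
of \<open>\<rho>\<close> over the component, and the components are disjoint.\<close>

lemma values_near_le_circle:
  assumes x: "x \<in> Q" and r: "0 < r" "2 * r \<le> r0" and s: "r < s" "s < 2 * r"
    and W: "connected W" "W \<subseteq> Q" "W \<inter> cball x r0 = {}" "W \<inter> \<zeta>\<^sub>1 \<phi> \<noteq> {}" "W \<inter> \<zeta>\<^sub>3 \<phi> \<noteq> {}" "\<zeta>\<^sub>1 \<phi> \<subseteq> W \<or> \<zeta>\<^sub>3 \<phi> \<subseteq> W"
    and tame_continuum: "\<And>K. K \<in> components {p \<in> Q. infdist p {x} = s} \<Longrightarrow> tame_continuum K"
  shows "emeasure lborel (values_near x r) \<le> (\<integral>\<^sup>+p\<in>{p \<in> Q. infdist p {x} = s}. \<rho> p \<partial>hausdorff 1)"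
proof -
  define S where "S = {p \<in> Q. infdist p {x} = s}"
  have Sd: "dist x p = s" if "p \<in> S" for p using that by (simp add: S_def dist_commute)
  have WS: "W \<inter> S = {}"
  proof (rule ccontr)
    assume "W \<inter> S \<noteq> {}"
    then obtain p where "p \<in> W" "dist x p = s" using Sd by blast
    then have "p \<in> W \<inter> cball x r0" using s r by simp
    then show False using W(3) by blast
  qed
  have lip: "\<bar>infdist p {x} - infdist q {x}\<bar> \<le> dist p q" for p q by (rule infdist_lipschitz)
  have clS: "closed S" unfolding S_def by (rule level_set_closed(1)[OF lip])
  have [measurable]: "S \<in> sets borel" using clS by simp
  have Wne: "W \<noteq> {}" using W(4) by blast
  have "\<exists>C. C \<in> components S \<and> (\<forall>T. connected T \<longrightarrow> T \<subseteq> Q \<longrightarrow> z \<in> T \<longrightarrow> T \<inter> W \<noteq> {} \<longrightarrow> T \<inter> C \<noteq> {})"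
    if z: "z \<in> Q \<inter> cball x r" for z
  proof -
    obtain C where "C \<in> components {p \<in> Q. infdist p {x} = s}"
      "\<And>T. connected T \<Longrightarrow> T \<subseteq> Q \<Longrightarrow> T \<inter> {z} \<noteq> {} \<Longrightarrow> T \<inter> W \<noteq> {} \<Longrightarrow> T \<inter> C \<noteq> {}"
    proof (rule level_component_separates[OF level_set_closed(2)[OF lip] _ _ _ _ W(1,2) Wne, of "{z}" s])
      show "infdist z' {x} < s" if "z' \<in> {z}" for z' using that z s by (simp add: dist_commute)
      show "s < infdist w {x}" if "w \<in> W" for w
      proof -
        have "w \<notin> cball x r0" using that W(3) by blast
        then show ?thesis using s r by (simp add: dist_commute)
      qed
    qed (use z in auto)
    then show ?thesis unfolding S_def by blast
  qed
  then have "\<exists>C. \<forall>z\<in>Q \<inter> cball x r. C z \<in> components S \<and> (\<forall>T. connected T \<longrightarrow> T \<subseteq> Q \<longrightarrow> z \<in> T \<longrightarrow> T \<inter> W \<noteq> {} \<longrightarrow> T \<inter> C z \<noteq> {})"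
    by (intro bchoice ballI)
  then obtain C where "\<forall>z\<in>Q \<inter> cball x r. C z \<in> components S \<and> (\<forall>T. connected T \<longrightarrow> T \<subseteq> Q \<longrightarrow> z \<in> T \<longrightarrow> T \<inter> W \<noteq> {} \<longrightarrow> T \<inter> C z \<noteq> {})"
    by (elim exE)
  then have C: "C z \<in> components S" "\<And>T. connected T \<Longrightarrow> T \<subseteq> Q \<Longrightarrow> z \<in> T \<Longrightarrow> T \<inter> W \<noteq> {} \<Longrightarrow> T \<inter> C z \<noteq> {}"
    if "z \<in> Q \<inter> cball x r" for z using that by blast+
  have Cn: "tame_continuum (C z)" "C z \<subseteq> S" "C z \<noteq> {}" if "z \<in> Q \<inter> cball x r" for z
    using C(1)[OF that] tame_continuum in_components_subset in_components_nonempty unfolding S_def by blast+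
  have Ccl: "closed (C z)" if "z \<in> Q \<inter> cball x r" for z
    using Cn(1)[OF that] by (auto simp: tame_continuum_def intro: compact_imp_closed)
  let ?V = "\<lambda>z. connected_component_set (Q - C z) z"
  have "\<exists>N. open N \<and> ?V z = Q \<inter> N" if "z \<in> Q \<inter> cball x r" for z
    using openin_component_diff[OF Ccl[OF that]] by (auto simp: openin_open)
  then have "\<exists>N. \<forall>z\<in>Q \<inter> cball x r. open (N z) \<and> ?V z = Q \<inter> N z" by (intro bchoice ballI)
  then obtain N where "\<forall>z\<in>Q \<inter> cball x r. open (N z) \<and> ?V z = Q \<inter> N z" by (elim exE)
  then have N: "open (N z)" "?V z = Q \<inter> N z" if "z \<in> Q \<inter> cball x r" for z using that by blast+
  have zV: "z \<in> ?V z" if "z \<in> Q \<inter> cball x r" for z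
  proof -
    have "z \<notin> C z" using Cn(2)[OF that] Sd[of z] that s by force
    then show ?thesis using that by (simp add: connected_component_refl)
  qed
  have "compact (Q \<inter> cball x r)" by (intro compact_Int_closed compact_Q closed_cball)
  moreover have "Q \<inter> cball x r \<subseteq> \<Union> (N ` (Q \<inter> cball x r))" using zV N(2) by blast
  ultimately obtain D where D: "D \<subseteq> Q \<inter> cball x r" "finite D" "Q \<inter> cball x r \<subseteq> \<Union> (N ` D)"
    using N(1) compactE_image[of "Q \<inter> cball x r" "Q \<inter> cball x r" N] by metis
  have hit: "\<exists>z\<in>D. C z \<subseteq> E \<and> (\<forall>T. connected T \<longrightarrow> T \<subseteq> Q \<longrightarrow> y \<in> T \<longrightarrow> T \<inter> W \<noteq> {} \<longrightarrow> T \<inter> C z \<noteq> {})"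
    if y: "y \<in> E" "y \<in> ball x r" for y
  proof -
    have yQ: "y \<in> Q" using y(1) E_subset by blast
    then have "y \<in> Q \<inter> cball x r" using y(2) by auto
    then obtain z where z: "z \<in> D" "y \<in> N z" using D(3) by blast
    then have zQ: "z \<in> Q \<inter> cball x r" using D(1) by blast
    have yV: "y \<in> ?V z" using N(2)[OF zQ] z(2) yQ by blast
    have sub: "?V z \<subseteq> Q - C z" by (rule connected_component_subset)
    have sep: "T \<inter> C z \<noteq> {}" if T: "connected T" "T \<subseteq> Q" "y \<in> T" "T \<inter> W \<noteq> {}" for T
    proof -
      have "connected (?V z \<union> T)" using yV T(1,3) by (intro connected_Un) auto
      then have "(?V z \<union> T) \<inter> C z \<noteq> {}" using sub T(2,4) zV[OF zQ] by (intro C(2)[OF zQ]) blast+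
      then show ?thesis using sub by blast
    qed
    obtain \<gamma> where j: "joins \<gamma> {y} W" using tame_path_to[OF y(1) W(6)] .
    have g: "tame_path \<gamma>" "\<gamma> 0 = y" "\<gamma> 1 \<in> W" using j by (auto simp: joins_def pathstart_def pathfinish_def)
    have "\<gamma> 0 \<in> path_image \<gamma>" "\<gamma> 1 \<in> path_image \<gamma>" by (auto simp: path_image_def)
    then have "path_image \<gamma> \<inter> C z \<noteq> {}" using joins_connected_image[OF j] g by (intro sep) auto
    then obtain t where t: "t \<in> {0..1}" "\<gamma> t \<in> C z" unfolding path_image_def by blast
    have "\<gamma> t \<in> E" using tame_path_in_E[OF g(1) _ _ t(1), of 0] g(2) y(1) by simp
    then have "C z \<subseteq> E" using tame_continuum_subset_E[OF Cn(1)[OF zQ] t(2)] by blast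
    then show ?thesis using z(1) sep by blast
  qed
  define I where "I = {K \<in> C ` D. K \<subseteq> E}"
  have finI: "finite I" using D(2) by (simp add: I_def)
  have I: "tame_continuum K" "K \<subseteq> E" "K \<noteq> {}" "K \<subseteq> S" "K \<in> components S" if "K \<in> I" for K
  proof -
    obtain z where z: "z \<in> D" "K = C z" using \<open>K \<in> I\<close> by (auto simp: I_def)
    then have zQ: "z \<in> Q \<inter> cball x r" using D(1) by blast
    show "tame_continuum K" "K \<noteq> {}" "K \<subseteq> S" "K \<in> components S" unfolding z(2) by (rule Cn[OF zQ] C(1)[OF zQ])+
    show "K \<subseteq> E" using that by (simp add: I_def)
  qed
  have sum_le: "(\<Sum>K\<in>I. \<integral>\<^sup>+p\<in>K. \<rho> p \<partial>hausdorff 1) \<le> (\<integral>\<^sup>+p\<in>S. \<rho> p \<partial>hausdorff 1)"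
  proof -
    have disj: "disjoint_family_on (\<lambda>K. K) I"
      using components_nonoverlap[of _ S] I(5) unfolding disjoint_family_on_def by blast
    have "(\<Sum>K\<in>I. \<integral>\<^sup>+p\<in>K. \<rho> p \<partial>hausdorff 1) = (\<integral>\<^sup>+p. (\<Sum>K\<in>I. \<rho> p * indicator K p) \<partial>hausdorff 1)"
    proof (rule nn_integral_sum[symmetric])
      fix K assume "K \<in> I"
      then have [measurable]: "K \<in> sets borel" by (rule tame_continuum_borel[OF I(1)])
      show "(\<lambda>p. \<rho> p * indicator K p) \<in> borel_measurable (hausdorff 1)" by measurable
    qed
    also have "\<dots> = (\<integral>\<^sup>+p. \<rho> p * indicator (\<Union>K\<in>I. K) p \<partial>hausdorff 1)"
      by (simp only: indicator_UN_disjoint[OF finI disj] sum_distrib_left)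
    also have "\<dots> \<le> (\<integral>\<^sup>+p\<in>S. \<rho> p \<partial>hausdorff 1)"
      using I(4) by (intro nn_integral_mono) (auto split: split_indicator)
    finally show ?thesis .
  qed
  show ?thesis
  proof (cases "(\<integral>\<^sup>+p\<in>S. \<rho> p \<partial>hausdorff 1) < \<infinity>")
    case False
    then show ?thesis by (simp add: S_def top_unique less_top[symmetric])
  next
    case True
    have "\<exists>ab. fst ab \<le> snd ab \<and> (\<forall>q\<in>K. fst ab \<le> U q \<and> U q \<le> snd ab) \<and> ennreal (snd ab - fst ab) \<le> (\<integral>\<^sup>+p\<in>K. \<rho> p \<partial>hausdorff 1)"
      if K: "K \<in> I" for K
    proof -
      have "(\<integral>\<^sup>+p\<in>K. \<rho> p \<partial>hausdorff 1) \<le> (\<integral>\<^sup>+p\<in>S. \<rho> p \<partial>hausdorff 1)"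
        using I(4)[OF K] by (intro nn_integral_mono) (auto split: split_indicator)
      then have "(\<integral>\<^sup>+p\<in>K. \<rho> p \<partial>hausdorff 1) < \<infinity>" using True by (rule order.strict_trans1)
      then obtain a b where "a \<le> b" "\<And>q. q \<in> K \<Longrightarrow> a \<le> U q \<and> U q \<le> b" "ennreal (b - a) \<le> (\<integral>\<^sup>+x\<in>K. \<rho> x \<partial>hausdorff 1)"
        by (rule tame_continuum_range[OF I(1-3)[OF K]]) blast
      then show ?thesis by (intro exI[of _ "(a, b)"]) auto
    qed
    then have "\<exists>ab. \<forall>K\<in>I. fst (ab K) \<le> snd (ab K) \<and> (\<forall>q\<in>K. fst (ab K) \<le> U q \<and> U q \<le> snd (ab K)) \<and>
        ennreal (snd (ab K) - fst (ab K)) \<le> (\<integral>\<^sup>+p\<in>K. \<rho> p \<partial>hausdorff 1)" by (intro bchoice ballI)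
    then obtain ab where "\<forall>K\<in>I. fst (ab K) \<le> snd (ab K) \<and> (\<forall>q\<in>K. fst (ab K) \<le> U q \<and> U q \<le> snd (ab K)) \<and>
        ennreal (snd (ab K) - fst (ab K)) \<le> (\<integral>\<^sup>+p\<in>K. \<rho> p \<partial>hausdorff 1)" by (elim exE)
    then have ab: "fst (ab K) \<le> snd (ab K)" "\<And>q. q \<in> K \<Longrightarrow> fst (ab K) \<le> U q" "\<And>q. q \<in> K \<Longrightarrow> U q \<le> snd (ab K)"
        "ennreal (snd (ab K) - fst (ab K)) \<le> (\<integral>\<^sup>+p\<in>K. \<rho> p \<partial>hausdorff 1)" if "K \<in> I" for K using that by blast+
    have "U ` (E \<inter> ball x r) \<subseteq> {1..} \<union> (\<Union>K\<in>I. {fst (ab K)..snd (ab K)})"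
    proof
      fix t assume "t \<in> U ` (E \<inter> ball x r)"
      then obtain y where y: "y \<in> E" "y \<in> ball x r" "t = U y" by blast
      obtain z where z: "z \<in> D" "C z \<subseteq> E" "\<forall>T. connected T \<longrightarrow> T \<subseteq> Q \<longrightarrow> y \<in> T \<longrightarrow> T \<inter> W \<noteq> {} \<longrightarrow> T \<inter> C z \<noteq> {}"
        using hit[OF y(1,2)] by (elim bexE conjE)
      define K where "K = C z"
      have K: "K \<in> I" using z by (auto simp: I_def K_def)
      have sep: "T \<inter> K \<noteq> {}" if "connected T" "T \<subseteq> Q" "y \<in> T" "T \<inter> W \<noteq> {}" for T
        unfolding K_def using z(3)[rule_format, OF that] .
      have WK: "W \<inter> K = {}" using WS I(4)[OF K] by blast
      have low: "fst (ab K) \<le> U y"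
        by (rule minimum_principle[OF I(2)[OF K] y(1) WK W(4) sep ab(2)[OF K]])
      have up: "U y \<le> snd (ab K)" if "snd (ab K) < 1"
        by (rule maximum_principle[OF I(1,2)[OF K] y(1) W(1,2) WK W(5,6) sep ab(3)[OF K] that])
      show "t \<in> {1..} \<union> (\<Union>K\<in>I. {fst (ab K)..snd (ab K)})"
      proof (cases "1 \<le> U y")
        case False
        then have "U y \<le> snd (ab K)" using up by (cases "snd (ab K) < 1") auto
        then show ?thesis using K low y(3) by auto
      qed (use y(3) in simp)
    qed
    from emeasure_finite_cover_intervals[OF finI this ab(1)]
    have "emeasure lborel (values_near x r) \<le> (\<Sum>K\<in>I. ennreal (snd (ab K) - fst (ab K)))" unfolding values_near_def .
    also have "\<dots> \<le> (\<Sum>K\<in>I. \<integral>\<^sup>+p\<in>K. \<rho> p \<partial>hausdorff 1)" by (intro sum_mono ab(4))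
    also note sum_le
    finally show ?thesis unfolding S_def .
  qed
qed

text \<open>Averaging over the circles of radius \<open>s \<in> (r,2r)\<close> by means of the coarea inequality.\<close>

lemma values_near_bound:
  obtains r0 where "r0 > 0" "\<And>x r. x \<in> Q \<Longrightarrow> 0 < r \<Longrightarrow> 2 * r \<le> r0 \<Longrightarrow>
    ennreal r * emeasure lborel (values_near x r) \<le> ennreal (4 / pi) * emeasure \<nu> (cball x (2 * r))"
proof -
  obtain r0 where r0: "r0 > 0" "\<And>x. x \<in> Q \<Longrightarrow> \<exists>W. connected W \<and> W \<subseteq> Q \<and> W \<inter> cball x r0 = {} \<and>
    W \<inter> \<zeta>\<^sub>1 \<phi> \<noteq> {} \<and> W \<inter> \<zeta>\<^sub>3 \<phi> \<noteq> {} \<and> (\<zeta>\<^sub>1 \<phi> \<subseteq> W \<or> \<zeta>\<^sub>3 \<phi> \<subseteq> W)" by (rule far_cross) blast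
  show ?thesis
  proof (rule that[OF r0(1)])
    fix x r assume x: "x \<in> Q" and r: "0 < r" "2 * r \<le> r0"
    obtain W where W: "connected W" "W \<subseteq> Q" "W \<inter> cball x r0 = {}" "W \<inter> \<zeta>\<^sub>1 \<phi> \<noteq> {}" "W \<inter> \<zeta>\<^sub>3 \<phi> \<noteq> {}" "\<zeta>\<^sub>1 \<phi> \<subseteq> W \<or> \<zeta>\<^sub>3 \<phi> \<subseteq> W"
      using r0(2)[OF x] by blast
    have lip: "\<bar>infdist p {x} - infdist q {x}\<bar> \<le> dist p q" for p q by (rule infdist_lipschitz)
    let ?I = "\<lambda>s. \<integral>\<^sup>+p\<in>{p \<in> Q. infdist p {x} = s}. \<rho> p * indicator (cball x (2 * r)) p \<partial>hausdorff 1"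
    have "AE s in lebesgue. s \<in> {r<..<2 * r} \<longrightarrow> emeasure lborel (values_near x r) \<le> ?I s"
      using AE_level_components_tame[OF lip]
    proof eventually_elim
      case (elim s)
      show ?case
      proof
        assume s: "s \<in> {r<..<2 * r}"
        have "emeasure lborel (values_near x r) \<le> (\<integral>\<^sup>+p\<in>{p \<in> Q. infdist p {x} = s}. \<rho> p \<partial>hausdorff 1)"
          by (rule values_near_le_circle[OF x r _ _ W]) (use s elim in auto)
        also have "\<dots> \<le> ?I s"
          using s by (intro nn_integral_mono) (auto split: split_indicator simp: dist_commute)
        finally show "emeasure lborel (values_near x r) \<le> ?I s" .
      qed
    qed
    then have "ennreal (2 * r - r) * emeasure lborel (values_near x r) \<le> upper_lebesgue_integral UNIV ?I"
      using r(1) by (intro upper_integral_ge_const) auto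
    also have "\<dots> \<le> ennreal (4 / pi) * (\<integral>\<^sup>+p\<in>Q. \<rho> p * indicator (cball x (2 * r)) p \<partial>hausdorff 2)"
      by (rule coarea_Q[OF lip]) (intro borel_measurable_times_ennreal \<rho>_borel borel_measurable_indicator, simp)
    also have "\<dots> = ennreal (4 / pi) * emeasure \<nu> (cball x (2 * r))" by (simp add: emeasure_\<nu>)
    finally show "ennreal r * emeasure lborel (values_near x r) \<le> ennreal (4 / pi) * emeasure \<nu> (cball x (2 * r))" by simp
  qed
qed

definition level :: "real \<Rightarrow> 'a set" where
  "level t = closure {x \<in> Q. harmonic_function Q \<phi> \<rho>k \<rho> x = ennreal t}"

lemma level_subset_Q: "level t \<subseteq> Q"
  unfolding level_def using closed_Q by (intro closure_minimal) auto

text \<open>A point where \<open>u = t\<close> is in \<open>E\<close> or a limit of points of \<open>E\<close> at which \<open>u\<close> tends to \<open>t\<close>.\<close>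

lemma level_in_values_near:
  assumes t: "t \<in> {0..1}" and z: "z \<in> level t" "z \<in> ball x r"
  shows "t \<in> values_near x r"
proof -
  obtain e where "e > 0" "ball z e \<subseteq> ball x r" using z(2) open_ball openE by blast
  then obtain y where "y \<in> Q" "harmonic_function Q \<phi> \<rho>k \<rho> y = ennreal t" "dist y z < e"
    using z(1) unfolding level_def closure_approachable by blast
  moreover from this have "y \<in> ball z e" by (simp add: dist_commute)
  ultimately have y: "y \<in> Q" "harmonic_function Q \<phi> \<rho>k \<rho> y = ennreal t" "y \<in> ball x r"
    using \<open>ball z e \<subseteq> ball x r\<close> by blast+
  have "t \<in> closure (U ` (E \<inter> ball x r))"
  proof (cases "y \<in> E")
    case True
    then have "v y = ennreal t" using y(2) by (simp add: harmonic_function_def)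
    then have "U y = t" using t by (simp add: U_def)
    then show ?thesis using True y(3) by (intro closure_subset[THEN subsetD]) blast
  next
    case False
    then have lim: "Liminf (at y within E) v = ennreal t" using y(2) by (simp add: harmonic_function_def)
    show ?thesis
      unfolding closure_approachable
    proof (intro allI impI)
      fix e :: real assume e: "e > 0"
      have "\<forall>\<^sub>F w in at y within E. w \<in> E \<inter> ball x r"
        unfolding eventually_at_topological using y(3) by (intro exI[of _ "ball x r"]) auto
      moreover have "\<forall>\<^sub>F w in at y within E. t - e < U w \<or> w \<notin> E"
      proof (cases "t < e")
        case True
        then have "t - e < U w" for w using U_nonneg[of w] by linarith
        then show ?thesis by simp
      next
        case False
        have "ennreal (t - e) < ennreal t" using e False by (intro ennreal_lessI) auto
        then have "ennreal (t - e) < Liminf (at y within E) v" using lim by simp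
        then have "\<forall>\<^sub>F w in at y within E. ennreal (t - e) < v w" by (rule less_LiminfD)
        then show ?thesis by eventually_elim (use False in \<open>auto simp: v_eq_U ennreal_less_iff\<close>)
      qed
      moreover have "\<exists>\<^sub>F w in at y within E. v w < ennreal (t + e)"
      proof (rule ccontr)
        assume "\<not> ?thesis"
        then have "\<forall>\<^sub>F w in at y within E. ennreal (t + e) \<le> v w" by (simp add: not_frequently not_less)
        then have "ennreal (t + e) \<le> ennreal t" unfolding lim[symmetric] by (rule Liminf_bounded)
        then show False using e t by simp
      qed
      ultimately have "\<exists>\<^sub>F w in at y within E. (t - e < U w \<or> w \<notin> E) \<and> w \<in> E \<inter> ball x r \<and> v w < ennreal (t + e)"
        by (intro frequently_eventually_conj)
      then obtain w where w: "w \<in> E \<inter> ball x r" "t - e < U w" "v w < ennreal (t + e)" by (auto dest!: frequently_ex)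
      have "U w < t + e" using w(1,3) e t by (auto simp: v_eq_U ennreal_less_iff U_nonneg)
      then show "\<exists>z\<in>U ` (E \<inter> ball x r). dist z t < e" using w by (intro bexI[of _ "U w"]) (auto simp: dist_real_def)
    qed
  qed
  then show ?thesis using t by (simp add: values_near_def)
qed

end

section \<open>Covering of the level sets\<close>

text \<open>The selection of Vitali's covering lemma, with ranks in place of radii. Zorn's lemma is applied to the disjoint
families in which a member of rank \<open>n\<close> is used only if all sets of smaller rank are met already, by members
whose ranks are no larger than theirs. If a maximal family failed to meet some set in this way, such a set of least rank could be
added to it.\<close>

lemma greedy_disjoint_subfamily:
  fixes B :: "'i \<Rightarrow> 'b set" and rank :: "'i \<Rightarrow> nat"
  assumes ne: "\<And>p. p \<in> P \<Longrightarrow> B p \<noteq> {}"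
  obtains M where "M \<subseteq> P" "disjoint_family_on B M"
    "\<And>p. p \<in> P \<Longrightarrow> \<exists>q\<in>M. rank q \<le> rank p \<and> B q \<inter> B p \<noteq> {}"
proof -
  define cov where "cov = (\<lambda>M p. \<exists>q\<in>M. rank q \<le> rank p \<and> B q \<inter> B p \<noteq> {})"
  define \<F> where "\<F> = {M. M \<subseteq> P \<and> disjoint_family_on B M \<and> (\<forall>q\<in>M. \<forall>p\<in>P. rank p < rank q \<longrightarrow> cov M p)}"
  have mono: "cov M p \<Longrightarrow> M \<subseteq> M' \<Longrightarrow> cov M' p" for M M' p unfolding cov_def by blast
  have "\<exists>M\<in>\<F>. \<forall>X\<in>\<F>. M \<subseteq> X \<longrightarrow> X = M"
  proof (rule subset_Zorn')
    fix \<C> assume "subset.chain \<F> \<C>"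
    then have sub: "\<C> \<subseteq> \<F>" and chain: "\<And>X Y. X \<in> \<C> \<Longrightarrow> Y \<in> \<C> \<Longrightarrow> X \<subseteq> Y \<or> Y \<subseteq> X"
      unfolding subset.chain_def by blast+
    have "\<Union>\<C> \<subseteq> P" using sub unfolding \<F>_def by blast
    moreover have "disjoint_family_on B (\<Union>\<C>)"
      unfolding disjoint_family_on_def
    proof (intro ballI impI)
      fix p q assume pq: "p \<in> \<Union>\<C>" "q \<in> \<Union>\<C>" "p \<noteq> q"
      then obtain X Y where XY: "X \<in> \<C>" "p \<in> X" "Y \<in> \<C>" "q \<in> Y" by blast
      then obtain Z where "Z \<in> \<C>" "p \<in> Z" "q \<in> Z" using chain[OF XY(1,3)] by blast
      moreover from this have "disjoint_family_on B Z" using sub unfolding \<F>_def by blast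
      ultimately show "B p \<inter> B q = {}" using pq(3) unfolding disjoint_family_on_def by blast
    qed
    moreover have "cov (\<Union>\<C>) p" if q: "q \<in> \<Union>\<C>" "p \<in> P" "rank p < rank q" for p q
    proof -
      obtain X where X: "X \<in> \<C>" "q \<in> X" using q(1) by blast
      then have "cov X p" using sub q(2,3) unfolding \<F>_def by blast
      then show ?thesis by (rule mono) (use X in blast)
    qed
    ultimately show "\<Union>\<C> \<in> \<F>" unfolding \<F>_def by blast
  qed
  then obtain M where M: "M \<in> \<F>" "\<And>X. X \<in> \<F> \<Longrightarrow> M \<subseteq> X \<Longrightarrow> X = M" by blast
  have "p \<in> P \<longrightarrow> cov M p" for p
  proof (induction "rank p" arbitrary: p rule: less_induct)
    case less
    show ?case
    proof (rule impI, rule ccontr)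
      assume p: "p \<in> P" and n: "\<not> cov M p"
      have le: "rank q \<le> rank p" if "q \<in> M" for q
        using M(1) that p n unfolding \<F>_def by (force simp: not_le[symmetric])
      have dj: "B q \<inter> B p = {}" if "q \<in> M" for q using le[OF that] n that unfolding cov_def by blast
      have "insert p M \<in> \<F>"
      proof -
        have "disjoint_family_on B M" "M \<subseteq> P" using M(1) unfolding \<F>_def by blast+
        then have "disjoint_family_on B (insert p M)" using dj unfolding disjoint_family_on_def by blast
        moreover have "cov (insert p M) p'" if "q \<in> insert p M" "p' \<in> P" "rank p' < rank q" for p' q
        proof (rule mono)
          have "rank p' < rank p" using that le[of q] by auto
          then show "cov M p'" using less that(2) by blast
        qed blast
        ultimately show ?thesis using p \<open>M \<subseteq> P\<close> unfolding \<F>_def by blast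
      qed
      then have "insert p M = M" using M(2) by blast
      then have "p \<in> M" by blast
      then show False using dj ne[OF p] by blast
    qed
  qed
  then show ?thesis using that M(1) unfolding \<F>_def cov_def by blast
qed

lemma compact_separated_finite:
  fixes Q :: "'b::metric_space set"
  assumes Q: "compact Q" and D: "D \<subseteq> Q" "\<And>p q. p \<in> D \<Longrightarrow> q \<in> D \<Longrightarrow> p \<noteq> q \<Longrightarrow> e \<le> dist p q" and e: "e > 0"
  shows "finite D"
proof -
  have "e / 2 > 0" using e by simp
  then obtain F where F: "finite F" "Q \<subseteq> (\<Union>x\<in>F. ball x (e / 2))"
    using Q unfolding compact_eq_totally_bounded by blast
  have "\<exists>x\<in>F. dist x p < e / 2" if "p \<in> D" for p using that D(1) F(2) by (auto simp: subset_iff)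
  then obtain f where f: "\<And>p. p \<in> D \<Longrightarrow> f p \<in> F \<and> dist (f p) p < e / 2" by metis
  have "inj_on f D"
  proof (rule inj_onI, rule ccontr)
    fix p q assume pq: "p \<in> D" "q \<in> D" "f p = f q" "p \<noteq> q"
    have "dist p q \<le> dist (f p) p + dist (f p) q" using dist_triangle2[of p q "f p"] by (simp add: dist_commute)
    also have "\<dots> < e" using f[OF pq(1)] f[OF pq(2)] pq(3) by simp
    finally show False using D(2)[OF pq(1,2,4)] by simp
  qed
  moreover have "f ` D \<subseteq> F" using f by blast
  ultimately show ?thesis using F(1) by (rule inj_on_finite)
qed

lemma eventually_small_scale:
  fixes a e :: real
  assumes "e > 0"
  obtains N where "\<And>n. N \<le> n \<Longrightarrow> a / 5 ^ n < e"
proof -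
  have "\<forall>\<^sub>F n in sequentially. a / 5 ^ n < e"
    using LIMSEQ_divide_realpow_zero[of 5 a] assms by (intro order_tendstoD(2)) auto
  then obtain N where "\<forall>n\<ge>N. a / 5 ^ n < e" unfolding eventually_sequentially by blast
  then show ?thesis using that by blast
qed

lemma ediam_le: "(\<And>x y. x \<in> A \<Longrightarrow> y \<in> A \<Longrightarrow> dist x y \<le> d) \<Longrightarrow> ediam A \<le> ennreal d"
  unfolding ediam_def by (auto intro!: SUP_least ennreal_leI)

lemma hausdorff_pre_UN_le:
  assumes "k > 0" "\<epsilon> > 0"
  shows "hausdorff_pre k \<epsilon> (\<Union>i. A i :: 'b::metric_space set) \<le> (\<Sum>i. hausdorff_pre k \<epsilon> (A i))"
proof -
  have "countably_subadditive (Pow UNIV) (hausdorff_pre k \<epsilon> :: 'b set \<Rightarrow> ennreal)"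
    using hausdorff_pre_outer_measure_space[OF assms] unfolding outer_measure_space_def by blast
  then have "hausdorff_pre k \<epsilon> (\<Union>i. disjointed A i) \<le> (\<Sum>i. hausdorff_pre k \<epsilon> (disjointed A i))"
    unfolding countably_subadditive_def using disjoint_family_disjointed[of A] by blast
  also have "\<dots> \<le> (\<Sum>i. hausdorff_pre k \<epsilon> (A i))"
    by (intro suminf_le allI hausdorff_pre_mono disjointed_subset) auto
  finally show ?thesis by (simp add: UN_disjointed_eq)
qed

context minimizing_square
begin

definition oscillation_radius :: "real \<Rightarrow> bool" where
  "oscillation_radius r0 \<longleftrightarrow> (\<forall>x r. x \<in> Q \<longrightarrow> 0 < r \<longrightarrow> 2 * r \<le> r0 \<longrightarrow>
    ennreal r * emeasure lborel (values_near x r) \<le> ennreal (4 / pi) * emeasure \<nu> (cball x (2 * r)))"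

text \<open>Only those sets of the cover contribute to the content of \<open>level t\<close> for which \<open>t\<close> is among the values near
them; sets of diameter \<open>0\<close> never contribute.\<close>

lemma level_cover_bound:
  assumes r0: "oscillation_radius r0" and \<epsilon>: "\<epsilon> > 0" and cover: "S \<subseteq> (\<Union>j. A j)"
    and d: "\<And>j. ediam (A j) \<le> ennreal (d j)" "\<And>j. 0 \<le> d j" "\<And>j. d j < \<epsilon>"
    and b: "\<And>j. d j = 0 \<or> (\<exists>x R. x \<in> Q \<and> 0 < R \<and> 2 * R \<le> r0 \<and> A j \<subseteq> ball x R \<and>
      ennreal (d j * (4 / (pi * R))) * emeasure \<nu> (cball x (2 * R)) \<le> b j)"
  shows "upper_lebesgue_integral {0..1} (\<lambda>t. hausdorff_pre 1 \<epsilon> (level t \<inter> S)) \<le> (\<Sum>j. b j)"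
proof -
  have "\<exists>F. closed F \<and> ennreal (d j) * emeasure lborel F \<le> b j \<and>
      (\<forall>t\<in>{0..1}. level t \<inter> A j \<noteq> {} \<longrightarrow> d j = 0 \<or> t \<in> F)" for j
  proof (cases "d j = 0")
    case False
    then obtain x R where xR: "x \<in> Q" "0 < R" "2 * R \<le> r0" "A j \<subseteq> ball x R"
      "ennreal (d j * (4 / (pi * R))) * emeasure \<nu> (cball x (2 * R)) \<le> b j" using b by blast
    have dR: "d j = d j / R * R" "0 \<le> d j / R" using xR(2) d(2)[of j] by auto
    have "ennreal (d j) = ennreal (d j / R) * ennreal R"
      using dR xR(2) by (subst ennreal_mult[symmetric]) auto
    then have "ennreal (d j) * emeasure lborel (values_near x R) = ennreal (d j / R) * (ennreal R * emeasure lborel (values_near x R))"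
      by (simp add: mult.assoc)
    also have "\<dots> \<le> ennreal (d j / R) * (ennreal (4 / pi) * emeasure \<nu> (cball x (2 * R)))"
      using r0 xR(1-3) unfolding oscillation_radius_def by (intro mult_left_mono) auto
    also have "\<dots> = ennreal (d j * (4 / (pi * R))) * emeasure \<nu> (cball x (2 * R))"
      using dR(2) by (simp add: mult.assoc[symmetric] ennreal_mult[symmetric] mult.commute)
    also note xR(5)
    finally have "ennreal (d j) * emeasure lborel (values_near x R) \<le> b j" .
    moreover have "t \<in> values_near x R" if "t \<in> {0..1}" "level t \<inter> A j \<noteq> {}" for t
      using level_in_values_near[OF that(1)] that(2) xR(4) by blast
    ultimately show ?thesis by (intro exI[of _ "values_near x R"]) (use closed_values_near in blast)
  qed (auto intro!: exI[of _ "{}"])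
  then have "\<exists>F. \<forall>j. closed (F j) \<and> ennreal (d j) * emeasure lborel (F j) \<le> b j \<and>
      (\<forall>t\<in>{0..1}. level t \<inter> A j \<noteq> {} \<longrightarrow> d j = 0 \<or> t \<in> F j)" by (intro choice allI)
  then obtain F where "\<forall>j. closed (F j) \<and> ennreal (d j) * emeasure lborel (F j) \<le> b j \<and>
      (\<forall>t\<in>{0..1}. level t \<inter> A j \<noteq> {} \<longrightarrow> d j = 0 \<or> t \<in> F j)" by (elim exE)
  then have F: "closed (F j)" "ennreal (d j) * emeasure lborel (F j) \<le> b j"
    "\<And>t. t \<in> {0..1} \<Longrightarrow> level t \<inter> A j \<noteq> {} \<Longrightarrow> d j = 0 \<or> t \<in> F j" for j by blast+
  have Fb [measurable]: "F j \<in> sets borel" for j using F(1) by simp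
  have meas: "(\<lambda>t. ennreal (d j) * indicator (F j) t) \<in> borel_measurable (lebesgue_on {0..1})" for j
    by (rule measurable_restrict_space1, rule measurable_completion) measurable
  have pointwise: "hausdorff_pre 1 \<epsilon> (level t \<inter> S) \<le> (\<Sum>j. ennreal (d j) * indicator (F j) t)" if t: "t \<in> {0..1}" for t
  proof -
    define B where "B = (\<lambda>j. level t \<inter> A j)"
    have "hausdorff_pre 1 \<epsilon> (level t \<inter> S) \<le> (\<Sum>j. ennreal (hausdorff_const 1) * ediam (B j) ^ 1)"
    proof (rule hausdorff_pre_le)
      show "level t \<inter> S \<subseteq> (\<Union>j. B j)" using cover by (auto simp: B_def)
      show "ediam (B j) < ennreal \<epsilon>" for j
      proof -
        have "ediam (B j) \<le> ediam (A j)" by (rule ediam_mono) (simp add: B_def)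
        also have "\<dots> \<le> ennreal (d j)" by (rule d(1))
        also have "\<dots> < ennreal \<epsilon>" using d(3) \<epsilon> by (intro ennreal_lessI)
        finally show ?thesis .
      qed
    qed
    also have "\<dots> \<le> (\<Sum>j. ennreal (d j) * indicator (F j) t)"
    proof (intro suminf_le allI)
      fix j
      have "ediam (B j) \<le> ennreal (d j) * indicator (F j) t"
      proof (cases "B j = {}")
        case False
        have "ediam (B j) \<le> ediam (A j)" by (rule ediam_mono) (simp add: B_def)
        then have "ediam (B j) \<le> ennreal (d j)" using d(1)[of j] by (rule order_trans)
        moreover have "d j = 0 \<or> t \<in> F j" using F(3)[OF t] False by (simp add: B_def)
        ultimately show ?thesis by auto
      qed simp
      then show "ennreal (hausdorff_const 1) * ediam (B j) ^ 1 \<le> ennreal (d j) * indicator (F j) t"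
        by (simp add: hausdorff_const_def)
    qed auto
    finally show ?thesis .
  qed
  have "upper_lebesgue_integral {0..1} (\<lambda>t. hausdorff_pre 1 \<epsilon> (level t \<inter> S))
      \<le> (\<integral>\<^sup>+t. (\<Sum>j. ennreal (d j) * indicator (F j) t) \<partial>lebesgue_on {0..1})"
    using meas pointwise by (intro upper_integral_le borel_measurable_suminf_order) auto
  also have "\<dots> = (\<Sum>j. \<integral>\<^sup>+t. ennreal (d j) * indicator (F j) t \<partial>lebesgue_on {0..1})"
    using meas by (rule nn_integral_suminf)
  also have "\<dots> \<le> (\<Sum>j. b j)"
  proof (intro suminf_le allI)
    fix j
    have "(\<integral>\<^sup>+t. ennreal (d j) * indicator (F j) t \<partial>lebesgue_on {0..1})
        = (\<integral>\<^sup>+t. ennreal (d j) * indicator (F j) t * indicator {0..1} t \<partial>lebesgue)"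
      by (rule nn_integral_restrict_space) simp
    also have "\<dots> \<le> (\<integral>\<^sup>+t. ennreal (d j) * indicator (F j) t \<partial>lebesgue)"
      by (intro nn_integral_mono) (auto split: split_indicator)
    also have "\<dots> = ennreal (d j) * emeasure lborel (F j)" by (simp add: nn_integral_completion nn_integral_cmult_indicator)
    also note F(2)
    finally show "(\<integral>\<^sup>+t. ennreal (d j) * indicator (F j) t \<partial>lebesgue_on {0..1}) \<le> b j" .
  qed auto
  finally show ?thesis .
qed

text \<open>The pairs of a centre and a scale where the mass grows at most by the factor 50 when the radius is multiplied
by 5. The factor has to exceed \<open>5\<^sup>2\<close>, so that a failure at all small scales lets the mass decay faster
than the square of the radius.\<close>

definition doubling_points :: "real \<Rightarrow> ('a \<times> nat) set" where
  "doubling_points a = {(x, n). x \<in> Q \<and> measure \<nu> (cball x (5 * (a / 5 ^ n))) \<le> 50 * measure \<nu> (cball x (a / 5 ^ n))}"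

lemma emeasure_\<nu>_measure: "emeasure \<nu> S = ennreal (measure \<nu> S)"
  using \<nu>_finite'[of S] by (simp add: emeasure_eq_ennreal_measure less_top)

text \<open>Select disjoint balls at doubling scales, larger ones first. A ball that is not selected meets a selected one
that is at least as large, so the selected balls enlarged by \<open>5/2\<close> cover. Such a ball of radius
\<open>R = 5/2 * r\<close> contributes at most \<open>2 * R\<close> times the length \<open>(4 / \<pi>) \<nu>(B(x,2R)) / R\<close> of the set
of values, which is at most \<open>8 / \<pi> * 50\<close> times the mass of the ball of radius \<open>r\<close>; and these balls
are disjoint subsets of \<open>G\<close>.\<close>

lemma doubling_part_bound:
  assumes r0: "oscillation_radius r0" and a: "a > 0" "5 * a \<le> r0" "5 * a < \<epsilon>" and G: "open G"
  shows "upper_lebesgue_integral {0..1} (\<lambda>t. hausdorff_pre 1 \<epsilon>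
      (level t \<inter> {x. \<exists>n. (x, n) \<in> doubling_points a \<and> cball x (a / 5 ^ n) \<subseteq> G})) \<le> ennreal (400 / pi) * emeasure \<nu> G"
proof -
  define P where "P = {(x, n). (x, n) \<in> doubling_points a \<and> cball x (a / 5 ^ n) \<subseteq> G}"
  define rad where "rad = (\<lambda>p :: 'a \<times> nat. a / 5 ^ snd p)"
  define B where "B = (\<lambda>p. cball (fst p) (rad p))"
  have rad: "rad p > 0" "rad p \<le> a" for p
  proof -
    show "rad p > 0" using a(1) by (simp add: rad_def)
    have "a * 1 \<le> a * 5 ^ snd p" using a(1) by (intro mult_left_mono) auto
    then show "rad p \<le> a" by (simp add: rad_def divide_le_eq)
  qed
  have "B p \<noteq> {}" for p using rad(1)[of p] by (simp add: B_def)
  then obtain M where M: "M \<subseteq> P" "disjoint_family_on B M"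
    and greedy: "\<And>p. p \<in> P \<Longrightarrow> \<exists>q\<in>M. snd q \<le> snd p \<and> B q \<inter> B p \<noteq> {}"
    by (rule greedy_disjoint_subfamily[of P B snd]) blast
  have MP: "fst p \<in> Q" "measure \<nu> (cball (fst p) (5 * rad p)) \<le> 50 * measure \<nu> (B p)" "B p \<subseteq> G" if "p \<in> M" for p
  proof -
    have "p \<in> P" using that M(1) by blast
    then show "fst p \<in> Q" "measure \<nu> (cball (fst p) (5 * rad p)) \<le> 50 * measure \<nu> (B p)" "B p \<subseteq> G"
      by (auto simp: P_def doubling_points_def rad_def B_def split: prod.splits)
  qed
  have "countable M"
  proof -
    have "finite {x. (x, n) \<in> M}" for n
    proof (rule compact_separated_finite[OF compact_Q])
      show "{x. (x, n) \<in> M} \<subseteq> Q" using MP(1) by force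
      show "rad (undefined, n) > 0" by (rule rad)
      fix p q assume pq: "p \<in> {x. (x, n) \<in> M}" "q \<in> {x. (x, n) \<in> M}" "p \<noteq> q"
      then have "B (p, n) \<inter> B (q, n) = {}" using M(2) unfolding disjoint_family_on_def by blast
      moreover have "p \<in> B (p, n)" using rad(1)[of "(p, n)"] by (simp add: B_def)
      ultimately have "p \<notin> B (q, n)" by blast
      then show "rad (undefined, n) \<le> dist p q" by (simp add: B_def rad_def dist_commute)
    qed
    then have "countable (\<Union>n. (\<lambda>x. (x, n)) ` {x. (x, n) \<in> M})" by (intro countable_UN countable_image) (auto intro: countable_finite)
    moreover have "M \<subseteq> (\<Union>n. (\<lambda>x. (x, n)) ` {x. (x, n) \<in> M})" by auto
    ultimately show ?thesis by (rule countable_subset[rotated])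
  qed
  define p where "p = (\<lambda>j. from_nat_into M j)"
  define J where "J = to_nat_on M ` M"
  have pJ: "p j \<in> M" "to_nat_on M (p j) = j" if "j \<in> J" for j
    using that \<open>countable M\<close> by (auto simp: p_def J_def)
  have surj: "\<exists>j\<in>J. p j = q" if "q \<in> M" for q
    using that \<open>countable M\<close> by (intro bexI[of _ "to_nat_on M q"]) (auto simp: p_def J_def)
  define A where "A = (\<lambda>j. if j \<in> J then ball (fst (p j)) (5/2 * rad (p j)) else {})"
  define d where "d = (\<lambda>j. if j \<in> J then 5 * rad (p j) else 0)"
  define C where "C = (\<lambda>j. if j \<in> J then B (p j) else {})"
  have "upper_lebesgue_integral {0..1} (\<lambda>t. hausdorff_pre 1 \<epsilon> (level t \<inter> {x. \<exists>n. (x, n) \<in> P}))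
      \<le> (\<Sum>j. ennreal (400 / pi) * emeasure \<nu> (C j))"
  proof (rule level_cover_bound[OF r0])
    show "\<epsilon> > 0" using a by linarith
    show "{x. \<exists>n. (x, n) \<in> P} \<subseteq> (\<Union>j. A j)"
    proof clarify
      fix x n assume "(x, n) \<in> P"
      then obtain q where q: "q \<in> M" "snd q \<le> n" "B q \<inter> B (x, n) \<noteq> {}" using greedy[of "(x, n)"] by auto
      obtain j where j: "j \<in> J" "p j = q" using surj[OF q(1)] by blast
      obtain w where "dist (fst q) w \<le> rad q" "dist x w \<le> rad (x, n)" using q(3) by (auto simp: B_def)
      moreover have "rad (x, n) \<le> rad q" using a(1) q(2) by (auto simp: rad_def intro!: divide_left_mono power_increasing)
      ultimately have "dist (fst q) x \<le> 2 * rad q" using dist_triangle2[of "fst q" x w] by linarith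
      then have "dist (fst q) x < 5/2 * rad q" using rad(1)[of q] by linarith
      then show "x \<in> (\<Union>j. A j)" using j by (auto simp: A_def intro!: exI[of _ j])
    qed
    show "ediam (A j) \<le> ennreal (d j)" for j
    proof (cases "j \<in> J")
      case True
      have "dist x y \<le> 5 * rad (p j)" if "x \<in> A j" "y \<in> A j" for x y
        using that True dist_triangle3[of x y "fst (p j)"] by (auto simp: A_def)
      then show ?thesis using True by (simp add: d_def ediam_le)
    qed (simp add: A_def)
    show "0 \<le> d j" "d j < \<epsilon>" for j using rad[of "p j"] a by (auto simp: d_def)
    fix j
    show "d j = 0 \<or> (\<exists>x R. x \<in> Q \<and> 0 < R \<and> 2 * R \<le> r0 \<and> A j \<subseteq> ball x R \<and>
      ennreal (d j * (4 / (pi * R))) * emeasure \<nu> (cball x (2 * R)) \<le> ennreal (400 / pi) * emeasure \<nu> (C j))"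
    proof (cases "j \<in> J")
      case True
      let ?x = "fst (p j)" and ?R = "5/2 * rad (p j)"
      have "ennreal (d j * (4 / (pi * ?R))) * emeasure \<nu> (cball ?x (2 * ?R)) = ennreal (8 / pi * measure \<nu> (cball ?x (5 * rad (p j))))"
        using True rad(1)[of "p j"] by (simp add: d_def emeasure_\<nu>_measure ennreal_mult[symmetric] field_simps)
      also have "\<dots> \<le> ennreal (8 / pi * (50 * measure \<nu> (C j)))"
        using MP(2)[OF pJ(1)[OF True]] True by (intro ennreal_leI mult_left_mono) (auto simp: C_def)
      also have "\<dots> = ennreal (400 / pi) * emeasure \<nu> (C j)"
        by (simp add: emeasure_\<nu>_measure ennreal_mult[symmetric] field_simps)
      finally show ?thesis using True MP(1)[OF pJ(1)[OF True]] rad[of "p j"] a(2)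
        by (intro disjI2 exI[of _ ?x] exI[of _ ?R]) (auto simp: A_def)
    qed (simp add: d_def)
  qed
  also have "\<dots> = ennreal (400 / pi) * (\<Sum>j. emeasure \<nu> (C j))" by simp
  also have "(\<Sum>j. emeasure \<nu> (C j)) = emeasure \<nu> (\<Union>j. C j)"
  proof (rule suminf_emeasure)
    show "disjoint_family C"
      unfolding disjoint_family_on_def
    proof (intro ballI impI)
      fix i j :: nat assume ij: "i \<noteq> j"
      show "C i \<inter> C j = {}"
      proof (cases "i \<in> J \<and> j \<in> J")
        case True
        then have "p i \<noteq> p j" using pJ(2) ij by metis
        then show ?thesis using True pJ(1) M(2) unfolding disjoint_family_on_def C_def by auto
      qed (auto simp: C_def)
    qed
  qed (auto simp: C_def B_def)
  also have "\<dots> \<le> emeasure \<nu> G"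
  proof (rule emeasure_mono)
    have "C j \<subseteq> G" for j using MP(3)[OF pJ(1)[of j]] by (auto simp: C_def)
    then show "(\<Union>j. C j) \<subseteq> G" by blast
  qed (use G in simp)
  finally show ?thesis by (simp add: P_def mult_left_mono)
qed

definition non_doubling :: "real \<Rightarrow> nat \<Rightarrow> 'a set" where
  "non_doubling a N = {x \<in> Q. \<forall>n\<ge>N. (x, n) \<notin> doubling_points a}"

lemma non_doubling_decay:
  assumes x: "x \<in> non_doubling a N" and n: "N \<le> n"
  shows "measure \<nu> (cball x (5 * (a / 5 ^ n))) \<le> measure \<nu> UNIV / 50 ^ (n - N)"
  using n
proof (induction n rule: dec_induct)
  case base
  have "ennreal (measure \<nu> (cball x (5 * (a / 5 ^ N)))) \<le> ennreal (measure \<nu> UNIV)"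
    unfolding emeasure_\<nu>_measure[symmetric] by (intro emeasure_mono) auto
  then show ?case by simp
next
  case (step n)
  have "50 * measure \<nu> (cball x (a / 5 ^ n)) \<le> measure \<nu> (cball x (5 * (a / 5 ^ n)))"
    using x step(1) by (force simp: non_doubling_def doubling_points_def)
  also note step.IH
  finally have "measure \<nu> (cball x (a / 5 ^ n)) \<le> measure \<nu> UNIV / 50 ^ (n - N) / 50" by simp
  also have "\<dots> = measure \<nu> UNIV / 50 ^ (Suc n - N)" using step(1) by (simp add: Suc_diff_le)
  finally show ?case by simp
qed

text \<open>As \<open>50 ^ n = 2 ^ n * (5 ^ n) ^ 2\<close> and \<open>d\<close> is comparable with \<open>a / 5 ^ n\<close>, the left-hand side is of
the order \<open>d ^ 2 / 2 ^ n\<close>.\<close>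

lemma non_doubling_estimate:
  fixes a d m :: real
  assumes "a > 0" "a / 5 ^ Suc n < d" "d \<le> a / 5 ^ n" "m \<ge> 0" "k \<le> n" "N \<le> n"
  shows "d * (4 / (pi * (5/2 * (a / 5 ^ n)))) * (m / 50 ^ (n - N)) \<le> (100 * m * 50 ^ N / a ^ 2 / 2 ^ k) * (pi / 4 * d ^ 2)"
proof -
  define q where "q = (5::real) ^ n"
  have q: "q > 0" by (simp add: q_def)
  have pi: "3 \<le> pi" using pi_gt3 by simp
  have d0: "d > 0" using assms(1,2) by (smt (verit) divide_pos_pos zero_less_power)
  have dq: "d * q \<le> a" using assms(3) q by (simp add: q_def field_simps)
  have dq': "a \<le> 5 * (d * q)" using assms(2) q by (simp add: q_def field_simps)
  have pw: "(50::real) ^ n = 2 ^ n * q ^ 2"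
  proof -
    have "(50::real) ^ n = (2 * (5 * 5)) ^ n" by simp
    also have "\<dots> = 2 ^ n * (5 ^ n * 5 ^ n)" by (simp only: power_mult_distrib)
    finally show ?thesis by (simp add: q_def power2_eq_square)
  qed
  have "(50::real) ^ n = 50 ^ (n - N) * 50 ^ N" using assms(6) by (simp add: power_add[symmetric])
  then have m: "m / 50 ^ (n - N) = m * 50 ^ N / (2 ^ n * q ^ 2)" unfolding pw[symmetric] by simp
  have "d * (4 / (pi * (5/2 * (a / q)))) = (8 / (5 * pi)) * (d * q / a)" using q assms(1) by (simp add: field_simps)
  also have "\<dots> \<le> 1 * 1" using dq pi d0 q assms(1) by (intro mult_mono) auto
  finally have "d * (4 / (pi * (5/2 * (a / q)))) * (m * 50 ^ N / (2 ^ n * q ^ 2)) \<le> 1 * (m * 50 ^ N / (2 ^ n * q ^ 2))"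
    using assms(4) by (intro mult_right_mono) auto
  also have "\<dots> \<le> m * 50 ^ N / (2 ^ k * q ^ 2)"
    using assms(4,5) q by (simp add: divide_left_mono power_increasing)
  also have "\<dots> \<le> (m * 50 ^ N / (2 ^ k * q ^ 2)) * (25 * (d * q / a) ^ 2)"
  proof -
    have "1 \<le> 5 * (d * q / a)" using dq' assms(1) by (simp add: field_simps)
    then have "1 ^ 2 \<le> (5 * (d * q / a)) ^ 2" by (intro power_mono) auto
    then have "1 \<le> 25 * (d * q / a) ^ 2" by (simp add: power2_eq_square)
    moreover have "0 \<le> m * 50 ^ N / (2 ^ k * q ^ 2)" using assms(4) by simp
    ultimately show ?thesis using mult_left_mono by fastforce
  qed
  also have "\<dots> = (25 * m * 50 ^ N / a ^ 2 / 2 ^ k) * d ^ 2" using q assms(1) by (simp add: power2_eq_square field_simps)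
  also have "\<dots> \<le> (25 * m * 50 ^ N / a ^ 2 / 2 ^ k) * (pi * d ^ 2)"
    using pi assms(4) by (intro mult_left_mono) (auto simp: mult_le_cancel_right1)
  also have "\<dots> = (100 * m * 50 ^ N / a ^ 2 / 2 ^ k) * (pi / 4 * d ^ 2)" by simp
  finally show ?thesis unfolding m q_def .
qed

text \<open>Cover \<open>Q\<close> by sets of diameter less than \<open>a / 5 ^ k\<close> such that the sum of the squares of the diameters
is bounded in terms of the area of \<open>Q\<close>. By the decay of the mass, the set with diameter \<open>d\<close> contributes at
most a constant times \<open>d ^ 2 / 2 ^ k\<close>, and \<open>k\<close> is arbitrary.\<close>

lemma non_doubling_part_null:
  assumes r0: "oscillation_radius r0" and a: "a > 0" "5 * a \<le> r0" "5 * a < \<epsilon>"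
  shows "upper_lebesgue_integral {0..1} (\<lambda>t. hausdorff_pre 1 \<epsilon> (level t \<inter> non_doubling a N)) = 0"
proof -
  let ?X = "upper_lebesgue_integral {0..1} (\<lambda>t. hausdorff_pre 1 \<epsilon> (level t \<inter> non_doubling a N))"
  define m where "m = measure \<nu> UNIV"
  have m0: "m \<ge> 0" by (simp add: m_def)
  obtain H where H: "hausdorff_outer 2 Q = ennreal H" "H \<ge> 0"
    using hausdorff_2_Q_finite by (cases "hausdorff_outer 2 Q") (auto simp: emeasure_hausdorff)
  define c where "c = 100 * m * 50 ^ N / a ^ 2"
  have c0: "c \<ge> 0" using m0 by (simp add: c_def)
  have bound: "?X \<le> ennreal (c * (H + 1) / 2 ^ k)" if k: "N \<le> k" for k
  proof -
    let ?\<delta> = "a / 5 ^ k"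
    have \<delta>: "?\<delta> > 0" using a(1) by simp
    have "hausdorff_pre 2 ?\<delta> Q \<le> ennreal H" using hausdorff_pre_le_outer[OF \<delta>, of 2 Q] H(1) by simp
    also have "\<dots> < ennreal (H + 1)" using H(2) by (intro ennreal_lessI) auto
    finally have "hausdorff_pre 2 ?\<delta> Q < ennreal (H + 1)" .
    from hausdorff_pre_cover[OF this] obtain A' where A': "Q \<subseteq> (\<Union>j. A' j)" "\<forall>j. ediam (A' j) < ennreal ?\<delta>"
      "(\<Sum>j. ennreal (hausdorff_const 2) * ediam (A' j) ^ 2) < ennreal (H + 1)" by (elim exE conjE)
    define A where "A = (\<lambda>j. A' j \<inter> non_doubling a N)"
    have le: "ediam (A j) \<le> ediam (A' j)" for j by (rule ediam_mono) (simp add: A_def)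
    define d where "d = (\<lambda>j. enn2real (ediam (A j)))"
    have small: "ediam (A j) < ennreal ?\<delta>" for j using le[of j] A'(2) by (auto intro: order.strict_trans1)
    have d: "ediam (A j) = ennreal (d j)" "0 \<le> d j" "d j < ?\<delta>" for j
    proof -
      show e: "ediam (A j) = ennreal (d j)" unfolding d_def using small[of j] by (metis ennreal_enn2real ennreal_less_top order.strict_trans infinity_ennreal_def)
      show "0 \<le> d j" by (simp add: d_def)
      show "d j < ?\<delta>" using small[of j] \<delta> unfolding e by (simp add: ennreal_less_iff d_def)
    qed
    have "?X \<le> (\<Sum>j. ennreal (c / 2 ^ k) * (ennreal (hausdorff_const 2) * ediam (A' j) ^ 2))"
    proof (rule level_cover_bound[OF r0, where A = A and d = d])
      show "\<epsilon> > 0" using a by linarith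
      show "non_doubling a N \<subseteq> (\<Union>j. A j)" using A'(1) unfolding A_def non_doubling_def by blast
      show "ediam (A j) \<le> ennreal (d j)" "0 \<le> d j" for j using d by auto
      have "a / 5 ^ k \<le> a / 1" using a(1) by (intro divide_left_mono) auto
      then have \<delta>a: "?\<delta> \<le> a" by simp
      show "d j < \<epsilon>" for j using d(3)[of j] \<delta>a a by linarith
      fix j
      show "d j = 0 \<or> (\<exists>x R. x \<in> Q \<and> 0 < R \<and> 2 * R \<le> r0 \<and> A j \<subseteq> ball x R \<and>
        ennreal (d j * (4 / (pi * R))) * emeasure \<nu> (cball x (2 * R))
          \<le> ennreal (c / 2 ^ k) * (ennreal (hausdorff_const 2) * ediam (A' j) ^ 2))"
      proof (cases "d j = 0")
        case False
        then have pos: "d j > 0" using d(2)[of j] by simp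
        have "A j \<noteq> {}" using pos by (auto simp: d_def)
        then obtain x where x: "x \<in> A j" by blast
        \<comment> \<open>The scale \<open>n\<close> is chosen so that \<open>d j\<close> lies between \<open>a / 5 ^ Suc n\<close> and \<open>a / 5 ^ n\<close>.\<close>
        have "\<exists>n. a / 5 ^ Suc n < d j"
        proof -
          obtain N' where N': "\<And>n. N' \<le> n \<Longrightarrow> a / 5 ^ n < d j" by (rule eventually_small_scale[OF pos, of a]) blast
          have "a / 5 ^ Suc N' < d j" by (rule N') simp
          then show ?thesis ..
        qed
        then obtain n where n: "a / 5 ^ Suc n < d j" "\<And>i. i < n \<Longrightarrow> \<not> a / 5 ^ Suc i < d j"
          using exists_least_iff[of "\<lambda>n. a / 5 ^ Suc n < d j"] by blast
        have kn: "k \<le> n"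
        proof (rule ccontr)
          assume "\<not> k \<le> n"
          then have "a / 5 ^ k \<le> a / 5 ^ Suc n" using a(1) by (intro divide_left_mono power_increasing) auto
          then show False using n(1) d(3)[of j] by simp
        qed
        have dn: "d j \<le> a / 5 ^ n"
        proof (cases n)
          case 0
          then show ?thesis using d(3)[of j] \<delta>a by simp
        next
          case (Suc i)
          then show ?thesis using n(2)[of i] by simp
        qed
        let ?R = "5/2 * (a / 5 ^ n)"
        have xN: "x \<in> non_doubling a N" using x by (simp add: A_def)
        have "a / 5 ^ n \<le> a / 1" using a(1) by (intro divide_left_mono) auto
        then have R: "0 < ?R" "2 * ?R \<le> r0" using a by auto
        have "A j \<subseteq> ball x ?R"
        proof
          fix y assume "y \<in> A j"
          then have "ennreal (dist x y) \<le> ennreal (d j)" using dist_le_ediam[OF x] d(1) by metis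
          then have "dist x y \<le> d j" using d(2)[of j] by simp
          also have "d j < ?R" using dn R(1) by linarith
          finally show "y \<in> ball x ?R" by simp
        qed
        moreover have "ennreal (d j * (4 / (pi * ?R))) * emeasure \<nu> (cball x (2 * ?R))
          \<le> ennreal (c / 2 ^ k) * (ennreal (hausdorff_const 2) * ediam (A' j) ^ 2)"
        proof -
          have "ennreal (d j * (4 / (pi * ?R))) * emeasure \<nu> (cball x (2 * ?R))
              = ennreal (d j * (4 / (pi * ?R)) * measure \<nu> (cball x (5 * (a / 5 ^ n))))"
          proof -
            have R5: "2 * ?R = 5 * (a / 5 ^ n)" by simp
            have "0 \<le> d j * (4 / (pi * ?R))" using pos a(1) by (intro mult_nonneg_nonneg divide_nonneg_nonneg) auto
            then show ?thesis unfolding R5 emeasure_\<nu>_measure by (intro ennreal_mult[symmetric] measure_nonneg)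
          qed
          also have "\<dots> \<le> ennreal (d j * (4 / (pi * ?R)) * (m / 50 ^ (n - N)))"
            using non_doubling_decay[OF xN, of n] k kn pos a(1) unfolding m_def
            by (intro ennreal_leI mult_left_mono) auto
          also have "\<dots> \<le> ennreal (c / 2 ^ k * (pi / 4 * d j ^ 2))"
            using non_doubling_estimate[OF a(1) n(1) dn m0 kn, of N] k kn unfolding c_def by (intro ennreal_leI) auto
          also have "\<dots> = ennreal (c / 2 ^ k) * (ennreal (hausdorff_const 2) * ediam (A j) ^ 2)"
          proof -
            have "ennreal (c / 2 ^ k * (pi / 4 * d j ^ 2)) = ennreal (c / 2 ^ k) * ennreal (pi / 4 * d j ^ 2)"
              using c0 by (intro ennreal_mult) auto
            also have "ennreal (pi / 4 * d j ^ 2) = ennreal (pi / 4) * ennreal (d j ^ 2)" by (rule ennreal_mult) auto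
            also have "ennreal (d j ^ 2) = ediam (A j) ^ 2" unfolding d(1) by (rule ennreal_power[OF d(2), symmetric])
            finally show ?thesis by (simp add: hausdorff_const_def)
          qed
          also have "\<dots> \<le> ennreal (c / 2 ^ k) * (ennreal (hausdorff_const 2) * ediam (A' j) ^ 2)"
            by (intro mult_left_mono power_mono le) auto
          finally show ?thesis .
        qed
        ultimately show ?thesis using xN R unfolding non_doubling_def by blast
      qed simp
    qed
    also have "\<dots> = ennreal (c / 2 ^ k) * (\<Sum>j. ennreal (hausdorff_const 2) * ediam (A' j) ^ 2)" by simp
    also have "\<dots> \<le> ennreal (c / 2 ^ k) * ennreal (H + 1)" using A'(3) by (intro mult_left_mono) auto
    also have "\<dots> = ennreal (c * (H + 1) / 2 ^ k)" using c0 H(2) by (subst ennreal_mult[symmetric]) auto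
    finally show ?thesis .
  qed
  have "(\<lambda>k. ennreal (c * (H + 1) / 2 ^ k)) \<longlonglongrightarrow> ennreal 0"
    by (intro tendsto_ennrealI LIMSEQ_divide_realpow_zero) simp
  then have "?X \<le> ennreal 0" using bound by (intro LIMSEQ_le_const) auto
  then show ?thesis by simp
qed

lemma level_open_bound:
  assumes G: "open G" and \<epsilon>: "\<epsilon> > 0"
  shows "upper_lebesgue_integral {0..1} (\<lambda>t. hausdorff_pre 1 \<epsilon> (level t \<inter> G)) \<le> ennreal (400 / pi) * emeasure \<nu> G"
proof -
  obtain r0 where r0: "r0 > 0" "oscillation_radius r0"
    using values_near_bound unfolding oscillation_radius_def by metis
  \<comment> \<open>The factor makes \<open>5 * a\<close>, the diameter of the largest covering balls, strictly less than \<open>\<epsilon>\<close>.\<close>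
  define a where "a = min \<epsilon> r0 / 6"
  have a: "a > 0" "5 * a \<le> r0" "5 * a < \<epsilon>" using \<epsilon> r0(1) by (auto simp: a_def)
  define S where "S = (\<lambda>i. case i of 0 \<Rightarrow> {x. \<exists>n. (x, n) \<in> doubling_points a \<and> cball x (a / 5 ^ n) \<subseteq> G}
    | Suc N \<Rightarrow> non_doubling a N)"
  have cover: "level t \<inter> G \<subseteq> (\<Union>i. level t \<inter> S i)" for t
  proof
    fix x assume x: "x \<in> level t \<inter> G"
    then have xQ: "x \<in> Q" using level_subset_Q by blast
    obtain e where e: "e > 0" "cball x e \<subseteq> G" using x G open_contains_cball by blast
    obtain N where N: "\<And>n. N \<le> n \<Longrightarrow> a / 5 ^ n < e" by (rule eventually_small_scale[OF e(1), of a]) blast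
    show "x \<in> (\<Union>i. level t \<inter> S i)"
    proof (cases "x \<in> non_doubling a N")
      case True
      then have "x \<in> S (Suc N)" by (simp add: S_def)
      then show ?thesis using x by blast
    next
      case False
      then obtain n where n: "N \<le> n" "(x, n) \<in> doubling_points a" using xQ by (auto simp: non_doubling_def)
      have "cball x (a / 5 ^ n) \<subseteq> cball x e" using N[OF n(1)] by auto
      then have "x \<in> S 0" using n(2) e(2) by (auto simp: S_def)
      then show ?thesis using x by blast
    qed
  qed
  have "upper_lebesgue_integral {0..1} (\<lambda>t. hausdorff_pre 1 \<epsilon> (level t \<inter> G))
      \<le> upper_lebesgue_integral {0..1} (\<lambda>t. \<Sum>i. hausdorff_pre 1 \<epsilon> (level t \<inter> S i))"
  proof (rule upper_integral_mono)
    fix t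
    have "hausdorff_pre 1 \<epsilon> (level t \<inter> G) \<le> hausdorff_pre 1 \<epsilon> (\<Union>i. level t \<inter> S i)" by (rule hausdorff_pre_mono[OF cover])
    also have "\<dots> \<le> (\<Sum>i. hausdorff_pre 1 \<epsilon> (level t \<inter> S i))"
      using \<epsilon> by (intro hausdorff_pre_UN_le) auto
    finally show "hausdorff_pre 1 \<epsilon> (level t \<inter> G) \<le> (\<Sum>i. hausdorff_pre 1 \<epsilon> (level t \<inter> S i))" .
  qed
  also have "\<dots> \<le> (\<Sum>i. upper_lebesgue_integral {0..1} (\<lambda>t. hausdorff_pre 1 \<epsilon> (level t \<inter> S i)))"
    by (rule upper_integral_suminf)
  also have "\<dots> = upper_lebesgue_integral {0..1} (\<lambda>t. hausdorff_pre 1 \<epsilon> (level t \<inter> S 0))"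
  proof -
    have "upper_lebesgue_integral {0..1} (\<lambda>t. hausdorff_pre 1 \<epsilon> (level t \<inter> S i)) = 0" if "i \<notin> {0}" for i
      using that non_doubling_part_null[OF r0(2) a] by (cases i) (auto simp: S_def)
    then show ?thesis by (subst suminf_finite[of "{0}"]) auto
  qed
  also have "\<dots> \<le> ennreal (400 / pi) * emeasure \<nu> G"
    using doubling_part_bound[OF r0(2) a G] by (simp add: S_def)
  finally show ?thesis .
qed

theorem level_coarea:
  assumes g: "g \<in> borel_measurable (restrict_space borel Q)"
  shows "upper_lebesgue_integral {0..1} (\<lambda>t. \<integral>\<^sup>+x\<in>level t. g x \<partial>hausdorff 1)
    \<le> ennreal (400 / pi) * (\<integral>\<^sup>+x\<in>Q. g x * \<rho> x \<partial>hausdorff 2)"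
proof -
  let ?g = "\<lambda>x. g x * indicator Q x"
  have [measurable]: "?g \<in> borel_measurable borel"
    using g by (subst (asm) borel_measurable_restrict_space_iff_ennreal) auto
  have "upper_lebesgue_integral {0..1} (\<lambda>t. \<integral>\<^sup>+x\<in>level t. g x \<partial>hausdorff 1)
      = upper_lebesgue_integral {0..1} (\<lambda>t. \<integral>\<^sup>+x\<in>level t. ?g x \<partial>hausdorff 1)"
  proof -
    have "(\<integral>\<^sup>+x\<in>level t. g x \<partial>hausdorff 1) = (\<integral>\<^sup>+x\<in>level t. ?g x \<partial>hausdorff 1)" for t
      using level_subset_Q by (intro nn_integral_cong) (auto split: split_indicator)
    then show ?thesis by simp
  qed
  also have "\<dots> \<le> ennreal (400 / pi) * (\<integral>\<^sup>+x. ?g x \<partial>\<nu>)"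
  proof (rule coarea_extension)
    show "level t \<in> sets borel" for t by (simp add: level_def)
    show "\<exists>G. open G \<and> S \<subseteq> G \<and> emeasure \<nu> G \<le> emeasure \<nu> S + e" if "S \<in> sets borel" "e > 0" for S and e :: ennreal
      using outer_regular_homeomorphic_plane[OF plane sets_\<nu> \<nu>_finite that] by metis
    show "upper_lebesgue_integral {0..1} (\<lambda>t. hausdorff_pre 1 \<epsilon> (level t \<inter> G)) \<le> ennreal (400 / pi) * emeasure \<nu> G"
      if "open G" "\<epsilon> > 0" for G \<epsilon> using that by (rule level_open_bound)
  qed simp_all
  also have "(\<integral>\<^sup>+x. ?g x \<partial>\<nu>) = (\<integral>\<^sup>+x\<in>Q. g x * \<rho> x \<partial>hausdorff 2)"
    unfolding \<nu>_def by (subst nn_integral_density) (auto intro!: nn_integral_cong split: split_indicator simp: mult.commute)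
  finally show ?thesis .
qed

end

theorem proposition4p1:
  fixes Q :: "'a::metric_space set"
    and \<phi> :: "real \<times> real \<Rightarrow> 'a"
    and \<rho>k :: "nat \<Rightarrow> 'a \<Rightarrow> ennreal"
    and \<rho> u g :: "'a \<Rightarrow> ennreal"
  assumes "(UNIV :: 'a set) homeomorphic (UNIV :: (real ^ 2) set)"
    and "\<forall>x :: 'a. \<exists>U. open U \<and> x \<in> U \<and> emeasure (hausdorff 2) U < \<infinity>"
    and "quadrilateral Q \<phi>"
    and "minimizing_function Q \<phi> \<rho>k \<rho>"
    and "u = harmonic_function Q \<phi> \<rho>k \<rho>"
    and "g \<in> borel_measurable (restrict_space borel Q)"
  shows "upper_lebesgue_integral {0..1}
           (\<lambda>t. \<integral>\<^sup>+x\<in>closure {x \<in> Q. u x = ennreal t}. g x \<partial>hausdorff 1)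
         \<le> 2000 * (\<integral>\<^sup>+x\<in>Q. g x * \<rho> x \<partial>hausdorff 2)"
  proof -
  obtain \<psi> where \<psi>: "homeomorphism ({0..1} \<times> {0..1}) Q \<phi> \<psi>" using assms(3) unfolding quadrilateral_def by blast
  interpret minimizing_square Q \<phi> \<psi> \<rho>k \<rho>
    by unfold_locales (use assms \<psi> in auto)
  have "(400 / pi :: real) \<le> 2000" using pi_gt3 by (simp add: field_simps)
  then have C: "ennreal (400 / pi) \<le> 2000" using ennreal_leI[of "400 / pi" 2000] by simp
  have "upper_lebesgue_integral {0..1} (\<lambda>t. \<integral>\<^sup>+x\<in>level t. g x \<partial>hausdorff 1)
      \<le> ennreal (400 / pi) * (\<integral>\<^sup>+x\<in>Q. g x * \<rho> x \<partial>hausdorff 2)"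
    by (rule level_coarea[OF assms(6)])
  also have "\<dots> \<le> 2000 * (\<integral>\<^sup>+x\<in>Q. g x * \<rho> x \<partial>hausdorff 2)" by (rule mult_right_mono[OF C]) simp
  finally show ?thesis unfolding level_def assms(5) .
qed

end
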